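(* Let $n,m\ge 1$, $N=n+m$, $\lambda>0$, $\beta>0$, $\alpha\in(0,1)$. Let $\Omega\subset\mathbb{R}^N=\mathbb{R}^n\times\mathbb{R}^m$ be a domain that is radial and bounded in the variable $z\in\mathbb{R}^n$, and $2\lambda$-periodic and symmetric in the directions $t_1,\dots,t_m$ of $\mathbb{R}^m$. Assume that there is a positive solution $u\in C^{2,\alpha}(\overline{\Omega})$ of the overdetermined problem $$-\Delta u=1\ \text{ in }\Omega,\qquad u=0,\quad \partial_\nu u=-\beta\ \text{ on }\partial\Omega,$$ where $\nu$ is the unit outer normal on $\partial\Omega$. Let $a,b\in\lambda\mathbb{Z}^m$ with $a_i<b_i$ for $i=1,\dots,m$, and set $$S_a^b:=\mathbb{R}^n\times(a_1,b_1)\times\dots\times(a_m,b_m).$$ Then $\Omega$ is uniquely self-Cheeger relative to $S_a^b$, with relative Cheeger constant $h(\Omega,S_a^b)=\frac1\beta$. Moreover, $$-\operatorname{div}\left(\frac{\nabla 1_\Omega}{|\nabla 1_\Omega|}\right)=\frac1\beta\,1_\Omega,$$ and $\Omega$ is calibrable relative to $S_a^b$.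
   Context: Points of $\mathbb{R}^N$ are written $(z,t)$, $z\in\mathbb{R}^n$, $t\in\mathbb{R}^m$. A domain is a connected open set. "Radial in $z$" means invariant under $(z,t)\mapsto(Rz,t)$ for all $R\in O(n)$; "bounded in $z$" means $\Omega\subset B_R(0)\times\mathbb{R}^m$ for some $R>0$; "$2\lambda$-periodic and symmetric in $t_1,\dots,t_m$" means invariant, for each $i$, under $t_i\mapsto t_i+2\lambda$ and $t_i\mapsto -t_i$. $1_E$ is the characteristic function of $E$, $|A|$ is Lebesgue measure, $\mathcal{H}^{N-1}$ is $(N-1)$-dimensional Hausdorff measure, $\partial^*A$ is the reduced boundary. Relative perimeter: for $S\subset\mathbb{R}^N$ open and $A\subset\mathbb{R}^N$ Borel, $P(A,S):=\sup\{\int_A\operatorname{div}(\xi)\,dx:\ \xi\in C_c^\infty(S;\mathbb{R}^N),\ |\xi|\le1\}$; the perimeter of $A$ is $P(A,\mathbb{R}^N)$. Relative Cheeger constant: for open $\Omega,S\subset\mathbb{R}^N$, $h(\Omega,S):=\inf_{A\subseteq\Omega\cap S}\frac{P(A,S)}{|A|}$, the infimum over Borel sets $A\subseteq\Omega\cap S$ of finite perimeter (and positive measure). A Borel set $A\subset\Omega\cap S$ of finite perimeter attaining the infimum is called a Cheeger set of $\Omega$ relative to $S$. $\Omega$ is self-Cheeger relative to $S$ if $A=\Omega\cap S$ attains $h(\Omega,S)$; it is uniquely self-Cheeger relative to $S$ if, moreover, every Cheeger set of $\Omega$ relative to $S$ equals $\Omega\cap S$ up to a Lebesgue null set. Relative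 calibrability: $E$ is calibrable relative to $S$ if there are a constant $\lambda_E$ and a vector field $\xi\in L^\infty(E,\mathbb{R}^N)$ with $|\xi|_\infty\le1$ such that $-\operatorname{div}\xi=\lambda_E1_E$ in the sense of distributions in $E$, $\xi\cdot\nu=-1$ on $\partial^*E\cap S$ (with $\nu$ the outer unit normal of $E$), and $\xi\cdot\nu=0$ on $E\cap\partial S$ (with $\nu$ the outer unit normal of $S$, defined $\mathcal{H}^{N-1}$-a.e.). Meaning of the $1$-Laplacian equation: a function $v$ solves $-\operatorname{div}\frac{\nabla v}{|\nabla v|}=f$ if there is a vector field $\xi\in W^{1,1}_{loc}(\Omega,\mathbb{R}^N)$ with $|\xi|\le1$ such that $-\operatorname{div}\xi=f$ in the sense of distributions in $\Omega$ and $(\xi,\nabla v)=|\nabla v|$ as Radon measures, where $(\xi,\nabla v)(\varphi)=-\int v\varphi\operatorname{div}\xi\,dx-\int v\,\xi\cdot\nabla\varphi\,dx$ for test functions $\varphi$. For $v=1_\Omega$ these measures are $(\xi,\nabla 1_\Omega)=-\xi\cdot\nu\,\mathcal{H}^{N-1}|_{\partial\Omega}$ and $|\nabla1_\Omega|=\mathcal{H}^{N-1}|_{\partial\Omega}$, so that the condition amounts to $\xi\cdot\nu=-1$ $\mathcal{H}^{N-1}$-a.e. on $\partial\Omega$. *)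

theory Defs
  imports "HOL-Analysis.Analysis"
begin

section \<open>Classical differential operators and regularity classes\<close>

definition partial_deriv :: "'a::euclidean_space \<Rightarrow> ('a \<Rightarrow> real) \<Rightarrow> 'a \<Rightarrow> real" where
  "partial_deriv b f x = frechet_derivative f (at x) b"

definition grad :: "('a::euclidean_space \<Rightarrow> real) \<Rightarrow> 'a \<Rightarrow> 'a" where
  "grad f x = (\<Sum>b\<in>Basis. partial_deriv b f x *\<^sub>R b)"

definition divergence :: "('a::euclidean_space \<Rightarrow> 'a) \<Rightarrow> 'a \<Rightarrow> real" where
  "divergence \<xi> x = (\<Sum>b\<in>Basis. partial_deriv b (\<lambda>y. \<xi> y \<bullet> b) x)"

definition laplacian :: "('a::euclidean_space \<Rightarrow> real) \<Rightarrow> 'a \<Rightarrow> real" where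
  "laplacian u x = (\<Sum>b\<in>Basis. partial_deriv b (partial_deriv b u) x)"

text \<open>\<open>Ck_on k U f\<close> is meant for open \<open>U\<close> only.\<close>

primrec Ck_on :: "nat \<Rightarrow> 'a::euclidean_space set \<Rightarrow> ('a \<Rightarrow> real) \<Rightarrow> bool" where
  "Ck_on 0 U f \<longleftrightarrow> continuous_on U f"
| "Ck_on (Suc k) U f \<longleftrightarrow> f differentiable_on U \<and> (\<forall>b\<in>Basis. Ck_on k U (partial_deriv b f))"

definition extends_continuously :: "'a::euclidean_space set \<Rightarrow> ('a \<Rightarrow> real) \<Rightarrow> bool" where
  "extends_continuously \<Omega> f \<longleftrightarrow> (\<exists>g. continuous_on (closure \<Omega>) g \<and> (\<forall>x\<in>\<Omega>. g x = f x))"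

definition holder_on :: "real \<Rightarrow> 'a::euclidean_space set \<Rightarrow> ('a \<Rightarrow> real) \<Rightarrow> bool" where
  "holder_on \<alpha> \<Omega> f \<longleftrightarrow> (\<exists>C. \<forall>x\<in>\<Omega>. \<forall>y\<in>\<Omega>. \<bar>f x - f y\<bar> \<le> C * dist x y powr \<alpha>)"

text \<open>The class \<open>C\<^sup>2\<^sup>,\<^sup>\<alpha>\<close> of the closure, as in Gilbarg and Trudinger: the derivatives up to order
  two extend continuously to the closure, and those of order two are uniformly Hoelder
  continuous. On an unbounded set the derivatives are not required to be bounded.\<close>

definition C2_holder_closure :: "real \<Rightarrow> 'a::euclidean_space set \<Rightarrow> ('a \<Rightarrow> real) \<Rightarrow> bool" where
  "C2_holder_closure \<alpha> \<Omega> u \<longleftrightarrow>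
     Ck_on 2 \<Omega> u \<and> continuous_on (closure \<Omega>) u \<and>
     (\<forall>b\<in>Basis. extends_continuously \<Omega> (partial_deriv b u)) \<and>
     (\<forall>b\<in>Basis. \<forall>c\<in>Basis. extends_continuously \<Omega> (partial_deriv c (partial_deriv b u))
        \<and> holder_on \<alpha> \<Omega> (partial_deriv c (partial_deriv b u)))"

text \<open>\<open>\<nu>\<close> is the outer unit normal at a boundary point near which \<open>\<Omega>\<close> is the sublevel set of
  a \<open>C\<^sup>1\<close> function without critical points.\<close>

definition outer_unit_normal :: "'a::euclidean_space set \<Rightarrow> 'a \<Rightarrow> 'a \<Rightarrow> bool" where
  "outer_unit_normal \<Omega> x \<nu> \<longleftrightarrow> x \<in> frontier \<Omega> \<and>
     (\<exists>U g. open U \<and> x \<in> U \<and> Ck_on 1 U g \<and> (\<forall>y\<in>U. grad g y \<noteq> 0) \<and>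
        \<Omega> \<inter> U = {y\<in>U. g y < 0} \<and> \<nu> = grad g x /\<^sub>R norm (grad g x))"

text \<open>The normal derivative on the boundary is taken from inside: the gradient at a boundary
  point is the value of its continuous extension from \<open>\<Omega>\<close>.\<close>

definition has_normal_derivative ::
    "'a::euclidean_space set \<Rightarrow> ('a \<Rightarrow> real) \<Rightarrow> 'a \<Rightarrow> real \<Rightarrow> 'a \<Rightarrow> bool" where
  "has_normal_derivative \<Omega> u \<nu> d x \<longleftrightarrow> ((\<lambda>y. grad u y \<bullet> \<nu>) \<longlongrightarrow> d) (at x within \<Omega>)"

section \<open>Test functions, distributional divergence, local Sobolev functions\<close>

definition test_functions :: "'a::euclidean_space set \<Rightarrow> ('a \<Rightarrow> real) set" where
  "test_functions U = {\<phi>. (\<forall>k. Ck_on k UNIV \<phi>) \<and>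
     compact (closure {x. \<phi> x \<noteq> 0}) \<and> closure {x. \<phi> x \<noteq> 0} \<subseteq> U}"

definition test_fields :: "'a::euclidean_space set \<Rightarrow> ('a \<Rightarrow> 'a) set" where
  "test_fields U = {\<xi>. \<forall>b\<in>Basis. (\<lambda>x. \<xi> x \<bullet> b) \<in> test_functions U}"

definition locally_integrable :: "'a::euclidean_space set \<Rightarrow> ('a \<Rightarrow> real) \<Rightarrow> bool" where
  "locally_integrable U f \<longleftrightarrow> (\<forall>K. compact K \<and> K \<subseteq> U \<longrightarrow> set_integrable lborel K f)"

text \<open>\<open>div \<xi> = d\<close> in the sense of distributions in the open set \<open>U\<close>.\<close>

definition has_weak_divergence ::
    "'a::euclidean_space set \<Rightarrow> ('a \<Rightarrow> 'a) \<Rightarrow> ('a \<Rightarrow> real) \<Rightarrow> bool" where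
  "has_weak_divergence U \<xi> d \<longleftrightarrow>
     (\<forall>b\<in>Basis. locally_integrable U (\<lambda>x. \<xi> x \<bullet> b)) \<and> locally_integrable U d \<and>
     (\<forall>\<phi>\<in>test_functions U.
        (LINT x:U|lborel. \<xi> x \<bullet> grad \<phi> x) = - (LINT x:U|lborel. d x * \<phi> x))"

definition W11_loc :: "'a::euclidean_space set \<Rightarrow> ('a \<Rightarrow> real) \<Rightarrow> bool" where
  "W11_loc U w \<longleftrightarrow> locally_integrable U w \<and>
     (\<forall>c\<in>Basis. \<exists>g. locally_integrable U g \<and>
        (\<forall>\<phi>\<in>test_functions U.
           (LINT x:U|lborel. w x * partial_deriv c \<phi> x) = - (LINT x:U|lborel. g x * \<phi> x)))"

section \<open>Perimeter and relative Cheeger sets\<close>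

definition perimeter :: "'a::euclidean_space set \<Rightarrow> 'a set \<Rightarrow> ereal" where
  "perimeter A S = (SUP \<xi>\<in>{\<xi>\<in>test_fields S. \<forall>x. norm (\<xi> x) \<le> 1}.
     ereal (LINT x:A|lborel. divergence \<xi> x))"

definition cheeger_competitors :: "'a::euclidean_space set \<Rightarrow> 'a set \<Rightarrow> 'a set set" where
  "cheeger_competitors \<Omega> S = {A. A \<in> sets borel \<and> A \<subseteq> \<Omega> \<inter> S \<and>
     perimeter A UNIV < \<infinity> \<and> emeasure lborel A > 0}"

definition cheeger_ratio :: "'a::euclidean_space set \<Rightarrow> 'a set \<Rightarrow> ereal" where
  "cheeger_ratio S A = perimeter A S / enn2ereal (emeasure lborel A)"

definition cheeger_constant :: "'a::euclidean_space set \<Rightarrow> 'a set \<Rightarrow> ereal" where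
  "cheeger_constant \<Omega> S = (INF A\<in>cheeger_competitors \<Omega> S. cheeger_ratio S A)"

definition cheeger_set :: "'a::euclidean_space set \<Rightarrow> 'a set \<Rightarrow> 'a set \<Rightarrow> bool" where
  "cheeger_set \<Omega> S A \<longleftrightarrow>
     A \<in> cheeger_competitors \<Omega> S \<and> cheeger_ratio S A = cheeger_constant \<Omega> S"

definition self_cheeger :: "'a::euclidean_space set \<Rightarrow> 'a set \<Rightarrow> bool" where
  "self_cheeger \<Omega> S \<longleftrightarrow> cheeger_set \<Omega> S (\<Omega> \<inter> S)"

definition uniquely_self_cheeger :: "'a::euclidean_space set \<Rightarrow> 'a set \<Rightarrow> bool" where
  "uniquely_self_cheeger \<Omega> S \<longleftrightarrow> self_cheeger \<Omega> S \<and>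
     (\<forall>A. cheeger_set \<Omega> S A \<longrightarrow> sym_diff A (\<Omega> \<inter> S) \<in> null_sets lborel)"

section \<open>Total variation measure and reduced boundary\<close>

definition variation :: "('a::euclidean_space \<Rightarrow> real) \<Rightarrow> 'a set \<Rightarrow> ereal" where
  "variation v U = (SUP \<xi>\<in>{\<xi>\<in>test_fields U. \<forall>x. norm (\<xi> x) \<le> 1}.
     ereal (LINT x|lborel. v x * divergence \<xi> x))"

text \<open>The measure \<open>|\<nabla>v|\<close>: the Borel measure equal to \<open>variation v\<close> on open sets, extended to
  Borel sets by outer regularity. That the extension is countably additive is the criterion of
  De Giorgi and Letta.\<close>

definition variation_measure :: "('a::euclidean_space \<Rightarrow> real) \<Rightarrow> 'a measure" where
  "variation_measure v = measure_of UNIV (sets borel)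
     (\<lambda>B. INF U\<in>{U. open U \<and> B \<subseteq> U}. e2ennreal (variation v U))"

definition BV_loc :: "('a::euclidean_space \<Rightarrow> real) \<Rightarrow> bool" where
  "BV_loc v \<longleftrightarrow> locally_integrable UNIV v \<and> (\<forall>U. open U \<and> bounded U \<longrightarrow> variation v U < \<infinity>)"

abbreviation perimeter_measure :: "'a::euclidean_space set \<Rightarrow> 'a measure" where
  "perimeter_measure E \<equiv> variation_measure (indicat_real E)"

text \<open>The polar decomposition \<open>\<nabla>1\<^sub>E = - \<sigma> |\<nabla>1\<^sub>E|\<close>; the density \<open>\<sigma>\<close> is determined up to a
  \<open>|\<nabla>1\<^sub>E|\<close>-null set, so the averages in \<open>reduced_boundary\<close> do not depend on its choice.\<close>

definition normal_density :: "'a::euclidean_space set \<Rightarrow> ('a \<Rightarrow> 'a) \<Rightarrow> bool" where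
  "normal_density E \<sigma> \<longleftrightarrow> \<sigma> \<in> borel_measurable borel \<and>
     (AE x in perimeter_measure E. norm (\<sigma> x) = 1) \<and>
     (\<forall>\<eta>\<in>test_fields UNIV. (LINT x:E|lborel. divergence \<eta> x) =
        (LINT x|perimeter_measure E. \<eta> x \<bullet> \<sigma> x))"

definition reduced_boundary :: "'a::euclidean_space set \<Rightarrow> 'a set" where
  "reduced_boundary E = {x.
     (\<forall>r>0. emeasure (perimeter_measure E) (ball x r) > 0) \<and>
     (\<exists>\<sigma> \<nu>. normal_density E \<sigma> \<and> norm \<nu> = 1 \<and>
        ((\<lambda>r. (LINT y:ball x r|perimeter_measure E. \<sigma> y)
                 /\<^sub>R measure (perimeter_measure E) (ball x r)) \<longlongrightarrow> \<nu>) (at_right 0))}"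

section \<open>Normal traces and relative calibrability\<close>

text \<open>\<open>g\<close> is the normal trace \<open>\<xi> \<cdot> \<nu>\<close>, on the part of the boundary of \<open>A\<close> lying in the open
  set \<open>U\<close>, of a bounded field \<open>\<xi>\<close> on \<open>A \<inter> U\<close> with distributional divergence \<open>d\<close>. Such a field
  has no pointwise boundary values; its trace is defined by the Gauss-Green formula. By De Giorgi's
  structure theorem \<open>perimeter_measure A\<close> is the Hausdorff measure of codimension one restricted
  to the reduced boundary of \<open>A\<close>, so the right hand side is the usual surface integral.\<close>

definition has_normal_trace ::
    "'a::euclidean_space set \<Rightarrow> 'a set \<Rightarrow> ('a \<Rightarrow> 'a) \<Rightarrow> ('a \<Rightarrow> real) \<Rightarrow> ('a \<Rightarrow> real) \<Rightarrow> bool" where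
  "has_normal_trace A U \<xi> d g \<longleftrightarrow> g \<in> borel_measurable borel \<and>
     (\<exists>C. AE x in perimeter_measure A. \<bar>g x\<bar> \<le> C) \<and>
     (\<forall>\<phi>\<in>test_functions U.
        (LINT x:A \<inter> U|lborel. \<xi> x \<bullet> grad \<phi> x) + (LINT x:A \<inter> U|lborel. d x * \<phi> x) =
        (LINT x:reduced_boundary A|perimeter_measure A. g x * \<phi> x))"

text \<open>For open \<open>E\<close> and \<open>S\<close>. The first trace is taken on the boundary of \<open>E\<close> inside \<open>S\<close>, the second
  one on the boundary of \<open>S\<close> inside \<open>E\<close>, where the normal is that of \<open>S\<close>.\<close>

definition calibrable :: "'a::euclidean_space set \<Rightarrow> 'a set \<Rightarrow> bool" where
  "calibrable E S \<longleftrightarrow> BV_loc (indicat_real E) \<and>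
     (\<exists>(c::real) \<xi>. set_borel_measurable lborel E \<xi> \<and>
        (AE x in lborel. x \<in> E \<longrightarrow> norm (\<xi> x) \<le> 1) \<and>
        has_weak_divergence E \<xi> (\<lambda>x. - (c * indicat_real E x)) \<and>
        (\<exists>g. has_normal_trace E S \<xi> (\<lambda>x. - (c * indicat_real E x)) g \<and>
           (AE x in perimeter_measure E. x \<in> reduced_boundary E \<inter> S \<longrightarrow> g x = - 1)) \<and>
        (\<exists>g. has_normal_trace S E \<xi> (\<lambda>x. - (c * indicat_real E x)) g \<and>
           (AE x in perimeter_measure S. x \<in> E \<inter> frontier S \<longrightarrow> g x = 0)))"

section \<open>The 1-Laplacian equation\<close>

text \<open>The pairing \<open>(\<xi>, \<nabla>v)\<close> of a field \<open>\<xi>\<close> on \<open>\<Omega>\<close>, with \<open>div \<xi> = d\<close>, and a function \<open>v\<close> that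
  vanishes outside \<open>\<Omega>\<close>.\<close>

definition pairing ::
    "'a::euclidean_space set \<Rightarrow> ('a \<Rightarrow> 'a) \<Rightarrow> ('a \<Rightarrow> real) \<Rightarrow> ('a \<Rightarrow> real) \<Rightarrow> ('a \<Rightarrow> real) \<Rightarrow> real" where
  "pairing \<Omega> \<xi> d v \<phi> =
     - (LINT x:\<Omega>|lborel. v x * \<phi> x * d x) - (LINT x:\<Omega>|lborel. v x * (\<xi> x \<bullet> grad \<phi> x))"

text \<open>The equation \<open>- div (\<nabla>v / |\<nabla>v|) = f\<close>. The test functions in the last condition live on
  the whole space: for \<open>v = 1\<^sub>\<Omega>\<close> both measures are carried by the boundary of \<open>\<Omega>\<close>, and
  testing inside \<open>\<Omega>\<close> would make the condition void.\<close>

definition solves_one_laplace ::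
    "'a::euclidean_space set \<Rightarrow> ('a \<Rightarrow> real) \<Rightarrow> ('a \<Rightarrow> real) \<Rightarrow> bool" where
  "solves_one_laplace \<Omega> v f \<longleftrightarrow> BV_loc v \<and>
     (\<exists>\<xi>. (\<forall>b\<in>Basis. W11_loc \<Omega> (\<lambda>x. \<xi> x \<bullet> b)) \<and>
        (AE x in lborel. x \<in> \<Omega> \<longrightarrow> norm (\<xi> x) \<le> 1) \<and>
        has_weak_divergence \<Omega> \<xi> (\<lambda>x. - f x) \<and>
        (\<forall>\<phi>\<in>test_functions UNIV.
           pairing \<Omega> \<xi> (\<lambda>x. - f x) v \<phi> = (LINT x|variation_measure v. \<phi> x)))"

section \<open>Symmetries of subsets of a product space and the slabs\<close>

definition radial_fst :: "((real^'n) \<times> (real^'m)) set \<Rightarrow> bool" where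
  "radial_fst \<Omega> \<longleftrightarrow> (\<forall>R. orthogonal_transformation R \<longrightarrow> (\<lambda>(z, t). (R z, t)) ` \<Omega> = \<Omega>)"

definition bounded_fst :: "((real^'n) \<times> (real^'m)) set \<Rightarrow> bool" where
  "bounded_fst \<Omega> \<longleftrightarrow> (\<exists>R>0. \<Omega> \<subseteq> ball 0 R \<times> UNIV)"

definition periodic_snd :: "real \<Rightarrow> ((real^'n) \<times> (real^'m)) set \<Rightarrow> bool" where
  "periodic_snd p \<Omega> \<longleftrightarrow> (\<forall>i. (\<lambda>(z, t). (z, t + axis i p)) ` \<Omega> = \<Omega>)"

definition symmetric_snd :: "((real^'n) \<times> (real^'m)) set \<Rightarrow> bool" where
  "symmetric_snd \<Omega> \<longleftrightarrow>
     (\<forall>i. (\<lambda>(z, t). (z, \<chi> j. if j = i then - (t $ j) else t $ j)) ` \<Omega> = \<Omega>)"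

definition slab :: "real^'m \<Rightarrow> real^'m \<Rightarrow> ((real^'n) \<times> (real^'m)) set" where
  "slab a b = {(z, t). \<forall>i. a $ i < t $ i \<and> t $ i < b $ i}"

end

theory Submission
  imports Defs
begin

text \<open>Why the theorem holds. The field \<open>\<xi> = \<nabla>u / \<beta>\<close> calibrates \<open>\<Omega>\<close>: its divergence is \<open>- 1 / \<beta>\<close>, and
on the boundary it is minus the outer normal, because \<open>u\<close> is constant there with normal derivative
\<open>- \<beta>\<close>. Each directional derivative of \<open>u\<close> is harmonic and at most \<open>\<beta>\<close> on the boundary, so the maximum
principle in the cylinder gives \<open>|\<xi>| \<le> 1\<close>, and the strong maximum principle gives \<open>|\<xi>| < 1\<close> inside
(\<open>gradient_bound\<close>, \<open>gradient_strict\<close>). By uniqueness \<open>u\<close> is even about every hyperplane \<open>t\<^sub>i = \<lambda>k\<close>, so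
\<open>\<xi>\<close> is tangential to the faces of the slab (\<open>u_reflect\<close>, \<open>tangency\<close>). Testing the perimeter of a
competitor \<open>A\<close> with \<open>- \<xi>\<close> gives \<open>|A| / \<beta> \<le> P(A, S)\<close>, and for \<open>A = \<Omega> \<inter> S\<close> there is equality
(\<open>calibration_inequality\<close>, \<open>flux_upper\<close>). If equality holds for \<open>A\<close>, the field may be perturbed
inside \<open>\<Omega> \<inter> S\<close>, where \<open>|\<xi>| < 1\<close>; so the indicator of \<open>A\<close> has zero distributional gradient there, and
\<open>A\<close> is everything because \<open>\<Omega>\<close> cut by the closed slab is connected: it is the image of \<open>\<Omega>\<close> under a
continuous folding (\<open>Eb_fold\<close>).

Two points need care. First, the surface measure is constructed as the weak limit \<open>\<Lambda>\<close> of the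
weights concentrated on thin layers \<open>0 < u < 2 / k\<close>; the Riesz representation theorem turns \<open>\<Lambda>\<close> into a
measure, which is then the perimeter measure of \<open>\<Omega>\<close> (\<open>perimeter_measure_eq\<close>), carried by the boundary.
Second, \<open>\<xi>\<close> lives on \<open>\<Omega>\<close> only and has no compact support in the slab. It is Lipschitz on bounded
parts of \<open>\<Omega>\<close>, so it has a Lipschitz extension of norm at most one, and such fields may be tested against
the perimeter (\<open>integral_divergence_le_perimeter\<close>). Cutoffs in the variables \<open>t\<^sub>i\<close> provide compact
support; their gradients grow like \<open>n\<close> in layers of width \<open>2 / n\<close>, where the tangential field has normal
component of order \<open>1 / n\<close>, so the error is bounded and its integral tends to zero.\<close>

section \<open>Differential calculus of real functions\<close>

lemmas differentiable_on_open = differentiable_on_eq_differentiable_at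

lemma has_derivative_grad:
 fixes f :: "'a::euclidean_space => real"
 assumes "f differentiable (at x)"
 shows "(f has_derivative (%h. grad f x \<bullet> h)) (at x)"
proof -
 let ?D = "frechet_derivative f (at x)"
 have D: "(f has_derivative ?D) (at x)"
  using assms frechet_derivative_works by blast
 then have lin: "linear ?D" by (rule has_derivative_linear)
 have "?D h = grad f x \<bullet> h" for h
 proof -
  have "?D h = ?D (\<Sum>b\<in>Basis. (h \<bullet> b) *\<^sub>R b)" by (simp add: euclidean_representation)
  also have "... = (\<Sum>b\<in>Basis. (h \<bullet> b) * ?D b)"
   using lin by (simp add: linear_sum linear_cmul)
  also have "... = grad f x \<bullet> h"
   by (simp add: grad_def partial_deriv_def inner_sum_left inner_sum_right inner_commute[of _ h] mult.commute)
  finally show ?thesis .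
 qed
 then have "?D = (%h. grad f x \<bullet> h)" by (rule ext)
 then show ?thesis using D by simp
qed

lemma partial_deriv_eq:
 assumes "(f has_derivative f') (at x)"
 shows "partial_deriv b f x = f' b"
 using frechet_derivative_at[OF assms] by (simp add: partial_deriv_def)

lemma partial_deriv_const [simp]: "partial_deriv b (%x. c) x = 0"
 by (simp add: partial_deriv_def)

lemma grad_inner_Basis: "b \<in> Basis ==> grad f x \<bullet> b = partial_deriv b f x"
 by (simp add: grad_def inner_sum_left inner_Basis if_distrib sum.delta cong: if_cong)

lemma grad_eqI:
 assumes "(f has_derivative (%h. w \<bullet> h)) (at x)"
 shows "grad f x = w"
 by (rule euclidean_eqI) (simp add: grad_inner_Basis partial_deriv_eq[OF assms])

lemma partial_deriv_cong:
 assumes "open U" "x \<in> U" "!!y. y \<in> U ==> f y = g y"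
 shows "partial_deriv b f x = partial_deriv b g x"
proof -
 have "(f has_derivative D) (at x) \<longleftrightarrow> (g has_derivative D) (at x)" for D
  using assms by (metis has_derivative_transform_within_open)
 then show ?thesis by (simp add: partial_deriv_def frechet_derivative_def)
qed

lemma grad_cong:
 assumes "open U" "x \<in> U" "!!y. y \<in> U ==> f y = g y"
 shows "grad f x = grad g x"
 using partial_deriv_cong[OF assms] by (simp add: grad_def)

lemma partial_deriv_off_support:
 assumes "closed K" "!!y. y ~: K ==> f y = 0" "x ~: K"
 shows "partial_deriv b f x = 0"
 using partial_deriv_cong[of "- K" x f "%_. 0" b] assms by (simp add: open_Compl)

lemma grad_off_support:
 assumes "closed K" "!!y. y ~: K ==> f y = 0" "x ~: K"
 shows "grad f x = 0"
 by (simp add: grad_def partial_deriv_off_support[OF assms])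

lemma Ck_on_cong:
 assumes "open U" "!!y. y \<in> U ==> f y = g y"
 shows "Ck_on k U f \<longleftrightarrow> Ck_on k U g"
 using assms(2)
proof (induction k arbitrary: f g)
 case 0
 then show ?case by (simp cong: continuous_on_cong)
next
 case (Suc k)
 have "f differentiable_on U \<longleftrightarrow> g differentiable_on U"
  using Suc.prems by (simp add: differentiable_on_open[OF \<open>open U\<close>] differentiable_def)
   (metis assms(1) has_derivative_transform_within_open)
 moreover have "Ck_on k U (partial_deriv b f) \<longleftrightarrow> Ck_on k U (partial_deriv b g)" for b
  by (rule Suc.IH) (rule partial_deriv_cong[OF assms(1) _ Suc.prems])
 ultimately show ?case by simp
qed

lemma Ck_on_subset:
 assumes "Ck_on k U f" "V \<subseteq> U"
 shows "Ck_on k V f"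
 using assms
 by (induction k arbitrary: f) (auto intro: continuous_on_subset differentiable_on_subset)

lemma Ck_on_SucD: "Ck_on (Suc k) U f ==> Ck_on k U f"
 by (induction k arbitrary: f) (auto intro: differentiable_imp_continuous_on)

lemma Ck_on_le: "k <= l ==> Ck_on l U f ==> Ck_on k U f"
 by (induction l) (auto simp: le_Suc_eq dest: Ck_on_SucD simp del: Ck_on.simps)

lemma Ck_on_continuous: "Ck_on k U f ==> continuous_on U f"
 using Ck_on_le[of 0 k U f] by simp

lemma Ck_on_has_derivative:
 assumes "Ck_on (Suc k) U f" "open U" "x \<in> U"
 shows "(f has_derivative (%h. grad f x \<bullet> h)) (at x)"
 using assms by (auto intro!: has_derivative_grad simp: differentiable_on_open)

lemma Ck_on_SucI:
 assumes "open U"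
  and "!!x. x \<in> U ==> (f has_derivative (%h. D x h)) (at x)"
  and "!!b. b \<in> Basis ==> Ck_on k U (%x. D x b)"
 shows "Ck_on (Suc k) U f"
proof -
 have "f differentiable_on U"
  using assms by (auto simp: differentiable_on_open differentiable_def)
 moreover have "Ck_on k U (partial_deriv b f)" if "b \<in> Basis" for b
  using assms(3)[OF that] partial_deriv_eq[OF assms(2)]
  by (subst Ck_on_cong[OF \<open>open U\<close>, where g="%x. D x b"]) auto
 ultimately show ?thesis by simp
qed

lemma Ck_on_const: "open U ==> Ck_on k U (%x. c)"
proof (induction k arbitrary: c)
 case (Suc k)
 show ?case
  by (rule Ck_on_SucI[where D="%x h. 0"]) (use Suc in auto)
qed auto

lemma Ck_on_bounded_linear:
 assumes "open U" "bounded_linear f"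
 shows "Ck_on k U f"
proof (cases k)
 case 0
 then show ?thesis using assms by (auto intro: linear_continuous_on)
next
 case (Suc l)
 have "Ck_on (Suc l) U f"
  by (rule Ck_on_SucI[where D="%x. f"])
   (auto intro: assms(1) bounded_linear_imp_has_derivative[OF assms(2)] Ck_on_const[OF assms(1)])
 then show ?thesis using Suc by simp
qed

lemma Ck_on_add:
 assumes "open U" "Ck_on k U f" "Ck_on k U g"
 shows "Ck_on k U (%x. f x + g x)"
 using assms(2,3)
proof (induction k arbitrary: f g)
 case 0 then show ?case by (auto intro: continuous_intros)
next
 case (Suc k)
 show ?case
 proof (rule Ck_on_SucI[OF \<open>open U\<close>])
  fix x assume "x \<in> U"
  then show "((%x. f x + g x) has_derivative (%h. grad f x \<bullet> h + grad g x \<bullet> h)) (at x)"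
   using Suc.prems Ck_on_has_derivative \<open>open U\<close> by (blast intro: has_derivative_add)
 next
  fix b :: 'a assume b: "b \<in> Basis"
  then show "Ck_on k U (%x. grad f x \<bullet> b + grad g x \<bullet> b)"
   unfolding grad_inner_Basis[OF b] using Suc by (intro Suc.IH) auto
 qed
qed

lemma Ck_on_mult:
 assumes "open U" "Ck_on k U f" "Ck_on k U g"
 shows "Ck_on k U (%x. f x * g x)"
 using assms(2,3)
proof (induction k arbitrary: f g)
 case 0 then show ?case by (auto intro: continuous_intros)
next
 case (Suc k)
 show ?case
 proof (rule Ck_on_SucI[OF \<open>open U\<close>])
  fix x assume "x \<in> U"
  then show "((%x. f x * g x) has_derivative (%h. f x * (grad g x \<bullet> h) + (grad f x \<bullet> h) * g x)) (at x)"
   using Suc.prems Ck_on_has_derivative \<open>open U\<close> by (blast intro: has_derivative_mult)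
 next
  fix b :: 'a assume b: "b \<in> Basis"
  then show "Ck_on k U (%x. f x * (grad g x \<bullet> b) + (grad f x \<bullet> b) * g x)"
   unfolding grad_inner_Basis[OF b]
   using Suc.prems b
   by (intro Ck_on_add[OF \<open>open U\<close>] Suc.IH Ck_on_SucD[OF Suc.prems(1)] Ck_on_SucD[OF Suc.prems(2)]) auto
 qed
qed

lemma Ck_on_sum:
 assumes "open U" "!!i. i \<in> I ==> Ck_on k U (f i)"
 shows "Ck_on k U (%x. \<Sum>i\<in>I. f i x)"
 using assms(2)
proof (induction I rule: infinite_finite_induct)
 case (insert i I)
 have "Ck_on k U (%x. f i x + (\<Sum>i\<in>I. f i x))"
  by (rule Ck_on_add[OF assms(1)]) (use insert in blast)+
 then show ?case by (simp only: sum.insert[OF insert(1,2)])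
qed (simp_all only: sum.infinite sum.empty Ck_on_const[OF assms(1)] not_False_eq_True)

lemma Ck_on_cmult: "open U ==> Ck_on k U f ==> Ck_on k U (%x. c * f x)"
 by (intro Ck_on_mult Ck_on_const)

lemma Ck_on_diff:
 assumes "open U" "Ck_on k U f" "Ck_on k U g"
 shows "Ck_on k U (%x. f x - g x)"
 using Ck_on_add[OF assms(1,2) Ck_on_cmult[OF assms(1,3), of "-1"]] by simp

lemma Ck_on_inner_const: "open U ==> Ck_on k U (%x::'a::euclidean_space. x \<bullet> b)"
 by (intro Ck_on_bounded_linear bounded_linear_inner_left)

lemma Ck_on_norm_sq:
 assumes "open U"
 shows "Ck_on k U (%x::'a::euclidean_space. (norm (x - c))\<^sup>2)"
proof -
 have eq: "(%x. (norm (x - c))\<^sup>2) = (%x. \<Sum>b\<in>Basis. (x \<bullet> b - c \<bullet> b) * (x \<bullet> b - c \<bullet> b))"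
  unfolding power2_norm_eq_inner
  by (rule ext, subst euclidean_inner) (simp only: inner_diff_left)
 show ?thesis unfolding eq
  by (intro Ck_on_sum Ck_on_mult Ck_on_diff Ck_on_const Ck_on_inner_const assms)
qed

text \<open>A family of functions on the line that is closed under differentiation consists of smooth functions,
so the chain rule may be iterated without naming the higher derivatives.\<close>

lemma Ck_on_compose_closed_family:
 assumes "open U" and fam: "!!h. h \<in> F ==> \<exists>h'\<in>F. \<forall>x. (h has_real_derivative h' x) (at x)"
  and "h \<in> F" "Ck_on k U l"
 shows "Ck_on k U (%x. h (l x))"
 using assms(3,4)
proof (induction k arbitrary: h)
 case 0
 then obtain h' where "!!x. (h has_real_derivative h' x) (at x)" using fam by blast
 then have "continuous_on UNIV h"
  by (meson DERIV_isCont continuous_at_imp_continuous_on)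
 then show ?case using 0 by (auto intro: continuous_on_compose2)
next
 case (Suc k)
 then obtain h' where h': "h' \<in> F" "!!x. (h has_real_derivative h' x) (at x)" using fam by blast
 show ?case
 proof (rule Ck_on_SucI[OF \<open>open U\<close>])
  fix x assume "x \<in> U"
  then have "(l has_derivative (%d. grad l x \<bullet> d)) (at x)"
   using Suc.prems Ck_on_has_derivative \<open>open U\<close> by blast
  moreover have "(h has_derivative (%d. h' (l x) * d)) (at (l x))"
   using h'(2) by (simp add: has_field_derivative_def)
  ultimately show "((%x. h (l x)) has_derivative (%d. h' (l x) * (grad l x \<bullet> d))) (at x)"
   by (rule has_derivative_compose[where f=l and g=h and g'="%d. h' (l x) * d"])
 next
  fix b :: 'a assume b: "b \<in> Basis"
  have "Ck_on k U (%x. h' (l x))"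
   by (rule Suc.IH[OF h'(1) Ck_on_SucD[OF Suc.prems(2)]])
  moreover have "Ck_on k U (partial_deriv b l)" using Suc.prems(2) b by simp
  ultimately show "Ck_on k U (%x. h' (l x) * (grad l x \<bullet> b))"
   unfolding grad_inner_Basis[OF b] by (rule Ck_on_mult[OF \<open>open U\<close>])
 qed
qed

lemma C1_on_compose:
 assumes "open U" and h': "!!x. (h has_real_derivative h' x) (at x)"
  and "continuous_on UNIV h'" "Ck_on 1 U l"
 shows "Ck_on 1 U (%x. h (l x))"
 unfolding One_nat_def
proof (rule Ck_on_SucI[OF \<open>open U\<close>])
 fix x assume "x \<in> U"
 then have "(l has_derivative (%d. grad l x \<bullet> d)) (at x)"
  using Ck_on_has_derivative[OF assms(4)[unfolded One_nat_def] \<open>open U\<close>] by simp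
 moreover have "(h has_derivative (%d. h' (l x) * d)) (at (l x))"
  using h' by (simp add: has_field_derivative_def)
 ultimately show "((%x. h (l x)) has_derivative (%d. h' (l x) * (grad l x \<bullet> d))) (at x)"
  by (rule has_derivative_compose[where f=l and g=h and g'="%d. h' (l x) * d"])
next
 fix b :: 'a assume b: "b \<in> Basis"
 have "continuous_on U l" by (rule Ck_on_continuous[OF assms(4)])
 then have "continuous_on U (%x. h' (l x))"
  by (rule continuous_on_compose2[OF assms(3)]) auto
 moreover have "continuous_on U (partial_deriv b l)"
  using assms(4) b by (simp add: One_nat_def)
 ultimately show "Ck_on 0 U (%x. h' (l x) * (grad l x \<bullet> b))"
  unfolding grad_inner_Basis[OF b] Ck_on.simps by (rule continuous_on_mult)
qed

text \<open>Regularity is local, and near a point outside \<open>W\<close> the function vanishes because \<open>K\<close> is closed.\<close>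

lemma Ck_on_extend_zero:
 assumes "open W" "closed K" "K \<subseteq> W" "Ck_on k W f" "!!x. x ~: K ==> f x = 0"
 shows "Ck_on k UNIV f"
proof -
 have "Ck_on k W f ==> (!!x. x ~: K ==> f x = 0) ==> Ck_on k (W \<union> - K) f"
 proof (induction k arbitrary: f)
  case 0
  then show ?case using assms
   by (auto intro!: continuous_on_open_Un simp: open_Compl) (metis ComplD continuous_on_cong continuous_on_const)
 next
  case (Suc k)
  have z: "Ck_on (Suc k) (- K) f"
   using Suc.prems(2) Ck_on_const[of "-K" "Suc k" 0] assms(2)
   by (subst Ck_on_cong[where g="%x. 0"]) (auto simp: open_Compl)
  have "f differentiable_on (W \<union> - K)"
   using Suc.prems(1) z assms(1,2)
   by (auto simp: differentiable_on_open open_Compl open_Un)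
  moreover have "Ck_on k (W \<union> - K) (partial_deriv b f)" if b: "b \<in> Basis" for b
  proof (rule Suc.IH)
   show "Ck_on k W (partial_deriv b f)" using Suc.prems b by auto
   fix x assume "x ~: K"
   then have "partial_deriv b f x = partial_deriv b (%x. 0) x"
    using Suc.prems(2) assms(2) by (intro partial_deriv_cong[of "-K"]) (auto simp: open_Compl)
   then show "partial_deriv b f x = 0"
    by simp
  qed
  ultimately show ?case by simp
 qed
 moreover have "W \<union> - K = UNIV" using assms by auto
 ultimately show ?thesis using assms by auto
qed

lemma partial_deriv_mult:
 assumes "f differentiable (at x)" "g differentiable (at x)"
 shows "partial_deriv b (%x. f x * g x) x = f x * partial_deriv b g x + partial_deriv b f x * g x"
 using partial_deriv_eq[OF has_derivative_mult[OF assms[unfolded frechet_derivative_works]]]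
 by (simp add: partial_deriv_def)

lemma partial_deriv_add:
 assumes "f differentiable (at x)" "g differentiable (at x)"
 shows "partial_deriv b (%x. f x + g x) x = partial_deriv b f x + partial_deriv b g x"
 using partial_deriv_eq[OF has_derivative_add[OF assms[unfolded frechet_derivative_works]]]
 by (simp add: partial_deriv_def)

lemma partial_deriv_cmult:
 assumes "f differentiable (at x)"
 shows "partial_deriv b (%x. c * f x) x = c * partial_deriv b f x"
 using partial_deriv_mult[where f="%_. c" and g=f and b=b and x=x, OF differentiable_const assms]
 by simp

section \<open>A smooth bump function\<close>

text \<open>The derivative of \<open>p(1/x) exp(-1/x)\<close> has the same shape with another polynomial; this makes the
family closed under differentiation, also at the origin.\<close>

definition exp_jet :: "real poly => real => real" where
 "exp_jet p x = (if x > 0 then poly p (1 / x) * exp (- (1 / x)) else 0)"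

lemma poly_exp_tendsto_0: "((%y. poly p y * exp (- y)) \<longlongrightarrow> 0) at_top" for p :: "real poly"
proof -
 have "((%y. \<Sum>i\<le>degree p. coeff p i * (y ^ i / exp y)) \<longlongrightarrow> (\<Sum>i\<le>degree p. coeff p i * 0)) at_top"
  by (intro tendsto_intros tendsto_power_div_exp_0)
 then show ?thesis
  by (simp add: poly_altdef sum_distrib_right exp_minus divide_inverse mult.assoc)
qed

lemma exp_jet_deriv:
 "(exp_jet p has_real_derivative exp_jet ([:0,0,1:] * (p - pderiv p)) x) (at x)"
proof (cases "x = 0")
 case False
 show ?thesis
 proof (cases "x > 0")
  case True
  have "((%x. poly p (1 / x) * exp (- (1 / x))) has_real_derivative
    exp_jet ([:0,0,1:] * (p - pderiv p)) x) (at x)"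
   using True
   by (auto intro!: derivative_eq_intros DERIV_chain'[where f="%x. 1/x" and g="poly p"] poly_DERIV
     simp: exp_jet_def field_simps power2_eq_square)
  then show ?thesis
   by (rule has_field_derivative_transform_within_open[where S="{0<..}"]) (use True in \<open>auto simp: exp_jet_def\<close>)
 next
  case F: False
  show ?thesis
   by (rule has_field_derivative_transform_within_open[where S="{..<0}" and f="%x. 0"])
    (use False F in \<open>auto simp: exp_jet_def\<close>)
 qed
next
 case True
 have "((%h. exp_jet p h / h) \<longlongrightarrow> 0) (at 0)"
 proof (rule filterlim_split_at)
  show "((%h. exp_jet p h / h) \<longlongrightarrow> 0) (at_left 0)"
   by (rule tendsto_eventually) (auto simp: exp_jet_def eventually_at_filter)
  have "((%h. poly (pCons 0 p) (inverse h) * exp (- inverse h)) \<longlongrightarrow> 0) (at_right 0)"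
   by (rule filterlim_compose[OF poly_exp_tendsto_0 filterlim_inverse_at_top_right])
  then show "((%h. exp_jet p h / h) \<longlongrightarrow> 0) (at_right 0)"
   by (rule Lim_transform_eventually)
    (auto simp: exp_jet_def eventually_at_filter field_simps)
 qed
 then show ?thesis using True
  by (simp add: has_field_derivative_iff exp_jet_def)
qed

definition bump :: "real => 'a::euclidean_space => real" where
 "bump e x = exp_jet 1 (e\<^sup>2 - (norm x)\<^sup>2)"

lemma bump_Ck: "Ck_on k UNIV (bump e)"
proof -
 have *: "Ck_on k UNIV (%x::'a. e\<^sup>2 - (norm (x - 0))\<^sup>2)"
  by (intro Ck_on_diff Ck_on_const Ck_on_norm_sq) auto
 have "Ck_on k UNIV (%x::'a. exp_jet 1 (e\<^sup>2 - (norm (x - 0))\<^sup>2))"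
  by (rule Ck_on_compose_closed_family[where F="range exp_jet", OF _ _ _ *])
   (use exp_jet_deriv in blast)+
 then show ?thesis by (simp add: bump_def[abs_def])
qed

lemma bump_nonneg: "0 <= bump e x"
 by (simp add: bump_def exp_jet_def)

lemma bump_pos_iff: "e > 0 ==> 0 < bump e x \<longleftrightarrow> norm x < e"
 by (simp add: bump_def exp_jet_def abs_le_square_iff[symmetric] not_le[symmetric])

lemma bump_zero: "e > 0 ==> e <= norm x ==> bump e x = 0"
 using bump_pos_iff[of e x] bump_nonneg[of e x] by linarith

lemma bump_minus: "bump e (- x) = bump e x"
 by (simp add: bump_def)

section \<open>Integration by parts\<close>

lemma integrable_compact_support:
 fixes f :: "'a::euclidean_space => 'b::euclidean_space"
 assumes "continuous_on UNIV f" "compact K" "!!x. x ~: K ==> f x = 0"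
 shows "integrable lborel f"
proof -
 have "set_integrable lborel K f"
  unfolding set_integrable_def
  using borel_integrable_compact[OF assms(2) continuous_on_subset[OF assms(1)]] by auto
 moreover have "(%x. indicator K x *\<^sub>R f x) = f" using assms(3) by (auto simp: indicator_def)
 ultimately show ?thesis by (simp add: set_integrable_def)
qed

lemma bounded_compact_support:
 fixes f :: "'a::euclidean_space => 'b::real_normed_vector"
 assumes "continuous_on UNIV f" "compact K" "!!x. x ~: K ==> f x = 0"
 obtains C where "C > 0" "!!x. norm (f x) <= C"
proof -
 have "bounded (f ` K)" using assms compact_continuous_image compact_imp_bounded
  by (metis continuous_on_subset top_greatest)
 then obtain C where "C > 0" "!!x. x \<in> K ==> norm (f x) <= C"
  by (auto simp: bounded_pos)
 then show ?thesis using that[of C] assms(3) by (metis norm_zero order_less_imp_le)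
qed

lemma integral_translate:
 fixes f :: "'a::euclidean_space => real"
 assumes "f \<in> borel_measurable borel"
 shows "(LBINT x. f (x + c)) = (LBINT x. f x)"
proof -
 have "(LBINT x. f x) = (LINT x|distr lborel borel ((+) c). f x)"
  by (simp add: lborel_distr_plus)
 also have "... = (LBINT x. f (c + x))"
  using assms by (intro integral_distr) auto
 finally show ?thesis by (simp add: add.commute)
qed

lemma integrable_translate:
 fixes f :: "'a::euclidean_space => real"
 assumes "integrable lborel f"
 shows "integrable lborel (%x. f (x + c))"
proof -
 have "integrable (distr lborel borel ((+) c)) f"
  using assms by (simp add: lborel_distr_plus)
 then have "integrable lborel (%x. f (c + x))"
  by (rule integrable_distr[rotated]) auto
 then show ?thesis by (simp add: add.commute)
qed

text \<open>Lebesgue measure is translation invariant, so every difference quotient of \<open>f\<close> has integral zero; the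
difference quotients converge dominatedly.\<close>

lemma integral_partial_deriv_zero:
 fixes f :: "'a::euclidean_space => real"
 assumes f: "Ck_on 1 UNIV f" and K: "compact K" "!!x. x ~: K ==> f x = 0" and b: "b \<in> Basis"
 shows "integrable lborel (partial_deriv b f)" "(LBINT x. partial_deriv b f x) = 0"
proof -
 have d: "(f has_derivative (%h. grad f x \<bullet> h)) (at x)" for x
  using Ck_on_has_derivative[of 0 UNIV f x] f by auto
 have cont: "continuous_on UNIV (partial_deriv b f)" using f b by auto
 have z: "partial_deriv b f x = 0" if "x ~: K" for x
 by (rule partial_deriv_off_support[OF compact_imp_closed[OF K(1)] K(2) that])
 show int: "integrable lborel (partial_deriv b f)"
  using integrable_compact_support[OF cont K(1) z] .
 obtain C where C: "C > 0" "!!x. norm (partial_deriv b f x) <= C"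
  using bounded_compact_support[OF cont K(1) z] by blast
 have contf: "continuous_on UNIV f" by (rule Ck_on_continuous[OF f])
 have intf: "integrable lborel f" using integrable_compact_support[OF contf K] .
 define s where "s = (%n::nat. inverse (real (Suc n)))"
 have s0: "s \<longlonglongrightarrow> 0" unfolding s_def by (rule LIMSEQ_inverse_real_of_nat)
 have spos: "s n > 0" "s n <= 1" for n by (auto simp: s_def field_simps)
 define q where "q = (%n x. (f (x + s n *\<^sub>R b) - f x) / s n)"
 define K' where "K' = {x + y |x y. x \<in> K & y \<in> cball (0::'a) 1}"
 have K': "compact K'" unfolding K'_def by (rule compact_sums[OF K(1) compact_cball])
 have line: "((%t. f (x + t *\<^sub>R b)) has_real_derivative partial_deriv b f (x + t *\<^sub>R b)) (at t)" for x t
 proof -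
  have "((%t. f (x + t *\<^sub>R b)) has_derivative (%h. grad f (x + t *\<^sub>R b) \<bullet> (h *\<^sub>R b))) (at t)"
   by (rule has_derivative_compose[OF _ d]) (auto intro!: derivative_eq_intros)
  moreover have "(%h. grad f (x + t *\<^sub>R b) \<bullet> (h *\<^sub>R b)) = (*) (partial_deriv b f (x + t *\<^sub>R b))"
   by (auto simp: grad_inner_Basis[OF b])
  ultimately show ?thesis by (simp add: has_field_derivative_def)
 qed
 have "(%n. LBINT x. q n x) \<longlonglongrightarrow> (LBINT x. partial_deriv b f x)"
 proof (rule integral_dominated_convergence)
  show "partial_deriv b f \<in> borel_measurable lborel" using int by auto
  show "q n \<in> borel_measurable lborel" for n
   unfolding q_def using contf
   by (auto intro!: borel_measurable_continuous_onI continuous_intros continuous_on_compose2[OF contf] simp: spos less_imp_neq[symmetric])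
  show "integrable lborel (%x. indicator K' x *\<^sub>R C)"
   using K' emeasure_compact_finite[OF K']
   by (auto intro!: integrable_real_indicator simp: compact_imp_closed)
  show "AE x in lborel. (%n. q n x) \<longlonglongrightarrow> partial_deriv b f x"
  proof (rule AE_I2)
   fix x
   have "((%h. (f (x + (0 + h) *\<^sub>R b) - f (x + 0 *\<^sub>R b)) / h) \<longlongrightarrow> partial_deriv b f (x + 0 *\<^sub>R b)) (at 0)"
    using line[of x 0] by (simp add: has_field_derivative_iff)
   then have "((%h. (f (x + h *\<^sub>R b) - f x) / h) \<longlongrightarrow> partial_deriv b f x) (at 0)" by simp
   moreover have "filterlim s (at 0) sequentially"
    using s0 spos by (auto simp: filterlim_at less_imp_neq[symmetric])
   ultimately show "(%n. q n x) \<longlonglongrightarrow> partial_deriv b f x"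
    unfolding q_def by (rule filterlim_compose)
  qed
  show "AE x in lborel. norm (q n x) <= indicator K' x *\<^sub>R C" for n
  proof (rule AE_I2)
   fix x
   show "norm (q n x) <= indicator K' x *\<^sub>R C"
   proof (cases "x \<in> K'")
    case True
    obtain t where "f (x + s n *\<^sub>R b) - f (x + 0 *\<^sub>R b) = (s n - 0) * partial_deriv b f (x + t *\<^sub>R b)"
     using MVT2[of 0 "s n" "%t. f (x + t *\<^sub>R b)" "%t. partial_deriv b f (x + t *\<^sub>R b)"] line spos[of n] by blast
    then have "q n x = partial_deriv b f (x + t *\<^sub>R b)" using spos[of n] by (simp add: q_def)
    then show ?thesis using C True by simp
   next
    case False
    have "x ~: K" using False unfolding K'_def by force
    moreover have "x + s n *\<^sub>R b ~: K"
    proof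
     assume "x + s n *\<^sub>R b \<in> K"
     moreover have "- s n *\<^sub>R b \<in> cball 0 1" using spos[of n] b by (simp add: norm_Basis)
     moreover have "x = (x + s n *\<^sub>R b) + - s n *\<^sub>R b" by simp
     ultimately show False using False unfolding K'_def by blast
    qed
    ultimately show ?thesis using K False by (simp add: q_def)
   qed
  qed
 qed
 moreover have "(LBINT x. q n x) = 0" for n
 proof -
  note tr = integrable_translate[OF intf, of "s n *\<^sub>R b"] integral_translate[OF borel_measurable_continuous_onI[OF contf], of "s n *\<^sub>R b"]
  then show ?thesis unfolding q_def using intf by simp
 qed
 ultimately show "(LBINT x. partial_deriv b f x) = 0"
  by (simp add: LIMSEQ_const_iff)
qed

text \<open>The product extends by zero to a \<open>C\<^sup>1\<close> function with compact support.\<close>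

lemma integration_by_parts:
 fixes f \<phi> :: "'a::euclidean_space => real"
 assumes W: "open W" "Ck_on 1 W f" "Ck_on 1 W \<phi>"
  and K: "compact K" "K \<subseteq> W" "!!x. x ~: K ==> \<phi> x = 0" and b: "b \<in> Basis"
 shows "integrable lborel (%x. \<phi> x * partial_deriv b f x)" "integrable lborel (%x. partial_deriv b \<phi> x * f x)"
  and "(LBINT x. \<phi> x * partial_deriv b f x) = - (LBINT x. partial_deriv b \<phi> x * f x)"
proof -
 note cK = compact_imp_closed[OF K(1)]
 have z: "partial_deriv b \<phi> x = 0" if "x ~: K" for x by (rule partial_deriv_off_support[OF cK K(3) that])
 have c: "continuous_on W (partial_deriv b f)" "continuous_on W (partial_deriv b \<phi>)" using W b by auto
 have e: "integrable lborel h" if "continuous_on W h" "!!x. x ~: K ==> h x = 0" for h :: "'a => real"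
  using Ck_on_extend_zero[OF W(1) cK K(2), of 0 h] integrable_compact_support[OF _ K(1), of h] that by simp
 show i1: "integrable lborel (%x. \<phi> x * partial_deriv b f x)"
  by (rule e) (auto intro!: continuous_intros c Ck_on_continuous[OF W(3)] simp: K(3))
 show i2: "integrable lborel (%x. partial_deriv b \<phi> x * f x)"
  by (rule e) (auto intro!: continuous_intros c Ck_on_continuous[OF W(2)] simp: z)
 have PC: "Ck_on 1 UNIV (%x. \<phi> x * f x)"
  by (rule Ck_on_extend_zero[OF W(1) cK K(2) Ck_on_mult[OF W(1,3,2)]]) (simp add: K(3))
 have dP: "partial_deriv b (%x. \<phi> x * f x) x = \<phi> x * partial_deriv b f x + partial_deriv b \<phi> x * f x" for x
 proof (cases "x \<in> W")
  case True
  then show ?thesis using W by (intro partial_deriv_mult) (auto simp: differentiable_on_open)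
 next
  case False
  then have "x ~: K" using K(2) by blast
  then show ?thesis using partial_deriv_off_support[OF cK, of "%x. \<phi> x * f x" x b] z K(3) by simp
 qed
 have "(LBINT x. partial_deriv b (%x. \<phi> x * f x) x) = 0"
  by (rule integral_partial_deriv_zero(2)[OF PC K(1) _ b]) (simp add: K(3))
 then show "(LBINT x. \<phi> x * partial_deriv b f x) = - (LBINT x. partial_deriv b \<phi> x * f x)"
  using i1 i2 by (simp add: dP)
qed

section \<open>Convolution and mollification\<close>

lemma lborel_distr_reflect: "distr lborel borel (%y. x - y) = (lborel :: 'a::euclidean_space measure)"
proof -
 have "lborel = density (distr lborel borel (%y::'a. x + (-1) *\<^sub>R y)) (%_. ennreal (\<bar>-1\<bar> ^ DIM('a)))"
  using lborel_affine[of "-1" x] by simp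
 then show ?thesis by (simp add: density_1)
qed

lemma integral_reflect:
 fixes g :: "'a::euclidean_space => 'b::euclidean_space"
 assumes "g \<in> borel_measurable borel"
 shows "(LBINT y. g (x - y)) = (LBINT y. g y)"
proof -
 have "(LBINT y. g y) = (LINT y|distr lborel borel (%y. x - y). g y)"
  by (simp add: lborel_distr_reflect)
 also have "... = (LBINT y. g (x - y))"
  using assms by (intro integral_distr) auto
 finally show ?thesis by simp
qed

lemma uniformly_continuous_of_compact_support:
 fixes f :: "'a::euclidean_space => 'b::euclidean_space"
 assumes f: "continuous_on UNIV f" and K: "compact K" "!!x. x ~: K ==> f x = 0"
 shows "uniformly_continuous_on UNIV f"
 unfolding uniformly_continuous_on_def
proof (intro allI impI)
 fix e :: real assume e: "e > 0"
 define K1 where "K1 = {x + y |x y. x \<in> K & y \<in> cball (0::'a) 1}"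
 have "compact K1" unfolding K1_def by (rule compact_sums[OF K(1) compact_cball])
 then have "uniformly_continuous_on K1 f"
  using f by (intro compact_uniformly_continuous) (auto intro: continuous_on_subset)
 then obtain d where d: "d > 0" "!!x y. x \<in> K1 ==> y \<in> K1 ==> dist y x < d ==> dist (f y) (f x) < e"
  unfolding uniformly_continuous_on_def using e by metis
 have near: "y \<in> K1" if "x \<in> K" "dist y x <= 1" for x y
 proof -
  have "y = x + (y - x)" "y - x \<in> cball 0 1" using that by (auto simp: dist_norm norm_minus_commute)
  then show ?thesis unfolding K1_def using that(1) by blast
 qed
 show "\<exists>d>0. \<forall>x\<in>UNIV. \<forall>y\<in>UNIV. dist y x < d --> dist (f y) (f x) < e"
 proof (intro exI[of _ "min d 1"] conjI ballI impI)
  fix x y :: 'a assume "dist y x < min d 1"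
  then show "dist (f y) (f x) < e"
   using d(2)[of x y] near[of x y] near[of y x] near[of x x] near[of y y] K(2)[of x] K(2)[of y] e
   by (cases "x \<in> K"; cases "y \<in> K") (auto simp: dist_commute)
 qed (use d in auto)
qed

text \<open>Differentiation under the integral: the gradient of the kernel is uniformly continuous, so the
linearization error is small uniformly in the integration variable.\<close>

lemma convolution_has_derivative:
 fixes f \<rho> :: "'a::euclidean_space => real"
 assumes f: "integrable lborel f" and \<rho>: "Ck_on 1 UNIV \<rho>"
  and K: "compact K" "!!x. x ~: K ==> \<rho> x = 0"
 shows "((%x. LBINT y. \<rho> (x - y) * f y) has_derivative
   (%h. \<Sum>b\<in>Basis. (h \<bullet> b) * (LBINT y. partial_deriv b \<rho> (x - y) * f y))) (at x)"
proof -
 have d: "(\<rho> has_derivative (%h. grad \<rho> z \<bullet> h)) (at z)" for z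
  using Ck_on_has_derivative[of 0 UNIV \<rho> z] \<rho> by auto
 have cont\<rho>: "continuous_on UNIV \<rho>" by (rule Ck_on_continuous[OF \<rho>])
 have contp: "continuous_on UNIV (partial_deriv b \<rho>)" if "b \<in> Basis" for b using \<rho> that by auto
 have contg: "continuous_on UNIV (grad \<rho>)"
  unfolding grad_def[abs_def] by (intro continuous_intros contp)
 have zp: "partial_deriv b \<rho> z = 0" if "z ~: K" for b z
 by (rule partial_deriv_off_support[OF compact_imp_closed[OF K(1)] K(2) that])
 have zg: "grad \<rho> z = 0" if "z ~: K" for z using zp[OF that] by (simp add: grad_def)
 have fm: "f \<in> borel_measurable lborel" using f by auto
 have int: "integrable lborel (%y. g (x - y) * f y)"
  if gc: "continuous_on UNIV g" and gz: "!!z. z ~: K ==> g z = 0" for g :: "'a => real" and x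
 proof -
  obtain C where C: "C > 0" "!!x. norm (g x) <= C"
   using bounded_compact_support[OF gc K(1) gz] by blast
  have gm: "(%y. g (x - y)) \<in> borel_measurable borel"
   by (intro borel_measurable_continuous_onI continuous_on_compose2[OF gc] continuous_intros) auto
  show ?thesis
  proof (rule Bochner_Integration.integrable_bound)
   show "integrable lborel (%y. C * f y)" using f by simp
   show "AE y in lborel. norm (g (x - y) * f y) <= norm (C * f y)"
    using C by (auto simp: abs_mult intro!: mult_right_mono)
  qed (use gm fm in auto)
 qed
 let ?D = "%h. \<Sum>b\<in>Basis. (h \<bullet> b) * (LBINT y. partial_deriv b \<rho> (x - y) * f y)"
 have D: "?D h = (LBINT y. (grad \<rho> (x - y) \<bullet> h) * f y)" for h
 proof -
  have "(LBINT y. (grad \<rho> (x - y) \<bullet> h) * f y)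
    = (LBINT y. (\<Sum>b\<in>Basis. (h \<bullet> b) * (partial_deriv b \<rho> (x - y) * f y)))"
   by (intro Bochner_Integration.integral_cong refl)
    (simp add: grad_def inner_sum_left sum_distrib_right sum_distrib_left inner_commute[of h] mult_ac)
  also have "... = (\<Sum>b\<in>Basis. (LBINT y. (h \<bullet> b) * (partial_deriv b \<rho> (x - y) * f y)))"
   by (intro Bochner_Integration.integral_sum integrable_mult_right int contp zp) auto
  finally show ?thesis by simp
 qed
 have Dint: "integrable lborel (%y. (grad \<rho> (x - y) \<bullet> h) * f y)" for h
 proof -
  have "continuous_on UNIV (%z. grad \<rho> z \<bullet> h)" by (intro continuous_intros contg)
  from int[OF this, of x] zg show ?thesis by simp
 qed
 define I where "I = (LBINT y. \<bar>f y\<bar>)"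
 have I0: "I \<ge> 0" unfolding I_def by simp
 have unif: "uniformly_continuous_on UNIV (grad \<rho>)"
  by (rule uniformly_continuous_of_compact_support[OF contg K(1) zg]) 
 show ?thesis
  unfolding has_derivative_at_alt
 proof (intro conjI allI impI)
  show "bounded_linear ?D"
   by (intro bounded_linear_sum bounded_linear_mult_const[OF bounded_linear_inner_left])
  fix e :: real assume e: "e > 0"
  define e' where "e' = e / (I + 1)"
  have e': "e' > 0" using e I0 by (simp add: e'_def)
  obtain \<delta> where \<delta>: "\<delta> > 0" "!!z w. dist w z < \<delta> ==> dist (grad \<rho> w) (grad \<rho> z) < e'"
   using unif e' unfolding uniformly_continuous_on_def by (metis UNIV_I)
  show "\<exists>d>0. \<forall>y. norm (y - x) < d -->
    norm ((LBINT z. \<rho> (y - z) * f z) - (LBINT z. \<rho> (x - z) * f z) - ?D (y - x)) <= e * norm (y - x)"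
  proof (intro exI[of _ \<delta>] conjI allI impI)
   fix y assume y: "norm (y - x) < \<delta>"
   define h where "h = y - x"
   have pt: "\<bar>\<rho> (y - z) - \<rho> (x - z) - grad \<rho> (x - z) \<bullet> h\<bar> <= norm h * e'" for z
   proof -
    have "norm (\<rho> (y - z) - \<rho> (x - z) - grad \<rho> (x - z) \<bullet> ((y - z) - (x - z))) <= norm ((y - z) - (x - z)) * e'"
    proof (rule differentiable_bound_linearization[where S="ball (x - z) \<delta>" and f'="%w h. grad \<rho> w \<bullet> h"])
     fix t :: real assume "t \<in> {0..1}"
     then have "norm (t *\<^sub>R (y - x)) <= norm (y - x)" by (simp add: mult_left_le_one_le)
     then show "x - z + t *\<^sub>R (y - z - (x - z)) \<in> ball (x - z) \<delta>"
      using y by (simp add: dist_norm)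
    next
     fix w assume "w \<in> ball (x - z) \<delta>"
     show "(\<rho> has_derivative (%h. grad \<rho> w \<bullet> h)) (at w within ball (x - z) \<delta>)"
      using d has_derivative_at_withinI by blast
    next
     fix w assume w: "w \<in> ball (x - z) \<delta>"
     then have "norm (grad \<rho> w - grad \<rho> (x - z)) <= e'"
      using \<delta>(2)[of w "x - z"] by (simp add: dist_norm dist_commute less_imp_le norm_minus_commute)
     then show "onorm ((\<bullet>) (grad \<rho> w) - (\<bullet>) (grad \<rho> (x - z))) <= e'"
      by (intro onorm_le) (metis Cauchy_Schwarz_ineq2 fun_diff_def inner_diff_left mult_right_mono norm_ge_zero order_trans real_norm_def)
    qed (use \<delta> in auto)
    then show ?thesis by (simp add: h_def)
   qed
   have "norm ((LBINT z. \<rho> (y - z) * f z) - (LBINT z. \<rho> (x - z) * f z) - ?D h)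
    = norm (LBINT z. \<rho> (y - z) * f z - \<rho> (x - z) * f z - (grad \<rho> (x - z) \<bullet> h) * f z)"
    unfolding D using int[OF cont\<rho> K(2)] Dint by simp
   also have "... <= (LBINT z. norm h * e' * \<bar>f z\<bar>)"
   proof (rule Bochner_Integration.integral_norm_bound_integral)
    show "norm (\<rho> (y - z) * f z - \<rho> (x - z) * f z - grad \<rho> (x - z) \<bullet> h * f z) <= norm h * e' * \<bar>f z\<bar>" for z
     using mult_right_mono[OF pt[of z], of "\<bar>f z\<bar>"]
     by (simp add: abs_mult[symmetric] left_diff_distrib)
   qed (use int[OF cont\<rho> K(2)] Dint f in auto)
   also have "... = norm h * e' * I" by (simp add: I_def)
   also have "... <= e * norm h"
    using I0 e by (simp add: e'_def field_simps mult_left_mono)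
   finally show "norm ((LBINT z. \<rho> (y - z) * f z) - (LBINT z. \<rho> (x - z) * f z) - ?D (y - x)) <= e * norm (y - x)"
    by (simp add: h_def)
  qed (use \<delta> in auto)
 qed
qed

lemma convolution_Ck:
 fixes f \<rho> :: "'a::euclidean_space => real"
 assumes f: "integrable lborel f" and \<rho>: "!!k. Ck_on k UNIV \<rho>"
  and K: "compact K" "!!x. x ~: K ==> \<rho> x = 0"
 shows "Ck_on k UNIV (%x. LBINT y. \<rho> (x - y) * f y)"
  and "b \<in> Basis ==> partial_deriv b (%x. LBINT y. \<rho> (x - y) * f y) x = (LBINT y. partial_deriv b \<rho> (x - y) * f y)"
proof -
 have single: "(\<Sum>c\<in>Basis. (b \<bullet> c) * g c) = g b" if "b \<in> Basis" for b and g :: "'a => real"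
  using that by (subst sum.cong[OF refl, of _ _ "%c. if c = b then g b else 0"]) (auto simp: inner_Basis)
 show "Ck_on k UNIV (%x. LBINT y. \<rho> (x - y) * f y)"
  using \<rho> K(2)
 proof (induction k arbitrary: \<rho>)
  case 0
  from convolution_has_derivative[OF f 0(1) K(1) 0(2)]
  have "isCont (%x. LBINT y. \<rho> (x - y) * f y) x" for x
   by (rule has_derivative_continuous)
  then show ?case by (simp add: continuous_at_imp_continuous_on)
 next
  case (Suc k)
  show ?case
  proof (rule Ck_on_SucI[OF open_UNIV convolution_has_derivative[OF f Suc.prems(1) K(1) Suc.prems(2)]])
   fix b :: 'a assume b: "b \<in> Basis"
   have "Ck_on k UNIV (%x. LBINT y. partial_deriv b \<rho> (x - y) * f y)"
   proof (rule Suc.IH)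
    show "Ck_on k UNIV (partial_deriv b \<rho>)" for k using Suc.prems(1)[of "Suc k"] b by simp
    fix z assume "z ~: K"
    then have "partial_deriv b \<rho> z = partial_deriv b (%x. 0) z"
     using K(1) Suc.prems(2) compact_imp_closed by (intro partial_deriv_cong[of "-K"]) (auto simp: open_Compl)
    then show "partial_deriv b \<rho> z = 0" by simp
   qed
   then show "Ck_on k UNIV (%x. \<Sum>c\<in>Basis. b \<bullet> c * (LBINT y. partial_deriv c \<rho> (x - y) * f y))"
    by (simp add: single[OF b])
  qed auto
 qed
 show "partial_deriv b (%x. LBINT y. \<rho> (x - y) * f y) x = (LBINT y. partial_deriv b \<rho> (x - y) * f y)" if "b \<in> Basis"
  using partial_deriv_eq[OF convolution_has_derivative[OF f \<rho> K], of b] single[OF that] by simp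
qed

definition mollifier :: "real => 'a::euclidean_space => real" where
 "mollifier e x = bump e x / (LBINT y. bump e (y::'a))"

lemma bump_integrable:
 assumes "e > 0"
 shows "integrable lborel (bump e :: 'a::euclidean_space => real)" "(LBINT y. bump e (y::'a)) > 0"
proof -
 have c: "continuous_on UNIV (bump e :: 'a => real)" by (rule Ck_on_continuous[OF bump_Ck[of 0]])
 show int: "integrable lborel (bump e :: 'a => real)"
  by (rule integrable_compact_support[OF c compact_cball[of 0 e]]) (use assms in \<open>auto intro!: bump_zero\<close>)
 have "\<not> (AE x in lborel. bump e (x::'a) = 0)"
 proof
  assume "AE x in lborel. bump e (x::'a) = 0"
  then have "AE x in lborel. x ~: ball (0::'a) e"
   by eventually_elim (metis assms bump_pos_iff less_irrefl mem_ball_0)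
  then have "ball (0::'a) e \<in> null_sets lborel"
   by (subst AE_iff_null_sets) auto
  then have "emeasure lborel (ball (0::'a) e) = 0" by auto
  moreover have "emeasure lborel (ball (0::'a) e) > 0"
   using assms by (simp add: emeasure_ball unit_ball_vol_pos)
  ultimately show False by simp
 qed
 then show "(LBINT y. bump e (y::'a)) > 0"
  using integral_nonneg_eq_0_iff_AE[OF int] bump_nonneg
  by (metis (no_types, lifting) AE_I2 Bochner_Integration.integral_nonneg less_eq_real_def)
qed

lemma mollifier:
 assumes "e > 0"
 shows mollifier_Ck: "Ck_on k UNIV (mollifier e :: 'a::euclidean_space => real)"
  and mollifier_nonneg: "0 <= mollifier e (x::'a)"
  and mollifier_zero: "e <= norm x ==> mollifier e x = 0"
  and mollifier_minus: "mollifier e (- x) = mollifier e x"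
  and mollifier_integrable: "integrable lborel (mollifier e :: 'a => real)"
  and mollifier_integral: "(LBINT y. mollifier e (y::'a)) = 1"
proof -
 have "mollifier e = (%x::'a. (1 / (LBINT y. bump e (y::'a))) * bump e x)"
  by (simp add: mollifier_def fun_eq_iff)
 then show "Ck_on k UNIV (mollifier e :: 'a => real)"
  using Ck_on_cmult[OF open_UNIV bump_Ck] by metis
qed (use assms bump_integrable[OF assms, where 'a='a] bump_nonneg[of e x] bump_zero[of e x] in
  \<open>auto simp: mollifier_def[abs_def] bump_minus intro!: integrable_divide divide_nonneg_pos\<close>)

definition mollify :: "real => ('a::euclidean_space => 'b::euclidean_space) => 'a => 'b" where
 "mollify e f x = (LBINT y. mollifier e (x - y) *\<^sub>R f y)"

lemma mollifier_continuous: "e > 0 ==> continuous_on UNIV (mollifier e)"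
 by (rule Ck_on_continuous[OF mollifier_Ck[of e 0]])

lemma mollify_reflect:
 fixes f :: "'a::euclidean_space => 'b::euclidean_space"
 assumes "e > 0" "continuous_on UNIV f"
 shows "mollify e f x = (LBINT y. mollifier e y *\<^sub>R f (x - y))"
proof -
 have "(%y. mollifier e y *\<^sub>R f (x - y)) \<in> borel_measurable borel"
  by (intro borel_measurable_continuous_onI continuous_intros mollifier_continuous assms
    continuous_on_compose2[OF assms(2)]) auto
 from integral_reflect[OF this, of x] show ?thesis by (simp add: mollify_def)
qed

lemma integrable_mollifier_mult:
 fixes f :: "'a::euclidean_space => 'b::euclidean_space"
 assumes "e > 0" "continuous_on UNIV f"
 shows "integrable lborel (%y. mollifier e (x - y) *\<^sub>R f y)"
  and "integrable lborel (%y. mollifier e y *\<^sub>R f (x - y))"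
proof -
 show "integrable lborel (%y. mollifier e (x - y) *\<^sub>R f y)"
 proof (rule integrable_compact_support[OF _ compact_cball[of x e]])
  show "continuous_on UNIV (%y. mollifier e (x - y) *\<^sub>R f y)"
   by (intro continuous_intros assms continuous_on_compose2[OF mollifier_continuous[OF assms(1)]]) auto
 qed (use assms(1) in \<open>auto simp: dist_norm intro!: mollifier_zero\<close>)
 show "integrable lborel (%y. mollifier e y *\<^sub>R f (x - y))"
 proof (rule integrable_compact_support[OF _ compact_cball[of 0 e]])
  show "continuous_on UNIV (%y. mollifier e y *\<^sub>R f (x - y))"
   by (intro continuous_intros mollifier_continuous assms continuous_on_compose2[OF assms(2)]) auto
 qed (use assms(1) in \<open>auto simp: dist_norm intro!: mollifier_zero\<close>)
qed

text \<open>A mollification is an average with a probability density supported in the ball of radius \<open>e\<close>.\<close>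

lemma norm_mollify_diff_le:
 fixes f g :: "'a::euclidean_space => 'b::euclidean_space"
 assumes e: "e > 0" and f: "continuous_on UNIV f"
  and b: "!!y. norm y < e ==> norm (f (x - y) - c) <= B"
 shows "norm (mollify e f x - c) <= B"
proof -
 have "integrable lborel (%y::'a. mollifier e y *\<^sub>R c)" by (intro integrable_scaleR_left mollifier_integrable e)
 moreover have "c = (LBINT y. mollifier e (y::'a) *\<^sub>R c)"
  by (simp add: mollifier_integrable[OF e] mollifier_integral[OF e])
 ultimately have "mollify e f x - c = (LBINT y. mollifier e y *\<^sub>R f (x - y) - mollifier e y *\<^sub>R c)"
  using integrable_mollifier_mult[OF e f] by (simp add: mollify_reflect[OF e f])
 also have "norm ... <= (LBINT y. mollifier e (y::'a) * B)"
 proof (rule Bochner_Integration.integral_norm_bound_integral)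
  fix y :: 'a
  show "norm (mollifier e y *\<^sub>R f (x - y) - mollifier e y *\<^sub>R c) <= mollifier e y * B"
   using b[of y] mollifier_nonneg[OF e, of y] mollifier_zero[OF e, of y]
   by (cases "norm y < e") (auto simp: scaleR_diff_right[symmetric] intro: mult_left_mono)
 qed (use integrable_mollifier_mult[OF e f] mollifier_integrable[OF e] in auto)
 finally show ?thesis by (simp add: mollifier_integral[OF e])
qed

lemma norm_mollify_le:
 fixes f g :: "'a::euclidean_space => 'b::euclidean_space"
 assumes "e > 0" "continuous_on UNIV f" "!!y. norm (f y) <= B"
 shows "norm (mollify e f x) <= B"
 using norm_mollify_diff_le[of e f x 0 B] assms by simp

lemma mollify_zero:
 fixes f g :: "'a::euclidean_space => 'b::euclidean_space"
 assumes "e > 0" "continuous_on UNIV f" "!!y. norm y < e ==> f (x - y) = 0"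
 shows "mollify e f x = 0"
 using norm_mollify_diff_le[of e f x 0 0] assms by simp

lemma mollify_lipschitz:
 fixes f :: "'a::euclidean_space => 'b::euclidean_space"
 assumes e: "e > 0" and L: "L-lipschitz_on UNIV f"
 shows "L-lipschitz_on UNIV (mollify e f)"
proof (rule lipschitz_onI)
 have f: "continuous_on UNIV f" using L by (rule lipschitz_on_continuous_on)
 fix x z :: 'a
 define g where "g = (%y. f y - f (y + (z - x)))"
 have g: "continuous_on UNIV g"
  unfolding g_def by (intro continuous_intros f continuous_on_compose2[OF f]) auto
 have "mollify e f x - mollify e f z = mollify e g x"
  unfolding mollify_reflect[OF e f] mollify_reflect[OF e g]
  using integrable_mollifier_mult(2)[OF e f]
  by (subst Bochner_Integration.integral_diff[symmetric])
   (auto simp: g_def scaleR_diff_right algebra_simps)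
 moreover have "norm (g y) <= L * dist x z" for y
  using lipschitz_onD[OF L, of y "y + (z - x)"] by (simp add: g_def dist_norm norm_minus_commute)
 ultimately show "dist (mollify e f x) (mollify e f z) <= L * dist x z"
  using norm_mollify_le[OF e g] by (metis dist_norm)
qed (use lipschitz_on_nonneg[OF L] in auto)

lemma mollify_inner:
 fixes f :: "'a::euclidean_space => 'b::euclidean_space"
 assumes "e > 0" "continuous_on UNIV f"
 shows "mollify e f x \<bullet> b = mollify e (%y. f y \<bullet> b) x"
 unfolding mollify_def using integrable_mollifier_mult[OF assms]
 by (subst integral_inner_left[symmetric]) auto

lemma mollify_Ck:
 fixes f :: "'a::euclidean_space => real"
 assumes "e > 0" "integrable lborel f"
 shows "Ck_on k UNIV (mollify e f)"
  and "b \<in> Basis ==> partial_deriv b (mollify e f) x = (LBINT y. partial_deriv b (mollifier e) (x - y) * f y)"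
proof -
 note * = convolution_Ck[OF assms(2) mollifier_Ck[OF assms(1)] compact_cball[of 0 e]]
 have z: "!!x::'a. x ~: cball 0 e ==> mollifier e x = 0"
  using assms(1) by (auto intro!: mollifier_zero)
 show "Ck_on k UNIV (mollify e f)" using *(1)[OF z] by (simp add: mollify_def[abs_def])
 show "b \<in> Basis ==> partial_deriv b (mollify e f) x = (LBINT y. partial_deriv b (mollifier e) (x - y) * f y)"
  using *(2)[OF z] by (simp add: mollify_def[abs_def])
qed

text \<open>Integration by parts moves the derivative from the kernel to the function.\<close>

lemma partial_deriv_mollify:
 fixes f :: "'a::euclidean_space => real"
 assumes e: "e > 0" and f: "continuous_on UNIV f" "integrable lborel f"
  and W: "open W" "cball x e \<subseteq> W" "Ck_on 1 W f" and b: "b \<in> Basis"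
 shows "integrable lborel (%y. mollifier e (x - y) * partial_deriv b f y)"
  and "partial_deriv b (mollify e f) x = (LBINT y. mollifier e (x - y) * partial_deriv b f y)"
proof -
 define m where "m = (%y::'a. mollifier e (x - y))"
 have cm: "continuous_on UNIV (%y. partial_deriv b (mollifier e) (x - y))" if "b \<in> Basis" for b
 proof -
  have "continuous_on UNIV (partial_deriv b (mollifier e :: 'a => real))"
   using mollifier_Ck[OF e, of 1, where 'a='a] that by simp
  then show ?thesis by (rule continuous_on_compose2) (auto intro!: continuous_intros)
 qed
 have mC: "Ck_on 1 UNIV m"
 proof -
  have "(m has_derivative (%h. grad (mollifier e) (x - y) \<bullet> (- h))) (at y)" for y
   unfolding m_def
   by (rule has_derivative_compose[where g="mollifier e", OF _ Ck_on_has_derivative[OF mollifier_Ck[OF e] open_UNIV UNIV_I]])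
    (auto intro!: derivative_eq_intros)
  moreover have "continuous_on UNIV (%y. grad (mollifier e) (x - y) \<bullet> (- b))" if "b \<in> Basis" for b
   using cm[OF that] that by (simp add: grad_inner_Basis continuous_on_minus)
  ultimately show ?thesis unfolding One_nat_def by (intro Ck_on_SucI[where D="%y h. grad (mollifier e) (x - y) \<bullet> (- h)"]) auto
 qed
 have dm: "partial_deriv b m y = - partial_deriv b (mollifier e) (x - y)" for y
 proof -
  have "(m has_derivative (%h. grad (mollifier e) (x - y) \<bullet> (- h))) (at y)"
   unfolding m_def
   by (rule has_derivative_compose[where g="mollifier e", OF _ Ck_on_has_derivative[OF mollifier_Ck[OF e] open_UNIV UNIV_I]])
    (auto intro!: derivative_eq_intros)
  from partial_deriv_eq[OF this, of b] show ?thesis by (simp add: grad_inner_Basis[OF b])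
 qed
 have z: "m y = 0" if "y ~: cball x e" for y
  using that mollifier_zero[OF e, of "x - y"] by (auto simp: m_def dist_norm)
 note p = integration_by_parts[OF W(1,3) Ck_on_subset[OF mC subset_UNIV] compact_cball W(2) z b]
 show "integrable lborel (%y. mollifier e (x - y) * partial_deriv b f y)" using p(1) by (simp add: m_def)
 show "partial_deriv b (mollify e f) x = (LBINT y. mollifier e (x - y) * partial_deriv b f y)"
  unfolding mollify_Ck(2)[OF e f(2) b] using p(3) unfolding dm by (simp add: m_def)
qed

section \<open>Test fields and the perimeter\<close>

lemma test_functionsI:
 assumes "!!k. Ck_on k UNIV \<phi>" "compact K" "K \<subseteq> U" "!!x. x ~: K ==> \<phi> x = 0"
 shows "\<phi> \<in> test_functions U"
proof -
 have "closure {x. \<phi> x ~= 0} \<subseteq> K"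
  using assms(2,4) by (intro closure_minimal) (auto simp: compact_imp_closed)
 then show ?thesis
  using assms compact_closure by (auto simp: test_functions_def) (meson bounded_subset closure_subset compact_imp_bounded subset_trans)
qed

lemma test_functionsD:
 assumes "\<phi> \<in> test_functions U"
 obtains K where "compact K" "K \<subseteq> U" "!!x. x ~: K ==> \<phi> x = 0"
proof
 show "compact (closure {x. \<phi> x ~= 0})" "closure {x. \<phi> x ~= 0} \<subseteq> U"
  using assms by (auto simp: test_functions_def)
 show "\<phi> x = 0" if "x ~: closure {x. \<phi> x ~= 0}" for x
  using that closure_subset[of "{x. \<phi> x ~= 0}"] by blast
qed

lemma test_functions_Ck: "\<phi> \<in> test_functions U ==> Ck_on k UNIV \<phi>"
 by (auto simp: test_functions_def)

lemma test_functions_mono: "\<phi> \<in> test_functions U ==> U \<subseteq> V ==> \<phi> \<in> test_functions V"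
 by (auto simp: test_functions_def)

lemma test_fields_component: "\<xi> \<in> test_fields U ==> b \<in> Basis ==> (%x. \<xi> x \<bullet> b) \<in> test_functions U"
 by (auto simp: test_fields_def)

lemma test_fieldsD:
 assumes "\<xi> \<in> test_fields U"
 obtains K where "compact K" "K \<subseteq> U" "!!x. x ~: K ==> \<xi> x = 0"
proof -
 have "\<exists>K. compact K & K \<subseteq> U & (\<forall>x. x ~: K --> \<xi> x \<bullet> b = 0)" if "b \<in> Basis" for b
  using test_functionsD[OF test_fields_component[OF assms that]] by metis
 then obtain k where k: "!!b. b \<in> Basis ==> compact (k b) & k b \<subseteq> U & (\<forall>x. x ~: k b --> \<xi> x \<bullet> b = 0)"
  by metis
 show thesis
 proof
  show "compact (\<Union>b\<in>Basis. k b)" "(\<Union>b\<in>Basis. k b) \<subseteq> U" using k by auto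
  show "\<xi> x = 0" if "x ~: (\<Union>b\<in>Basis. k b)" for x
   by (rule euclidean_eqI) (use that k in auto)
 qed
qed

lemma continuous_on_components:
 fixes f :: "'a::euclidean_space => 'b::euclidean_space"
 assumes "!!b. b \<in> Basis ==> continuous_on S (%x. f x \<bullet> b)"
 shows "continuous_on S f"
 by (subst continuous_on_componentwise) (use assms in simp)

lemma test_fields_continuous: "\<xi> \<in> test_fields U ==> continuous_on S \<xi>"
proof (rule continuous_on_subset[OF continuous_on_components[of UNIV]])
 fix b :: 'a assume "\<xi> \<in> test_fields U" "b \<in> Basis"
 then show "continuous_on UNIV (%x. \<xi> x \<bullet> b)"
  by (rule Ck_on_continuous[where k=0, OF test_functions_Ck[OF test_fields_component]])
qed simp

lemma mollify_support:
 fixes f :: "'a::euclidean_space => 'b::euclidean_space"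
 assumes "e > 0" "continuous_on UNIV f" "!!x. x ~: K ==> f x = 0" "x ~: {x + y |x y. x \<in> K & y \<in> cball 0 e}"
 shows "mollify e f x = 0"
proof (rule mollify_zero[OF assms(1,2)])
 fix y :: 'a assume "norm y < e"
 have "x - y ~: K"
 proof
  assume "x - y \<in> K"
  moreover have "x = (x - y) + y" "y \<in> cball 0 e" using \<open>norm y < e\<close> by auto
  ultimately show False using assms(4) by blast
 qed
 then show "f (x - y) = 0" using assms(3) by blast
qed

lemma mollify_test_function:
 fixes f :: "'a::euclidean_space => real"
 assumes e: "e > 0" and f: "continuous_on UNIV f" and K: "compact K" "!!x. x ~: K ==> f x = 0"
  and U: "{x + y |x y. x \<in> K & y \<in> cball 0 e} \<subseteq> U"
 shows "mollify e f \<in> test_functions U"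
proof (rule test_functionsI[OF _ _ U])
 show "Ck_on k UNIV (mollify e f)" for k
  by (rule mollify_Ck(1)[OF e integrable_compact_support[OF f K]])
 show "compact {x + y |x y. x \<in> K & y \<in> cball (0::'a) e}" by (rule compact_sums[OF K(1) compact_cball])
qed (rule mollify_support[OF e f K(2)])

lemma mollify_test_field:
 fixes f :: "'a::euclidean_space => 'a"
 assumes e: "e > 0" and f: "continuous_on UNIV f" and K: "compact K" "!!x. x ~: K ==> f x = 0"
  and U: "{x + y |x y. x \<in> K & y \<in> cball 0 e} \<subseteq> U"
 shows "mollify e f \<in> test_fields U"
 unfolding test_fields_def mem_Collect_eq mollify_inner[OF e f]
 by (intro ballI mollify_test_function[OF e _ K(1) _ U]) (auto intro!: continuous_intros f simp: K)

lemma compact_thicken: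
 fixes K :: "'a::euclidean_space set"
 assumes "compact K" "open U" "K \<subseteq> U"
 obtains e where "e > 0" "!!d. d <= e ==> {x + y |x y. x \<in> K & y \<in> cball 0 d} \<subseteq> U"
proof -
 obtain e where e: "e > 0" "(\<Union>x\<in>K. cball x e) \<subseteq> U"
  using compact_subset_open_imp_cball_epsilon_subset[OF assms] .
 have "x + y \<in> U" if "d <= e" "x \<in> K" "norm y <= d" for d x y
 proof -
  have "x + y \<in> cball x e" using that by (simp add: dist_norm)
  then show ?thesis using e that by blast
 qed
 then show thesis using that[OF e(1)] by fastforce
qed

lemma mollify_uniform:
 fixes f :: "'a::euclidean_space => 'b::euclidean_space"
 assumes f: "continuous_on UNIV f" and K: "compact K" "!!x. x ~: K ==> f x = 0" and r: "r > 0"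
 obtains d where "d > 0" "!!e x. 0 < e ==> e <= d ==> norm (mollify e f x - f x) <= r"
proof -
 obtain d where d: "d > 0" "!!x y. dist y x < d ==> dist (f y) (f x) < r"
  using uniformly_continuous_of_compact_support[OF f K] r unfolding uniformly_continuous_on_def by (metis UNIV_I)
 show thesis
 proof (rule that[OF d(1)])
  fix e x assume e: "0 < e" "e <= d"
  show "norm (mollify e f x - f x) <= r"
  proof (rule norm_mollify_diff_le[OF e(1) f])
   fix y :: 'a assume "norm y < e"
   then show "norm (f (x - y) - f x) <= r" using d(2)[of "x - y" x] e by (simp add: dist_norm)
  qed
 qed
qed

lemma mollifier_shift:
 assumes "e > 0"
 shows "integrable lborel (%y. mollifier e (x - y))" "(LBINT y. mollifier e (x - y)) = 1"
 using integrable_mollifier_mult(1)[OF assms, of "%_. 1::real" x]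
  integral_reflect[of "mollifier e" x] mollifier_integral[OF assms, where 'a='a]
  borel_measurable_continuous_onI[OF mollifier_continuous[OF assms, where 'a='a]]
 by auto

lemma partial_deriv_mollify_tendsto:
 fixes f :: "'a::euclidean_space => real"
 assumes f: "continuous_on UNIV f" "integrable lborel f"
  and W: "open W" "x \<in> W" "Ck_on 1 W f" and b: "b \<in> Basis"
 shows "((%e. partial_deriv b (mollify e f) x) \<longlongrightarrow> partial_deriv b f x) (at_right 0)"
proof (rule tendstoI)
 fix r :: real assume r: "r > 0"
 have "continuous_on W (partial_deriv b f)" using W b by auto
 then have "isCont (partial_deriv b f) x" using W continuous_on_eq_continuous_at by blast
 then obtain d1 where d1: "d1 > 0" "!!y. dist y x < d1 ==> dist (partial_deriv b f y) (partial_deriv b f x) < r / 2"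
  unfolding continuous_at_eps_delta using r by (metis half_gt_zero)
 obtain d2 where d2: "d2 > 0" "cball x d2 \<subseteq> W" using W open_contains_cball by blast
 have "dist (partial_deriv b (mollify e f) x) (partial_deriv b f x) < r" if e: "0 < e" "e < min d1 d2" for e
 proof -
  let ?c = "partial_deriv b f x"
  note * = partial_deriv_mollify[OF e(1) f W(1) _ W(3) b, of x]
  have sub: "cball x e \<subseteq> W" using e d2 by (meson min.strict_boundedE subset_cball less_imp_le subset_trans)
  have i: "integrable lborel (%y. mollifier e (x - y) * ?c)" "(LBINT y. mollifier e (x - y) * ?c) = ?c"
   using mollifier_shift[OF e(1), of x] by auto
  have "\<bar>partial_deriv b (mollify e f) x - ?c\<bar>
   = \<bar>LBINT y. mollifier e (x - y) * partial_deriv b f y - mollifier e (x - y) * ?c\<bar>"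
   by (subst Bochner_Integration.integral_diff) (use *[OF sub] i in auto)
  also have "... <= (LBINT y. mollifier e (x - y) * (r / 2))"
   unfolding real_norm_def[symmetric]
  proof (rule Bochner_Integration.integral_norm_bound_integral)
   show "integrable lborel (%y. mollifier e (x - y) * (r / 2))"
    using mollifier_shift[OF e(1), of x] by auto
   fix y :: 'a
   show "norm (mollifier e (x - y) * partial_deriv b f y - mollifier e (x - y) * ?c) <= mollifier e (x - y) * (r / 2)"
   proof (cases "norm (x - y) < e")
    case True
    then have "\<bar>partial_deriv b f y - ?c\<bar> <= r / 2" using d1(2)[of y] e by (simp add: dist_norm norm_minus_commute)
    from mult_left_mono[OF this mollifier_nonneg[OF e(1), of "x - y"]] show ?thesis
     using mollifier_nonneg[OF e(1), of "x - y"]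
     by (simp only: right_diff_distrib[symmetric] real_norm_def abs_mult abs_of_nonneg)
   next
    case False
    then show ?thesis using mollifier_zero[OF e(1), of "x - y"] by simp
   qed
  qed (use *[OF sub] i in auto)
  also have "... = r / 2"
   using mollifier_shift[OF e(1), of x] by simp
  finally show ?thesis using r by (simp add: dist_norm)
 qed
 moreover have "eventually (%e. e \<in> {0<..<min d1 d2}) (at_right 0)"
  using d1 d2 by (intro eventually_at_right_real) auto
 ultimately show "\<forall>\<^sub>F e in at_right 0. dist (partial_deriv b (mollify e f) x) (partial_deriv b f x) < r"
  by (auto elim!: eventually_mono)
qed

lemma has_derivative_direction:
 assumes "(f has_derivative (%h. w \<bullet> h)) (at (x + t *\<^sub>R b))"
 shows "((%t. f (x + t *\<^sub>R b)) has_real_derivative (w \<bullet> b)) (at t)"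
proof -
 have "((%t. f (x + t *\<^sub>R b)) has_derivative (%h. w \<bullet> (h *\<^sub>R b))) (at t)"
  by (rule has_derivative_compose[where g=f and f="%t. x + t *\<^sub>R b" and g'="%h. w \<bullet> h", OF _ assms]) (auto intro!: derivative_eq_intros)
 moreover have "(%h. w \<bullet> (h *\<^sub>R b)) = (*) (w \<bullet> b)" by auto
 ultimately show ?thesis by (simp add: has_field_derivative_def)
qed

lemma partial_deriv_lipschitz_le:
 fixes f :: "'a::euclidean_space => real"
 assumes L: "L-lipschitz_on UNIV f" and d: "f differentiable (at x)" and b: "b \<in> Basis"
 shows "\<bar>partial_deriv b f x\<bar> <= L"
proof -
 have "((%t. f (x + t *\<^sub>R b)) has_real_derivative (grad f x \<bullet> b)) (at 0)"
  using has_derivative_direction[of f "grad f x" x 0 b] has_derivative_grad[OF d] by simp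
 then have "((%h. (f (x + h *\<^sub>R b) - f x) / h) \<longlongrightarrow> partial_deriv b f x) (at 0)"
  by (simp add: has_field_derivative_iff grad_inner_Basis[OF b])
 then have "((%h. \<bar>(f (x + h *\<^sub>R b) - f x) / h\<bar>) \<longlongrightarrow> \<bar>partial_deriv b f x\<bar>) (at 0)"
  by (rule tendsto_rabs)
 then show ?thesis
 proof (rule tendsto_upperbound)
  show "\<forall>\<^sub>F h in at 0. \<bar>(f (x + h *\<^sub>R b) - f x) / h\<bar> <= L"
  proof (rule eventually_at_filter[THEN iffD2], rule always_eventually, intro allI impI)
   fix h :: real assume "h ~= 0"
   then show "\<bar>(f (x + h *\<^sub>R b) - f x) / h\<bar> <= L"
    using lipschitz_onD[OF L, of "x + h *\<^sub>R b" x] b by (simp add: dist_norm field_simps norm_Basis)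
  qed
 qed auto
qed

lemma lipschitz_on_inner_Basis:
 fixes V :: "'a::metric_space => 'b::euclidean_space"
 assumes "L-lipschitz_on S V" "b \<in> Basis"
 shows "L-lipschitz_on S (%x. V x \<bullet> b)"
proof (rule lipschitz_onI)
 fix x y assume "x \<in> S" "y \<in> S"
 then show "dist (V x \<bullet> b) (V y \<bullet> b) <= L * dist x y"
  using lipschitz_onD[OF assms(1)] Basis_le_norm[OF assms(2), of "V x - V y"]
  by (force simp: dist_norm inner_diff_left)
qed (use lipschitz_on_nonneg[OF assms(1)] in auto)

lemma set_integrable_bounded_finite:
 fixes f :: "'a::euclidean_space => real"
 assumes "A \<in> sets borel" "emeasure lborel A < \<infinity>" "set_borel_measurable lborel A f"
  "!!x. x \<in> A ==> \<bar>f x\<bar> <= C"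
 shows "set_integrable lborel A f"
 unfolding set_integrable_def
proof (rule Bochner_Integration.integrable_bound)
 show "integrable lborel (%x. indicat_real A x *\<^sub>R C)"
  using assms by (auto intro!: integrable_real_indicator)
 show "AE x in lborel. norm (indicat_real A x *\<^sub>R f x) <= norm (indicat_real A x *\<^sub>R C)"
  using assms(4) by (auto simp: indicator_def intro!: AE_I2) (metis abs_ge_zero abs_of_nonneg order_trans)
qed (use assms(3) in \<open>simp add: set_borel_measurable_def\<close>)

lemma divergence_borel:
 assumes "\<eta> \<in> test_fields U"
 shows "continuous_on UNIV (divergence \<eta>)"
proof -
 have "continuous_on UNIV (partial_deriv b (%y. \<eta> y \<bullet> b))" if "b \<in> Basis" for b
  using test_functions_Ck[OF test_fields_component[OF assms that], of 1] that by simp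
 then show ?thesis unfolding divergence_def[abs_def] by (intro continuous_on_sum)
qed

text \<open>Mollifications of a Lipschitz field are admissible test fields with the same Lipschitz constant, so
their divergences are uniformly bounded and converge where the field is \<open>C\<^sup>1\<close>.\<close>

lemma integral_divergence_le_perimeter:
 fixes V :: "'a::euclidean_space => 'a"
 assumes V: "L-lipschitz_on UNIV V" "!!x. norm (V x) <= 1"
  and K: "compact K" "K \<subseteq> U" "!!x. x ~: K ==> V x = 0" and U: "open U"
  and W: "open W" "!!b. b \<in> Basis ==> Ck_on 1 W (%x. V x \<bullet> b)"
  and A: "A \<in> sets borel" "A \<subseteq> W" "emeasure lborel A < \<infinity>"
 shows "ereal (LBINT x:A. divergence V x) <= perimeter A U"
proof -
 have c: "continuous_on UNIV V" by (rule lipschitz_on_continuous_on[OF V(1)])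
 have cb: "continuous_on UNIV (%x. V x \<bullet> b)" for b by (intro continuous_intros c)
 have ib: "integrable lborel (%x. V x \<bullet> b)" for b
  by (rule integrable_compact_support[OF cb K(1)]) (simp add: K)
 obtain e0 where e0: "e0 > 0" "!!d. d <= e0 ==> {x + y |x y. x \<in> K & y \<in> cball 0 d} \<subseteq> U"
  using compact_thicken[OF K(1) U K(2)] by blast
 define e where "e = (%n::nat. e0 / real (Suc n))"
 have e: "e n > 0" "e n <= e0" for n using e0 by (auto simp: e_def field_simps)
 have "e \<longlonglongrightarrow> 0" unfolding e_def by (rule LIMSEQ_Suc[OF lim_const_over_n])
 then have elim: "filterlim e (at_right 0) sequentially"
  using e(1) by (auto simp: filterlim_at intro!: always_eventually) (metis less_irrefl)
 define \<eta> where "\<eta> = (%n. mollify (e n) V)"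
 have \<eta>: "\<eta> n \<in> test_fields U" "norm (\<eta> n x) <= 1" for n x
  unfolding \<eta>_def using mollify_test_field[OF e(1) c K(1,3) e0(2)[OF e(2)]] norm_mollify_le[OF e(1) c V(2)] by auto
 have d\<eta>: "divergence (\<eta> n) x = (\<Sum>b\<in>Basis. partial_deriv b (mollify (e n) (%x. V x \<bullet> b)) x)" for n x
  by (simp add: divergence_def \<eta>_def mollify_inner[OF e(1) c])
 have bound: "\<bar>divergence (\<eta> n) x\<bar> <= real DIM('a) * L" for n x
 proof -
  have "\<bar>divergence (\<eta> n) x\<bar> <= (\<Sum>b\<in>Basis. \<bar>partial_deriv b (mollify (e n) (%x. V x \<bullet> b)) x\<bar>)"
   unfolding d\<eta> by (rule sum_abs)
  also have "... <= (\<Sum>b\<in>(Basis::'a set). L)"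
  proof (rule sum_mono)
   fix b :: 'a assume b: "b \<in> Basis"
   have "Ck_on 1 UNIV (mollify (e n) (%x. V x \<bullet> b))" by (rule mollify_Ck(1)[OF e(1) ib])
   then have "mollify (e n) (%x. V x \<bullet> b) differentiable (at x)"
    by (auto simp: differentiable_on_open)
   then show "\<bar>partial_deriv b (mollify (e n) (%x. V x \<bullet> b)) x\<bar> <= L"
    using partial_deriv_lipschitz_le[OF mollify_lipschitz[OF e(1) lipschitz_on_inner_Basis[OF V(1) b]] _ b] by blast
  qed
  finally show ?thesis by simp
 qed
 have "(%n. LBINT x:A. divergence (\<eta> n) x) \<longlonglongrightarrow> (LBINT x:A. divergence V x)"
  unfolding set_lebesgue_integral_def
 proof (rule integral_dominated_convergence)
  have lim: "(%n. indicat_real A x *\<^sub>R divergence (\<eta> n) x) \<longlonglongrightarrow> indicat_real A x *\<^sub>R divergence V x" for x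
  proof (cases "x \<in> A")
   case True
   then have x: "x \<in> W" using A by auto
   have "(%n. divergence (\<eta> n) x) \<longlonglongrightarrow> divergence V x"
    unfolding d\<eta> divergence_def[of V]
    by (intro tendsto_sum filterlim_compose[OF partial_deriv_mollify_tendsto[OF cb ib W(1) x W(2)] elim])
   then show ?thesis by (intro tendsto_intros)
  qed simp
  show m: "(%x. indicat_real A x *\<^sub>R divergence (\<eta> n) x) \<in> borel_measurable lborel" for n
   using borel_measurable_continuous_onI[OF divergence_borel[OF \<eta>(1)]] A by simp
  show "(%x. indicat_real A x *\<^sub>R divergence V x) \<in> borel_measurable lborel"
   by (rule borel_measurable_LIMSEQ_real[OF lim m])
  show "AE x in lborel. (%n. indicat_real A x *\<^sub>R divergence (\<eta> n) x) \<longlonglongrightarrow> indicat_real A x *\<^sub>R divergence V x"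
   using lim by simp
  show "integrable lborel (%x. indicat_real A x *\<^sub>R (real DIM('a) * L))"
   using A by (auto intro!: integrable_real_indicator)
  show "AE x in lborel. norm (indicat_real A x *\<^sub>R divergence (\<eta> n) x) <= indicat_real A x *\<^sub>R (real DIM('a) * L)" for n
   using bound by (auto simp: indicator_def)
 qed
 then have "(%n. ereal (LBINT x:A. divergence (\<eta> n) x)) \<longlonglongrightarrow> ereal (LBINT x:A. divergence V x)"
  by simp
 then show ?thesis
 proof (rule LIMSEQ_le_const2)
  show "\<exists>N. \<forall>n\<ge>N. ereal (LBINT x:A. divergence (\<eta> n) x) <= perimeter A U"
   unfolding perimeter_def using \<eta> by (auto intro!: SUP_upper2[OF _ order_refl])
 qed
qed

section \<open>Sets with vanishing distributional gradient\<close>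

lemma mollify_symmetric:
 fixes f \<phi> :: "'a::euclidean_space => real"
 assumes e: "e > 0" and f: "integrable lborel f" and \<phi>: "continuous_on UNIV \<phi>" "compact K" "!!x. x ~: K ==> \<phi> x = 0"
 shows "(LBINT x. \<phi> x * mollify e f x) = (LBINT y. f y * mollify e \<phi> y)"
proof -
 obtain C where C: "C > 0" "!!x. norm (mollifier e (x::'a)) <= C"
  using bounded_compact_support[OF mollifier_continuous[OF e] compact_cball[of 0 e]]
   mollifier_zero[OF e] by (metis less_imp_le mem_cball_0 not_le)
 have i\<phi>: "integrable lborel \<phi>" by (rule integrable_compact_support[OF \<phi>])
 have [measurable]: "\<phi> \<in> borel_measurable borel" "f \<in> borel_measurable borel"
  "mollifier e \<in> borel_measurable (borel :: 'a measure)"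
  using f i\<phi> borel_measurable_continuous_onI[OF mollifier_continuous[OF e]] by auto
 let ?F = "%x y. \<phi> x * (mollifier e (x - y) * f y)"
 have if': "integrable lborel (%y. mollifier e (x - y) * f y)" for x
  by (rule Bochner_Integration.integrable_bound[of _ "%x. C * f x"])
   (use f C in \<open>auto simp: abs_mult intro!: mult_right_mono\<close>)
 have "integrable (lborel \<Otimes>\<^sub>M lborel) (case_prod ?F)"
 proof (rule lborel_pair.Fubini_integrable)
  show "case_prod ?F \<in> borel_measurable (lborel \<Otimes>\<^sub>M lborel)" by measurable
  show "AE x in lborel. integrable lborel (%y. case (x, y) of (x, y) => ?F x y)"
   using if' by auto
  show "integrable lborel (%x. LBINT y. norm (case (x, y) of (x, y) => ?F x y))"
  proof (rule Bochner_Integration.integrable_bound)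
   show "integrable lborel (%x. \<phi> x * (C * (LBINT y. \<bar>f y\<bar>)))" using i\<phi> by simp
   show "(%x. LBINT y. norm (case (x, y) of (x, y) => ?F x y)) \<in> borel_measurable lborel" by measurable
   show "AE x in lborel. norm (LBINT y. norm (case (x, y) of (x, y) => ?F x y))
     <= norm (\<phi> x * (C * (LBINT y. \<bar>f y\<bar>)))"
   proof (rule AE_I2)
    fix x
    have "(LBINT y. \<bar>mollifier e (x - y) * f y\<bar>) <= (LBINT y. C * \<bar>f y\<bar>)"
     using integrable_abs[OF if'[of x]] f C(2) by (intro integral_mono) (auto simp: abs_mult intro!: mult_right_mono)
    then have "\<bar>\<phi> x\<bar> * (LBINT y. \<bar>mollifier e (x - y) * f y\<bar>) <= \<bar>\<phi> x\<bar> * (C * (LBINT y. \<bar>f y\<bar>))"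
     by (intro mult_left_mono) auto
    moreover have "0 <= (LBINT y. \<bar>f y\<bar>)" "0 <= (LBINT y. \<bar>mollifier e (x - y) * f y\<bar>)" by auto
    ultimately show "norm (LBINT y. norm (case (x, y) of (x, y) => ?F x y))
     <= norm (\<phi> x * (C * (LBINT y. \<bar>f y\<bar>)))"
     using C(1) by (simp add: abs_mult)
   qed
  qed
 qed
 from lborel_pair.Fubini_integral[OF this]
 have "(LBINT y. (LBINT x. ?F x y)) = (LBINT x. (LBINT y. ?F x y))" .
 moreover have "(LBINT x. ?F x y) = f y * mollify e \<phi> y" for y
 proof -
  have "?F x y = f y * (mollifier e (y - x) *\<^sub>R \<phi> x)" for x
   using mollifier_minus[OF e, of "x - y"] by simp
  then have "(LBINT x. ?F x y) = (LBINT x. f y * (mollifier e (y - x) *\<^sub>R \<phi> x))"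
   by (intro Bochner_Integration.integral_cong) auto
  then show ?thesis by (simp add: mollify_def)
 qed
 ultimately have "(LBINT x. (LBINT y. ?F x y)) = (LBINT y. f y * mollify e \<phi> y)" by simp
 then show ?thesis by (simp add: mollify_def)
qed

text \<open>The derivatives of the mollified indicator are integrals of derivatives of a test function over \<open>A\<close>,
hence zero; the points whose \<open>e\<close>-ball lies in a convex set form a convex set.\<close>

lemma mollify_constant_of_zero_gradient:
 assumes C: "open C" "convex C" "bounded C" and A: "A \<in> sets borel"
  and z: "!!\<phi> b. \<phi> \<in> test_functions C ==> b \<in> Basis ==> (LBINT x:A. partial_deriv b \<phi> x) = 0"
  and e: "e > 0"
 shows "\<exists>c. \<forall>x. cball x e \<subseteq> C --> mollify e (indicat_real (A \<inter> C)) x = c"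
proof -
 have CA: "A \<inter> C \<in> sets borel" using A C by auto
 have "emeasure lborel (A \<inter> C) <= emeasure lborel (closure C)"
  using C CA closure_subset by (intro emeasure_mono) auto
 then have fin: "emeasure lborel (A \<inter> C) < \<infinity>"
  using emeasure_compact_finite[of "closure C"] C by (auto simp: compact_closure)
 have i: "integrable lborel (indicat_real (A \<inter> C))" using CA fin by (auto intro!: integrable_real_indicator)
 let ?S = "{x. cball x e \<subseteq> C}"
 have "convex ?S"
 proof (rule convexI)
  fix x y and u v :: real assume *: "x \<in> ?S" "y \<in> ?S" "0 <= u" "0 <= v" "u + v = 1"
  show "u *\<^sub>R x + v *\<^sub>R y \<in> ?S"
  proof safe
   fix z assume z: "z \<in> cball (u *\<^sub>R x + v *\<^sub>R y) e"
   define w where "w = z - (u *\<^sub>R x + v *\<^sub>R y)"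
   have "norm w <= e" using z by (simp add: w_def dist_norm norm_minus_commute)
   then have "x + w \<in> C" "y + w \<in> C" using * by (auto simp: subset_eq dist_norm)
   then have "u *\<^sub>R (x + w) + v *\<^sub>R (y + w) \<in> C" using C(2) * by (simp add: convexD)
   moreover have "u *\<^sub>R (x + w) + v *\<^sub>R (y + w) = u *\<^sub>R x + v *\<^sub>R y + (u + v) *\<^sub>R w"
    by (simp add: algebra_simps)
   ultimately show "z \<in> C" using * by (simp add: w_def)
  qed
 qed
 moreover have "(mollify e (indicat_real (A \<inter> C)) has_derivative (%h. 0)) (at x within ?S)" if x: "x \<in> ?S" for x
 proof -
  have "partial_deriv b (mollify e (indicat_real (A \<inter> C))) x = 0" if b: "b \<in> Basis" for b
  proof -
   have z0: "mollifier e (x - y) = 0" if "y ~: cball x e" for y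
    using that by (intro mollifier_zero[OF e]) (simp add: dist_norm)
   have d: "((%y. mollifier e (x - y)) has_derivative (%h. grad (mollifier e) (x - y) \<bullet> - h)) (at y)" for y
    by (rule has_derivative_compose[where g="mollifier e", OF _ Ck_on_has_derivative[OF mollifier_Ck[OF e] open_UNIV UNIV_I]])
     (auto intro!: derivative_eq_intros)
   have T: "(%y. mollifier e (x - y)) \<in> test_functions C"
   proof (rule test_functionsI[OF _ compact_cball[of x e]])
    have eq: "(%y. mollifier e (x - y)) = (%y. (1 / (LBINT y. bump e (y::'a))) * exp_jet 1 (e\<^sup>2 - (norm (y - x))\<^sup>2))"
     by (simp add: mollifier_def bump_def norm_minus_commute fun_eq_iff)
    show "Ck_on k UNIV (%y. mollifier e (x - y))" for k
     unfolding eq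
    proof (intro Ck_on_cmult open_UNIV)
     have l: "Ck_on k UNIV (%y. e\<^sup>2 - (norm (y - x))\<^sup>2)"
      by (intro Ck_on_diff Ck_on_const Ck_on_norm_sq) auto
     show "Ck_on k UNIV (%y. exp_jet 1 (e\<^sup>2 - (norm (y - x))\<^sup>2))"
      by (rule Ck_on_compose_closed_family[where F="range exp_jet", OF _ _ _ l])
       (use exp_jet_deriv in blast)+
    qed
   qed (use x z0 in auto)
   have p: "partial_deriv b (%y. mollifier e (x - y)) y = - partial_deriv b (mollifier e) (x - y)" for y
    using partial_deriv_eq[OF d, of b] by (simp add: grad_inner_Basis[OF b])
   have "partial_deriv b (mollifier e) (x - y) * indicat_real (A \<inter> C) y
     = - (indicat_real A y *\<^sub>R partial_deriv b (%y. mollifier e (x - y)) y)" for y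
   proof (cases "y \<in> C")
    case False
    then have "y \<in> - cball x e" using x by auto
    then have "partial_deriv b (%y. mollifier e (x - y)) y = partial_deriv b (%y. 0) y"
     using z0 by (intro partial_deriv_cong[of "- cball x e"]) (auto simp: open_Compl)
    then show ?thesis using False by simp
   qed (auto simp: p indicator_def)
   then show ?thesis
    unfolding mollify_Ck(2)[OF e i b] using z[OF T b] by (simp add: set_lebesgue_integral_def)
  qed
  then have "grad (mollify e (indicat_real (A \<inter> C))) x = 0" by (simp add: grad_def)
  then show ?thesis
   using Ck_on_has_derivative[OF mollify_Ck(1)[OF e i, of "Suc 0"] open_UNIV UNIV_I, of x]
   by (auto intro: has_derivative_at_withinI)
 qed
 ultimately have "\<exists>c. \<forall>x\<in>?S. mollify e (indicat_real (A \<inter> C)) x = c"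
  by (rule has_derivative_zero_constant)
 then show ?thesis by simp
qed

text \<open>Mollification is symmetric, so testing with a mollified function is integration against a constant.
The constants belonging to different radii agree in the limit.\<close>

lemma indicator_proportional_of_zero_gradient:
 assumes C: "open C" "convex C" "bounded C" "C ~= {}" and A: "A \<in> sets borel"
  and z: "!!\<phi> b. \<phi> \<in> test_functions C ==> b \<in> Basis ==> (LBINT x:A. partial_deriv b \<phi> x) = 0"
 obtains c where "!!\<phi> K. continuous_on UNIV \<phi> ==> compact K ==> K \<subseteq> C ==> (!!x. x ~: K ==> \<phi> x = 0)
  ==> (LBINT x. indicat_real (A \<inter> C) x * \<phi> x) = c * (LBINT x. \<phi> x)"
proof -
 define f where "f = indicat_real (A \<inter> C)"
 have CA: "A \<inter> C \<in> sets borel" using A C by auto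
 have "emeasure lborel (A \<inter> C) <= emeasure lborel (closure C)"
  using C CA closure_subset by (intro emeasure_mono) auto
 then have fin: "emeasure lborel (A \<inter> C) < \<infinity>"
  using emeasure_compact_finite[of "closure C"] C by (auto simp: compact_closure)
 have i: "integrable lborel f" unfolding f_def using CA fin by (auto intro!: integrable_real_indicator)
 obtain c where c: "!!e x. e > 0 ==> cball x e \<subseteq> C ==> mollify e f x = c e"
  using mollify_constant_of_zero_gradient[OF C(1-3) A z] unfolding f_def by metis
 define s where "s = (%n::nat. inverse (real (Suc n)))"
 have s: "s \<longlonglongrightarrow> 0" "s n > 0" for n unfolding s_def by (rule LIMSEQ_inverse_real_of_nat) auto
 have lim: "(%n. c (s n) * (LBINT x. \<phi> x)) \<longlonglongrightarrow> (LBINT x. f x * \<phi> x)"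
  if \<phi>: "continuous_on UNIV \<phi>" "compact K" "K \<subseteq> C" "!!x. x ~: K ==> \<phi> x = 0" for \<phi> K
 proof (rule LIMSEQ_I)
  fix r :: real assume r: "r > 0"
  define I where "I = (LBINT x. \<bar>f x\<bar>)"
  have I: "I \<ge> 0" by (simp add: I_def)
  define r' where "r' = r / (2 * (I + 1))"
  have r': "r' > 0" using r I by (simp add: r'_def)
  obtain d where d: "d > 0" "!!e x. 0 < e ==> e <= d ==> norm (mollify e \<phi> x - \<phi> x) <= r'"
   using mollify_uniform[OF \<phi>(1,2,4) r'] by blast
  obtain d' where d': "d' > 0" "!!d. d <= d' ==> {x + y |x y. x \<in> K & y \<in> cball 0 d} \<subseteq> C"
   using compact_thicken[OF \<phi>(2) C(1) \<phi>(3)] by blast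
  obtain N where N: "!!n. n \<ge> N ==> s n < min d d'"
   using order_tendstoD(2)[OF s(1), of "min d d'"] d d' by (auto simp: eventually_sequentially)
  show "\<exists>N. \<forall>n\<ge>N. norm (c (s n) * (LBINT x. \<phi> x) - (LBINT x. f x * \<phi> x)) < r"
  proof (intro exI[of _ N] allI impI)
   fix n assume n: "n \<ge> N"
   have e: "s n > 0" "s n <= d" "s n <= d'" using s N[OF n] by auto
   have "\<phi> x * mollify (s n) f x = c (s n) * \<phi> x" for x
   proof (cases "x \<in> K")
    case True
    have "cball x (s n) \<subseteq> C"
    proof
     fix y assume "y \<in> cball x (s n)"
     then have "y - x \<in> cball 0 (s n)" "y = x + (y - x)" by (auto simp: dist_norm norm_minus_commute)
     then show "y \<in> C" using d'(2)[OF e(3)] True by blast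
    qed
    then show ?thesis using c[OF e(1)] by simp
   qed (use \<phi>(4) in simp)
   then have "(LBINT x. \<phi> x * mollify (s n) f x) = (LBINT x. c (s n) * \<phi> x)"
    by (intro Bochner_Integration.integral_cong) auto
   moreover have "(LBINT x. \<phi> x * mollify (s n) f x) = (LBINT x. f x * mollify (s n) \<phi> x)"
    by (rule mollify_symmetric[OF e(1) i \<phi>(1,2)]) (rule \<phi>(4))
   ultimately have cs: "c (s n) * (LBINT x. \<phi> x) = (LBINT x. f x * mollify (s n) \<phi> x)"
    by simp
   have m: "mollify (s n) \<phi> \<in> borel_measurable borel" "\<phi> \<in> borel_measurable borel"
    using borel_measurable_continuous_onI[OF \<phi>(1)]
     borel_measurable_continuous_onI[OF Ck_on_continuous[OF mollify_Ck(1)[OF e(1) integrable_compact_support[OF \<phi>(1,2,4)], of 0]]]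
    by auto
   obtain B where B: "B > 0" "!!x. norm (\<phi> x) <= B" using bounded_compact_support[OF \<phi>(1,2,4)] by blast
   have ii: "integrable lborel (%x. f x * \<psi> x)" if "\<psi> \<in> borel_measurable borel" "!!x. norm (\<psi> x) <= B" for \<psi> :: "'a => real"
    by (rule Bochner_Integration.integrable_bound[of _ "%x. B * f x"])
     (use i that B in \<open>auto simp: abs_mult mult.commute intro!: mult_right_mono\<close>)
   have "\<bar>(LBINT x. f x * mollify (s n) \<phi> x) - (LBINT x. f x * \<phi> x)\<bar>
    = \<bar>LBINT x. f x * mollify (s n) \<phi> x - f x * \<phi> x\<bar>"
    by (subst Bochner_Integration.integral_diff) (use ii[OF m(1)] norm_mollify_le[OF e(1) \<phi>(1) B(2)] ii[OF m(2) B(2)] in auto)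
   also have "... <= (LBINT x. \<bar>f x\<bar> * r')"
    unfolding real_norm_def[symmetric]
   proof (rule Bochner_Integration.integral_norm_bound_integral)
    show "norm (f x * mollify (s n) \<phi> x - f x * \<phi> x) <= norm (f x) * r'" for x
     using d(2)[OF e(1,2), of x] by (simp add: right_diff_distrib[symmetric] abs_mult mult_left_mono)
   qed (use ii[OF m(1)] norm_mollify_le[OF e(1) \<phi>(1) B(2)] ii[OF m(2) B(2)] i in auto)
   also have "... = I * r'" by (simp add: I_def)
   also have "... < r"
   proof -
    have "I * r < 2 * (I + 1) * r" using r I by (intro mult_strict_right_mono) auto
    then show ?thesis using I by (simp add: r'_def field_simps)
   qed
   finally show "norm (c (s n) * (LBINT x. \<phi> x) - (LBINT x. f x * \<phi> x)) < r"
    using cs by simp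
  qed
 qed
 obtain x0 r0 where x0: "r0 > 0" "cball x0 r0 \<subseteq> C" using C(1,4) open_contains_cball by blast
 define \<psi> where "\<psi> = (%y. mollifier r0 (x0 - y))"
 have \<psi>: "continuous_on UNIV \<psi>" "!!x. x ~: cball x0 r0 ==> \<psi> x = 0" "(LBINT x. \<psi> x) = 1"
  unfolding \<psi>_def using mollifier_shift[OF x0(1), of x0]
  by (auto simp: dist_norm intro!: mollifier_zero[OF x0(1)] continuous_on_compose2[OF mollifier_continuous[OF x0(1)]] continuous_intros)
 have cl: "(%n. c (s n)) \<longlonglongrightarrow> (LBINT x. f x * \<psi> x)"
  using lim[OF \<psi>(1) compact_cball x0(2) \<psi>(2)] \<psi>(3) by simp
 show thesis
 proof (rule that[of "LBINT x. f x * \<psi> x"])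
  fix \<phi> :: "'a => real" and K assume \<phi>: "continuous_on UNIV \<phi>" "compact K" "K \<subseteq> C" "!!x. x ~: K ==> \<phi> x = 0"
  show "(LBINT x. indicat_real (A \<inter> C) x * \<phi> x) = (LBINT x. f x * \<psi> x) * (LBINT x. \<phi> x)"
   unfolding f_def[symmetric]
   by (rule LIMSEQ_unique[OF lim[OF \<phi>] tendsto_mult_right[OF cl]])
 qed
qed

lemma compact_subset_of_positive_measure:
 fixes B :: "'a::euclidean_space set"
 assumes B: "B \<in> sets borel" "bounded B" "emeasure lborel B ~= 0"
 obtains K where "compact K" "K \<subseteq> B" "measure lborel K > 0"
proof -
 have "emeasure lborel B <= emeasure lborel (closure B)"
  using B closure_subset by (intro emeasure_mono) auto
 then have "emeasure lborel B ~= top"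
  using emeasure_compact_finite[of "closure B"] B by (auto simp: compact_closure)
 then have m1: "emeasure lborel B = ennreal (measure lborel B)" by (rule emeasure_eq_ennreal_measure)
 then have m: "emeasure lborel B = ennreal (measure lborel B)" "measure lborel B > 0"
  using B(3) by (auto simp: less_le)
 obtain T where T: "closed T" "T \<subseteq> B" "B - T \<in> lmeasurable" "emeasure lebesgue (B - T) < ennreal (measure lborel B)"
  using sets_lebesgue_inner_closed[of B "measure lborel B"] B m by auto
 have TB: "T \<in> sets borel" using T by auto
 have cT: "compact T" using T B bounded_subset compact_eq_bounded_closed by blast
 have "emeasure lborel T ~= 0"
 proof
  assume "emeasure lborel T = 0"
  then have "emeasure lborel (B - T) = emeasure lborel B"
   using emeasure_Diff_null_set[OF null_setsI[of lborel T], of B] TB B by auto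
  then show False using T(4) m B TB by auto
 qed
 then have "measure lborel T > 0"
  using emeasure_compact_finite[OF cT] by (auto simp: measure_def enn2real_positive_iff zero_less_iff_neq_zero)
 then show thesis using that cT T by blast
qed

text \<open>By proportionality \<open>|A \<inter> K| = c |K|\<close> for compact \<open>K\<close>. A compact part of \<open>A\<close> of positive measure
forces \<open>c = 1\<close>, one of the complement forces \<open>c = 0\<close>.\<close>

lemma null_or_conull_of_zero_gradient:
 fixes A C :: "'a::euclidean_space set"
 assumes C: "open C" "convex C" "bounded C" and A: "A \<in> sets borel"
  and z: "!!\<phi> b. \<phi> \<in> test_functions C ==> b \<in> Basis ==> (LBINT x:A. partial_deriv b \<phi> x) = 0"
 shows "emeasure lborel (A \<inter> C) = 0 \<or> emeasure lborel (C - A) = 0"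
proof (rule ccontr)
 assume n: "\<not> ?thesis"
 then have "C ~= {}" by auto
 from indicator_proportional_of_zero_gradient[OF C this A z]
 obtain c where c: "!!\<phi> K. continuous_on UNIV \<phi> ==> compact K ==> K \<subseteq> C ==> (!!x. x ~: K ==> \<phi> x = 0)
  ==> (LBINT x. indicat_real (A \<inter> C) x * \<phi> x) = c * (LBINT x. \<phi> x)" by blast
 have meas: "measure lborel (A \<inter> K) = c * measure lborel K" if K: "compact K" "K \<subseteq> C" "K ~= {}" for K
 proof -
  obtain d where d: "d > 0" "{x. infdist x K <= d} \<subseteq> C"
   using compact_in_open_separated[OF K(3,1) C(1) K(2)] .
  define N where "N = {x. infdist x K <= d}"
  have N: "compact N" unfolding N_def using compact_infdist_le[OF K(3,1) d(1)] .
  define \<phi> where "\<phi> = (%n x. max 0 (1 - real (Suc n) / d * infdist x K))"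
  have \<phi>c: "continuous_on UNIV (\<phi> n)" for n unfolding \<phi>_def by (intro continuous_intros)
  have \<phi>1: "0 <= \<phi> n x" "\<phi> n x <= 1" for n x using d infdist_nonneg[of x K] by (auto simp: \<phi>_def)
  have \<phi>z: "\<phi> n x = 0" if "x ~: N" for n x
  proof -
   have "1 <= infdist x K / d" using that d by (simp add: N_def)
   also have "... <= real (Suc n) / d * infdist x K" using d infdist_nonneg[of x K] by (simp add: field_simps)
   finally show ?thesis by (simp add: \<phi>_def)
  qed
  have lim: "(%n. \<phi> n x) \<longlonglongrightarrow> indicat_real K x" for x
  proof (cases "x \<in> K")
   case True then show ?thesis by (simp add: \<phi>_def)
  next
   case False
   then have p: "infdist x K > 0"
    using in_closed_iff_infdist_zero[of K x] K compact_imp_closed infdist_nonneg[of x K] by (auto simp: less_le)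
   obtain M where M: "real M > d / infdist x K" using reals_Archimedean2 by blast
   have "\<phi> n x = 0" if "n \<ge> M" for n
   proof -
    have "d / infdist x K <= real (Suc n)" using M that by linarith
    then have "d <= real (Suc n) * infdist x K" using p by (simp add: field_simps)
    then show ?thesis using d by (simp add: \<phi>_def field_simps)
   qed
   then show ?thesis using False by (intro tendsto_eventually) (auto simp: eventually_sequentially)
  qed
  have iN: "integrable lborel (indicat_real N)"
   using N emeasure_compact_finite[OF N] by (auto intro!: integrable_real_indicator simp: compact_imp_closed)
  have Kb: "K \<in> sets borel" "C \<in> sets borel" using K C by (auto simp: compact_imp_closed)
  have "(%n. LBINT x. \<phi> n x) \<longlonglongrightarrow> (LBINT x. indicat_real K x)"
   by (rule integral_dominated_convergence[OF _ _ iN])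
    (use lim \<phi>1 \<phi>z Kb borel_measurable_continuous_onI[OF \<phi>c] in \<open>auto simp: indicator_def\<close>)
  then have l1: "(%n. c * (LBINT x. \<phi> n x)) \<longlonglongrightarrow> c * measure lborel K"
   using Kb by (intro tendsto_intros) (simp add: measure_def)
  have "(%n. LBINT x. indicat_real (A \<inter> C) x * \<phi> n x) \<longlonglongrightarrow> (LBINT x. indicat_real (A \<inter> C) x * indicat_real K x)"
  proof (rule integral_dominated_convergence[OF _ _ iN])
   show "AE x in lborel. (%n. indicat_real (A \<inter> C) x * \<phi> n x) \<longlonglongrightarrow> indicat_real (A \<inter> C) x * indicat_real K x"
    by (intro AE_I2 tendsto_mult tendsto_const lim)
  qed (use \<phi>1 \<phi>z Kb A borel_measurable_continuous_onI[OF \<phi>c] in \<open>auto simp: indicator_def\<close>)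
  moreover have "(%x. indicat_real (A \<inter> C) x * indicat_real K x) = indicat_real (A \<inter> K)"
   using K by (auto simp: indicator_def fun_eq_iff)
  ultimately have "(%n. LBINT x. indicat_real (A \<inter> C) x * \<phi> n x) \<longlonglongrightarrow> measure lborel (A \<inter> K)"
   using A Kb by (simp add: measure_def)
  moreover have "(LBINT x. indicat_real (A \<inter> C) x * \<phi> n x) = c * (LBINT x. \<phi> n x)" for n
   using c[OF \<phi>c N _ \<phi>z] d by (auto simp: N_def)
  ultimately show ?thesis using l1 LIMSEQ_unique by auto
 qed
 obtain K where K: "compact K" "K \<subseteq> A \<inter> C" "measure lborel K > 0"
  using compact_subset_of_positive_measure[of "A \<inter> C"] n A C by (auto intro: bounded_subset)
 have "K ~= {}" using K by auto
 then have "measure lborel K = c * measure lborel K" using meas[of K] K by (simp add: Int_absorb1)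
 then have c1: "c = 1" using K by simp
 obtain K where K: "compact K" "K \<subseteq> C - A" "measure lborel K > 0"
  using compact_subset_of_positive_measure[of "C - A"] n A C by (auto intro: bounded_subset)
 have "K ~= {}" using K by auto
 moreover have "A \<inter> K = {}" "K \<subseteq> C" using K by auto
 ultimately have "0 = c * measure lborel K" using meas[of K] K by simp
 then show False using c1 K by simp
qed

section \<open>The Riesz representation theorem\<close>

definition Cc :: "('a::euclidean_space => real) set" where
 "Cc = {f. continuous_on UNIV f & (\<exists>K. compact K & (\<forall>x. x ~: K --> f x = 0))}"

lemma CcI: "continuous_on UNIV f ==> compact K ==> (!!x. x ~: K ==> f x = 0) ==> f \<in> Cc"
 by (auto simp: Cc_def)

lemma CcD: assumes "f \<in> Cc" shows "continuous_on UNIV f" "\<exists>K. compact K & (\<forall>x. x ~: K --> f x = 0)"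
 using assms by (auto simp: Cc_def)

lemma Cc_add: assumes "f \<in> Cc" "g \<in> Cc" shows "(%x. f x + g x) \<in> Cc"
proof -
 obtain K L where "compact K" "compact L" "\<forall>x. x ~: K --> f x = 0" "\<forall>x. x ~: L --> g x = 0"
  using assms CcD by metis
 then show ?thesis using assms[THEN CcD(1)]
  by (intro CcI[of _ "K \<union> L"] continuous_intros) auto
qed

lemma Cc_mult_continuous: assumes "continuous_on UNIV g" "f \<in> Cc" shows "(%x. g x * f x) \<in> Cc"
proof -
 obtain K where "compact K" "\<forall>x. x ~: K --> f x = 0"
  using assms CcD by metis
 then show ?thesis using assms CcD(1)
  by (intro CcI[of _ K] continuous_intros) auto
qed

lemma Cc_cmult: "f \<in> Cc ==> (%x. c * f x) \<in> Cc"
 by (rule Cc_mult_continuous) auto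

lemma Cc_compose: assumes "continuous_on UNIV h" "h 0 = 0" "f \<in> Cc" shows "(%x. h (f x)) \<in> Cc"
proof -
 obtain K where "compact K" "\<forall>x. x ~: K --> f x = 0"
  using assms CcD by metis
 moreover have "continuous_on UNIV (%x. h (f x))"
  by (rule continuous_on_compose2[OF assms(1) CcD(1)[OF assms(3)]]) auto
 ultimately show ?thesis using assms(2) by (intro CcI[of _ K]) auto
qed

lemma Cc_zero: "(%x. 0) \<in> Cc" by (rule CcI[of _ "{}"]) auto

lemma Cc_sum: "(!!i. i \<in> I ==> f i \<in> Cc) ==> (%x. \<Sum>i\<in>I. f i x) \<in> Cc"
 by (induction I rule: infinite_finite_induct) (auto simp: Cc_zero intro!: Cc_add)

lemma Cc_integrable: assumes "f \<in> Cc" shows "integrable lborel f"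
proof -
 obtain K where "compact K" "\<forall>x. x ~: K --> f x = 0" using assms CcD by metis
 then show ?thesis using integrable_compact_support[OF CcD(1)[OF assms]] by auto
qed

lemma Cc_bounded: assumes "f \<in> Cc" obtains B where "B > 0" "!!x. \<bar>f x\<bar> <= B"
proof -
 obtain K where "compact K" "\<forall>x. x ~: K --> f x = 0" using assms CcD by metis
 then show ?thesis using bounded_compact_support[OF CcD(1)[OF assms]] that by (metis real_norm_def)
qed

definition plateau :: "real => 'a::euclidean_space => real" where
 "plateau R x = min 1 (max 0 (R + 1 - norm x))"

lemma plateau: "plateau R \<in> Cc" "0 <= plateau R x" "plateau R x <= 1" "norm x <= R ==> plateau R x = 1"
 "plateau R x ~= 0 ==> norm x < R + 1"
proof -
 show "plateau R \<in> Cc"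
  by (rule CcI[of _ "cball 0 (R + 1)"]) (auto simp: plateau_def[abs_def] intro!: continuous_intros)
qed (auto simp: plateau_def)

lemma Cc_support_ball: assumes "f \<in> Cc" obtains R where "R > 0" "!!x. norm x > R ==> f x = 0"
proof -
 obtain K where K: "compact K" "\<forall>x. x ~: K --> f x = 0" using assms CcD by metis
 obtain R where "R > 0" "!!x. x \<in> K ==> norm x <= R" using compact_imp_bounded[OF K(1)] bounded_pos by metis
 then show ?thesis using that K by (metis not_le)
qed

lemma Cc_superlevel_compact:
 assumes "f \<in> Cc" "e > 0" shows "compact {x. f x \<ge> e}"
proof -
 obtain K where K: "compact K" "\<forall>x. x ~: K --> f x = 0" using assms CcD by metis
 have "closed {x. f x \<ge> e}" using CcD(1)[OF assms(1)] by (intro closed_Collect_le) auto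
 moreover have "{x. f x \<ge> e} \<subseteq> K" using K assms(2) by force
 ultimately show ?thesis using K(1) by (metis compact_Int_closed inf.absorb_iff2 inf_commute)
qed

text \<open>The measure is obtained from the inner content of open sets by Caratheodory's construction.\<close>

locale positive_functional =
 fixes \<Lambda> :: "('a::euclidean_space => real) => real"
 assumes Lam_add: "f \<in> Cc ==> g \<in> Cc ==> \<Lambda> (%x. f x + g x) = \<Lambda> f + \<Lambda> g"
  and Lam_cmult: "f \<in> Cc ==> \<Lambda> (%x. c * f x) = c * \<Lambda> f"
  and Lam_nonneg: "f \<in> Cc ==> (!!x. 0 <= f x) ==> 0 <= \<Lambda> f"
begin

lemma Lam_diff: assumes "f \<in> Cc" "g \<in> Cc" shows "\<Lambda> (%x. f x - g x) = \<Lambda> f - \<Lambda> g"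
 using Lam_add[OF assms(1) Cc_cmult[OF assms(2), of "-1"]] Lam_cmult[OF assms(2), of "-1"] by simp

lemma Lam_mono: assumes "f \<in> Cc" "g \<in> Cc" "!!x. f x <= g x" shows "\<Lambda> f <= \<Lambda> g"
proof -
 have "(%x. g x - f x) \<in> Cc" using Cc_add[OF assms(2) Cc_cmult[OF assms(1), of "-1"]] by simp
 from Lam_nonneg[OF this] show ?thesis using Lam_diff[OF assms(2,1)] assms(3) by simp
qed

lemma Lam_zero: "\<Lambda> (%x. 0) = 0" using Lam_cmult[OF Cc_zero, of 0] by simp

lemma Lam_sum: "finite I ==> (!!i. i \<in> I ==> f i \<in> Cc) ==> \<Lambda> (%x. \<Sum>i\<in>I. f i x) = (\<Sum>i\<in>I. \<Lambda> (f i))"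
 by (induction I rule: finite_induct) (auto simp: Lam_zero Lam_add Cc_sum)

definition below :: "'a set => ('a => real) set" where
 "below U = {\<phi> \<in> Cc. (\<forall>x. 0 <= \<phi> x & \<phi> x <= 1) & (\<forall>x. x ~: U --> \<phi> x = 0)}"

definition content :: "'a set => ennreal" where
 "content U = (SUP \<phi>\<in>below U. ennreal (\<Lambda> \<phi>))"

definition outer :: "'a set => ennreal" where
 "outer B = (INF U\<in>{U. open U & B \<subseteq> U}. content U)"

lemma below_zero: "(%x. 0) \<in> below U" by (auto simp: below_def Cc_zero)

lemma below_Cc: "\<phi> \<in> below U ==> \<phi> \<in> Cc" by (simp add: below_def)

lemma below_Lam_nonneg: "\<phi> \<in> below U ==> 0 <= \<Lambda> \<phi>" by (simp add: below_def Lam_nonneg)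

lemma below_mono: "\<phi> \<in> below U ==> U \<subseteq> V ==> \<phi> \<in> below V" by (auto simp: below_def)

lemma content_upper: "\<phi> \<in> below U ==> ennreal (\<Lambda> \<phi>) <= content U"
 unfolding content_def by (rule SUP_upper)

lemma content_mono: "U \<subseteq> V ==> content U <= content V"
 unfolding content_def by (rule SUP_subset_mono) (auto simp: below_def)

lemma outer_open: "open U ==> outer U = content U"
 unfolding outer_def by (intro antisym INF_lower2[of U] INF_greatest content_mono) auto

lemma outer_mono: "A \<subseteq> B ==> outer A <= outer B"
 unfolding outer_def by (rule INF_superset_mono) auto

lemma outer_le: "open U ==> B \<subseteq> U ==> outer B <= content U"
 unfolding outer_def by (rule INF_lower) auto

lemma content_empty: "content {} = 0"
proof -
 have "\<phi> = (%x. 0)" if "\<phi> \<in> below {}" for \<phi> using that by (auto simp: below_def)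
 then have "below {} = {%x. 0}" using below_zero by blast
 then show ?thesis by (simp add: content_def Lam_zero)
qed

text \<open>Subtracting a small constant moves the support of \<open>\<phi>\<close> into a compact superlevel set, at the price
of a small multiple of the value on a plateau function.\<close>

lemma truncation:
 assumes \<phi>: "\<phi> \<in> below U" and e: "e > 0"
 obtains \<psi> K where "compact K" "K \<subseteq> U" "\<psi> \<in> below K" "\<Lambda> \<phi> <= \<Lambda> \<psi> + e"
proof -
 have \<phi>C: "\<phi> \<in> Cc" using \<phi> by (simp add: below_def)
 obtain R where R: "R > 0" "!!x. norm x > R ==> \<phi> x = 0" using Cc_support_ball[OF \<phi>C] by blast
 define L where "L = \<Lambda> (plateau R)"
 have L: "L \<ge> 0" unfolding L_def by (intro Lam_nonneg plateau)
 define d where "d = e / (L + 1)"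
 have d: "d > 0" using e L by (simp add: d_def)
 have dL: "d * L <= e" using e L by (simp add: d_def field_simps)
 define \<psi> where "\<psi> = (%x. max 0 (\<phi> x - d))"
 have \<psi>C: "\<psi> \<in> Cc" unfolding \<psi>_def
  by (rule Cc_compose[where h="%y. max 0 (y - d)", OF _ _ \<phi>C]) (use d in \<open>auto intro!: continuous_intros\<close>)
 show thesis
 proof
  show "compact {x. \<phi> x \<ge> d}" by (rule Cc_superlevel_compact[OF \<phi>C d])
  show "{x. \<phi> x \<ge> d} \<subseteq> U" using \<phi> d by (auto simp: below_def)
  show "\<psi> \<in> below {x. \<phi> x \<ge> d}"
   using \<phi> \<psi>C d by (auto simp: below_def \<psi>_def) (smt (verit))+
  have "\<Lambda> \<phi> <= \<Lambda> (%x. \<psi> x + d * plateau R x)"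
  proof (rule Lam_mono[OF \<phi>C Cc_add[OF \<psi>C Cc_cmult[OF plateau(1)]]])
   fix x
   show "\<phi> x <= \<psi> x + d * plateau R x"
   proof (cases "norm x <= R")
    case True then show ?thesis by (simp add: plateau \<psi>_def)
   next
    case False then show ?thesis using R(2)[of x] d plateau(2)[of R x] by (simp add: \<psi>_def)
   qed
  qed
  also have "... = \<Lambda> \<psi> + d * L"
   by (simp add: Lam_add[OF \<psi>C Cc_cmult[OF plateau(1)]] Lam_cmult[OF plateau(1)] L_def)
  finally show "\<Lambda> \<phi> <= \<Lambda> \<psi> + e" using dL by simp
 qed
qed

text \<open>A function below the union is split in the proportions of the two distances to the complements.\<close>

lemma content_Un:
 assumes U: "open U" and V: "open V"
 shows "content (U \<union> V) <= content U + content V"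
proof (cases "U = UNIV \<or> V = UNIV")
 case True
 then show ?thesis by auto
next
 case False
 then have ne: "- U ~= {}" "- V ~= {}" by auto
 let ?d = "%x. infdist x (- U)" let ?e = "%x. infdist x (- V)"
 have d0: "?d x = 0 \<longleftrightarrow> x ~: U" "?e x = 0 \<longleftrightarrow> x ~: V" for x
  using in_closed_iff_infdist_zero[OF _ ne(1), of x] in_closed_iff_infdist_zero[OF _ ne(2), of x] U V
  by auto
 show ?thesis
  unfolding content_def[of "U \<union> V"]
 proof (rule SUP_least)
  fix \<phi> assume \<phi>: "\<phi> \<in> below (U \<union> V)"
  then have \<phi>C: "\<phi> \<in> Cc" by (rule below_Cc)
  have \<phi>c: "continuous_on UNIV \<phi>" by (rule CcD[OF \<phi>C])
  have split: "(%x. \<phi> x * (g x / (?d x + ?e x))) \<in> below W"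
   if g: "continuous_on UNIV g" "!!x. 0 <= g x" "!!x. g x <= ?d x + ?e x" "!!x. x ~: W ==> g x = 0" for g W
  proof -
   let ?q = "%x. \<phi> x * (g x / (?d x + ?e x))"
   have q01: "0 <= g x / (?d x + ?e x)" "g x / (?d x + ?e x) <= 1" for x
    using g(2,3)[of x] infdist_nonneg[of x "-U"] infdist_nonneg[of x "-V"]
    by (auto simp: divide_le_eq_1 intro!: divide_nonneg_nonneg)
   have p0: "0 <= \<phi> x" for x using \<phi> by (simp add: below_def)
   have le: "0 <= ?q x" "?q x <= \<phi> x" for x
    by (rule mult_nonneg_nonneg[OF p0 q01(1)], rule mult_right_le_one_le[OF p0 q01])
   have "isCont ?q x" for x
   proof (cases "x \<in> U \<union> V")
    case True
    have "?d x + ?e x ~= 0"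
     using True d0[of x] infdist_nonneg[of x "-U"] infdist_nonneg[of x "-V"] by auto
    then show ?thesis using \<phi>c g(1)
     by (intro continuous_intros) (auto simp: continuous_on_eq_continuous_at)
   next
    case F: False
    then have 0: "\<phi> x = 0" using \<phi> by (auto simp: below_def)
    have "(\<phi> \<longlongrightarrow> 0) (at x)"
     using \<phi>c 0 by (metis UNIV_I continuous_on_def at_within_open open_UNIV)
    then have "(?q \<longlongrightarrow> 0) (at x)"
    proof (rule Lim_null_comparison[rotated], intro always_eventually allI)
     show "norm (?q y) <= \<phi> y" for y unfolding real_norm_def abs_of_nonneg[OF le(1)] by (rule le(2))
    qed
    then show ?thesis using 0 by (simp add: isCont_def)
   qed
   then have qc: "continuous_on UNIV ?q" by (simp add: continuous_at_imp_continuous_on)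
   obtain K where K: "compact K" "\<forall>x. x ~: K --> \<phi> x = 0" using CcD[OF \<phi>C] by metis
   have "?q \<in> Cc" by (rule CcI[OF qc K(1)]) (use K in auto)
   moreover have "\<phi> x <= 1" for x using \<phi> by (auto simp: below_def)
   ultimately show ?thesis using le g(4) unfolding below_def by (auto intro: order_trans)
  qed
  have a: "(%x. \<phi> x * (?d x / (?d x + ?e x))) \<in> below U" (is "?a \<in> _")
   using U d0 infdist_nonneg[of _ "-V"] by (intro split) (auto intro!: continuous_intros infdist_nonneg)
  have b: "(%x. \<phi> x * (?e x / (?d x + ?e x))) \<in> below V" (is "?b \<in> _")
   using V d0 infdist_nonneg[of _ "-U"] by (intro split) (auto intro!: continuous_intros infdist_nonneg)
  have "\<phi> x = ?a x + ?b x" for x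
  proof (cases "x \<in> U \<union> V")
   case True
   have "?d x + ?e x ~= 0"
    using True d0[of x] infdist_nonneg[of x "-U"] infdist_nonneg[of x "-V"] by auto
   then have "?d x / (?d x + ?e x) + ?e x / (?d x + ?e x) = 1" by (simp add: add_divide_distrib[symmetric])
   then show ?thesis by (metis mult.right_neutral ring_class.ring_distribs(1))
  next
   case False then show ?thesis using \<phi> by (auto simp: below_def)
  qed
  then have "\<Lambda> \<phi> = \<Lambda> ?a + \<Lambda> ?b" using Lam_add[OF below_Cc[OF a] below_Cc[OF b]] by simp
  then have "ennreal (\<Lambda> \<phi>) = ennreal (\<Lambda> ?a) + ennreal (\<Lambda> ?b)"
   using below_Lam_nonneg[OF a] below_Lam_nonneg[OF b] by simp
  also have "... <= content U + content V" by (intro add_mono content_upper a b)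
  finally show "ennreal (\<Lambda> \<phi>) <= content U + content V" .
 qed
qed

lemma content_finite_UN:
 fixes U :: "nat => 'a set"
 assumes "!!i. open (U i)"
 shows "content (\<Union>i<n. U i) <= (\<Sum>i<n. content (U i))"
proof (induction n)
 case (Suc n)
 have "content (\<Union>i<Suc n. U i) <= content (\<Union>i<n. U i) + content (U n)"
  using content_Un[of "\<Union>i<n. U i" "U n"] assms by (auto simp: lessThan_Suc Un_commute)
 also have "... <= (\<Sum>i<n. content (U i)) + content (U n)" by (intro add_mono Suc order_refl)
 finally show ?case by simp
qed (simp add: content_empty)

lemma content_UN:
 fixes U :: "nat => 'a set"
 assumes U: "!!i. open (U i)"
 shows "content (\<Union>i. U i) <= (\<Sum>i. content (U i))"
 unfolding content_def[of "\<Union>i. U i"]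
proof (rule SUP_least, rule ennreal_le_epsilon)
 fix \<phi> and e :: real assume \<phi>: "\<phi> \<in> below (\<Union>i. U i)" and e: "0 < e"
 obtain \<psi> K where K: "compact K" "K \<subseteq> (\<Union>i. U i)" "\<psi> \<in> below K" "\<Lambda> \<phi> <= \<Lambda> \<psi> + e"
  by (rule truncation[OF \<phi> e])
 obtain I where I: "finite I" "K \<subseteq> (\<Union>i\<in>I. U i)"
  by (rule compactE_image[OF K(1) U K(2)])
 obtain n where n: "I \<subseteq> {..<n}" using finite_nat_iff_bounded I(1) by auto
 have "\<psi> \<in> below (\<Union>i<n. U i)" using K(3) I n by (elim below_mono) blast
 then have "ennreal (\<Lambda> \<psi>) <= content (\<Union>i<n. U i)" by (rule content_upper)
 also have "... <= (\<Sum>i<n. content (U i))" by (rule content_finite_UN[OF U])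
 also have "... <= (\<Sum>i. content (U i))" by (rule sum_le_suminf) auto
 finally have "ennreal (\<Lambda> \<psi>) + ennreal e <= (\<Sum>i. content (U i)) + ennreal e" by (rule add_right_mono)
 moreover have "ennreal (\<Lambda> \<phi>) <= ennreal (\<Lambda> \<psi>) + ennreal e"
  using K(4) e below_Lam_nonneg[OF K(3)] by (simp add: ennreal_plus[symmetric] del: ennreal_plus)
 ultimately show "ennreal (\<Lambda> \<phi>) <= (\<Sum>i. content (U i)) + ennreal e" by (rule order_trans[rotated])
qed

lemma outer_UN:
 fixes A :: "nat => 'a set"
 shows "outer (\<Union>i. A i) <= (\<Sum>n. outer (A n))"
proof -
 show ?thesis
 proof (rule ennreal_le_epsilon)
  fix e :: real assume e: "0 < e" and "(\<Sum>n. outer (A n)) < top"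
  then have *: "outer (A n) < outer (A n) + e * (1/2)^Suc n" for n
   by (auto simp add: less_top dest!: ennreal_suminf_lessD)
  have "\<exists>U. open U & A n \<subseteq> U & content U < outer (A n) + e * (1/2)^Suc n" for n
   using *[of n] unfolding outer_def[of "A n"] INF_less_iff by auto
  then obtain U where U: "!!n. open (U n)" "!!n. A n \<subseteq> U n" "!!n. content (U n) < outer (A n) + e * (1/2)^Suc n"
   by metis
  have "outer (\<Union>i. A i) <= content (\<Union>i. U i)" using U by (intro outer_le) auto
  also have "... <= (\<Sum>n. content (U n))" by (rule content_UN[OF U(1)])
  also have "... <= (\<Sum>n. outer (A n) + e * (1/2) ^ Suc n)"
   using U(3) by (intro suminf_le) (auto intro: less_imp_le)
  also have "... = (\<Sum>n. outer (A n)) + (\<Sum>n. ennreal e * ennreal ((1/2) ^ Suc n))"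
   using e by (subst suminf_add[symmetric])
            (auto simp del: ennreal_suminf_cmult simp add: ennreal_mult[symmetric])
  also have "... = (\<Sum>n. outer (A n)) + e"
   unfolding ennreal_suminf_cmult
   by (subst suminf_ennreal_eq[OF zero_le_power power_half_series]) auto
  finally show "outer (\<Union>i. A i) <= (\<Sum>n. outer (A n)) + e" .
 qed
qed

lemma outer_measure_space: "outer_measure_space UNIV outer"
 unfolding outer_measure_space_def
proof (intro conjI)
 show "countably_subadditive UNIV outer" by (simp add: countably_subadditive_def outer_UN)
 show "positive UNIV outer" by (simp add: positive_def outer_open content_empty)
 show "increasing UNIV outer" by (simp add: increasing_def outer_mono)
qed

lemma outer_Un: "outer (A \<union> B) <= outer A + outer B"
proof -
 let ?C = "%i::nat. if i = 0 then A else if i = 1 then B else {}"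
 have "outer (\<Union>i. ?C i) <= (\<Sum>i. outer (?C i))"
  by (rule outer_UN)
 also have "... = (\<Sum>i<2. outer (?C i))"
  by (rule suminf_finite) (auto simp: outer_open content_empty)
 also have "... = outer A + outer B" by (simp add: numeral_2_eq_2)
 finally have "outer (\<Union>i. ?C i) <= outer A + outer B" .
 moreover have "A \<union> B = (\<Union>i. ?C i)"
 proof safe
  show "x \<in> (\<Union>i. ?C i)" if "x \<in> A" for x using that by (intro UN_I[of 0]) auto
  show "x \<in> (\<Union>i. ?C i)" if "x \<in> B" for x using that by (intro UN_I[of 1]) auto
 qed (simp split: if_splits)
 ultimately show ?thesis by simp
qed

text \<open>Two functions with disjoint supports, one in a compact subset of \<open>G \<inter> W\<close> and one in the rest of \<open>W\<close>, add
up to a function below \<open>W\<close>.\<close>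

lemma open_caratheodory_measurable:
 assumes O: "open G"
 shows "outer (G \<inter> T) + outer (T - G) = outer T"
proof (rule antisym)
 show "outer T <= outer (G \<inter> T) + outer (T - G)"
 proof -
  have "T = (G \<inter> T) \<union> (T - G)" by blast
  then show ?thesis using outer_Un[of "G \<inter> T" "T - G"] by simp
 qed
 show "outer (G \<inter> T) + outer (T - G) <= outer T"
  unfolding outer_def[of T]
 proof (rule INF_greatest)
  fix W assume "W \<in> {U. open U & T \<subseteq> U}"
  then have W: "open W" "T \<subseteq> W" by auto
  have "ennreal (\<Lambda> \<phi>) + outer (W - G) <= content W" if \<phi>: "\<phi> \<in> below (G \<inter> W)" for \<phi>
  proof (rule ennreal_le_epsilon)
   fix e :: real assume e: "0 < e"
   obtain \<psi> K where K: "compact K" "K \<subseteq> G \<inter> W" "\<psi> \<in> below K" "\<Lambda> \<phi> <= \<Lambda> \<psi> + e"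
    by (rule truncation[OF \<phi> e])
   have oWK: "open (W - K)" using W K by (auto intro: open_Diff compact_imp_closed)
   have "ennreal (\<Lambda> \<psi>) + content (W - K) <= content W"
   proof -
    have "ennreal (\<Lambda> \<psi>) + content (W - K) = (SUP \<eta>\<in>below (W - K). ennreal (\<Lambda> \<psi>) + ennreal (\<Lambda> \<eta>))"
     unfolding content_def using below_zero by (intro ennreal_SUP_add_right) auto
    also have "... <= content W"
    proof (rule SUP_least)
     fix \<eta> assume \<eta>: "\<eta> \<in> below (W - K)"
     have "(%x. \<psi> x + \<eta> x) \<in> below W"
      unfolding below_def
     proof (intro CollectI conjI allI impI)
      show "(%x. \<psi> x + \<eta> x) \<in> Cc" by (intro Cc_add below_Cc[OF K(3)] below_Cc[OF \<eta>])
      fix x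
      show "0 <= \<psi> x + \<eta> x" using K(3) \<eta> by (auto simp: below_def)
      show "\<psi> x + \<eta> x <= 1" using K(3) \<eta> by (cases "x \<in> K") (auto simp: below_def)
      assume "x ~: W" then show "\<psi> x + \<eta> x = 0" using K(2,3) \<eta> by (auto simp: below_def)
     qed
     from content_upper[OF this] show "ennreal (\<Lambda> \<psi>) + ennreal (\<Lambda> \<eta>) <= content W"
      using Lam_add[OF below_Cc[OF K(3)] below_Cc[OF \<eta>]] below_Lam_nonneg[OF K(3)] below_Lam_nonneg[OF \<eta>] by simp
    qed
    finally show ?thesis .
   qed
   moreover have "outer (W - G) <= content (W - K)" using K oWK by (intro outer_le) auto
   moreover have "ennreal (\<Lambda> \<phi>) <= ennreal (\<Lambda> \<psi>) + ennreal e"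
    using K(4) e below_Lam_nonneg[OF K(3)] by (simp add: ennreal_plus[symmetric] del: ennreal_plus)
   ultimately have "ennreal (\<Lambda> \<phi>) + outer (W - G) <= (ennreal (\<Lambda> \<psi>) + ennreal e) + content (W - K)"
    by (intro add_mono)
   also have "... = (ennreal (\<Lambda> \<psi>) + content (W - K)) + ennreal e" by (simp add: ac_simps)
   also have "... <= content W + ennreal e" using \<open>ennreal (\<Lambda> \<psi>) + content (W - K) <= content W\<close> by (rule add_right_mono)
   finally show "ennreal (\<Lambda> \<phi>) + outer (W - G) <= content W + ennreal e" .
  qed
  then have "content (G \<inter> W) + outer (W - G) <= content W"
   unfolding content_def[of "G \<inter> W"] using below_zero
   by (subst ennreal_SUP_add_left[symmetric]) (auto intro!: SUP_least)
  moreover have "outer (G \<inter> T) <= content (G \<inter> W)" using O W by (intro outer_le) auto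
  moreover have "outer (T - G) <= outer (W - G)" using W by (intro outer_mono) auto
  ultimately show "outer (G \<inter> T) + outer (T - G) <= content W"
   by (meson add_mono order_trans)
 qed
qed

definition M :: "'a measure" where
 "M = measure_of UNIV (sets borel) outer"

lemma sets_M [simp, measurable_cong]: "sets M = sets borel"
 unfolding M_def by (metis sets.sigma_sets_eq sets_measure_of space_borel sets.space_closed)

lemma space_M [simp]: "space M = UNIV"
 unfolding M_def by (simp add: space_measure_of_conv)

lemma emeasure_M:
 assumes "B \<in> sets borel"
 shows "emeasure M B = outer B"
proof -
 have Pow: "sigma_algebra UNIV (UNIV :: 'a set set)"
  using sigma_algebra_Pow[of "UNIV :: 'a set"] by simp
 have L: "measure_space UNIV (lambda_system UNIV UNIV outer) outer"
  using sigma_algebra.caratheodory_lemma[OF Pow outer_measure_space] .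
 then have sig: "sigma_algebra UNIV (lambda_system UNIV UNIV outer)" by (simp add: measure_space_def)
 have "{S :: 'a set. open S} \<subseteq> lambda_system UNIV UNIV outer"
  using open_caratheodory_measurable by (auto simp: lambda_system_def Diff_eq Int_commute Compl_eq_Diff_UNIV[symmetric])
 then have "sets borel \<subseteq> lambda_system UNIV UNIV outer"
  unfolding borel_def using sigma_algebra.sigma_sets_subset[OF sig]
  by (simp add: sets_measure_of_conv)
 then have ms: "measure_space UNIV (sets borel) outer"
  using measure_down[OF L] sets.sigma_algebra_axioms[of "borel :: 'a measure"] by simp
 then show ?thesis
  unfolding M_def using assms
  by (intro emeasure_measure_of_sigma) (auto simp: measure_space_def)
qed

lemma emeasure_M_open: "open U ==> emeasure M U = content U"
 by (simp add: emeasure_M outer_open)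

lemma content_ball_le: "content (ball 0 R) <= ennreal (\<Lambda> (plateau R))"
 unfolding content_def
proof (rule SUP_least)
 fix \<phi> assume \<phi>: "\<phi> \<in> below (ball 0 R)"
 have "\<Lambda> \<phi> <= \<Lambda> (plateau R)"
 proof (rule Lam_mono[OF below_Cc[OF \<phi>] plateau(1)])
  fix x show "\<phi> x <= plateau R x"
   using \<phi> plateau(2)[of R x] plateau(4)[of x R] by (cases "norm x < R") (auto simp: below_def)
 qed
 then show "ennreal (\<Lambda> \<phi>) <= ennreal (\<Lambda> (plateau R))" by (rule ennreal_leI)
qed

lemma emeasure_M_bounded:
 assumes "bounded B"
 shows "emeasure M B < \<infinity>"
proof -
 obtain R where R: "R > 0" "!!x. x \<in> B ==> norm x < R" using assms unfolding bounded_pos_less by blast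
 have "emeasure M B <= emeasure M (ball 0 R)" using R by (intro emeasure_mono) auto
 also have "... <= ennreal (\<Lambda> (plateau R))" by (simp add: emeasure_M_open content_ball_le)
 also have "... < \<infinity>" by simp
 finally show ?thesis .
qed

lemma Cc_integrable_M:
 assumes "f \<in> Cc"
 shows "integrable M f"
proof -
 obtain R where R: "R > 0" "!!x. norm x > R ==> f x = 0" using Cc_support_ball[OF assms] by blast
 obtain B where B: "B > 0" "!!x. \<bar>f x\<bar> <= B" using Cc_bounded[OF assms] by blast
 have m: "f \<in> borel_measurable M"
  using borel_measurable_continuous_onI[OF CcD(1)[OF assms]] by (simp cong: measurable_cong_sets)
 show ?thesis
 proof (rule Bochner_Integration.integrable_bound[OF _ m])
  show "integrable M (%x. indicat_real (cball 0 R) x *\<^sub>R B)"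
   using emeasure_M_bounded[of "cball 0 R"] by (auto intro!: integrable_real_indicator)
  show "AE x in M. norm (f x) <= norm (indicat_real (cball 0 R) x *\<^sub>R B)"
   using B R(2) by (auto simp: indicator_def not_le)
 qed
qed

text \<open>The function is cut into horizontal slices of small height. Each slice lies between multiples of
indicators of superlevel sets, on which the content and the functional can be compared.\<close>

lemma Riesz_nonneg:
 assumes f: "f \<in> Cc" and f0: "!!x. 0 <= f x"
 shows "(LINT x|M. f x) = \<Lambda> f"
proof -
 obtain R where R: "R > 0" "!!x. norm x > R ==> f x = 0" using Cc_support_ball[OF f] by blast
 obtain B where B: "B > 0" "!!x. \<bar>f x\<bar> <= B" using Cc_bounded[OF f] by blast
 define E where "E = (%c. {x. f x > c})"
 have oE: "open (E c)" for c unfolding E_def using CcD(1)[OF f] by (intro open_Collect_less) auto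
 have finE: "content (E c) < \<infinity>" if "c \<ge> 0" for c
 proof -
  have "bounded (E c)" using R(2) that by (intro boundedI[of _ R]) (force simp: E_def not_le[symmetric])
  then show ?thesis using emeasure_M_bounded[of "E c"] emeasure_M_open[OF oE] by simp
 qed
 define mr where "mr = (%c. enn2real (content (E c)))"
 have mr: "content (E c) = ennreal (mr c)" "measure M (E c) = mr c" if "c \<ge> 0" for c
  using finE[OF that] emeasure_M_open[OF oE] by (auto simp: mr_def measure_def)
 have mr0: "mr c \<ge> 0" for c by (simp add: mr_def)
 have close: "\<bar>\<Lambda> f - (LINT x|M. f x)\<bar> <= \<delta> * mr 0" if \<delta>: "\<delta> > 0" for \<delta>
 proof -
  define g where "g = (%k x. min (max (f x - real k * \<delta>) 0) \<delta>)"
  have gC: "g k \<in> Cc" for k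
   unfolding g_def
   by (rule Cc_compose[where h="%y. min (max (y - real k * \<delta>) 0) \<delta>", OF _ _ f])
    (use \<delta> in \<open>auto intro!: continuous_intros\<close>)
  have sumg: "(\<Sum>k<n. g k x) = min (f x) (real n * \<delta>)" for n x
  proof (induction n)
   case (Suc n)
   then show ?case using f0[of x] \<delta> by (auto simp: g_def min_def max_def algebra_simps)
  qed (use f0[of x] in simp)
  obtain n where n: "real n > B / \<delta>" using reals_Archimedean2 by blast
  have fg: "f x = (\<Sum>k<n. g k x)" for x
   using sumg[of x n] B(2)[of x] n \<delta> by (simp add: field_simps)
  have gE: "g k x = 0" if "x ~: E (real k * \<delta>)" for k x using that \<delta> by (auto simp: g_def E_def)
  have gE1: "g k x = \<delta>" if "x \<in> E (real (Suc k) * \<delta>)" for k x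
   using that \<delta> by (auto simp: g_def E_def algebra_simps)
  have g01: "0 <= g k x" "g k x <= \<delta>" for k x using \<delta> by (auto simp: g_def)
  have up: "\<Lambda> (g k) <= \<delta> * mr (real k * \<delta>)" for k
  proof -
   have "(%x. (1 / \<delta>) * g k x) \<in> below (E (real k * \<delta>))"
    unfolding below_def using Cc_cmult[OF gC[of k], of "1 / \<delta>"] gE g01 \<delta> by (auto simp: field_simps)
   from content_upper[OF this] have "ennreal (1 / \<delta> * \<Lambda> (g k)) <= ennreal (mr (real k * \<delta>))"
    using mr(1)[of "real k * \<delta>"] \<delta> Lam_cmult[OF gC[of k], of "1 / \<delta>"] by simp
   then show ?thesis using mr0 \<delta> by (simp add: field_simps)
  qed
  have low: "\<delta> * mr (real (Suc k) * \<delta>) <= \<Lambda> (g k)" for k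
  proof -
   have "content (E (real (Suc k) * \<delta>)) <= ennreal (\<Lambda> (g k) / \<delta>)"
    unfolding content_def
   proof (rule SUP_least)
    fix \<phi> assume \<phi>: "\<phi> \<in> below (E (real (Suc k) * \<delta>))"
    have "\<Lambda> (%x. \<delta> * \<phi> x) <= \<Lambda> (g k)"
    proof (rule Lam_mono[OF Cc_cmult[OF below_Cc[OF \<phi>]] gC])
     fix x show "\<delta> * \<phi> x <= g k x"
      using \<phi> gE1[of x k] g01[of k x] \<delta>
      by (cases "x \<in> E (real (Suc k) * \<delta>)") (auto simp: below_def intro: mult_left_le)
    qed
    then show "ennreal (\<Lambda> \<phi>) <= ennreal (\<Lambda> (g k) / \<delta>)"
     using \<delta> Lam_cmult[OF below_Cc[OF \<phi>], of \<delta>] by (intro ennreal_leI) (simp add: field_simps)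
   qed
   then have "mr (real (Suc k) * \<delta>) <= \<Lambda> (g k) / \<delta>"
    using mr(1)[of "real (Suc k) * \<delta>"] \<delta> Lam_nonneg[OF gC[of k]] g01 by (simp add: ennreal_le_iff)
   then show ?thesis using \<delta> by (simp add: field_simps)
  qed
  have iE: "integrable M (%x. \<delta> * indicat_real (E c) x)" "(LINT x|M. \<delta> * indicat_real (E c) x) = \<delta> * mr c"
   if "c \<ge> 0" for c
   using finE[OF that] emeasure_M_open[OF oE] oE mr(2)[OF that]
   by (auto intro!: integrable_mult_right integrable_real_indicator)
  have iup: "(LINT x|M. g k x) <= \<delta> * mr (real k * \<delta>)" for k
   unfolding iE(2)[of "real k * \<delta>", symmetric, OF mult_nonneg_nonneg[OF of_nat_0_le_iff less_imp_le[OF \<delta>]]]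
   using \<delta> g01 gE Cc_integrable_M[OF gC] iE(1)[of "real k * \<delta>"] by (intro integral_mono) (auto simp: indicator_def)
  have ilow: "\<delta> * mr (real (Suc k) * \<delta>) <= (LINT x|M. g k x)" for k
   unfolding iE(2)[of "real (Suc k) * \<delta>", symmetric, OF mult_nonneg_nonneg[OF of_nat_0_le_iff less_imp_le[OF \<delta>]]]
   using \<delta> g01 gE1 Cc_integrable_M[OF gC] iE(1)[of "real (Suc k) * \<delta>"] by (intro integral_mono) (auto simp: indicator_def)
  have "\<Lambda> f = (\<Sum>k<n. \<Lambda> (g k))" using Lam_sum[of "{..<n}" g] gC fg by (simp add: fun_eq_iff[symmetric]) (metis (no_types) ext fg)
  moreover have "(LINT x|M. f x) = (\<Sum>k<n. LINT x|M. g k x)"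
   unfolding fg using Cc_integrable_M[OF gC] by (intro Bochner_Integration.integral_sum) auto
  ultimately have "\<bar>\<Lambda> f - (LINT x|M. f x)\<bar> = \<bar>\<Sum>k<n. \<Lambda> (g k) - (LINT x|M. g k x)\<bar>"
   by (simp add: sum_subtractf)
  also have "... <= (\<Sum>k<n. \<bar>\<Lambda> (g k) - (LINT x|M. g k x)\<bar>)" by (rule sum_abs)
  also have "... <= (\<Sum>k<n. \<delta> * mr (real k * \<delta>) - \<delta> * mr (real (Suc k) * \<delta>))"
   using up low iup ilow by (intro sum_mono) (smt (verit))
  also have "... = \<delta> * mr (real 0 * \<delta>) - \<delta> * mr (real n * \<delta>)"
   by (rule sum_lessThan_telescope')
  also have "... <= \<delta> * mr 0" using \<delta> mr0 by simp
  finally show ?thesis .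
 qed
 have "\<bar>\<Lambda> f - (LINT x|M. f x)\<bar> <= 0"
 proof (rule field_le_epsilon)
  fix e :: real assume e: "e > 0"
  have "\<bar>\<Lambda> f - (LINT x|M. f x)\<bar> <= e / (mr 0 + 1) * mr 0" using close[of "e / (mr 0 + 1)"] e mr0[of 0] by simp
  also have "... <= e" using e mr0[of 0] by (simp add: field_simps)
  finally show "\<bar>\<Lambda> f - (LINT x|M. f x)\<bar> <= 0 + e" by simp
 qed
 then show ?thesis by simp
qed

theorem Riesz_representation:
 assumes f: "f \<in> Cc"
 shows "(LINT x|M. f x) = \<Lambda> f"
proof -
 have p: "(%x. max (f x) 0) \<in> Cc" "(%x. max (- f x) 0) \<in> Cc"
  by (rule Cc_compose[where h="%y. max y 0", OF _ _ f], auto intro!: continuous_intros,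
    rule Cc_compose[where h="%y. max (- y) 0", OF _ _ f], auto intro!: continuous_intros)
 have "f x = max (f x) 0 - max (- f x) 0" for x by auto
 then have eq: "f = (%x. max (f x) 0 - max (- f x) 0)" by blast
 have "(LINT x|M. f x) = (LINT x|M. max (f x) 0) - (LINT x|M. max (- f x) 0)"
  by (subst eq, rule Bochner_Integration.integral_diff) (intro Cc_integrable_M p)+
 also have "... = \<Lambda> (%x. max (f x) 0) - \<Lambda> (%x. max (- f x) 0)"
  using Riesz_nonneg[OF p(1)] Riesz_nonneg[OF p(2)] by simp
 also have "... = \<Lambda> f" using Lam_diff[OF p] eq by simp
 finally show ?thesis .
qed

end

section \<open>Mean values and maximum principles\<close>

text \<open>A multiple of \<open>y\<close> times this weight is the gradient of \<open>mv_potential\<close>, which vanishes on the unit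
sphere to second order; this is what makes averages computable by integration by parts.\<close>

definition mv_weight :: "'a::euclidean_space => real" where
 "mv_weight y = max 0 (1 - (norm y)\<^sup>2)"

definition mv_potential :: "'a::euclidean_space => real" where
 "mv_potential y = (mv_weight y)\<^sup>2"

definition average :: "('a::euclidean_space => real) => 'a => real => real" where
 "average w x s = integral (cbox (- One) One) (%y. w (x + s *\<^sub>R y) * mv_weight y)"

definition mv_mass :: "'a::euclidean_space itself => real" where
 "mv_mass _ = integral (cbox (- One) One) (mv_weight :: 'a => real)"

definition mv_second :: "'a::euclidean_space itself => real" where
 "mv_second _ = integral (cbox (- One) One) (mv_potential :: 'a => real) / 8"

lemma mv_weight_continuous: "continuous_on S mv_weight"
 unfolding mv_weight_def[abs_def] by (intro continuous_intros)

lemma mv_potential_continuous: "continuous_on S mv_potential"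
 unfolding mv_potential_def[abs_def] by (intro continuous_intros mv_weight_continuous)

lemma mv_weight_nonneg: "0 <= mv_weight y" by (simp add: mv_weight_def)

lemma mv_weight_zero: "1 <= norm y ==> mv_weight y = 0"
 by (simp add: mv_weight_def one_le_power)

lemma mv_weight_pos: "norm y < 1 ==> 0 < mv_weight y"
 by (simp add: mv_weight_def power_less_one_iff abs_square_less_1)

lemma cball_subset_unit_cbox: "cball 0 1 \<subseteq> cbox (- One) (One::'a::euclidean_space)"
proof
 fix y :: 'a assume "y \<in> cball 0 1"
 then have "\<bar>y \<bullet> b\<bar> <= 1" if "b \<in> Basis" for b using Basis_le_norm[OF that, of y] by simp
 then show "y \<in> cbox (- One) One" by (auto simp: mem_box abs_le_iff) 
qed

lemma norm_unit_cbox: "y \<in> cbox (- One) (One::'a::euclidean_space) ==> norm y <= real DIM('a)"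
proof -
 assume "y \<in> cbox (- One) (One::'a)"
 then have "\<bar>y \<bullet> b\<bar> <= 1" if "b \<in> Basis" for b using that by (auto simp: mem_box abs_le_iff)
 then have "(\<Sum>b\<in>Basis. \<bar>y \<bullet> b\<bar>) <= (\<Sum>b\<in>(Basis::'a set). 1)" by (intro sum_mono) auto
 then show ?thesis using norm_le_l1[of y] by simp
qed

lemma integral_pos_of_pos_ball:
 fixes g :: "'a::euclidean_space => real"
 assumes "continuous_on (cbox (- One) One) g" "!!y. y \<in> cbox (- One) One ==> 0 <= g y" 
  "z \<in> cbox (- One) One" "g z ~= 0"
 shows "integral (cbox (- One) One) g > 0"
proof -
 have "integral (cbox (- One) One) g ~= 0"
 proof
  assume "integral (cbox (- One) One) g = 0"
  then have hi: "(g has_integral 0) (cbox (- One) One)"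
   using integrable_integral[OF integrable_continuous[OF assms(1)]] by simp
  have ne: "box (- One) (One::'a) ~= {}" by (simp add: box_ne_empty)
  have g0: "0 <= g y" if "y \<in> box (- One) One" for y
   by (rule assms(2)[OF subsetD[OF box_subset_cbox that]])
  have "g z = 0" by (rule has_integral_0_cbox_imp_0[OF assms(1) g0 hi ne assms(3)])
  then show False using assms by simp
 qed
 moreover have "integral (cbox (- One) One) g \<ge> 0"
  using assms by (intro integral_nonneg integrable_continuous) auto
 ultimately show ?thesis by simp
qed

lemma mv_second_pos: "mv_second TYPE('a::euclidean_space) > 0"
proof -
 have "integral (cbox (- One) One) (mv_potential :: 'a => real) > 0"
  by (rule integral_pos_of_pos_ball[OF mv_potential_continuous, where z=0])
   (auto simp: mv_potential_def mv_weight_def mem_box)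
 then show ?thesis by (simp add: mv_second_def)
qed

lemma pos_square_deriv: "((%t. (max 0 t)\<^sup>2) has_real_derivative 2 * max 0 t) (at t)" for t :: real
proof (cases "t = 0")
 case True
 have "((%h. (max 0 (0 + h))\<^sup>2 / h) \<longlongrightarrow> 0) (at (0::real))"
 proof (rule Lim_null_comparison)
  show "((%h. \<bar>h\<bar>) \<longlongrightarrow> 0) (at (0::real))" by (intro tendsto_eq_intros) auto
  show "\<forall>\<^sub>F h in at (0::real). norm ((max 0 (0 + h))\<^sup>2 / h) <= \<bar>h\<bar>"
   by (rule always_eventually) (auto simp: max_def power2_eq_square)
 qed
 then show ?thesis using True by (simp add: has_field_derivative_iff)
next
 case False
 then consider "t > 0" | "t < 0" by linarith
 then show ?thesis
 proof cases
  case 1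
  have "((%t. t\<^sup>2) has_real_derivative 2 * max 0 t) (at t)"
   using 1 by (auto intro!: derivative_eq_intros)
  then show ?thesis by (rule has_field_derivative_transform_within_open[where S="{0<..}"]) (use 1 in auto)
 next
  case 2
  have "((%t. 0) has_real_derivative 2 * max 0 t) (at t)"
   using 2 by (auto intro!: derivative_eq_intros)
  then show ?thesis by (rule has_field_derivative_transform_within_open[where S="{..<0}"]) (use 2 in auto)
 qed
qed

lemma mv_potential_C1:
 fixes y b :: "'a::euclidean_space"
 shows "Ck_on 1 UNIV (mv_potential :: 'a => real)"
 and "partial_deriv b mv_potential y = - 4 * mv_weight y * (y \<bullet> b)"
proof -
 note h = pos_square_deriv
 have l: "Ck_on 1 UNIV (%y::'a. 1 - (norm (y - 0))\<^sup>2)"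
  by (intro Ck_on_diff Ck_on_const Ck_on_norm_sq) auto
 have "Ck_on 1 UNIV (%y::'a. (max 0 (1 - (norm (y - 0))\<^sup>2))\<^sup>2)"
  by (rule C1_on_compose[OF open_UNIV h _ l]) (intro continuous_intros)
 then show "Ck_on 1 UNIV (mv_potential :: 'a => real)"
  by (simp add: mv_potential_def[abs_def] mv_weight_def)
 have "((%y::'a. 1 - y \<bullet> y) has_derivative (%d. - (2 * (y \<bullet> d)))) (at y)"
  by (auto intro!: derivative_eq_intros simp: inner_commute)
 moreover have "((%t. (max 0 t)\<^sup>2) has_derivative (*) (2 * max 0 (1 - y \<bullet> y))) (at (1 - y \<bullet> y))"
  using h by (simp add: has_field_derivative_def)
 ultimately have "((%y. (max 0 (1 - y \<bullet> y))\<^sup>2) has_derivative (%d. 2 * max 0 (1 - y \<bullet> y) * (- (2 * (y \<bullet> d))))) (at y)"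
  by (rule has_derivative_compose[where f="%y. 1 - y \<bullet> y" and g="%t. (max 0 t)\<^sup>2"])
 then have "(mv_potential has_derivative (%d. 2 * max 0 (1 - y \<bullet> y) * (- (2 * (y \<bullet> d))))) (at y)"
  by (simp add: mv_potential_def[abs_def] mv_weight_def power2_norm_eq_inner)
 from partial_deriv_eq[OF this, of b] show "partial_deriv b mv_potential y = - 4 * mv_weight y * (y \<bullet> b)"
  by (simp add: mv_weight_def power2_norm_eq_inner)
qed

lemma integral_cbox_lborel:
 fixes f :: "'a::euclidean_space => real"
 assumes "continuous_on (cbox (- One) One) f" "!!y. 1 <= norm y ==> f y = 0"
 shows "(LBINT y. f y) = integral (cbox (- One) One) f"
proof -
 have "set_integrable lborel (cbox (- One) One) f"
  unfolding set_integrable_def using borel_integrable_compact[OF compact_cbox assms(1)] by auto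
 then have "(LBINT y:cbox (- One) One. f y) = integral (cbox (- One) One) f"
  by (rule set_borel_integral_eq_integral)
 moreover have "indicator (cbox (- One) One) y *\<^sub>R f y = f y" for y
  using assms(2)[of y] cball_subset_unit_cbox by (cases "norm y <= 1") (auto simp: indicator_def)
 ultimately show ?thesis unfolding set_lebesgue_integral_def by (simp only:)
qed

text \<open>\<open>y\<close> times the weight is a gradient, so integrating by parts replaces \<open>\<nabla>w \<cdot> y\<close> by the Laplacian of
\<open>w\<close>, which is constant.\<close>

lemma average_gradient:
 fixes w :: "'a::euclidean_space => real"
 assumes \<Omega>: "open \<Omega>" "Ck_on 2 \<Omega> w" "!!x. x \<in> \<Omega> ==> laplacian w x = \<kappa>"
  and s: "s > 0" and sub: "!!y. y \<in> cbox (- One) One ==> x + s *\<^sub>R y \<in> \<Omega>"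
 shows "integral (cbox (- One) One) (%y. (grad w (x + s *\<^sub>R y) \<bullet> y) * mv_weight y) = 2 * \<kappa> * mv_second TYPE('a) * s"
proof -
 define W where "W = (%y. x + s *\<^sub>R y) -` \<Omega>"
 have W: "open W" unfolding W_def
  by (intro open_vimage \<Omega> continuous_intros)
 have KW: "cball 0 1 \<subseteq> W" using sub cball_subset_unit_cbox by (auto simp: W_def)
 have C2: "Ck_on (Suc (Suc 0)) \<Omega> w" using \<Omega>(2) by (simp add: numeral_2_eq_2)
 have zero: "mv_potential y = 0" if "y ~: cball 0 1" for y :: 'a
  using that mv_weight_zero[of y] by (simp add: mv_potential_def)
 have dw: "((%y. partial_deriv b w (x + s *\<^sub>R y)) has_derivative (%h. s * (grad (partial_deriv b w) (x + s *\<^sub>R y) \<bullet> h))) (at y)"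
  if b: "b \<in> Basis" and y: "y \<in> W" for b y
 proof -
  have pb: "Ck_on (Suc 0) \<Omega> (partial_deriv b w)" using C2 b by simp
  have "(partial_deriv b w has_derivative (%h. grad (partial_deriv b w) (x + s *\<^sub>R y) \<bullet> h)) (at (x + s *\<^sub>R y))"
   by (rule Ck_on_has_derivative[OF pb \<Omega>(1)]) (use y in \<open>simp add: W_def\<close>)
  moreover have "((%y. x + s *\<^sub>R y) has_derivative (%h. s *\<^sub>R h)) (at y)"
   by (auto intro!: derivative_eq_intros)
  ultimately have "((%y. partial_deriv b w (x + s *\<^sub>R y)) has_derivative (%h. grad (partial_deriv b w) (x + s *\<^sub>R y) \<bullet> (s *\<^sub>R h))) (at y)"
   by (rule has_derivative_compose[where f="%y. x + s *\<^sub>R y" and g="partial_deriv b w", rotated])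
  then show ?thesis by simp
 qed
 have cont1: "continuous_on W (%y. partial_deriv b w (x + s *\<^sub>R y))" if "b \<in> Basis" for b
  by (rule has_derivative_continuous_on[OF has_derivative_at_withinI[OF dw[OF that]]])
 have cont2: "continuous_on W (%y. partial_deriv c (partial_deriv b w) (x + s *\<^sub>R y))" if "b \<in> Basis" "c \<in> Basis" for b c
  by (rule continuous_on_compose2[of \<Omega>]) (use C2 that in \<open>auto intro!: continuous_intros simp: W_def\<close>)
 let ?F = "%b y. partial_deriv b w (x + s *\<^sub>R y)"
 have FC: "Ck_on 1 W (?F b)" if b: "b \<in> Basis" for b
  unfolding One_nat_def
 proof (rule Ck_on_SucI[OF W dw[OF b]])
  fix c :: 'a assume c: "c \<in> Basis"
  show "Ck_on 0 W (%y. s * (grad (partial_deriv b w) (x + s *\<^sub>R y) \<bullet> c))"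
   using cont2[OF b c] by (simp add: grad_inner_Basis[OF c] continuous_intros)
 qed
 have dF: "partial_deriv b (?F b) y = s * partial_deriv b (partial_deriv b w) (x + s *\<^sub>R y)" if b: "b \<in> Basis" and y: "y \<in> W" for b y
  using partial_deriv_eq[OF dw[OF b y], of b] by (simp add: grad_inner_Basis[OF b])
 have pC: "Ck_on 1 W (mv_potential :: 'a => real)" by (rule Ck_on_subset[OF mv_potential_C1(1) subset_UNIV])
 note p = integration_by_parts[OF W FC pC compact_cball KW zero]
 define g where "g = (%y. (grad w (x + s *\<^sub>R y) \<bullet> y) * mv_weight y)"
 have gs: "g = (%y. (\<Sum>b\<in>Basis. ?F b y * (y \<bullet> b)) * mv_weight y)"
  unfolding g_def by (subst euclidean_inner) (simp add: grad_inner_Basis)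
 have gc: "continuous_on (cbox (- One) One) g"
  unfolding gs using cont1 sub
  by (auto intro!: continuous_intros mv_weight_continuous intro: continuous_on_subset simp: W_def)
 have "(LBINT y. s * \<kappa> * mv_potential (y :: 'a)) = (LBINT y. (\<Sum>b\<in>Basis. mv_potential y * partial_deriv b (?F b) y))"
 proof (intro Bochner_Integration.integral_cong refl)
  fix y :: 'a
  show "s * \<kappa> * mv_potential y = (\<Sum>b\<in>Basis. mv_potential y * partial_deriv b (?F b) y)"
  proof (cases "y \<in> cball 0 1")
   case True
   then have y: "y \<in> W" using KW by blast
   then have "(\<Sum>b\<in>Basis. partial_deriv b (partial_deriv b w) (x + s *\<^sub>R y)) = \<kappa>"
    using \<Omega>(3)[of "x + s *\<^sub>R y"] by (simp add: laplacian_def W_def)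
   moreover have "(\<Sum>b\<in>Basis. mv_potential y * partial_deriv b (?F b) y)
     = (\<Sum>b\<in>Basis. (mv_potential y * s) * partial_deriv b (partial_deriv b w) (x + s *\<^sub>R y))"
    using dF[OF _ y] by (intro sum.cong) auto
   ultimately show ?thesis by (simp only: sum_distrib_left[symmetric] mult_ac)
  qed (simp add: zero)
 qed
 also have "... = (\<Sum>b\<in>Basis. (LBINT y. mv_potential y * partial_deriv b (?F b) y))"
  using p(1) by (intro Bochner_Integration.integral_sum) auto
 also have "... = (\<Sum>b\<in>Basis. (LBINT y. - (partial_deriv b mv_potential y * ?F b y)))"
  using p(3) by (intro sum.cong) auto
 also have "... = (LBINT y. (\<Sum>b\<in>Basis. - (partial_deriv b mv_potential y * ?F b y)))"
  using p(2) by (intro Bochner_Integration.integral_sum[symmetric]) auto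
 also have "... = (LBINT y. 4 * g y)"
  by (intro Bochner_Integration.integral_cong refl) (simp add: gs mv_potential_C1(2) sum_distrib_left sum_distrib_right mult_ac)
 finally have "s * \<kappa> * (LBINT y. mv_potential (y :: 'a)) = 4 * (LBINT y. g y)" by simp
 moreover have "(LBINT y. g y) = integral (cbox (- One) One) g"
  by (rule integral_cbox_lborel[OF gc]) (simp add: g_def mv_weight_zero)
 moreover have "(LBINT y. mv_potential (y :: 'a)) = integral (cbox (- One) One) (mv_potential :: 'a => real)"
  by (rule integral_cbox_lborel[OF mv_potential_continuous]) (simp add: mv_potential_def mv_weight_zero)
 ultimately have "4 * integral (cbox (- One) One) g = s * \<kappa> * integral (cbox (- One) One) (mv_potential :: 'a => real)" by simp
 then show ?thesis unfolding g_def[symmetric] mv_second_def by (simp add: mult_ac)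
qed

text \<open>Differentiating the average in the radius gives the integral computed in \<open>average_gradient\<close>.\<close>

lemma average_formula:
 fixes w :: "'a::euclidean_space => real"
 assumes \<Omega>: "open \<Omega>" "Ck_on 2 \<Omega> w" "!!x. x \<in> \<Omega> ==> laplacian w x = \<kappa>"
  and r: "r > 0" and sub: "cball x (r * real DIM('a)) \<subseteq> \<Omega>"
 shows "average w x r = mv_mass TYPE('a) * w x + \<kappa> * mv_second TYPE('a) * r\<^sup>2"
proof -
 have inO: "x + s *\<^sub>R y \<in> \<Omega>" if "s \<in> {0..r}" "y \<in> cbox (- One) One" for s y
 proof -
  have "norm (s *\<^sub>R y) <= r * real DIM('a)"
   using that norm_unit_cbox[OF that(2)] by (auto intro: mult_mono)
  then have "x + s *\<^sub>R y \<in> cball x (r * real DIM('a))" by (simp add: dist_norm)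
  then show ?thesis using sub by blast
 qed
 have C2: "Ck_on (Suc (Suc 0)) \<Omega> w" using \<Omega>(2) by (simp add: numeral_2_eq_2)
 have wc: "continuous_on \<Omega> w" by (rule Ck_on_continuous[OF C2])
 have gc: "continuous_on \<Omega> (grad w)"
  unfolding grad_def[abs_def] using Ck_on_le[of 1 2 \<Omega> w] \<Omega>(2) by (auto intro!: continuous_intros)
 have D: "((%s. average w x s) has_field_derivative
   integral (cbox (- One) One) (%y. (grad w (x + s *\<^sub>R y) \<bullet> y) * mv_weight y)) (at s within {0..r})"
  if s: "s \<in> {0..r}" for s
  unfolding average_def
 proof (rule leibniz_rule_field_derivative[OF _ _ _ s])
  fix t y assume t: "t \<in> {0..r}" and y: "y \<in> cbox (- One) (One::'a)"
  have "(w has_derivative (%h. grad w (x + t *\<^sub>R y) \<bullet> h)) (at (x + t *\<^sub>R y))"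
   by (rule Ck_on_has_derivative[OF C2 \<Omega>(1) inO[OF t y]])
  from has_derivative_direction[OF this]
  show "((%s. w (x + s *\<^sub>R y) * mv_weight y) has_field_derivative (grad w (x + t *\<^sub>R y) \<bullet> y) * mv_weight y) (at t within {0..r})"
   by (rule has_field_derivative_at_within[OF DERIV_cmult_right])
 next
  fix t assume "t \<in> {0..r}"
  then show "(%y. w (x + t *\<^sub>R y) * mv_weight y) integrable_on cbox (- One) One"
   using inO by (intro integrable_continuous continuous_intros mv_weight_continuous continuous_on_compose2[OF wc]) auto
 next
  have "continuous_on ({0..r} \<times> cbox (- One) One) (%p. grad w (x + fst p *\<^sub>R snd p))"
   using inO by (intro continuous_on_compose2[OF gc] continuous_intros) auto
  moreover have "continuous_on ({0..r} \<times> cbox (- One) (One::'a)) (%p. mv_weight (snd p))"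
   by (rule continuous_on_compose2[OF mv_weight_continuous[of UNIV]]) (auto intro!: continuous_intros)
  ultimately show "continuous_on ({0..r} \<times> cbox (- One) One) (%(s, y). (grad w (x + s *\<^sub>R y) \<bullet> y) * mv_weight y)"
   by (auto simp: case_prod_unfold intro!: continuous_intros)
 qed simp
 let ?k = "\<kappa> * mv_second TYPE('a)"
 let ?F = "%s. average w x s - ?k * s\<^sup>2"
 have "?F r = ?F 0"
 proof (rule DERIV_isconst_end[OF r])
  have "continuous_on {0..r} (average w x)"
   using D by (meson DERIV_continuous_on)
  then show "continuous_on {0..r} ?F" by (intro continuous_intros)
  fix s assume s: "0 < s" "s < r"
  have "(average w x has_field_derivative 2 * \<kappa> * mv_second TYPE('a) * s) (at s within {0..r})"
   using D[of s] average_gradient[OF \<Omega> s(1), of x] inO s by simp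
  moreover have "at s within {0..r} = at s" using s by (intro at_within_interior) simp
  ultimately have "(average w x has_field_derivative 2 * \<kappa> * mv_second TYPE('a) * s) (at s)" by simp
  then show "(?F has_real_derivative 0) (at s)" by (auto intro!: derivative_eq_intros)
 qed
 moreover have "average w x 0 = mv_mass TYPE('a) * w x"
  by (simp add: average_def mv_mass_def mult.commute)
 ultimately show ?thesis by simp
qed

text \<open>The mean value property of a derivative follows by differentiating the averages of \<open>w\<close> in the centre;
the term with \<open>\<kappa>\<close> does not depend on the centre. Only two derivatives of \<open>w\<close> are needed.\<close>

lemma average_directional_derivative:
 fixes w :: "'a::euclidean_space => real"
 assumes \<Omega>: "open \<Omega>" "Ck_on 2 \<Omega> w" "!!x. x \<in> \<Omega> ==> laplacian w x = \<kappa>"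
  and r: "r > 0" and sub: "cball x (r * real DIM('a)) \<subseteq> \<Omega>"
 shows "average (%y. grad w y \<bullet> e) x r = mv_mass TYPE('a) * (grad w x \<bullet> e)"
proof -
 obtain d0 where d0: "d0 > 0" "(\<Union>y\<in>cball x (r * real DIM('a)). cball y d0) \<subseteq> \<Omega>"
  using compact_subset_open_imp_cball_epsilon_subset[OF compact_cball \<Omega>(1) sub] by blast
 define d where "d = d0 / (norm e + 1)"
 have d: "d > 0" unfolding d_def using d0 by (intro divide_pos_pos) (auto intro: add_nonneg_pos)
 have de: "norm (t *\<^sub>R e) <= d0" if "t \<in> {-d..d}" for t
 proof -
  have "norm (t *\<^sub>R e) <= d * norm e" using that by (auto intro!: mult_right_mono)
  also have "... <= d * (norm e + 1)" using d by (intro mult_left_mono) auto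
  also have "... = d0" by (simp add: d_def add_nonneg_eq_0_iff)
  finally show ?thesis .
 qed
 have sub': "cball (x + t *\<^sub>R e) (r * real DIM('a)) \<subseteq> \<Omega>" if "t \<in> {-d..d}" for t
 proof
  fix y assume "y \<in> cball (x + t *\<^sub>R e) (r * real DIM('a))"
  then have "y - t *\<^sub>R e \<in> cball x (r * real DIM('a))" by (simp add: dist_norm algebra_simps)
  moreover have "y \<in> cball (y - t *\<^sub>R e) d0" using de[OF that] by (simp add: dist_norm)
  ultimately show "y \<in> \<Omega>" using d0(2) by blast
 qed
 have inO: "x + t *\<^sub>R e + r *\<^sub>R y \<in> \<Omega>" if "t \<in> {-d..d}" "y \<in> cbox (- One) One" for t y
 proof -
  have "x + t *\<^sub>R e + r *\<^sub>R y \<in> cball (x + t *\<^sub>R e) (r * real DIM('a))"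
   using norm_unit_cbox[OF that(2)] r by (simp add: dist_norm)
  then show ?thesis using sub'[OF that(1)] by blast
 qed
 have C2: "Ck_on (Suc (Suc 0)) \<Omega> w" using \<Omega>(2) by (simp add: numeral_2_eq_2)
 have wc: "continuous_on \<Omega> w" by (rule Ck_on_continuous[OF C2])
 have gc: "continuous_on \<Omega> (grad w)"
  unfolding grad_def[abs_def] using Ck_on_le[of 1 2 \<Omega> w] \<Omega>(2) by (auto intro!: continuous_intros)
 have D: "((%t. average w (x + t *\<^sub>R e) r) has_field_derivative
   integral (cbox (- One) One) (%y. (grad w (x + 0 *\<^sub>R e + r *\<^sub>R y) \<bullet> e) * mv_weight y)) (at 0 within {-d..d})"
  unfolding average_def
 proof (rule leibniz_rule_field_derivative)
  fix t y assume t: "t \<in> {-d..d}" and y: "y \<in> cbox (- One) (One::'a)"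
  have "(w has_derivative (%h. grad w (x + t *\<^sub>R e + r *\<^sub>R y) \<bullet> h)) (at ((x + r *\<^sub>R y) + t *\<^sub>R e))"
   using Ck_on_has_derivative[OF C2 \<Omega>(1) inO[OF t y]] by (simp add: algebra_simps)
  from has_derivative_direction[OF this]
  have "((%t. w (x + t *\<^sub>R e + r *\<^sub>R y)) has_field_derivative (grad w (x + t *\<^sub>R e + r *\<^sub>R y) \<bullet> e)) (at t)"
   by (simp add: algebra_simps)
  then show "((%t. w (x + t *\<^sub>R e + r *\<^sub>R y) * mv_weight y) has_field_derivative (grad w (x + t *\<^sub>R e + r *\<^sub>R y) \<bullet> e) * mv_weight y) (at t within {-d..d})"
   by (rule has_field_derivative_at_within[OF DERIV_cmult_right])
 next
  fix t assume "t \<in> {-d..d}"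
  then show "(%y. w (x + t *\<^sub>R e + r *\<^sub>R y) * mv_weight y) integrable_on cbox (- One) One"
   using inO by (intro integrable_continuous continuous_intros mv_weight_continuous continuous_on_compose2[OF wc]) auto
 next
  have "continuous_on ({-d..d} \<times> cbox (- One) One) (%p. grad w (x + fst p *\<^sub>R e + r *\<^sub>R snd p))"
   using inO by (intro continuous_on_compose2[OF gc] continuous_intros) auto
  moreover have "continuous_on ({-d..d} \<times> cbox (- One) (One::'a)) (%p. mv_weight (snd p))"
   by (rule continuous_on_compose2[OF mv_weight_continuous[of UNIV]]) (auto intro!: continuous_intros)
  ultimately show "continuous_on ({-d..d} \<times> cbox (- One) One) (%(t, y). (grad w (x + t *\<^sub>R e + r *\<^sub>R y) \<bullet> e) * mv_weight y)"
   by (auto simp: case_prod_unfold intro!: continuous_intros)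
 qed (use d in auto)
 have at0: "at 0 within {-d..d} = at 0" using d by (intro at_within_interior) simp
 have "((%t. average w (x + t *\<^sub>R e) r) has_field_derivative mv_mass TYPE('a) * (grad w x \<bullet> e)) (at 0)"
 proof (rule has_field_derivative_transform_within_open[where S="{-d<..<d}"])
  have "x \<in> \<Omega>" using inO[of 0 0] d by (auto simp: mem_box)
  then have "(w has_derivative (%h. grad w x \<bullet> h)) (at (x + 0 *\<^sub>R e))"
   using Ck_on_has_derivative[OF C2 \<Omega>(1)] by simp
  from has_derivative_direction[OF this]
  show "((%t. mv_mass TYPE('a) * w (x + t *\<^sub>R e) + \<kappa> * mv_second TYPE('a) * r\<^sup>2) has_field_derivative mv_mass TYPE('a) * (grad w x \<bullet> e)) (at 0)"
   by (auto intro!: derivative_eq_intros)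
  show "mv_mass TYPE('a) * w (x + t *\<^sub>R e) + \<kappa> * mv_second TYPE('a) * r\<^sup>2 = average w (x + t *\<^sub>R e) r"
   if "t \<in> {-d<..<d}" for t
   using average_formula[OF \<Omega> r sub', of t] that by simp
 qed (use d in auto)
 from DERIV_unique[OF D[unfolded at0] this] show ?thesis by (simp add: average_def)
qed

lemma average_mono_const:
 fixes w :: "'a::euclidean_space => real"
 assumes c: "continuous_on \<Omega> w" and sub: "cball x (r * real DIM('a)) \<subseteq> \<Omega>" and r: "r > 0"
  and le: "!!y. y \<in> \<Omega> ==> w y <= K"
 shows "average w x r <= mv_mass TYPE('a) * K"
  and "average w x r = mv_mass TYPE('a) * K ==> norm y < 1 ==> w (x + r *\<^sub>R y) = K"
proof -
 have inO: "x + r *\<^sub>R y \<in> \<Omega>" if "y \<in> cbox (- One) One" for y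
 proof -
  have "x + r *\<^sub>R y \<in> cball x (r * real DIM('a))"
   using norm_unit_cbox[OF that] r by (simp add: dist_norm)
  then show ?thesis using sub by blast
 qed
 let ?g = "%y. (K - w (x + r *\<^sub>R y)) * mv_weight y"
 have cw: "continuous_on (cbox (- One) One) (%y. w (x + r *\<^sub>R y))"
  using inO by (intro continuous_on_compose2[OF c] continuous_intros) auto
 have cg: "continuous_on (cbox (- One) One) ?g"
  by (intro continuous_intros cw mv_weight_continuous)
 have g0: "0 <= ?g y" if "y \<in> cbox (- One) One" for y
  using le[OF inO[OF that]] mv_weight_nonneg[of y] by simp
 have eq: "integral (cbox (- One) One) ?g = mv_mass TYPE('a) * K - average w x r"
  unfolding average_def mv_mass_def left_diff_distrib
  using cw by (subst Henstock_Kurzweil_Integration.integral_diff)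
   (auto intro!: integrable_continuous continuous_intros mv_weight_continuous simp: mult.commute)
 have "integral (cbox (- One) One) ?g \<ge> 0" using g0 cg by (intro integral_nonneg integrable_continuous) auto
 then show "average w x r <= mv_mass TYPE('a) * K" using eq by simp
 assume e: "average w x r = mv_mass TYPE('a) * K" and y: "norm y < 1"
 have yc: "y \<in> cbox (- One) One" using y cball_subset_unit_cbox by auto
 have "?g y = 0"
  using integral_pos_of_pos_ball[OF cg g0 yc] eq e by fastforce
 then show "w (x + r *\<^sub>R y) = K" using mv_weight_pos[OF y] by simp
qed

lemma average_diff:
 fixes w :: "'a::euclidean_space => real"
 assumes c: "continuous_on \<Omega> w" "continuous_on \<Omega> v" and sub: "cball x (r * real DIM('a)) \<subseteq> \<Omega>" and r: "r > 0"
 shows "average (%y. w y - c * v y) x r = average w x r - c * average v x r"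
proof -
 have inO: "x + r *\<^sub>R y \<in> \<Omega>" if "y \<in> cbox (- One) One" for y
 proof -
  have "x + r *\<^sub>R y \<in> cball x (r * real DIM('a))"
   using norm_unit_cbox[OF that] r by (simp add: dist_norm)
  then show ?thesis using sub by blast
 qed
 have cw: "continuous_on (cbox (- One) One) (%y. w (x + r *\<^sub>R y))" "continuous_on (cbox (- One) One) (%y. v (x + r *\<^sub>R y))"
  using inO by (intro continuous_on_compose2[OF c(1)] continuous_on_compose2[OF c(2)] continuous_intros; auto)+
 have "integral (cbox (- One) One) (%y. w (x + r *\<^sub>R y) * mv_weight y - c * (v (x + r *\<^sub>R y) * mv_weight y))
  = average w x r - c * average v x r"
  unfolding average_def using cw
  by (subst Henstock_Kurzweil_Integration.integral_diff) (auto intro!: integrable_continuous continuous_intros mv_weight_continuous)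
 then show ?thesis by (simp add: average_def algebra_simps)
qed

text \<open>If \<open>w - e B\<close> exceeded \<open>K\<close> it would have an interior maximum by the growth condition. There the mean
value property of \<open>w\<close> contradicts the strict mean value inequality of the superharmonic barrier \<open>B\<close>.\<close>

lemma maximum_principle:
 fixes w B :: "'a::euclidean_space => real"
 assumes \<Omega>: "open \<Omega>" and wc: "continuous_on (closure \<Omega>) w"
  and mvp: "!!x r. r > 0 ==> cball x (r * real DIM('a)) \<subseteq> \<Omega> ==> average w x r = mv_mass TYPE('a) * w x"
  and fr: "!!x. x \<in> frontier \<Omega> ==> w x <= K"
  and B: "Ck_on 2 UNIV B" "!!x. laplacian B x = \<kappa>" "\<kappa> < 0" "!!x. x \<in> closure \<Omega> ==> 0 <= B x"
  and growth: "!!\<epsilon>. \<epsilon> > 0 ==> \<exists>R. \<forall>x\<in>\<Omega>. norm x > R --> w x <= K + \<epsilon> * B x"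
  and x: "x \<in> \<Omega>"
 shows "w x <= K"
proof -
 have Bc: "continuous_on UNIV B" by (rule Ck_on_continuous[OF B(1)])
 have main: "w x <= K + \<epsilon> * B x" if \<epsilon>: "\<epsilon> > 0" for \<epsilon>
 proof (rule ccontr)
  assume neg: "\<not> w x <= K + \<epsilon> * B x"
  define g where "g = (%y. w y - \<epsilon> * B y)"
  have gx: "g x > K" using neg by (simp add: g_def)
  obtain R where R: "!!x. x \<in> \<Omega> ==> norm x > R ==> w x <= K + \<epsilon> * B x" using growth[OF \<epsilon>] by blast
  define R' where "R' = max R (norm x)"
  define C where "C = closure \<Omega> \<inter> cball 0 R'"
  have gc: "continuous_on (closure \<Omega>) g" unfolding g_def
   by (intro continuous_intros wc continuous_on_subset[OF Bc]) auto
  have C: "compact C" "x \<in> C" unfolding C_def using x closure_subset by (auto simp: R'_def closed_Int_compact)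
  obtain x0 where x0: "x0 \<in> C" "!!y. y \<in> C ==> g y <= g x0"
  proof -
   have "continuous_on C g" by (rule continuous_on_subset[OF gc]) (simp add: C_def)
   then show thesis using continuous_attains_sup[of C g] C that by blast
  qed
  have g0: "g x0 > K" using x0(2)[OF C(2)] gx by simp
  have max: "g y <= g x0" if "y \<in> \<Omega>" for y
  proof (cases "norm y <= R'")
   case True
   then show ?thesis using x0(2)[of y] that closure_subset by (auto simp: C_def)
  next
   case False
   then have "norm y > R" by (simp add: R'_def)
   then have "g y <= K" using R[OF that] by (simp add: g_def)
   then show ?thesis using g0 by simp
  qed
  have "x0 ~: frontier \<Omega>"
  proof
   assume f: "x0 \<in> frontier \<Omega>"
   then have "0 <= B x0" using B(4) x0 by (auto simp: C_def)
   then have "g x0 <= K" using fr[OF f] \<epsilon> by (simp add: g_def) (smt (verit) mult_nonneg_nonneg)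
   then show False using g0 by simp
  qed
  then have x0O: "x0 \<in> \<Omega>" using x0 \<Omega> by (auto simp: C_def frontier_def interior_open)
  then obtain s where s: "s > 0" "cball x0 s \<subseteq> \<Omega>" using \<Omega> open_contains_cball by blast
  define r where "r = s / real DIM('a)"
  have r: "r > 0" "cball x0 (r * real DIM('a)) \<subseteq> \<Omega>" using s by (auto simp: r_def)
  have gcO: "continuous_on \<Omega> g" "continuous_on \<Omega> w" "continuous_on \<Omega> B"
   using gc wc Bc closure_subset by (auto intro: continuous_on_subset)
  have "average g x0 r = average w x0 r - \<epsilon> * average B x0 r"
   unfolding g_def by (rule average_diff[OF gcO(2,3) r(2,1)])
  also have "average w x0 r = mv_mass TYPE('a) * w x0" by (rule mvp[OF r])
  also have "average B x0 r = mv_mass TYPE('a) * B x0 + \<kappa> * mv_second TYPE('a) * r\<^sup>2"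
   using average_formula[OF open_UNIV B(1,2) r(1), of x0] by simp
  finally have "average g x0 r = mv_mass TYPE('a) * g x0 - \<epsilon> * \<kappa> * mv_second TYPE('a) * r\<^sup>2"
   by (simp add: g_def algebra_simps)
  moreover have "\<epsilon> * \<kappa> * mv_second TYPE('a) * r\<^sup>2 < 0"
   using \<epsilon> B(3) mv_second_pos[where 'a='a] r(1) by (simp add: mult_pos_neg mult_neg_pos zero_less_mult_iff mult_less_0_iff)
  moreover have "average g x0 r <= mv_mass TYPE('a) * g x0"
   by (rule average_mono_const(1)[OF gcO(1) r(2,1) max])
  ultimately show False by simp
 qed
 show ?thesis
 proof (rule field_le_epsilon)
  fix e :: real assume e: "e > 0"
  have Bx: "B x \<ge> 0" using B(4) x closure_subset by blast
  have "w x <= K + e / (B x + 1) * B x" by (rule main) (use e Bx in auto)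
  also have "e / (B x + 1) * B x <= e" using e Bx by (simp add: field_simps)
  finally show "w x <= K + e" by simp
 qed
qed

text \<open>The set where the maximum is attained is closed, and it is open by the mean value property.\<close>

lemma strong_maximum_principle:
 fixes w :: "'a::euclidean_space => real"
 assumes \<Omega>: "open \<Omega>" "connected \<Omega>" and wc: "continuous_on \<Omega> w"
  and mvp: "!!x r. r > 0 ==> cball x (r * real DIM('a)) \<subseteq> \<Omega> ==> average w x r = mv_mass TYPE('a) * w x"
  and le: "!!x. x \<in> \<Omega> ==> w x <= K" and x0: "x0 \<in> \<Omega>" "w x0 = K" and x: "x \<in> \<Omega>"
 shows "w x = K"
proof -
 define S where "S = {x\<in>\<Omega>. w x = K}"
 have "closedin (top_of_set \<Omega>) S"
  unfolding S_def by (rule continuous_closedin_preimage_constant[OF wc])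
 moreover have "open S"
  unfolding open_contains_ball
 proof
  fix y assume "y \<in> S"
  then have y: "y \<in> \<Omega>" "w y = K" by (auto simp: S_def)
  obtain s where s: "s > 0" "cball y s \<subseteq> \<Omega>" using y \<Omega> open_contains_cball by blast
  define r where "r = s / real DIM('a)"
  have r: "r > 0" "cball y (r * real DIM('a)) \<subseteq> \<Omega>" using s by (auto simp: r_def)
  have rs: "r <= s" using s by (simp add: r_def field_simps Suc_leI DIM_positive)
  have "ball y r \<subseteq> S"
  proof
   fix z assume z: "z \<in> ball y r"
   define h where "h = (1 / r) *\<^sub>R (z - y)"
   have "norm h < 1" unfolding h_def norm_scaleR using z r by (simp add: dist_norm norm_minus_commute)
   then have "w (y + r *\<^sub>R h) = K"
    using average_mono_const(2)[OF wc r(2,1) le] mvp[OF r] y(2) by metis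
   moreover have "y + r *\<^sub>R h = z" using r by (simp add: h_def)
   moreover have "z \<in> \<Omega>" using z rs s(2) by auto
   ultimately show "z \<in> S" by (simp add: S_def)
  qed
  then show "\<exists>e>0. ball y e \<subseteq> S" using r by blast
 qed
 then have "openin (top_of_set \<Omega>) S" by (auto simp: S_def intro!: open_openin_trans \<Omega>)
 moreover have "S ~= {}" using x0 by (auto simp: S_def)
 ultimately have "S = \<Omega>" using \<Omega>(2) connected_clopen by metis
 then show ?thesis using x by (auto simp: S_def)
qed

section \<open>The surface functional of a torsion function\<close>

text \<open>A monotone \<open>C\<^sup>1\<close> step from 0 at \<open>t = 0\<close> to 1 at \<open>t = 1\<close>.\<close>

definition ramp :: "real => real" where
 "ramp t = 2 * ((max 0 t)\<^sup>2 - 2 * (max 0 (t - 1/2))\<^sup>2 + (max 0 (t - 1))\<^sup>2)"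

definition ramp' :: "real => real" where
 "ramp' t = 4 * (max 0 t - 2 * max 0 (t - 1/2) + max 0 (t - 1))"

lemma ramp_deriv: "(ramp has_real_derivative ramp' t) (at t)"
proof -
 have s: "((%t. (max 0 (t - c))\<^sup>2) has_real_derivative 2 * max 0 (t - c)) (at t)" for c :: real
  using DERIV_shift[of "%t. (max 0 t)\<^sup>2" "2 * max 0 (t - c)" t "- c"] pos_square_deriv[of "t - c"] by simp
 from DERIV_cmult[OF DERIV_add[OF DERIV_diff[OF s[of 0] DERIV_cmult[OF s[of "1/2"], of 2]] s[of 1]], of 2]
 show ?thesis by (simp add: ramp_def[abs_def] ramp'_def algebra_simps)
qed

lemma ramp'_continuous: "continuous_on S ramp'"
 unfolding ramp'_def[abs_def] by (intro continuous_intros)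

lemma ramp_continuous: "continuous_on S ramp"
 unfolding ramp_def[abs_def] by (intro continuous_intros)

lemma ramp_zero: "t <= 0 ==> ramp t = 0" by (simp add: ramp_def max_def)

lemma ramp_one: assumes "1 <= t" shows "ramp t = 1"
proof -
 have "ramp t = 2 * (t\<^sup>2 - 2 * (t - 1/2)\<^sup>2 + (t - 1)\<^sup>2)" using assms by (simp add: ramp_def max_def)
 also have "... = 1" by (simp add: power2_eq_square algebra_simps)
 finally show ?thesis .
qed

lemma ramp'_bounds: "0 <= ramp' t" "ramp' t <= 2"
 by (auto simp: ramp'_def max_def)

lemma ramp'_zero: "t <= 0 \<or> 1 <= t ==> ramp' t = 0"
 by (auto simp: ramp'_def max_def)

lemma ramp_bounds: "0 <= ramp t" "ramp t <= 1"
proof -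
 have mono: "ramp a <= ramp b" if "a <= b" for a b
  using ramp_deriv ramp'_bounds(1) by (intro DERIV_nonneg_imp_nondecreasing[OF that]) blast
 show "0 <= ramp t" using mono[of "min t 0" t] ramp_zero[of "min t 0"] by simp
 show "ramp t <= 1" using mono[of t "max t 1"] ramp_one[of "max t 1"] by simp
qed

lemma mollify_nonneg:
 fixes f :: "'a::euclidean_space => real"
 assumes "e > 0" "!!x. 0 <= f x"
 shows "0 <= mollify e f x"
 unfolding mollify_def real_scaleR_def
 by (intro Bochner_Integration.integral_nonneg mult_nonneg_nonneg mollifier_nonneg assms)

lemma test_functions_Cc: "\<phi> \<in> test_functions U ==> \<phi> \<in> Cc"
 by (rule test_functionsD[of \<phi> U]) (auto intro!: CcI intro: Ck_on_continuous[where k=0, OF test_functions_Ck])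

lemma test_fields_Cc_norm: "\<eta> \<in> test_fields U ==> (%x. norm (\<eta> x)) \<in> Cc"
 by (rule test_fieldsD[of \<eta> U]) (auto intro!: CcI continuous_on_norm test_fields_continuous)

lemma exists_smooth_plateau:
 obtains \<phi> where "\<phi> \<in> test_functions UNIV" "!!x. 0 <= \<phi> x" "!!x. plateau R x <= \<phi> x"
proof
 let ?p = "plateau (R + 2) :: 'a => real"
 have pc: "continuous_on UNIV ?p" by (rule CcD(1)[OF plateau(1)])
 show "mollify 1 ?p \<in> test_functions UNIV"
  by (rule mollify_test_function[OF _ pc compact_cball[of 0 "R + 3"]])
   (use plateau(5)[of "R + 2"] in \<open>fastforce+\<close>)
 show nn: "0 <= mollify 1 ?p x" for x by (rule mollify_nonneg) (auto simp: plateau)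
 show "plateau R x <= mollify 1 ?p x" for x
 proof (cases "norm x <= R + 1")
  case True
  have "norm (mollify 1 ?p x - 1) <= 0"
  proof (rule norm_mollify_diff_le[OF _ pc])
   fix y :: 'a assume "norm y < 1"
   then have "norm (x - y) <= R + 2" using True norm_triangle_ineq4[of x y] by simp
   then show "norm (?p (x - y) - 1) <= 0" by (simp add: plateau(4))
  qed simp
  then show ?thesis using plateau(3)[of R x] by simp
 next
  case False
  then have "plateau R x = 0" using plateau(5)[of R x] by force
  then show ?thesis using nn by simp
 qed
qed

text \<open>The field \<open>\<xi>\<close> is a continuous extension of \<open>\<nabla>u / \<beta>\<close> to the whole space.\<close>

locale torsion =
 fixes \<Omega> :: "'a::euclidean_space set" and u :: "'a => real" and \<xi> :: "'a => 'a" and \<beta> :: real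
 assumes open_\<Omega>: "open \<Omega>" and \<beta>_pos: "\<beta> > 0"
  and u_C2: "Ck_on 2 \<Omega> u" and u_cont: "continuous_on (closure \<Omega>) u"
  and u_pos: "x \<in> \<Omega> ==> u x > 0" and u_frontier: "x \<in> frontier \<Omega> ==> u x = 0"
  and u_laplacian: "x \<in> \<Omega> ==> laplacian u x = - 1"
  and \<xi>_cont: "continuous_on UNIV \<xi>" and \<xi>_le: "norm (\<xi> x) <= 1"
  and \<xi>_eq: "x \<in> \<Omega> ==> \<xi> x = grad u x /\<^sub>R \<beta>"
  and \<xi>_frontier: "x \<in> frontier \<Omega> ==> norm (\<xi> x) = 1"
begin

definition u0 :: "'a => real" where "u0 x = (if x \<in> \<Omega> then u x else 0)"

lemma u0_cont: "continuous_on UNIV u0"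
proof -
 have "continuous_on (closure \<Omega> \<union> - \<Omega>) (%x. if x \<in> \<Omega> then u x else 0)"
 proof (rule continuous_on_cases)
  show "closed (- \<Omega>)" using open_\<Omega> by (simp add: open_closed)
  show "\<forall>x. x \<in> closure \<Omega> & x ~: \<Omega> \<or> x \<in> - \<Omega> & x \<in> \<Omega> --> u x = 0"
   using u_frontier open_\<Omega> by (auto simp: frontier_def interior_open)
 qed (auto simp: u_cont)
 moreover have "closure \<Omega> \<union> - \<Omega> = UNIV" using closure_subset by blast
 ultimately show ?thesis by (simp add: u0_def[abs_def])
qed

lemma u0_nonneg: "0 <= u0 x" using u_pos by (auto simp: u0_def intro: less_imp_le)

lemma u0_pos_iff: "0 < u0 x \<longleftrightarrow> x \<in> \<Omega>" using u_pos by (auto simp: u0_def)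

definition \<psi> :: "nat => 'a => real" where "\<psi> k x = ramp (real k * u0 x - 1)"

definition wt :: "nat => 'a => real" where "wt k x = \<beta> * (real k * ramp' (real k * u0 x - 1))"

lemma wt_cont: "continuous_on S (wt k)"
 unfolding wt_def[abs_def]
 by (intro continuous_intros continuous_on_compose2[OF ramp'_continuous[of UNIV]] continuous_on_subset[OF u0_cont]) auto

lemma wt_nonneg: "0 <= wt k x" using \<beta>_pos ramp'_bounds by (simp add: wt_def)

lemma wt_nonzero: assumes "wt k x ~= 0" shows "x \<in> \<Omega>" "real k * u0 x < 2"
proof -
 have "\<not> (real k * u0 x - 1 <= 0 \<or> 1 <= real k * u0 x - 1)"
  using assms ramp'_zero[of "real k * u0 x - 1"] by (auto simp: wt_def)
 then have "real k * u0 x > 1" "real k * u0 x < 2" by auto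
 then show "real k * u0 x < 2" "x \<in> \<Omega>" using u0_pos_iff[of x] u0_nonneg[of x]
  by (auto simp: less_le)
qed

lemma \<psi>_zero: "real k * u0 x <= 1 ==> \<psi> k x = 0" by (simp add: \<psi>_def ramp_zero)

lemma \<psi>_limit: "(%k. \<psi> k x) \<longlonglongrightarrow> indicat_real \<Omega> x"
proof (cases "x \<in> \<Omega>")
 case True
 then have p: "u0 x > 0" using u0_pos_iff by blast
 obtain N where N: "real N > 2 / u0 x" using reals_Archimedean2 by blast
 have "\<psi> k x = 1" if "k \<ge> N" for k
 proof -
  have "2 / u0 x <= real k" using N that by linarith
  then have "2 <= real k * u0 x" using p by (simp add: field_simps)
  then show ?thesis by (simp add: \<psi>_def ramp_one)
 qed
 then show ?thesis using True by (intro tendsto_eventually) (auto simp: eventually_sequentially)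
next
 case False
 then show ?thesis by (simp add: \<psi>_def u0_def ramp_zero)
qed

lemma u_differentiable: "x \<in> \<Omega> ==> (u has_derivative (%h. grad u x \<bullet> h)) (at x)"
 using Ck_on_has_derivative[of 1 \<Omega> u x] u_C2 open_\<Omega> by (simp add: numeral_2_eq_2)

lemma u_partial_C1: "b \<in> Basis ==> Ck_on 1 \<Omega> (partial_deriv b u)"
 using u_C2 by (simp add: numeral_2_eq_2)

lemma grad_u: "x \<in> \<Omega> ==> grad u x = \<beta> *\<^sub>R \<xi> x"
 using \<xi>_eq \<beta>_pos by simp

lemma closed_superlevel: "closed {x. real k * u0 x \<ge> 1}"
 by (intro closed_Collect_le continuous_intros u0_cont)

text \<open>The function \<open>\<psi> k\<close> is a cutoff compactly supported in \<open>\<Omega>\<close> on bounded sets, with gradient \<open>wt k\<close> times \<open>\<xi>\<close>.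
So the identity is integration by parts, and no regularity of the boundary enters.\<close>

lemma superlevel_divergence:
 fixes V :: "'a => 'a"
 assumes V: "!!b. b \<in> Basis ==> Ck_on 1 \<Omega> (%x. V x \<bullet> b)" "continuous_on UNIV V"
  and K: "compact K" "!!x. x ~: K ==> V x = 0"
 shows "integrable lborel (%x. \<psi> k x * divergence V x)"
  and "(LBINT x. \<psi> k x * divergence V x) = - (LBINT x. wt k x * (\<xi> x \<bullet> V x))"
proof -
 define D where "D = {x. real k * u0 x \<ge> 1} \<inter> K"
 have D: "compact D" unfolding D_def using closed_superlevel K(1) by (simp add: closed_Int_compact)
 have D\<Omega>: "D \<subseteq> \<Omega>"
  unfolding D_def using u0_pos_iff by (auto simp: u0_def split: if_splits)
 have Dz: "\<psi> k x * (V x \<bullet> b) = 0" if "x ~: D" for x b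
  using that K(2)[of x] \<psi>_zero[of k x] by (auto simp: D_def)
 define f where "f = (%b x. \<psi> k x * (V x \<bullet> b))"
 have ud: "(\<psi> k has_derivative (%h. real k * ramp' (real k * u0 x - 1) * (grad u x \<bullet> h))) (at x)" if x: "x \<in> \<Omega>" for x
 proof -
  have "(u0 has_derivative (%h. grad u x \<bullet> h)) (at x)"
   by (rule has_derivative_transform_within_open[OF u_differentiable[OF x] open_\<Omega> x]) (simp add: u0_def)
  then have 1: "((%x. real k * u0 x - 1) has_derivative (%h. real k * (grad u x \<bullet> h))) (at x)"
   by (auto intro!: derivative_eq_intros)
  have 2: "(ramp has_derivative (%t. ramp' (real k * u0 x - 1) * t)) (at (real k * u0 x - 1))"
   using ramp_deriv by (simp add: has_field_derivative_def)
  show ?thesis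
   using has_derivative_compose[OF 1 2] by (simp add: \<psi>_def[abs_def] mult_ac)
 qed
 have \<psi>C: "Ck_on 1 \<Omega> (\<psi> k)"
  unfolding One_nat_def
 proof (rule Ck_on_SucI[OF open_\<Omega> ud])
  fix b :: 'a assume b: "b \<in> Basis"
  have "continuous_on \<Omega> (partial_deriv b u)" using u_partial_C1[OF b] by (rule Ck_on_continuous)
  then show "Ck_on 0 \<Omega> (%x. real k * ramp' (real k * u0 x - 1) * (grad u x \<bullet> b))"
   unfolding grad_inner_Basis[OF b] Ck_on.simps
   by (intro continuous_intros continuous_on_compose2[OF ramp'_continuous[of UNIV]] continuous_on_subset[OF u0_cont]) auto
 qed
 have fC: "Ck_on 1 UNIV (f b)" if b: "b \<in> Basis" for b
  by (rule Ck_on_extend_zero[OF open_\<Omega> compact_imp_closed[OF D] D\<Omega>])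
   (use Dz in \<open>auto simp: f_def intro!: Ck_on_mult open_\<Omega> \<psi>C V b simp del: One_nat_def\<close>)
 have fz: "f b x = 0" if "x ~: D" for b x using Dz[OF that] by (simp add: f_def)
 have df: "partial_deriv b (f b) x = \<psi> k x * partial_deriv b (%x. V x \<bullet> b) x + (wt k x / \<beta>) * (grad u x \<bullet> b) * (V x \<bullet> b)"
  if b: "b \<in> Basis" and x: "x \<in> \<Omega>" for b x
 proof -
  have "(%x. V x \<bullet> b) differentiable (at x)"
   using V(1)[OF b] x open_\<Omega> by (auto simp: differentiable_on_open)
  moreover have "\<psi> k differentiable (at x)" using ud[OF x] by (auto simp: differentiable_def)
  moreover have "partial_deriv b (\<psi> k) x = (wt k x / \<beta>) * (grad u x \<bullet> b)"
   using partial_deriv_eq[OF ud[OF x], of b] \<beta>_pos by (simp add: wt_def)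
  ultimately show ?thesis unfolding f_def by (simp add: partial_deriv_mult mult.assoc)
 qed
 have dfz: "partial_deriv b (f b) x = 0" if "x ~: \<Omega>" for b x
 using that D\<Omega> by (intro partial_deriv_off_support[OF compact_imp_closed[OF D]] fz) auto
 have sumf: "(\<Sum>b\<in>Basis. partial_deriv b (f b) x) = \<psi> k x * divergence V x + wt k x * (\<xi> x \<bullet> V x)" for x
 proof (cases "x \<in> \<Omega>")
  case True
  have "(\<Sum>b\<in>Basis. partial_deriv b (f b) x)
   = (\<Sum>b\<in>Basis. \<psi> k x * partial_deriv b (%x. V x \<bullet> b) x + (wt k x / \<beta>) * (grad u x \<bullet> b) * (V x \<bullet> b))"
   by (rule sum.cong[OF refl df[OF _ True]])
  also have "... = \<psi> k x * divergence V x + (wt k x / \<beta>) * (grad u x \<bullet> V x)"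
   by (subst euclidean_inner[of "grad u x"]) (simp add: sum.distrib divergence_def sum_distrib_left mult.assoc)
  also have "(wt k x / \<beta>) * (grad u x \<bullet> V x) = wt k x * (\<xi> x \<bullet> V x)"
   using \<beta>_pos by (simp add: grad_u[OF True])
  finally show ?thesis .
 next
  case False
  then have "wt k x = 0" using wt_nonzero(1) by blast
  moreover have "\<psi> k x = 0" using False by (intro \<psi>_zero) (simp add: u0_def)
  ultimately show ?thesis using dfz[OF False] by simp
 qed
 note ip = integral_partial_deriv_zero[OF fC D fz]
 have i1: "integrable lborel (%x. wt k x * (\<xi> x \<bullet> V x))"
  by (rule integrable_compact_support[OF _ K(1)])
   (auto intro!: continuous_intros wt_cont \<xi>_cont V(2) simp: K(2))
 have i2: "integrable lborel (%x. \<Sum>b\<in>Basis. partial_deriv b (f b) x)"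
  using ip(1) by (intro Bochner_Integration.integrable_sum) auto
 have "integrable lborel (%x. (\<Sum>b\<in>Basis. partial_deriv b (f b) x) - wt k x * (\<xi> x \<bullet> V x))"
  by (rule Bochner_Integration.integrable_diff[OF i2 i1])
 then show i3: "integrable lborel (%x. \<psi> k x * divergence V x)" by (simp add: sumf)
 have "(LBINT x. (\<Sum>b\<in>Basis. partial_deriv b (f b) x)) = 0"
  using ip by (subst Bochner_Integration.integral_sum) auto
 then show "(LBINT x. \<psi> k x * divergence V x) = - (LBINT x. wt k x * (\<xi> x \<bullet> V x))"
  unfolding sumf using i1 i3 by simp
qed

lemma flux_limit:
 fixes V :: "'a => 'a"
 assumes V: "!!b. b \<in> Basis ==> Ck_on 1 \<Omega> (%x. V x \<bullet> b)" "continuous_on UNIV V"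
  and K: "compact K" "!!x. x ~: K ==> V x = 0"
  and i: "set_integrable lborel \<Omega> (divergence V)"
 shows "(%k. LBINT x. wt k x * (\<xi> x \<bullet> V x)) \<longlonglongrightarrow> - (LBINT x:\<Omega>. divergence V x)"
proof -
 have "(%k. LBINT x. \<psi> k x * divergence V x) \<longlonglongrightarrow> (LBINT x:\<Omega>. divergence V x)"
  unfolding set_lebesgue_integral_def
 proof (rule integral_dominated_convergence)
  show "(%x. indicat_real \<Omega> x *\<^sub>R divergence V x) \<in> borel_measurable lborel"
   using i by (auto simp: set_integrable_def)
  show "(%x. \<psi> k x * divergence V x) \<in> borel_measurable lborel" for k
   using superlevel_divergence(1)[OF V K] by blast
  show "integrable lborel (%x. norm (indicat_real \<Omega> x *\<^sub>R divergence V x))"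
   using i by (auto simp: set_integrable_def simp del: real_scaleR_def)
  show "AE x in lborel. (%k. \<psi> k x * divergence V x) \<longlonglongrightarrow> indicat_real \<Omega> x *\<^sub>R divergence V x"
   by (auto intro!: tendsto_intros \<psi>_limit)
  show "AE x in lborel. norm (\<psi> k x * divergence V x) <= norm (indicat_real \<Omega> x *\<^sub>R divergence V x)" for k
  proof (rule AE_I2)
   fix x
   have "\<bar>\<psi> k x\<bar> <= indicat_real \<Omega> x"
    using ramp_bounds \<psi>_zero[of k x] by (auto simp: \<psi>_def u0_def indicator_def)
   then show "norm (\<psi> k x * divergence V x) <= norm (indicat_real \<Omega> x *\<^sub>R divergence V x)"
    by (auto simp: abs_mult intro!: mult_right_mono)
  qed
 qed
 then have "(%k. - (LBINT x. wt k x * (\<xi> x \<bullet> V x))) \<longlonglongrightarrow> (LBINT x:\<Omega>. divergence V x)"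
  by (simp add: superlevel_divergence(2)[OF V K])
 from tendsto_minus[OF this] show ?thesis by simp
qed

text \<open>The weight \<open>wt k\<close> lives where \<open>0 < k u < 2\<close>; on a compact set these layers shrink to the boundary.\<close>

lemma near_frontier:
 fixes f :: "'a => real"
 assumes f: "continuous_on UNIV f" "!!x. x \<in> frontier \<Omega> ==> f x = 0" and K: "compact K" and e: "e > 0"
 obtains N where "!!k x. k \<ge> N ==> x \<in> K ==> wt k x ~= 0 ==> \<bar>f x\<bar> < e"
proof -
 define D where "D = {x. \<bar>f x\<bar> \<ge> e} \<inter> (closure \<Omega> \<inter> K)"
 have "closed {x. \<bar>f x\<bar> \<ge> e}" using f(1) by (intro closed_Collect_le continuous_intros)
 then have D: "compact D" unfolding D_def using K
  by (intro closed_Int_compact) (auto simp: closed_Int_compact)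
 have D\<Omega>: "D \<subseteq> \<Omega>"
 proof
  fix x assume x: "x \<in> D"
  then have "x ~: frontier \<Omega>" using f(2)[of x] e by (auto simp: D_def)
  then show "x \<in> \<Omega>" using x open_\<Omega> by (auto simp: D_def frontier_def interior_open)
 qed
 have "\<exists>c>0. \<forall>x\<in>D. c <= u0 x"
 proof (cases "D = {}")
  case False
  then obtain x0 where "x0 \<in> D" "!!y. y \<in> D ==> u0 x0 <= u0 y"
   using continuous_attains_inf[OF D False continuous_on_subset[OF u0_cont]] by auto
  then show ?thesis using D\<Omega> u0_pos_iff by blast
 qed (auto intro: exI[of _ 1])
 then obtain c where c: "c > 0" "!!x. x \<in> D ==> c <= u0 x" by blast
 obtain N where N: "real N > 2 / c" using reals_Archimedean2 by blast
 show thesis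
 proof (rule that[of N])
  fix k x assume k: "N <= k" and x: "x \<in> K" "wt k x ~= 0"
  show "\<bar>f x\<bar> < e"
  proof (rule ccontr)
   assume "\<not> \<bar>f x\<bar> < e"
   then have "x \<in> D" using x wt_nonzero(1)[OF x(2)] closure_subset by (auto simp: D_def)
   then have "real k * c <= real k * u0 x" using c(2) by (intro mult_left_mono) auto
   moreover have "2 / c < real k" using N k by linarith
   then have "2 < real k * c" using c(1) by (simp add: field_simps)
   ultimately show False using wt_nonzero(2)[OF x(2)] by linarith
  qed
 qed
qed

definition I :: "nat => ('a => real) => real" where "I k f = (LBINT x. wt k x * f x)"

lemma I_integrable: "f \<in> Cc ==> integrable lborel (%x. wt k x * f x)"
 by (intro Cc_integrable Cc_mult_continuous wt_cont)

lemma I_add: "f \<in> Cc ==> g \<in> Cc ==> I k (%x. f x + g x) = I k f + I k g"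
 unfolding I_def by (simp add: distrib_left I_integrable)

lemma I_cmult: "I k (%x. c * f x) = c * I k f"
 unfolding I_def by (simp add: mult.left_commute)

lemma I_diff: "f \<in> Cc ==> g \<in> Cc ==> I k (%x. f x - g x) = I k f - I k g"
 unfolding I_def by (simp add: right_diff_distrib I_integrable)

lemma I_mono_on_support:
 assumes "f \<in> Cc" "g \<in> Cc" "!!x. wt k x ~= 0 ==> f x <= g x"
 shows "I k f <= I k g"
 unfolding I_def
proof (rule integral_mono[OF I_integrable I_integrable])
 show "wt k x * f x <= wt k x * g x" for x
  using assms(3)[of x] wt_nonneg[of k x] by (cases "wt k x = 0") (auto intro: mult_left_mono)
qed (use assms in auto)

lemma I_abs_le:
 assumes "f \<in> Cc" "g \<in> Cc" "!!x. wt k x ~= 0 ==> \<bar>f x\<bar> <= g x"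
 shows "\<bar>I k f\<bar> <= I k g"
proof -
 have "I k f <= I k g" by (rule I_mono_on_support) (use assms in \<open>auto simp: abs_le_iff\<close>)
 moreover have "I k (%x. (-1) * f x) <= I k g"
  by (rule I_mono_on_support[OF Cc_cmult]) (use assms in \<open>auto simp: abs_le_iff\<close>)
 ultimately show ?thesis unfolding I_cmult by simp
qed

text \<open>This is the flux of \<open>\<phi> \<nabla>u\<close>. The factor \<open>|\<xi>|\<^sup>2\<close> tends to 1 in the boundary layers, so the limit is the
surface integral of \<open>\<phi>\<close>.\<close>

lemma flux_gradient:
 assumes \<phi>: "\<phi> \<in> Cc" "Ck_on 1 UNIV \<phi>"
 shows "set_integrable lborel \<Omega> \<phi>" "set_integrable lborel \<Omega> (%x. grad u x \<bullet> grad \<phi> x)"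
  and "(%k. I k (%x. (norm (\<xi> x))\<^sup>2 * \<phi> x)) \<longlonglongrightarrow>
   ((LBINT x:\<Omega>. \<phi> x) - (LBINT x:\<Omega>. grad u x \<bullet> grad \<phi> x)) / \<beta>"
proof -
 obtain K where K: "compact K" "!!x. x ~: K ==> \<phi> x = 0" using CcD(2)[OF \<phi>(1)] by blast
 have om: "\<Omega> \<in> sets lborel" using open_\<Omega> by simp
 have gz: "grad \<phi> x = 0" if "x ~: K" for x
 by (rule grad_off_support[OF compact_imp_closed[OF K(1)] K(2) that])
 have gc: "continuous_on UNIV (grad \<phi>)"
  unfolding grad_def[abs_def] using \<phi>(2) by (intro continuous_intros) auto
 define V where "V = (%x. (\<beta> * \<phi> x) *\<^sub>R \<xi> x)"
 have Vc: "continuous_on UNIV V" unfolding V_def by (intro continuous_intros \<xi>_cont CcD(1)[OF \<phi>(1)])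
 have Vz: "V x = 0" if "x ~: K" for x using K(2)[OF that] by (simp add: V_def)
 have Vb: "V x \<bullet> b = \<phi> x * partial_deriv b u x" if "x \<in> \<Omega>" "b \<in> Basis" for x b
 proof -
  have "V x = \<phi> x *\<^sub>R grad u x" using grad_u[OF that(1)] by (simp add: V_def)
  then show ?thesis by (simp add: grad_inner_Basis[OF that(2)])
 qed
 have VC: "Ck_on 1 \<Omega> (%x. V x \<bullet> b)" if b: "b \<in> Basis" for b
 proof -
  have "Ck_on 1 \<Omega> (%x. \<phi> x * partial_deriv b u x)"
   by (intro Ck_on_mult open_\<Omega> u_partial_C1 b Ck_on_subset[OF \<phi>(2)]) auto
  then show ?thesis using Ck_on_cong[OF open_\<Omega>, of "%x. V x \<bullet> b" "%x. \<phi> x * partial_deriv b u x" 1] Vb[OF _ b] by blast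
 qed
 have div: "divergence V x = grad u x \<bullet> grad \<phi> x - \<phi> x" if x: "x \<in> \<Omega>" for x
 proof -
  have "partial_deriv b (%y. V y \<bullet> b) x = \<phi> x * partial_deriv b (partial_deriv b u) x + partial_deriv b \<phi> x * partial_deriv b u x"
   if b: "b \<in> Basis" for b
  proof -
   have "partial_deriv b (%y. V y \<bullet> b) x = partial_deriv b (%y. \<phi> y * partial_deriv b u y) x"
    by (rule partial_deriv_cong[OF open_\<Omega> x Vb[OF _ b]])
   also have "... = \<phi> x * partial_deriv b (partial_deriv b u) x + partial_deriv b \<phi> x * partial_deriv b u x"
   proof (rule partial_deriv_mult)
    show "\<phi> differentiable at x" using \<phi>(2) by (auto simp: differentiable_on_open)
    show "partial_deriv b u differentiable at x" using u_partial_C1[OF b] x open_\<Omega>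
     by (auto simp: differentiable_on_open)
   qed
   finally show ?thesis .
  qed
  then have "divergence V x = \<phi> x * laplacian u x + (\<Sum>b\<in>Basis. partial_deriv b \<phi> x * partial_deriv b u x)"
   by (simp add: divergence_def laplacian_def sum.distrib sum_distrib_left)
  also have "(\<Sum>b\<in>Basis. partial_deriv b \<phi> x * partial_deriv b u x) = grad u x \<bullet> grad \<phi> x"
   by (subst euclidean_inner) (simp add: grad_inner_Basis mult.commute)
  finally show ?thesis using u_laplacian[OF x] by simp
 qed
 show i1: "set_integrable lborel \<Omega> \<phi>"
  using integrable_mult_indicator[OF om Cc_integrable[OF \<phi>(1)]] by (simp add: set_integrable_def)
 have "integrable lborel (%x. (\<beta> *\<^sub>R \<xi> x) \<bullet> grad \<phi> x)"
  by (rule integrable_compact_support[OF _ K(1)])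
   (auto intro!: continuous_intros \<xi>_cont gc simp: gz)
 from integrable_mult_indicator[OF om this]
 show i2: "set_integrable lborel \<Omega> (%x. grad u x \<bullet> grad \<phi> x)"
  unfolding set_integrable_def
  by (rule Bochner_Integration.integrable_cong[THEN iffD1, rotated 2]) (auto simp: indicator_def grad_u)
 have i3: "set_integrable lborel \<Omega> (divergence V)"
  using set_integral_diff(1)[OF i2 i1] 
  by (rule set_integrable_cong[THEN iffD1, rotated 3]) (auto simp: div)
 have "(LBINT x:\<Omega>. divergence V x) = (LBINT x:\<Omega>. grad u x \<bullet> grad \<phi> x) - (LBINT x:\<Omega>. \<phi> x)"
  using set_integral_diff(2)[OF i2 i1] set_lebesgue_integral_cong[OF om, of "divergence V" "%x. grad u x \<bullet> grad \<phi> x - \<phi> x"] div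
  by simp
 moreover have "(%k. LBINT x. wt k x * (\<xi> x \<bullet> V x)) \<longlonglongrightarrow> - (LBINT x:\<Omega>. divergence V x)"
  by (rule flux_limit[OF VC Vc K(1) Vz i3])
 moreover have "(LBINT x. wt k x * (\<xi> x \<bullet> V x)) = \<beta> * I k (%x. (norm (\<xi> x))\<^sup>2 * \<phi> x)" for k
  unfolding I_cmult[symmetric] by (simp add: I_def V_def power2_norm_eq_inner mult_ac)
 ultimately have "(%k. \<beta> * I k (%x. (norm (\<xi> x))\<^sup>2 * \<phi> x)) \<longlonglongrightarrow>
   (LBINT x:\<Omega>. \<phi> x) - (LBINT x:\<Omega>. grad u x \<bullet> grad \<phi> x)" by simp
 from tendsto_divide[OF this tendsto_const, of \<beta>] show "(%k. I k (%x. (norm (\<xi> x))\<^sup>2 * \<phi> x)) \<longlonglongrightarrow>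
   ((LBINT x:\<Omega>. \<phi> x) - (LBINT x:\<Omega>. grad u x \<bullet> grad \<phi> x)) / \<beta>"
  using \<beta>_pos by simp
qed

lemma \<xi>_sq_cont: "continuous_on UNIV (%x. (norm (\<xi> x))\<^sup>2)"
 by (intro continuous_intros \<xi>_cont)

text \<open>In the boundary layers \<open>|\<xi>|\<^sup>2\<close> is at least one half, so the masses are controlled by the convergent
flux of a smooth function above the plateau.\<close>

lemma I_plateau_bounded: "\<exists>C>0. \<forall>k. I k (plateau R) <= C"
proof -
 obtain \<phi> :: "'a => real" where \<phi>: "\<phi> \<in> test_functions UNIV" "!!x. 0 <= \<phi> x" "!!x. plateau R x <= \<phi> x"
  using exists_smooth_plateau by blast
 have \<phi>C: "\<phi> \<in> Cc" by (rule test_functions_Cc[OF \<phi>(1)])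
 have s\<phi>C: "(%x. (norm (\<xi> x))\<^sup>2 * \<phi> x) \<in> Cc" by (rule Cc_mult_continuous[OF \<xi>_sq_cont \<phi>C])
 obtain K where K: "compact K" "!!x. x ~: K ==> \<phi> x = 0" using CcD(2)[OF \<phi>C] by blast
 have c1: "continuous_on UNIV (%x. 1 - (norm (\<xi> x))\<^sup>2)" by (intro continuous_intros \<xi>_cont)
 have f1: "1 - (norm (\<xi> x))\<^sup>2 = 0" if "x \<in> frontier \<Omega>" for x using \<xi>_frontier[OF that] by simp
 have half: "(1/2::real) > 0" by simp
 obtain N where N: "!!k x. k \<ge> N ==> x \<in> K ==> wt k x ~= 0 ==> \<bar>1 - (norm (\<xi> x))\<^sup>2\<bar> < 1/2"
  using near_frontier[OF c1 f1 K(1) half] by metis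
 have "convergent (%k. I k (%x. (norm (\<xi> x))\<^sup>2 * \<phi> x))"
  using flux_gradient(3)[OF \<phi>C test_functions_Ck[OF \<phi>(1)]] by (rule convergentI)
 then have "Bseq (%k. I k (%x. (norm (\<xi> x))\<^sup>2 * \<phi> x))"
  by (rule convergent_imp_Bseq)
 then obtain C where C: "C > 0" "!!k. norm (I k (%x. (norm (\<xi> x))\<^sup>2 * \<phi> x)) <= C"
  by (auto simp: Bseq_def)
 have big: "I k (plateau R) <= 2 * C" if k: "k \<ge> N" for k
 proof -
  have "I k (plateau R) <= I k (%x. 2 * ((norm (\<xi> x))\<^sup>2 * \<phi> x))"
  proof (rule I_mono_on_support[OF plateau(1) Cc_cmult[OF s\<phi>C]])
   fix x assume x: "wt k x ~= 0"
   show "plateau R x <= 2 * ((norm (\<xi> x))\<^sup>2 * \<phi> x)"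
   proof (cases "x \<in> K")
    case True
    have "1 <= 2 * (norm (\<xi> x))\<^sup>2" using N[OF k True x] by (simp add: abs_if split: if_splits)
    then have "1 * \<phi> x <= 2 * (norm (\<xi> x))\<^sup>2 * \<phi> x" using \<phi>(2) by (intro mult_right_mono) auto
    then show ?thesis using \<phi>(3)[of x] by (simp add: mult.assoc)
   next
    case False
    then show ?thesis using \<phi>(3)[of x] K(2) by simp
   qed
  qed
  also have "... = 2 * I k (%x. (norm (\<xi> x))\<^sup>2 * \<phi> x)" by (rule I_cmult)
  also have "... <= 2 * C" using C(2)[of k] by (simp add: abs_le_iff)
  finally show ?thesis .
 qed
 define C' where "C' = Max (insert (2 * C) ((%k. I k (plateau R)) ` {..N}))"
 have "I k (plateau R) <= C'" for k
 proof (cases "k \<ge> N")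
  case True
  then show ?thesis using big[OF True] unfolding C'_def by (auto intro: order_trans Max_ge)
 next
  case False
  then show ?thesis unfolding C'_def by (intro Max_ge) auto
 qed
 moreover have "C' \<ge> 2 * C" unfolding C'_def by (intro Max_ge) auto
 ultimately show ?thesis using C(1) by (intro exI[of _ C']) auto
qed

lemma I_vanishing:
 assumes f: "f \<in> Cc" "!!x. x \<in> frontier \<Omega> ==> f x = 0"
 shows "(%k. I k f) \<longlonglongrightarrow> 0"
proof (rule LIMSEQ_I)
 fix r :: real assume r: "r > 0"
 obtain R where R: "!!x. norm x > R ==> f x = 0" using Cc_support_ball[OF f(1)] by blast
 obtain C where C: "C > 0" "!!k. I k (plateau R) <= C" using I_plateau_bounded[of R] by blast
 have e: "r / (2 * C) > 0" using r C by simp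
 obtain N where N: "!!k x. k \<ge> N ==> x \<in> cball 0 R ==> wt k x ~= 0 ==> \<bar>f x\<bar> < r / (2 * C)"
  using near_frontier[OF CcD(1)[OF f(1)] f(2) compact_cball e] by blast
 have "norm (I k f - 0) < r" if k: "k \<ge> N" for k
 proof -
  have "\<bar>I k f\<bar> <= I k (%x. r / (2 * C) * plateau R x)"
  proof (rule I_abs_le[OF f(1) Cc_cmult[OF plateau(1)]])
   fix x assume x: "wt k x ~= 0"
   show "\<bar>f x\<bar> <= r / (2 * C) * plateau R x"
   proof (cases "norm x <= R")
    case True then show ?thesis using N[OF k _ x] by (simp add: plateau(4))
   next
    case False
    have "0 <= r / (2 * C) * plateau R x" using e plateau(2)[of R x] by (intro mult_nonneg_nonneg) auto
    then show ?thesis using R[of x] False by simp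
   qed
  qed
  also have "... = r / (2 * C) * I k (plateau R)" by (rule I_cmult)
  also have "... <= r / (2 * C) * C" using C(2) e by (intro mult_left_mono) auto
  also have "... < r" using r C by simp
  finally show ?thesis by simp
 qed
 then show "\<exists>N. \<forall>k\<ge>N. norm (I k f - 0) < r" by blast
qed

lemma I_C1_limit:
 assumes \<phi>: "\<phi> \<in> Cc" "Ck_on 1 UNIV \<phi>"
 shows "(%k. I k \<phi>) \<longlonglongrightarrow>
   ((LBINT x:\<Omega>. \<phi> x) - (LBINT x:\<Omega>. grad u x \<bullet> grad \<phi> x)) / \<beta>"
proof -
 have c: "(%x. (1 - (norm (\<xi> x))\<^sup>2) * \<phi> x) \<in> Cc" "(%x. (norm (\<xi> x))\<^sup>2 * \<phi> x) \<in> Cc"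
  by (rule Cc_mult_continuous[OF _ \<phi>(1)], intro continuous_intros \<xi>_cont)+
 have "(%k. I k (%x. (1 - (norm (\<xi> x))\<^sup>2) * \<phi> x)) \<longlonglongrightarrow> 0"
  by (rule I_vanishing[OF c(1)]) (simp add: \<xi>_frontier)
 from tendsto_add[OF flux_gradient(3)[OF \<phi>] this]
 have "(%k. I k (%x. (norm (\<xi> x))\<^sup>2 * \<phi> x + (1 - (norm (\<xi> x))\<^sup>2) * \<phi> x)) \<longlonglongrightarrow>
   ((LBINT x:\<Omega>. \<phi> x) - (LBINT x:\<Omega>. grad u x \<bullet> grad \<phi> x)) / \<beta>"
  by (simp only: I_add[OF c(2) c(1)] add_0_right)
 moreover have "(%x. (norm (\<xi> x))\<^sup>2 * \<phi> x + (1 - (norm (\<xi> x))\<^sup>2) * \<phi> x) = \<phi>"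
  by (simp add: fun_eq_iff algebra_simps)
 ultimately show ?thesis by simp
qed

text \<open>Uniform limits: a continuous function is uniformly close to its mollifications, for which the limit exists,
and the masses of the layers are bounded.\<close>

lemma I_convergent:
 assumes f: "f \<in> Cc"
 shows "convergent (%k. I k f)"
proof (rule Cauchy_convergent, rule CauchyI)
 fix r :: real assume r: "r > 0"
 obtain R where R: "!!x. norm x > R ==> f x = 0" using Cc_support_ball[OF f] by blast
 obtain C where C: "C > 0" "!!k. I k (plateau (R + 1)) <= C" using I_plateau_bounded[of "R + 1"] by blast
 have fz: "!!x. x ~: cball 0 R ==> f x = 0" using R by auto
 have fc: "continuous_on UNIV f" by (rule CcD(1)[OF f])
 define e where "e = r / (4 * C)"
 have e: "e > 0" using r C by (simp add: e_def)
 obtain d where d: "d > 0" "!!e' x. 0 < e' ==> e' <= d ==> norm (mollify e' f x - f x) <= e"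
  using mollify_uniform[OF fc compact_cball[of 0 R] fz e] by blast
 define \<phi> where "\<phi> = mollify (min d 1) f"
 have d1: "min d 1 > 0" using d by simp
 have \<phi>T: "\<phi> \<in> test_functions UNIV"
  unfolding \<phi>_def by (rule mollify_test_function[OF d1 fc compact_cball[of 0 R] fz]) auto
 have \<phi>C: "\<phi> \<in> Cc" by (rule test_functions_Cc[OF \<phi>T])
 have \<phi>f: "\<bar>\<phi> x - f x\<bar> <= e * plateau (R + 1) x" for x
 proof (cases "norm x <= R + 1")
  case True
  then show ?thesis using d(2)[of "min d 1" x] d1 by (simp add: \<phi>_def plateau(4))
 next
  case False
  have "mollify (min d 1) f x = 0"
  proof (rule mollify_zero[OF d1 fc])
   fix y :: 'a assume "norm y < min d 1"
   then have "norm (x - y) > R" using False norm_triangle_ineq2[of x y] by simp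
   then show "f (x - y) = 0" by (rule R)
  qed
  then show ?thesis using R[of x] False e plateau(2)[of "R + 1" x] by (simp add: \<phi>_def)
 qed
 have close: "\<bar>I k \<phi> - I k f\<bar> <= r / 4" for k
 proof -
  have "(%x. \<phi> x - f x) \<in> Cc" using Cc_add[OF \<phi>C Cc_cmult[OF f, of "-1"]] by simp
  then have "\<bar>I k (%x. \<phi> x - f x)\<bar> <= I k (%x. e * plateau (R + 1) x)"
   using \<phi>f by (intro I_abs_le Cc_cmult plateau(1)) auto
  also have "... = e * I k (plateau (R + 1))" by (rule I_cmult)
  also have "... <= e * C" using C(2) e by (intro mult_left_mono) auto
  also have "... = r / 4" using C by (simp add: e_def)
  finally show ?thesis by (simp add: I_diff[OF \<phi>C f])
 qed
 have "Cauchy (%k. I k \<phi>)"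
  using I_C1_limit[OF \<phi>C test_functions_Ck[OF \<phi>T]] by (rule LIMSEQ_imp_Cauchy)
 then obtain N where N: "!!m n. m \<ge> N ==> n \<ge> N ==> norm (I m \<phi> - I n \<phi>) < r / 4"
  using CauchyD[of _ "r / 4"] r by (metis zero_less_divide_iff zero_less_numeral)
 have "norm (I m f - I n f) < r" if "m \<ge> N" "n \<ge> N" for m n
  using N[OF that] close[of m] close[of n] r unfolding real_norm_def by linarith
 then show "\<exists>M. \<forall>m\<ge>M. \<forall>n\<ge>M. norm (I m f - I n f) < r" by blast
qed

definition \<Lambda> :: "('a => real) => real" where "\<Lambda> f = lim (%k. I k f)"

lemma I_tendsto: "f \<in> Cc ==> (%k. I k f) \<longlonglongrightarrow> \<Lambda> f"
 using I_convergent unfolding \<Lambda>_def convergent_LIMSEQ_iff by blast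

lemma \<Lambda>_eqI: "f \<in> Cc ==> (%k. I k f) \<longlonglongrightarrow> l ==> \<Lambda> f = l"
 using I_tendsto LIMSEQ_unique by blast

sublocale surface: positive_functional \<Lambda>
proof
 show "\<Lambda> (%x. f x + g x) = \<Lambda> f + \<Lambda> g" if "f \<in> Cc" "g \<in> Cc" for f g
  using tendsto_add[OF I_tendsto[OF that(1)] I_tendsto[OF that(2)]] that
  by (intro \<Lambda>_eqI) (auto simp: I_add Cc_add)
 show "\<Lambda> (%x. c * f x) = c * \<Lambda> f" if "f \<in> Cc" for f c
  using tendsto_mult[OF tendsto_const I_tendsto[OF that], of c] that
  by (intro \<Lambda>_eqI) (auto simp: I_cmult Cc_cmult)
 show "0 <= \<Lambda> f" if "f \<in> Cc" "!!x. 0 <= f x" for f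
 proof (rule LIMSEQ_le_const[OF I_tendsto[OF that(1)]])
  have "0 <= I k f" for k unfolding I_def using that wt_nonneg by (intro Bochner_Integration.integral_nonneg) auto
  then show "\<exists>N. \<forall>n\<ge>N. 0 <= I n f" by blast
 qed
qed

lemma \<Lambda>_vanishing: "f \<in> Cc ==> (!!x. x \<in> frontier \<Omega> ==> f x = 0) ==> \<Lambda> f = 0"
 using I_vanishing \<Lambda>_eqI by blast

lemma \<Lambda>_cong: 
 assumes "f \<in> Cc" "g \<in> Cc" "!!x. x \<in> frontier \<Omega> ==> f x = g x"
 shows "\<Lambda> f = \<Lambda> g"
proof -
 have "(%x. f x - g x) \<in> Cc" using Cc_add[OF assms(1) Cc_cmult[OF assms(2), of "-1"]] by simp
 then have "\<Lambda> (%x. f x - g x) = 0" using assms(3) by (intro \<Lambda>_vanishing) auto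
 then show ?thesis using surface.Lam_diff[OF assms(1,2)] by simp
qed

lemma \<Lambda>_C1:
 "\<phi> \<in> Cc ==> Ck_on 1 UNIV \<phi> ==>
  \<Lambda> \<phi> = ((LBINT x:\<Omega>. \<phi> x) - (LBINT x:\<Omega>. grad u x \<bullet> grad \<phi> x)) / \<beta>"
 using I_C1_limit \<Lambda>_eqI by blast

lemma \<Lambda>_flux:
 fixes V :: "'a => 'a"
 assumes V: "!!b. b \<in> Basis ==> Ck_on 1 \<Omega> (%x. V x \<bullet> b)" "continuous_on UNIV V"
  and K: "compact K" "!!x. x ~: K ==> V x = 0"
  and i: "set_integrable lborel \<Omega> (divergence V)"
 shows "\<Lambda> (%x. \<xi> x \<bullet> V x) = - (LBINT x:\<Omega>. divergence V x)"
proof (rule \<Lambda>_eqI)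
 show "(%x. \<xi> x \<bullet> V x) \<in> Cc"
  by (rule CcI[OF _ K(1)]) (auto intro!: continuous_intros \<xi>_cont V(2) simp: K(2))
 show "(%k. I k (%x. \<xi> x \<bullet> V x)) \<longlonglongrightarrow> - (LBINT x:\<Omega>. divergence V x)"
  unfolding I_def by (rule flux_limit[OF V K i])
qed

lemma \<Lambda>_test_field:
 assumes \<eta>: "\<eta> \<in> test_fields U"
 shows "(LBINT x:\<Omega>. divergence \<eta> x) = \<Lambda> (%x. - (\<xi> x \<bullet> \<eta> x))"
  and "(%x. \<xi> x \<bullet> \<eta> x) \<in> Cc" "set_integrable lborel \<Omega> (divergence \<eta>)"
proof -
 obtain K where K: "compact K" "K \<subseteq> U" "!!x. x ~: K ==> \<eta> x = 0" using test_fieldsD[OF \<eta>] by blast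
 have c: "continuous_on UNIV \<eta>" by (rule test_fields_continuous[OF \<eta>])
 show C: "(%x. \<xi> x \<bullet> \<eta> x) \<in> Cc"
  by (rule CcI[OF _ K(1)]) (auto intro!: continuous_intros \<xi>_cont c simp: K(3))
 have dz: "divergence \<eta> x = 0" if "x ~: K" for x
 proof -
  have "partial_deriv b (%y. \<eta> y \<bullet> b) x = partial_deriv b (%y. 0) x" for b
   using K compact_imp_closed that by (intro partial_deriv_cong[of "-K"]) (auto simp: open_Compl)
  then show ?thesis by (simp add: divergence_def)
 qed
 have "integrable lborel (divergence \<eta>)"
  by (rule integrable_compact_support[OF divergence_borel[OF \<eta>] K(1) dz])
 then show i: "set_integrable lborel \<Omega> (divergence \<eta>)"
  using integrable_mult_indicator[of \<Omega> lborel "divergence \<eta>"] open_\<Omega> by (simp add: set_integrable_def)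
 have "\<Lambda> (%x. \<xi> x \<bullet> \<eta> x) = - (LBINT x:\<Omega>. divergence \<eta> x)"
 proof (rule \<Lambda>_flux[OF _ c K(1,3) i])
  show "Ck_on 1 \<Omega> (%x. \<eta> x \<bullet> b)" if "b \<in> Basis" for b
   by (rule Ck_on_subset[OF test_functions_Ck[OF test_fields_component[OF \<eta> that]]]) simp
 qed
 then show "(LBINT x:\<Omega>. divergence \<eta> x) = \<Lambda> (%x. - (\<xi> x \<bullet> \<eta> x))"
  using surface.Lam_cmult[OF C, of "-1"] by simp
qed

end

section \<open>The perimeter measure, the 1-Laplacian and the normal trace\<close>

lemma set_integral_cmult: "(LINT x:A|M. (c::real) * f x) = c * (LINT x:A|M. f x)"
 unfolding set_lebesgue_integral_def integral_mult_right_zero[symmetric]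
 by (rule Bochner_Integration.integral_cong) auto

lemma open_emeasure_pos:
 fixes W :: "'a::euclidean_space set"
 assumes "open W" "W ~= {}"
 shows "emeasure lborel W > 0"
proof (rule ccontr)
 assume "\<not> ?thesis"
 then have "W \<in> null_sets lborel" using assms by (intro null_setsI) auto
 then have "negligible W" using negligible_iff_null_sets null_sets_completionI by blast
 then show False using open_not_negligible[OF assms] by simp
qed

context torsion begin

lemma variation_eq_integral:
 "variation (indicat_real \<Omega>) U = (SUP \<eta>\<in>{\<eta>\<in>test_fields U. \<forall>x. norm (\<eta> x) <= 1}. ereal (\<Lambda> (%x. - (\<xi> x \<bullet> \<eta> x))))"
 unfolding variation_def
proof (rule SUP_cong[OF refl])
 fix \<eta> :: "'a => 'a" assume "\<eta> \<in> {\<eta> \<in> test_fields U. \<forall>x. norm (\<eta> x) <= 1}"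
 then show "ereal (LBINT x. indicat_real \<Omega> x * divergence \<eta> x) = ereal (\<Lambda> (%x. - (\<xi> x \<bullet> \<eta> x)))"
  using \<Lambda>_test_field(1)[of \<eta> U] by (simp add: set_lebesgue_integral_def)
qed

lemma flux_le_norm:
 assumes "\<eta> \<in> test_fields U"
 shows "\<Lambda> (%x. - (\<xi> x \<bullet> \<eta> x)) <= \<Lambda> (%x. norm (\<eta> x))"
proof (rule surface.Lam_mono)
 show "(%x. - (\<xi> x \<bullet> \<eta> x)) \<in> Cc" using Cc_cmult[OF \<Lambda>_test_field(2)[OF assms], of "-1"] by simp
 show "(%x. norm (\<eta> x)) \<in> Cc" by (rule test_fields_Cc_norm[OF assms])
 fix x
 have "- (\<xi> x \<bullet> \<eta> x) <= norm (\<xi> x) * norm (\<eta> x)" using Cauchy_Schwarz_ineq2[of "\<xi> x" "\<eta> x"] by linarith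
 also have "... <= norm (\<eta> x)" using \<xi>_le[of x] by (simp add: mult_left_le_one_le)
 finally show "- (\<xi> x \<bullet> \<eta> x) <= norm (\<eta> x)" .
qed

text \<open>The field \<open>- \<psi> \<xi>\<close> has flux \<open>\<psi> |\<xi>|\<^sup>2\<close>, which is \<open>\<psi>\<close> on the boundary; mollifying makes it a test field.\<close>

lemma flux_approximation:
 assumes U: "open U" and \<phi>: "\<phi> \<in> surface.below U" and e: "e > 0"
 obtains \<eta> where "\<eta> \<in> test_fields U" "!!x. norm (\<eta> x) <= 1" "\<Lambda> \<phi> <= \<Lambda> (%x. - (\<xi> x \<bullet> \<eta> x)) + e"
proof -
 have e2: "e / 2 > 0" using e by simp
 obtain \<psi> K where K: "compact K" "K \<subseteq> U" "\<psi> \<in> surface.below K" "\<Lambda> \<phi> <= \<Lambda> \<psi> + e / 2"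
  by (rule surface.truncation[OF \<phi> e2])
 have \<psi>C: "\<psi> \<in> Cc" by (rule surface.below_Cc[OF K(3)])
 have \<psi>01: "0 <= \<psi> x" "\<psi> x <= 1" "x ~: K ==> \<psi> x = 0" for x using K(3) by (auto simp: surface.below_def)
 define V where "V = (%x. - \<psi> x *\<^sub>R \<xi> x)"
 have Vc: "continuous_on UNIV V" unfolding V_def by (intro continuous_intros \<xi>_cont CcD(1)[OF \<psi>C])
 have Vz: "V x = 0" if "x ~: K" for x using \<psi>01(3)[OF that] by (simp add: V_def)
 have V1: "norm (V x) <= 1" for x using \<psi>01(1,2)[of x] \<xi>_le[of x] by (simp add: V_def mult_le_one)
 obtain R where R: "R > 0" "!!x. x \<in> K ==> norm x <= R" using compact_imp_bounded[OF K(1)] bounded_pos by metis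
 define C where "C = \<Lambda> (plateau (R + 1))"
 have C: "C \<ge> 0" unfolding C_def by (intro surface.Lam_nonneg plateau)
 define e' where "e' = e / (2 * (C + 1))"
 have e': "e' > 0" using e C by (simp add: e'_def)
 obtain d1 where d1: "d1 > 0" "!!d x. 0 < d ==> d <= d1 ==> norm (mollify d V x - V x) <= e'"
  using mollify_uniform[OF Vc K(1) Vz e'] by blast
 obtain d2 where d2: "d2 > 0" "!!d. d <= d2 ==> {x + y |x y. x \<in> K & y \<in> cball 0 d} \<subseteq> U"
  using compact_thicken[OF K(1) U K(2)] by blast
 define d where "d = min 1 (min d1 d2)"
 have d: "d > 0" "d <= 1" "d <= d1" "d <= d2" using d1 d2 by (auto simp: d_def)
 define \<eta> where "\<eta> = mollify d V"
 have \<eta>: "\<eta> \<in> test_fields U" unfolding \<eta>_def by (rule mollify_test_field[OF d(1) Vc K(1) Vz d2(2)[OF d(4)]])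
 have close: "norm (\<eta> x - V x) <= e' * plateau (R + 1) x" for x
 proof (cases "norm x <= R + 1")
  case True
  then show ?thesis using d1(2)[OF d(1,3), of x] by (simp add: \<eta>_def plateau(4))
 next
  case False
  have "mollify d V x = 0"
  proof (rule mollify_zero[OF d(1) Vc])
   fix y :: 'a assume "norm y < d"
   then have "norm (x - y) > R" using False d norm_triangle_ineq2[of x y] by simp
   then show "V (x - y) = 0" using R(2)[of "x - y"] by (intro Vz) auto
  qed
  moreover have "V x = 0" using False R(2)[of x] by (intro Vz) auto
  ultimately show ?thesis using e' plateau(2)[of "R + 1" x] by (simp add: \<eta>_def)
 qed
 have s: "(%x. (norm (\<xi> x))\<^sup>2 * \<psi> x) \<in> Cc" by (rule Cc_mult_continuous[OF \<xi>_sq_cont \<psi>C])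
 have n: "(%x. - (\<xi> x \<bullet> \<eta> x)) \<in> Cc" using Cc_cmult[OF \<Lambda>_test_field(2)[OF \<eta>], of "-1"] by simp
 have "\<Lambda> \<psi> = \<Lambda> (%x. (norm (\<xi> x))\<^sup>2 * \<psi> x)" by (rule \<Lambda>_cong[OF \<psi>C s]) (simp add: \<xi>_frontier)
 also have "... <= \<Lambda> (%x. - (\<xi> x \<bullet> \<eta> x) + e' * plateau (R + 1) x)"
 proof (rule surface.Lam_mono[OF s Cc_add[OF n Cc_cmult[OF plateau(1)]]])
  fix x
  have "\<xi> x \<bullet> (\<eta> x - V x) <= norm (\<xi> x) * norm (\<eta> x - V x)" by (rule norm_cauchy_schwarz)
  also have "... <= norm (\<eta> x - V x)" using \<xi>_le[of x] by (simp add: mult_left_le_one_le)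
  also have "... <= e' * plateau (R + 1) x" by (rule close)
  finally show "(norm (\<xi> x))\<^sup>2 * \<psi> x <= - (\<xi> x \<bullet> \<eta> x) + e' * plateau (R + 1) x"
   by (simp add: V_def inner_diff_right power2_norm_eq_inner algebra_simps)
 qed
 also have "... = \<Lambda> (%x. - (\<xi> x \<bullet> \<eta> x)) + e' * C"
  unfolding C_def by (simp only: surface.Lam_add[OF n Cc_cmult[OF plateau(1)]] surface.Lam_cmult[OF plateau(1)])
 also have "e' * C <= e / 2" using e C by (simp add: e'_def field_simps)
 finally have "\<Lambda> \<phi> <= \<Lambda> (%x. - (\<xi> x \<bullet> \<eta> x)) + e" using K(4) by simp
 moreover have "norm (\<eta> x) <= 1" for x unfolding \<eta>_def by (rule norm_mollify_le[OF d(1) Vc V1])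
 ultimately show thesis using that \<eta> by blast
qed

text \<open>Upper bound: \<open>- \<xi> \<cdot> \<eta> \<le> |\<eta>|\<close>, and \<open>|\<eta>|\<close> is below \<open>U\<close>. Lower bound: \<open>flux_approximation\<close>.\<close>

lemma variation_eq_content:
 assumes U: "open U"
 shows "e2ennreal (variation (indicat_real \<Omega>) U) = surface.content U"
proof (rule antisym)
 have "variation (indicat_real \<Omega>) U <= enn2ereal (surface.content U)"
  unfolding variation_eq_integral
 proof (rule SUP_least)
  fix \<eta> :: "'a => 'a" assume "\<eta> \<in> {\<eta> \<in> test_fields U. \<forall>x. norm (\<eta> x) <= 1}"
  then have \<eta>: "\<eta> \<in> test_fields U" "!!x. norm (\<eta> x) <= 1" by auto
  obtain K where K: "compact K" "K \<subseteq> U" "!!x. x ~: K ==> \<eta> x = 0" using test_fieldsD[OF \<eta>(1)] by blast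
  have "(%x. norm (\<eta> x)) \<in> surface.below U"
   using test_fields_Cc_norm[OF \<eta>(1)] \<eta>(2) K by (auto simp: surface.below_def)
  from surface.content_upper[OF this] have "enn2ereal (ennreal (\<Lambda> (%x. norm (\<eta> x)))) <= enn2ereal (surface.content U)"
   by (simp add: less_eq_ennreal.rep_eq)
  moreover have "0 <= \<Lambda> (%x. norm (\<eta> x))" by (intro surface.Lam_nonneg test_fields_Cc_norm[OF \<eta>(1)]) simp
  ultimately have "ereal (\<Lambda> (%x. norm (\<eta> x))) <= enn2ereal (surface.content U)" by (simp add: enn2ereal_ennreal)
  then show "ereal (\<Lambda> (%x. - (\<xi> x \<bullet> \<eta> x))) <= enn2ereal (surface.content U)"
   using flux_le_norm[OF \<eta>(1)] by (metis ereal_less_eq(3) order_trans)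
 qed
 from e2ennreal_mono[OF this] show "e2ennreal (variation (indicat_real \<Omega>) U) <= surface.content U" by simp
 show "surface.content U <= e2ennreal (variation (indicat_real \<Omega>) U)"
  unfolding surface.content_def
 proof (rule SUP_least, rule ennreal_le_epsilon)
  fix \<phi> and e :: real assume \<phi>: "\<phi> \<in> surface.below U" and e: "0 < e"
  obtain \<eta> where \<eta>: "\<eta> \<in> test_fields U" "!!x. norm (\<eta> x) <= 1" "\<Lambda> \<phi> <= \<Lambda> (%x. - (\<xi> x \<bullet> \<eta> x)) + e"
   using flux_approximation[OF U \<phi> e] by blast
  let ?L = "\<Lambda> (%x. - (\<xi> x \<bullet> \<eta> x))"
  have "ereal ?L <= variation (indicat_real \<Omega>) U"
   unfolding variation_eq_integral by (rule SUP_upper2[OF _ order_refl]) (use \<eta> in auto)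
  from e2ennreal_mono[OF this] have "ennreal ?L <= e2ennreal (variation (indicat_real \<Omega>) U)" by simp
  moreover have "ennreal (\<Lambda> \<phi>) <= ennreal ?L + ennreal e"
  proof -
   have "ennreal (\<Lambda> \<phi>) <= ennreal (max ?L 0 + e)" using \<eta>(3) by (intro ennreal_leI) simp
   also have "... = ennreal (max ?L 0) + ennreal e" using e by (intro ennreal_plus) auto
   also have "ennreal (max ?L 0) = ennreal ?L" by (simp add: max_def ennreal_neg)
   finally show ?thesis .
  qed
  ultimately show "ennreal (\<Lambda> \<phi>) <= e2ennreal (variation (indicat_real \<Omega>) U) + ennreal e"
   by (meson add_right_mono order_trans)
 qed
qed

lemma perimeter_measure_eq: "perimeter_measure \<Omega> = surface.M"
proof -
 have "(%B. INF U\<in>{U. open U & B \<subseteq> U}. e2ennreal (variation (indicat_real \<Omega>) U)) = surface.outer"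
  by (auto simp: surface.outer_def fun_eq_iff variation_eq_content intro!: INF_cong)
 then show ?thesis by (simp add: variation_measure_def surface.M_def)
qed

text \<open>The functional vanishes on functions that are zero on the boundary, hence on those supported off it.\<close>

lemma surface_null: "AE x in surface.M. x \<in> frontier \<Omega>"
proof -
 have o: "open (- frontier \<Omega>)" by (simp add: open_Compl)
 have "surface.content (- frontier \<Omega>) <= 0"
  unfolding surface.content_def
 proof (rule SUP_least)
  fix \<phi> assume "\<phi> \<in> surface.below (- frontier \<Omega>)"
  then have "\<Lambda> \<phi> = 0" by (intro \<Lambda>_vanishing) (auto simp: surface.below_def)
  then show "ennreal (\<Lambda> \<phi>) <= 0" by simp
 qed
 then have "emeasure surface.M (- frontier \<Omega>) = 0" using surface.emeasure_M_open[OF o] by simp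
 then have "- frontier \<Omega> \<in> null_sets surface.M" using o by (intro null_setsI) auto
 from AE_not_in[OF this] show ?thesis by simp
qed

lemma BV_loc_indicator: "BV_loc (indicat_real \<Omega>)"
 unfolding BV_loc_def
proof (intro conjI allI impI)
 show "locally_integrable UNIV (indicat_real \<Omega>)"
  unfolding locally_integrable_def
 proof (intro allI impI)
  fix K :: "'a set" assume "compact K & K \<subseteq> UNIV"
  then have K: "K \<in> sets borel" "emeasure lborel K < \<infinity>" using emeasure_compact_finite by (auto simp: compact_imp_closed)
  show "set_integrable lborel K (indicat_real \<Omega>)"
  proof (rule set_integrable_bounded_finite[OF K, where C=1])
   show "set_borel_measurable lborel K (indicat_real \<Omega>)"
    unfolding set_borel_measurable_def using K open_\<Omega>
    by (intro borel_measurable_scaleR borel_measurable_indicator) auto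
  qed (simp add: indicator_def)
 qed
 fix U :: "'a set" assume U: "open U & bounded U"
 then have "e2ennreal (variation (indicat_real \<Omega>) U) < \<infinity>"
  using surface.emeasure_M_bounded[of U] by (simp add: variation_eq_content surface.emeasure_M_open)
 then show "variation (indicat_real \<Omega>) U < \<infinity>"
  by (cases "variation (indicat_real \<Omega>) U") auto
qed

lemma locally_integrable_continuous:
 assumes "continuous_on U f"
 shows "locally_integrable U f"
 unfolding locally_integrable_def
proof (intro allI impI)
 fix K assume K: "compact K & K \<subseteq> U"
 show "set_integrable lborel K f"
  unfolding set_integrable_def
  using borel_integrable_compact[of K f] K continuous_on_subset[OF assms] by auto
qed

lemma \<Lambda>_identity:
 assumes \<phi>: "\<phi> \<in> Cc" "Ck_on 1 UNIV \<phi>"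
 shows "(LBINT x:\<Omega>. \<xi> x \<bullet> grad \<phi> x) = (LBINT x:\<Omega>. \<phi> x) / \<beta> - \<Lambda> \<phi>"
proof -
 have om: "\<Omega> \<in> sets lborel" using open_\<Omega> by simp
 have "(LBINT x:\<Omega>. grad u x \<bullet> grad \<phi> x) = (LBINT x:\<Omega>. \<beta> * (\<xi> x \<bullet> grad \<phi> x))"
  by (rule set_lebesgue_integral_cong[OF om]) (simp add: grad_u)
 then show ?thesis using \<Lambda>_C1[OF \<phi>] \<beta>_pos by (simp add: field_simps)
qed

lemma indicator_absorb: "(LBINT x:\<Omega>. - (c * indicat_real \<Omega> x) * \<phi> x) = - (c * (LBINT x:\<Omega>. \<phi> x))"
proof -
 have "(LBINT x:\<Omega>. - (c * indicat_real \<Omega> x) * \<phi> x) = (LBINT x:\<Omega>. (- c) * \<phi> x)"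
  using open_\<Omega> by (intro set_lebesgue_integral_cong) auto
 then show ?thesis unfolding set_integral_cmult by simp
qed

lemma weak_divergence_\<xi>: "has_weak_divergence \<Omega> \<xi> (%x. - (1 / \<beta> * indicat_real \<Omega> x))"
 unfolding has_weak_divergence_def
proof (intro conjI ballI)
 show "locally_integrable \<Omega> (%x. \<xi> x \<bullet> b)" for b
  by (intro locally_integrable_continuous continuous_intros continuous_on_subset[OF \<xi>_cont]) auto
 have "continuous_on \<Omega> (%x. - (1 / \<beta> * indicat_real \<Omega> x))"
  by (rule continuous_on_eq[of _ "%x. - (1 / \<beta>)"]) auto
 then show "locally_integrable \<Omega> (%x. - (1 / \<beta> * indicat_real \<Omega> x))"
  by (rule locally_integrable_continuous)
 fix \<phi> assume \<phi>: "\<phi> \<in> test_functions \<Omega>"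
 obtain K where K: "K \<subseteq> \<Omega>" "!!x. x ~: K ==> \<phi> x = 0" using test_functionsD[OF \<phi>] by blast
 have "\<Lambda> \<phi> = 0"
  using K open_\<Omega> by (intro \<Lambda>_vanishing test_functions_Cc[OF \<phi>]) (auto simp: frontier_def interior_open)
 then show "(LBINT x:\<Omega>. \<xi> x \<bullet> grad \<phi> x) = - (LBINT x:\<Omega>. - (1 / \<beta> * indicat_real \<Omega> x) * \<phi> x)"
  unfolding indicator_absorb using \<Lambda>_identity[OF test_functions_Cc[OF \<phi>] test_functions_Ck[OF \<phi>]] by simp
qed

lemma W11_loc_\<xi>:
 assumes b: "b \<in> Basis"
 shows "W11_loc \<Omega> (%x. \<xi> x \<bullet> b)"
 unfolding W11_loc_def
proof (intro conjI ballI)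
 show "locally_integrable \<Omega> (%x. \<xi> x \<bullet> b)"
  by (intro locally_integrable_continuous continuous_intros continuous_on_subset[OF \<xi>_cont]) auto
 fix c :: 'a assume c: "c \<in> Basis"
 let ?g = "%x. partial_deriv c (partial_deriv b u) x / \<beta>"
 have gc: "continuous_on \<Omega> (partial_deriv c (partial_deriv b u))"
  using u_partial_C1[OF b] c by simp
 show "\<exists>g. locally_integrable \<Omega> g & (\<forall>\<phi>\<in>test_functions \<Omega>.
   (LBINT x:\<Omega>. \<xi> x \<bullet> b * partial_deriv c \<phi> x) = - (LBINT x:\<Omega>. g x * \<phi> x))"
 proof (intro exI[of _ ?g] conjI ballI)
  show "locally_integrable \<Omega> ?g"
   by (intro locally_integrable_continuous continuous_intros gc) (use \<beta>_pos in auto)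
  fix \<phi> assume \<phi>: "\<phi> \<in> test_functions \<Omega>"
  obtain K where K: "compact K" "K \<subseteq> \<Omega>" "!!x. x ~: K ==> \<phi> x = 0" using test_functionsD[OF \<phi>] by blast
  have \<phi>1: "Ck_on 1 UNIV \<phi>" by (rule test_functions_Ck[OF \<phi>])
  note p = integration_by_parts[OF open_\<Omega> u_partial_C1[OF b] Ck_on_subset[OF \<phi>1 subset_UNIV] K c]
  have dz: "partial_deriv c \<phi> x = 0" if "x ~: K" for x by (rule partial_deriv_off_support[OF compact_imp_closed[OF K(1)] K(3) that])
  have l: "(LBINT x:\<Omega>. \<xi> x \<bullet> b * partial_deriv c \<phi> x) = (LBINT x. partial_deriv c \<phi> x * partial_deriv b u x / \<beta>)"
   unfolding set_lebesgue_integral_def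
  proof (intro Bochner_Integration.integral_cong refl)
   fix x show "indicat_real \<Omega> x *\<^sub>R (\<xi> x \<bullet> b * partial_deriv c \<phi> x) = partial_deriv c \<phi> x * partial_deriv b u x / \<beta>"
    using dz[of x] K(2) \<xi>_eq[of x] by (cases "x \<in> \<Omega>") (auto simp: grad_inner_Basis[OF b] field_simps)
  qed
  have r: "(LBINT x:\<Omega>. ?g x * \<phi> x) = (LBINT x. \<phi> x * partial_deriv c (partial_deriv b u) x / \<beta>)"
   unfolding set_lebesgue_integral_def
  proof (intro Bochner_Integration.integral_cong refl)
   fix x show "indicat_real \<Omega> x *\<^sub>R (?g x * \<phi> x) = \<phi> x * partial_deriv c (partial_deriv b u) x / \<beta>"
    using K(2) K(3)[of x] by (cases "x \<in> \<Omega>") auto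
  qed
  show "(LBINT x:\<Omega>. \<xi> x \<bullet> b * partial_deriv c \<phi> x) = - (LBINT x:\<Omega>. ?g x * \<phi> x)"
   unfolding l r integral_divide_zero using p(3) by simp
 qed
qed

lemma one_laplace: "solves_one_laplace \<Omega> (indicat_real \<Omega>) (%x. 1 / \<beta> * indicat_real \<Omega> x)"
 unfolding solves_one_laplace_def
proof (intro conjI exI[of _ \<xi>] ballI)
 show "BV_loc (indicat_real \<Omega>)" by (rule BV_loc_indicator)
 show "W11_loc \<Omega> (%x. \<xi> x \<bullet> b)" if "b \<in> Basis" for b by (rule W11_loc_\<xi>[OF that])
 show "AE x in lborel. x \<in> \<Omega> --> norm (\<xi> x) <= 1" by (simp add: \<xi>_le)
 show "has_weak_divergence \<Omega> \<xi> (%x. - (1 / \<beta> * indicat_real \<Omega> x))" by (rule weak_divergence_\<xi>)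
 fix \<phi> :: "'a => real" assume \<phi>: "\<phi> \<in> test_functions UNIV"
 have \<phi>C: "\<phi> \<in> Cc" by (rule test_functions_Cc[OF \<phi>])
 have om: "\<Omega> \<in> sets lborel" using open_\<Omega> by simp
 have 1: "(LBINT x:\<Omega>. indicat_real \<Omega> x * \<phi> x * - (1 / \<beta> * indicat_real \<Omega> x)) = (LBINT x:\<Omega>. (- (1 / \<beta>)) * \<phi> x)"
  by (rule set_lebesgue_integral_cong[OF om]) simp
 have 2: "(LBINT x:\<Omega>. indicat_real \<Omega> x * (\<xi> x \<bullet> grad \<phi> x)) = (LBINT x:\<Omega>. \<xi> x \<bullet> grad \<phi> x)"
  by (rule set_lebesgue_integral_cong[OF om]) simp
 show "pairing \<Omega> \<xi> (%x. - (1 / \<beta> * indicat_real \<Omega> x)) (indicat_real \<Omega>) \<phi> = (LINT x|perimeter_measure \<Omega>. \<phi> x)"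
  unfolding pairing_def perimeter_measure_eq surface.Riesz_representation[OF \<phi>C] 1 2
  unfolding set_integral_cmult using \<Lambda>_identity[OF \<phi>C test_functions_Ck[OF \<phi>]] by simp
qed

text \<open>If the ball had no surface mass, the indicator of \<open>\<Omega>\<close> would have zero gradient in it and the ball would lie
in \<open>\<Omega>\<close> or in its complement up to a null set; but it meets both \<open>\<Omega>\<close> and the exterior in open sets.\<close>

lemma surface_ball_pos:
 assumes ext: "x \<in> closure (- closure \<Omega>)" and x: "x \<in> frontier \<Omega>" and r: "r > 0"
 shows "emeasure surface.M (ball x r) > 0"
proof (rule ccontr)
 assume "\<not> ?thesis"
 then have "emeasure surface.M (ball x r) = 0" by simp
 then have ae: "AE y in surface.M. y ~: ball x r"
  by (intro AE_not_in null_setsI) auto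
 have "(LBINT y:\<Omega>. partial_deriv b \<phi> y) = 0" if \<phi>: "\<phi> \<in> test_functions (ball x r)" and b: "b \<in> Basis" for \<phi> b
 proof -
  define \<eta> where "\<eta> = (%y. \<phi> y *\<^sub>R b)"
  have comp: "\<eta> y \<bullet> c = (if c = b then 1 else 0) * \<phi> y" if "c \<in> Basis" for c y
   using that b by (simp add: \<eta>_def inner_Basis)
  have \<eta>: "\<eta> \<in> test_fields (ball x r)"
   unfolding test_fields_def
  proof (intro CollectI ballI)
   fix c :: 'a assume c: "c \<in> Basis"
   obtain K where K: "compact K" "K \<subseteq> ball x r" "!!y. y ~: K ==> \<phi> y = 0" using test_functionsD[OF \<phi>] by blast
   show "(%y. \<eta> y \<bullet> c) \<in> test_functions (ball x r)"
    unfolding comp[OF c]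
    by (rule test_functionsI[OF _ K(1,2)]) (use K(3) test_functions_Ck[OF \<phi>] in \<open>auto intro: Ck_on_cmult simp: Ck_on_const\<close>)
  qed
  have "divergence \<eta> y = partial_deriv b \<phi> y" for y
  proof -
   have "divergence \<eta> y = (\<Sum>c\<in>Basis. if c = b then partial_deriv b \<phi> y else 0)"
    unfolding divergence_def by (rule sum.cong[OF refl]) (auto simp: comp b)
   then show ?thesis using b by simp
  qed
  then have "(LBINT y:\<Omega>. partial_deriv b \<phi> y) = \<Lambda> (%y. - (\<xi> y \<bullet> \<eta> y))"
   using \<Lambda>_test_field(1)[OF \<eta>] by simp
  also have "... = (LINT y|surface.M. - (\<xi> y \<bullet> \<eta> y))"
  proof (rule surface.Riesz_representation[symmetric])
   show "(%y. - (\<xi> y \<bullet> \<eta> y)) \<in> Cc" using Cc_cmult[OF \<Lambda>_test_field(2)[OF \<eta>], of "-1"] by simp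
  qed
  also have "... = 0"
  proof (rule integral_eq_zero_AE)
   obtain K where K: "K \<subseteq> ball x r" "!!y. y ~: K ==> \<eta> y = 0" using test_fieldsD[OF \<eta>] by blast
   have z: "\<eta> y = 0" if "y ~: ball x r" for y using K that by blast
   show "AE y in surface.M. - (\<xi> y \<bullet> \<eta> y) = 0" using ae by eventually_elim (simp add: z)
  qed
  finally show ?thesis .
 qed
 then have "emeasure lborel (\<Omega> \<inter> ball x r) = 0 \<or> emeasure lborel (ball x r - \<Omega>) = 0"
  using open_\<Omega> by (intro null_or_conull_of_zero_gradient) auto
 moreover have "emeasure lborel (\<Omega> \<inter> ball x r) > 0"
 proof (rule open_emeasure_pos)
  obtain y where "y \<in> \<Omega>" "dist y x < r"
   using x r closure_approachable[of x \<Omega>] by (auto simp: frontier_def)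
  then show "\<Omega> \<inter> ball x r ~= {}" by (auto simp: dist_commute)
 qed (use open_\<Omega> in auto)
 moreover have "emeasure lborel (ball x r - \<Omega>) > 0"
 proof -
  obtain y where "y \<in> - closure \<Omega>" "dist y x < r"
   using ext r unfolding closure_approachable[of x "- closure \<Omega>"] by blast
  then have "(- closure \<Omega>) \<inter> ball x r ~= {}" by (auto simp: dist_commute)
  then have "emeasure lborel ((- closure \<Omega>) \<inter> ball x r) > 0"
   by (intro open_emeasure_pos) (auto simp: open_Compl)
  also have "emeasure lborel ((- closure \<Omega>) \<inter> ball x r) <= emeasure lborel (ball x r - \<Omega>)"
   using closure_subset[of \<Omega>] open_\<Omega> by (intro emeasure_mono) auto
  finally show ?thesis .
 qed
 ultimately show False by auto
qed

end

text \<open>Boundary points are limits of exterior points; this excludes slits, whose points carry no perimeter.\<close>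

locale torsion_exterior = torsion +
 assumes exterior: "x \<in> frontier \<Omega> ==> x \<in> closure (- closure \<Omega>)"
begin

definition \<sigma> :: "'a => 'a" where "\<sigma> x = indicat_real (frontier \<Omega>) x *\<^sub>R (- \<xi> x)"

lemma \<sigma>_borel: "\<sigma> \<in> borel_measurable borel"
 unfolding \<sigma>_def[abs_def]
 by (intro borel_measurable_scaleR borel_measurable_indicator borel_measurable_uminus borel_measurable_continuous_onI[OF \<xi>_cont]) auto

lemma normal_density_\<sigma>: "normal_density \<Omega> \<sigma>"
 unfolding normal_density_def perimeter_measure_eq
proof (intro conjI ballI)
 show "\<sigma> \<in> borel_measurable borel" by (rule \<sigma>_borel)
 show "AE x in surface.M. norm (\<sigma> x) = 1"
  using surface_null by eventually_elim (simp add: \<sigma>_def \<xi>_frontier)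
 fix \<eta> :: "'a => 'a" assume \<eta>: "\<eta> \<in> test_fields UNIV"
 have C: "(%y. - (\<xi> y \<bullet> \<eta> y)) \<in> Cc" using Cc_cmult[OF \<Lambda>_test_field(2)[OF \<eta>], of "-1"] by simp
 have "(LBINT x:\<Omega>. divergence \<eta> x) = (LINT x|surface.M. - (\<xi> x \<bullet> \<eta> x))"
  using \<Lambda>_test_field(1)[OF \<eta>] surface.Riesz_representation[OF C] by simp
 also have "... = (LINT x|surface.M. \<eta> x \<bullet> \<sigma> x)"
 proof (rule integral_cong_AE)
  show "(%x. - (\<xi> x \<bullet> \<eta> x)) \<in> borel_measurable surface.M"
   using surface.Cc_integrable_M[OF C] by auto
  have "(%x. \<eta> x \<bullet> \<sigma> x) \<in> borel_measurable borel"
   using \<sigma>_borel borel_measurable_continuous_onI[OF test_fields_continuous[OF \<eta>]] by auto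
  then show "(%x. \<eta> x \<bullet> \<sigma> x) \<in> borel_measurable surface.M" by (simp cong: measurable_cong_sets)
  show "AE x in surface.M. - (\<xi> x \<bullet> \<eta> x) = \<eta> x \<bullet> \<sigma> x"
   using surface_null by eventually_elim (simp add: \<sigma>_def inner_commute)
 qed
 finally show "(LBINT x:\<Omega>. divergence \<eta> x) = (LINT x|surface.M. \<eta> x \<bullet> \<sigma> x)" .
qed

lemma \<sigma>_average:
 assumes x: "x \<in> frontier \<Omega>"
 shows "((%r. (LINT y:ball x r|surface.M. \<sigma> y) /\<^sub>R measure surface.M (ball x r)) \<longlongrightarrow> \<sigma> x) (at_right 0)"
proof (rule tendstoI)
 fix e :: real assume e: "e > 0"
 have "isCont \<xi> x" using \<xi>_cont by (simp add: continuous_on_eq_continuous_at)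
 then obtain d where d: "d > 0" "!!y. dist y x < d ==> dist (\<xi> y) (\<xi> x) < e / 2"
  unfolding continuous_at_eps_delta using e by (metis half_gt_zero)
 have "dist ((LINT y:ball x r|surface.M. \<sigma> y) /\<^sub>R measure surface.M (ball x r)) (\<sigma> x) < e" if r: "0 < r" "r < d" for r
 proof -
  let ?B = "ball x r" let ?m = "measure surface.M ?B"
  have fin: "emeasure surface.M ?B < \<infinity>" by (rule surface.emeasure_M_bounded) simp
  have m: "?m > 0" using surface_ball_pos[OF exterior[OF x] x r(1)] fin
   by (simp add: measure_def enn2real_positive_iff)
  have i0: "integrable surface.M (indicat_real ?B)" using fin by (intro integrable_real_indicator) auto
  have s1: "norm (\<sigma> y) <= 1" for y using \<xi>_le[of y] by (simp add: \<sigma>_def indicator_def)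
  have sm: "(%y. indicat_real ?B y *\<^sub>R \<sigma> y) \<in> borel_measurable surface.M"
  proof -
   have "(%y. indicat_real ?B y *\<^sub>R \<sigma> y) \<in> borel_measurable borel"
    by (intro borel_measurable_scaleR borel_measurable_indicator \<sigma>_borel) auto
   then show ?thesis by (simp cong: measurable_cong_sets)
  qed
  have i1: "integrable surface.M (%y. indicat_real ?B y *\<^sub>R \<sigma> y)"
   by (rule Bochner_Integration.integrable_bound[OF i0 sm]) (use s1 in \<open>auto simp: indicator_def\<close>)
  have i2: "integrable surface.M (%y. indicat_real ?B y *\<^sub>R \<sigma> x)"
   using i0 by (rule integrable_scaleR_left)
  have c: "(LINT y|surface.M. indicat_real ?B y *\<^sub>R \<sigma> x) = ?m *\<^sub>R \<sigma> x"
   using i0 fin by simp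
  have "norm ((LINT y:?B|surface.M. \<sigma> y) - ?m *\<^sub>R \<sigma> x)
    = norm (LINT y|surface.M. indicat_real ?B y *\<^sub>R \<sigma> y - indicat_real ?B y *\<^sub>R \<sigma> x)"
   unfolding set_lebesgue_integral_def c[symmetric] using i1 i2 by simp
  also have "... <= (LINT y|surface.M. indicat_real ?B y * (e / 2))"
  proof (rule order_trans[OF integral_norm_bound integral_mono_AE])
   show "AE y in surface.M. norm (indicat_real ?B y *\<^sub>R \<sigma> y - indicat_real ?B y *\<^sub>R \<sigma> x) <= indicat_real ?B y * (e / 2)"
    using surface_null
   proof eventually_elim
    case (elim y)
    then show ?case using d(2)[of y] r x
     by (auto simp: \<sigma>_def indicator_def dist_norm norm_minus_commute)
   qed
  qed (use i1 i2 i0 in \<open>auto intro!: integrable_norm\<close>)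
  also have "... = ?m * (e / 2)" using i0 fin by simp
  finally have *: "norm ((LINT y:?B|surface.M. \<sigma> y) - ?m *\<^sub>R \<sigma> x) <= ?m * (e / 2)" .
  have "(LINT y:?B|surface.M. \<sigma> y) /\<^sub>R ?m - \<sigma> x = ((LINT y:?B|surface.M. \<sigma> y) - ?m *\<^sub>R \<sigma> x) /\<^sub>R ?m"
   using m by (simp add: scaleR_diff_right)
  then have "norm ((LINT y:?B|surface.M. \<sigma> y) /\<^sub>R ?m - \<sigma> x) = norm ((LINT y:?B|surface.M. \<sigma> y) - ?m *\<^sub>R \<sigma> x) / ?m"
   using m by (simp add: divide_inverse mult.commute)
  also have "... <= (?m * (e / 2)) / ?m" using * m by (intro divide_right_mono) auto
  also have "... = e / 2" using m by simp
  finally have "norm ((LINT y:?B|surface.M. \<sigma> y) /\<^sub>R ?m - \<sigma> x) <= e / 2" .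
  then show ?thesis using e by (simp add: dist_norm)
 qed
 moreover have "eventually (%r. r \<in> {0<..<d}) (at_right 0)"
  using d by (intro eventually_at_right_real) auto
 ultimately show "\<forall>\<^sub>F r in at_right 0. dist ((LINT y:ball x r|surface.M. \<sigma> y) /\<^sub>R measure surface.M (ball x r)) (\<sigma> x) < e"
  by (auto elim!: eventually_mono)
qed

text \<open>Outside the boundary there is no perimeter. At a boundary point the density \<open>- \<xi>\<close> is continuous, so its
averages converge to the unit vector \<open>- \<xi> x\<close>.\<close>

lemma reduced_boundary_eq: "reduced_boundary \<Omega> = frontier \<Omega>"
proof (rule set_eqI, rule iffI)
 fix x assume x: "x \<in> frontier \<Omega>"
 have "norm (\<sigma> x) = 1" using x \<xi>_frontier by (simp add: \<sigma>_def)
 then show "x \<in> reduced_boundary \<Omega>"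
  unfolding reduced_boundary_def perimeter_measure_eq
  by (intro CollectI conjI allI impI exI[of _ \<sigma>] exI[of _ "\<sigma> x"] surface_ball_pos[OF exterior[OF x] x]
    normal_density_\<sigma> \<sigma>_average[OF x])
next
 fix x assume x: "x \<in> reduced_boundary \<Omega>"
 show "x \<in> frontier \<Omega>"
 proof (rule ccontr)
  assume "x ~: frontier \<Omega>"
  then obtain r where r: "r > 0" "ball x r \<subseteq> - frontier \<Omega>"
   using open_contains_ball[of "- frontier \<Omega>"] by (auto simp: open_Compl)
  have "AE y in surface.M. y ~: ball x r" using surface_null by eventually_elim (use r in auto)
  then have "ball x r \<in> null_sets surface.M" by (subst AE_iff_null_sets) auto
  then have "emeasure surface.M (ball x r) = 0" by auto
  then show False using x r(1) by (auto simp: reduced_boundary_def perimeter_measure_eq)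
 qed
qed

lemma normal_trace_\<xi>:
 "has_normal_trace \<Omega> U \<xi> (%x. - (1 / \<beta> * indicat_real \<Omega> x)) (%_. - 1)"
 unfolding has_normal_trace_def
proof (intro conjI ballI)
 show "\<exists>C. AE x in perimeter_measure \<Omega>. \<bar>- 1::real\<bar> <= C" by (rule exI[of _ 1]) simp
 fix \<phi> assume \<phi>: "\<phi> \<in> test_functions U"
 obtain K where K: "compact K" "K \<subseteq> U" "!!x. x ~: K ==> \<phi> x = 0" using test_functionsD[OF \<phi>] by blast
 have \<phi>C: "\<phi> \<in> Cc" by (rule test_functions_Cc[OF \<phi>])
 have gz: "grad \<phi> x = 0" if "x ~: U" for x
 proof -
  have "grad \<phi> x = grad (%x. 0) x"
   using K compact_imp_closed that by (intro grad_cong[of "-K"]) (auto simp: open_Compl)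
  then show ?thesis by (simp add: grad_def)
 qed
 have 1: "(LBINT x:\<Omega> \<inter> U. \<xi> x \<bullet> grad \<phi> x) = (LBINT x:\<Omega>. \<xi> x \<bullet> grad \<phi> x)"
  unfolding set_lebesgue_integral_def by (intro Bochner_Integration.integral_cong) (auto simp: indicator_def gz)
 have 2: "(LBINT x:\<Omega> \<inter> U. - (1 / \<beta> * indicat_real \<Omega> x) * \<phi> x) = (LBINT x:\<Omega>. - (1 / \<beta> * indicat_real \<Omega> x) * \<phi> x)"
  unfolding set_lebesgue_integral_def using K by (intro Bochner_Integration.integral_cong) (auto simp: indicator_def)
 have "(LINT x:reduced_boundary \<Omega>|perimeter_measure \<Omega>. - 1 * \<phi> x) = (LINT x|surface.M. - \<phi> x)"
  unfolding reduced_boundary_eq perimeter_measure_eq set_lebesgue_integral_def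
 proof (rule integral_cong_AE)
  have m: "\<phi> \<in> borel_measurable surface.M" using surface.Cc_integrable_M[OF \<phi>C] by auto
  show "(%x. indicat_real (frontier \<Omega>) x *\<^sub>R (- 1 * \<phi> x)) \<in> borel_measurable surface.M"
   using m by (intro borel_measurable_scaleR borel_measurable_indicator) auto
  show "(%x. - \<phi> x) \<in> borel_measurable surface.M" using m by auto
  show "AE x in surface.M. indicat_real (frontier \<Omega>) x *\<^sub>R (- 1 * \<phi> x) = - \<phi> x"
   using surface_null by eventually_elim simp
 qed
 also have "... = - \<Lambda> \<phi>" using surface.Riesz_representation[OF \<phi>C] by simp
 finally show "(LBINT x:\<Omega> \<inter> U. \<xi> x \<bullet> grad \<phi> x) + (LBINT x:\<Omega> \<inter> U. - (1 / \<beta> * indicat_real \<Omega> x) * \<phi> x) =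
    (LINT x:reduced_boundary \<Omega>|perimeter_measure \<Omega>. - 1 * \<phi> x)"
  unfolding 1 2 indicator_absorb using \<Lambda>_identity[OF \<phi>C test_functions_Ck[OF \<phi>]] by simp
qed auto

end

section \<open>Lipschitz extensions and regularity up to the boundary\<close>

lemma ray_exit:
 fixes \<Omega> :: "'a::real_normed_vector set"
 assumes \<Omega>: "open \<Omega>" and x: "x \<in> \<Omega>" and s: "0 <= s" "x + s *\<^sub>R e ~: \<Omega>"
 obtains s1 where "0 < s1" "s1 <= s" "x + s1 *\<^sub>R e \<in> frontier \<Omega>" "!!t. 0 <= t ==> t < s1 ==> x + t *\<^sub>R e \<in> \<Omega>"
proof -
 define T where "T = {t. 0 <= t & x + t *\<^sub>R e ~: \<Omega>}"
 have "T = {0..} \<inter> (%t. x + t *\<^sub>R e) -` (- \<Omega>)" by (auto simp: T_def)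
 moreover have "closed ((%t. x + t *\<^sub>R e) -` (- \<Omega>))"
  by (intro closed_vimage closed_Compl \<Omega> continuous_intros)
 ultimately have clT: "closed T" by (simp add: closed_Int)
 have ne: "T ~= {}" "bdd_below T" using s by (auto simp: T_def bdd_below_def)
 define s1 where "s1 = Inf T"
 have s1T: "s1 \<in> T" unfolding s1_def by (rule closed_contains_Inf[OF ne clT])
 have min: "s1 <= t" if "t \<in> T" for t unfolding s1_def using that ne(2) by (rule cInf_lower)
 have pos: "0 < s1" using s1T x by (cases "s1 = 0") (auto simp: T_def)
 have ins: "x + t *\<^sub>R e \<in> \<Omega>" if "0 <= t" "t < s1" for t
  using min[of t] that by (auto simp: T_def not_le[symmetric])
 have "x + s1 *\<^sub>R e \<in> closure \<Omega>"
 proof -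
  have "((%t. x + t *\<^sub>R e) \<longlongrightarrow> x + s1 *\<^sub>R e) (at_left s1)"
   by (intro tendsto_intros)
  moreover have "eventually (%t. x + t *\<^sub>R e \<in> \<Omega>) (at_left s1)"
   using eventually_at_left_real[OF pos] by eventually_elim (auto intro: ins)
  then have "eventually (%t. x + t *\<^sub>R e \<in> closure \<Omega>) (at_left s1)"
   by eventually_elim (use closure_subset in blast)
  ultimately show ?thesis
   using Lim_in_closed_set[of "closure \<Omega>" "%t. x + t *\<^sub>R e" "at_left s1"] by simp
 qed
 moreover have "x + s1 *\<^sub>R e ~: \<Omega>" using s1T by (simp add: T_def)
 ultimately have "x + s1 *\<^sub>R e \<in> frontier \<Omega>" using \<Omega> by (simp add: frontier_def interior_open)
 moreover have "s1 <= s" using min[of s] s by (simp add: T_def)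
 ultimately show thesis using that pos ins by blast
qed

lemma open_superlevel:
 fixes g :: "'a::euclidean_space => real"
 assumes "open U" "continuous_on U g"
 shows "open {y\<in>U. g y > c}"
proof -
 have "{y\<in>U. g y > c} = U \<inter> g -` {c<..}" by auto
 then show ?thesis using continuous_open_preimage[OF assms(2,1), of "{c<..}"] by simp
qed

text \<open>McShane's extension: the infimum over \<open>S\<close> of the cones with slope \<open>L\<close>.\<close>

lemma lipschitz_extension_real:
 fixes f :: "'a::metric_space => real"
 assumes L: "L-lipschitz_on S f"
 obtains F where "L-lipschitz_on UNIV F" "!!x. x \<in> S ==> F x = f x"
proof (cases "S = {}")
 case True
 have "L-lipschitz_on UNIV (%x. 0 :: real)"
  using lipschitz_on_nonneg[OF L] by (intro lipschitz_onI) auto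
 then show thesis using that True by blast
next
 case False
 have L0: "L \<ge> 0" by (rule lipschitz_on_nonneg[OF L])
 obtain y0 where y0: "y0 \<in> S" using False by blast
 define F where "F = (%x. INF y\<in>S. f y + L * dist x y)"
 have bdd: "bdd_below ((%y. f y + L * dist x y) ` S)" for x
 proof (rule bdd_belowI2)
  fix y assume y: "y \<in> S"
  have "f y0 - f y <= L * dist y0 y" using lipschitz_onD[OF L y0 y] by (simp add: dist_real_def)
  also have "... <= L * (dist x y0 + dist x y)" using L0 dist_triangle3[of y0 y x] by (intro mult_left_mono) auto
  finally show "f y0 - L * dist x y0 <= f y + L * dist x y" by (simp add: algebra_simps)
 qed
 have le: "F x <= f y + L * dist x y" if "y \<in> S" for x y
  unfolding F_def by (rule cINF_lower[OF bdd that])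
 have one: "F x <= F z + L * dist x z" for x z
 proof -
  have "F x - L * dist x z <= F z"
   unfolding F_def[of] 
  proof (rule cINF_greatest[OF False])
   fix y assume y: "y \<in> S"
   have "F x <= f y + L * dist x y" by (rule le[OF y])
   also have "L * dist x y <= L * (dist x z + dist z y)" using L0 dist_triangle[of x y z] by (intro mult_left_mono) auto
   finally show "(INF y\<in>S. f y + L * dist x y) - L * dist x z <= f y + L * dist z y" by (simp add: F_def algebra_simps)
  qed
  then show ?thesis by simp
 qed
 show thesis
 proof
  show "L-lipschitz_on UNIV F"
  proof (rule lipschitz_onI)
   fix x y show "dist (F x) (F y) <= L * dist x y"
    using one[of x y] one[of y x] by (auto simp: dist_real_def dist_commute abs_le_iff)
  qed (rule L0)
  fix x assume x: "x \<in> S"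
  have "f x <= F x"
   unfolding F_def
  proof (rule cINF_greatest[OF False])
   fix y assume y: "y \<in> S"
   show "f x <= f y + L * dist x y" using lipschitz_onD[OF L x y] by (simp add: dist_real_def abs_le_iff)
  qed
  then show "F x = f x" using le[OF x, of x] by simp
 qed
qed

text \<open>The components are extended one by one; the nearest point projection to the unit ball restores the
norm bound and does not increase the Lipschitz constant.\<close>

lemma lipschitz_extension_unit_ball:
 fixes f :: "'a::euclidean_space => 'b::euclidean_space"
 assumes L: "L-lipschitz_on S f" and f1: "!!x. x \<in> S ==> norm (f x) <= 1"
 obtains F L' where "L'-lipschitz_on UNIV F" "!!x. norm (F x) <= 1" "!!x. x \<in> S ==> F x = f x"
proof -
 have "\<exists>F. L-lipschitz_on UNIV F & (\<forall>x\<in>S. F x = f x \<bullet> b)" if "b \<in> Basis" for b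
 proof (rule lipschitz_extension_real[OF lipschitz_on_inner_Basis[OF L that]])
  fix F assume "L-lipschitz_on UNIV F" "!!x. x \<in> S ==> F x = f x \<bullet> b"
  then show ?thesis by (intro exI[of _ F]) auto
 qed
 then obtain F where F: "!!b. b \<in> Basis ==> L-lipschitz_on UNIV (F b)" "!!b x. b \<in> Basis ==> x \<in> S ==> F b x = f x \<bullet> b"
  by metis
 have L0: "L \<ge> 0" by (rule lipschitz_on_nonneg[OF L])
 define H where "H = (%x. \<Sum>b\<in>Basis. F b x *\<^sub>R (b::'b))"
 have HL: "dist (H x) (H y) <= real DIM('b) * L * dist x y" for x y
 proof -
  have "norm (H x - H y) = norm (\<Sum>b\<in>Basis. (F b x - F b y) *\<^sub>R (b::'b))"
   by (simp add: H_def sum_subtractf scaleR_diff_left)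
  also have "... <= (\<Sum>b\<in>(Basis::'b set). norm ((F b x - F b y) *\<^sub>R b))" by (rule norm_sum)
  also have "... <= (\<Sum>b\<in>(Basis::'b set). L * dist x y)"
   using lipschitz_onD[OF F(1)] by (intro sum_mono) (simp add: dist_real_def norm_Basis)
  finally show ?thesis by (simp add: dist_norm)
 qed
 let ?P = "closest_point (cball (0::'b) 1)"
 show thesis
 proof (rule that[of "real DIM('b) * L" "%x. ?P (H x)"])
  show "(real DIM('b) * L)-lipschitz_on UNIV (%x. ?P (H x))"
  proof (rule lipschitz_onI)
   fix x y
   have "dist (?P (H x)) (?P (H y)) <= dist (H x) (H y)"
    by (rule closest_point_lipschitz) auto
   then show "dist (?P (H x)) (?P (H y)) <= real DIM('b) * L * dist x y" using HL[of x y] by simp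
  qed (use L0 in simp)
  show "norm (?P (H x)) <= 1" for x
   using closest_point_in_set[of "cball (0::'b) 1" "H x"] by simp
  fix x assume x: "x \<in> S"
  have "H x = (\<Sum>b\<in>Basis. (f x \<bullet> b) *\<^sub>R b)" unfolding H_def using F(2)[OF _ x] by (intro sum.cong) auto
  then have "H x = f x" by (simp add: euclidean_representation)
  then show "?P (H x) = f x" using f1[OF x] by (simp add: closest_point_self)
 qed
qed

lemma grad_diff_segment:
 fixes f :: "'a::euclidean_space => real"
 assumes "open \<Omega>" "Ck_on 1 \<Omega> f" "closed_segment x y \<subseteq> \<Omega>" "!!z. z \<in> closed_segment x y ==> norm (grad f z) <= B"
 shows "\<bar>f x - f y\<bar> <= B * norm (x - y)"
proof -
 have "norm (f x - f y) <= B * norm (x - y)"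
 proof (rule differentiable_bound[where S="closed_segment x y" and f'="%z h. grad f z \<bullet> h"])
  fix z assume z: "z \<in> closed_segment x y"
  then have "z \<in> \<Omega>" using assms(3) by blast
  then show "(f has_derivative (%h. grad f z \<bullet> h)) (at z within closed_segment x y)"
   using Ck_on_has_derivative[of 0 \<Omega> f z] assms(1,2) by (auto intro: has_derivative_at_withinI)
  show "onorm (%h. grad f z \<bullet> h) <= B"
  proof (rule onorm_le)
   fix h
   have "norm (grad f z \<bullet> h) <= norm (grad f z) * norm h" by (simp add: Cauchy_Schwarz_ineq2)
   also have "... <= B * norm h" using assms(4)[OF z] by (intro mult_right_mono) auto
   finally show "norm (grad f z \<bullet> h) <= B * norm h" .
  qed
 qed (auto simp: convex_closed_segment)
 then show ?thesis by simp
qed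

locale overdetermined =
 fixes \<Omega> :: "'a::euclidean_space set" and u :: "'a => real" and \<nu> :: "'a => 'a" and \<beta> \<alpha> :: real
 assumes open_dom: "open \<Omega>" and dom_ne: "\<Omega> ~= {}" and \<beta>_pos: "\<beta> > 0" and \<alpha>: "0 < \<alpha>" "\<alpha> < 1"
  and normal: "x \<in> frontier \<Omega> ==> outer_unit_normal \<Omega> x (\<nu> x)"
  and regular: "C2_holder_closure \<alpha> \<Omega> u"
  and u_pos: "x \<in> \<Omega> ==> u x > 0"
  and laplace: "x \<in> \<Omega> ==> laplacian u x = - 1"
  and u_zero: "x \<in> frontier \<Omega> ==> u x = 0"
  and neumann: "x \<in> frontier \<Omega> ==> has_normal_derivative \<Omega> u (\<nu> x) (- \<beta>) x"
begin

lemma u_C2: "Ck_on 2 \<Omega> u" and u_cont: "continuous_on (closure \<Omega>) u"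
 using regular by (auto simp: C2_holder_closure_def)

lemma u_has_derivative: "x \<in> \<Omega> ==> (u has_derivative (%h. grad u x \<bullet> h)) (at x)"
 using Ck_on_has_derivative[of 1 \<Omega> u x] u_C2 open_dom by (simp add: numeral_2_eq_2)

lemma u_partial_C1: "b \<in> Basis ==> Ck_on 1 \<Omega> (partial_deriv b u)"
 using u_C2 by (simp add: numeral_2_eq_2)

lemma frontier_notin: "x \<in> frontier \<Omega> ==> x ~: \<Omega>"
 using open_dom by (simp add: frontier_def interior_open)

lemma closure_cases: "x \<in> closure \<Omega> ==> x \<in> \<Omega> \<or> x \<in> frontier \<Omega>"
 using open_dom by (auto simp: frontier_def interior_open)

lemma frontier_closure: "x \<in> frontier \<Omega> ==> x \<in> closure \<Omega>"
 by (simp add: frontier_def)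

lemma gradient_extension: "\<exists>G. continuous_on (closure \<Omega>) G & (\<forall>x\<in>\<Omega>. G x = grad u x)"
proof -
 have "\<forall>b\<in>Basis. \<exists>g. continuous_on (closure \<Omega>) g & (\<forall>x\<in>\<Omega>. g x = partial_deriv b u x)"
  using regular by (auto simp: C2_holder_closure_def extends_continuously_def)
 then obtain g where g: "!!b. b \<in> Basis ==> continuous_on (closure \<Omega>) (g b) & (\<forall>x\<in>\<Omega>. g b x = partial_deriv b u x)"
  by metis
 have "continuous_on (closure \<Omega>) (%x. \<Sum>b\<in>Basis. g b x *\<^sub>R b)"
  using g by (intro continuous_intros) auto
 moreover have "\<forall>x\<in>\<Omega>. (\<Sum>b\<in>Basis. g b x *\<^sub>R b) = grad u x"
  using g by (auto simp: grad_def intro!: sum.cong)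
 ultimately show ?thesis by blast
qed

definition G :: "'a => 'a" where
 "G = (SOME G. continuous_on (closure \<Omega>) G & (\<forall>x\<in>\<Omega>. G x = grad u x))"

lemma G_cont: "continuous_on (closure \<Omega>) G" and G_eq: "x \<in> \<Omega> ==> G x = grad u x"
 using someI_ex[OF gradient_extension] unfolding G_def[symmetric] by auto

lemma defining_function:
 assumes x: "x \<in> frontier \<Omega>"
 obtains U g where "open U" "x \<in> U" "Ck_on 1 U g" "grad g x ~= 0" "!!y. y \<in> U ==> y \<in> \<Omega> \<longleftrightarrow> g y < 0"
  "\<nu> x = grad g x /\<^sub>R norm (grad g x)" "g x = 0"
proof -
 from normal[OF x] obtain U g where g: "open U" "x \<in> U" "Ck_on 1 U g" "\<forall>y\<in>U. grad g y ~= 0"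
  "\<Omega> \<inter> U = {y\<in>U. g y < 0}" "\<nu> x = grad g x /\<^sub>R norm (grad g x)"
  unfolding outer_unit_normal_def by blast
 have iff: "y \<in> \<Omega> \<longleftrightarrow> g y < 0" if "y \<in> U" for y using g(5) that by blast
 have "g x <= 0"
 proof (rule ccontr)
  assume "\<not> g x <= 0"
  moreover have "continuous_on U g" by (rule Ck_on_continuous[OF g(3)])
  ultimately have op: "open {y\<in>U. g y > 0}" "x \<in> {y\<in>U. g y > 0}"
   using g(1,2) open_superlevel[OF g(1), of g 0] by auto
  then have "{y\<in>U. g y > 0} \<inter> \<Omega> ~= {}"
   using frontier_closure[OF x] open_Int_closure_eq_empty[OF op(1), of \<Omega>] by blast
  then show False using iff by auto
 qed
 then have "g x = 0" using iff[OF g(2)] frontier_notin[OF x] by simp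
 then show thesis using that g iff by blast
qed

lemma norm_\<nu>: "x \<in> frontier \<Omega> ==> norm (\<nu> x) = 1"
 using defining_function[of x] by (metis norm_inverse norm_scaleR abs_norm_cancel left_inverse norm_eq_zero abs_inverse)

text \<open>A direction along which the defining function decreases enters the domain.\<close>

lemma along_direction:
 assumes g: "Ck_on 1 U g" "open U" "x \<in> U" "g x = 0" and e: "grad g x \<bullet> e < 0"
 obtains s0 where "s0 > 0" "!!s. 0 < s ==> s < s0 ==> x + s *\<^sub>R e \<in> U & g (x + s *\<^sub>R e) < 0"
proof -
 have "(g has_derivative (%h. grad g x \<bullet> h)) (at (x + 0 *\<^sub>R e))"
  using Ck_on_has_derivative[of 0 U g x] g by auto
 from has_derivative_direction[OF this]
 have "((%s. g (x + s *\<^sub>R e)) has_real_derivative (grad g x \<bullet> e)) (at 0)" .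
 from DERIV_neg_dec_right[OF this e] obtain d where d: "d > 0" "!!h. 0 < h ==> h < d ==> g (x + h *\<^sub>R e) < 0"
  using g(4) by auto
 have "open ((%s. x + s *\<^sub>R e) -` U)" by (intro open_vimage g(2) continuous_intros)
 moreover have "0 \<in> (%s. x + s *\<^sub>R e) -` U" using g(3) by simp
 ultimately obtain d' where d': "d' > 0" "ball 0 d' \<subseteq> (%s. x + s *\<^sub>R e) -` U"
  using open_contains_ball by blast
 have "x + s *\<^sub>R e \<in> U & g (x + s *\<^sub>R e) < 0" if "0 < s" "s < min d d'" for s
 proof -
  have "s \<in> ball 0 d'" using that by simp
  then have "s \<in> (%s. x + s *\<^sub>R e) -` U" using d'(2) by blast
  then show ?thesis using d(2)[of s] that by auto
 qed
 then show thesis using that[of "min d d'"] d(1) d'(1) by auto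
qed

lemma exterior: 
 assumes x: "x \<in> frontier \<Omega>"
 shows "x \<in> closure (- closure \<Omega>)"
proof -
 obtain U g where g: "open U" "x \<in> U" "Ck_on 1 U g" "grad g x ~= 0" "!!y. y \<in> U ==> y \<in> \<Omega> \<longleftrightarrow> g y < 0" "g x = 0"
  using defining_function[OF x] by metis
 have mC: "Ck_on 1 U (%y. (-1) * g y)" by (intro Ck_on_cmult g)
 have gm: "grad (%y. (-1) * g y) x = - grad g x"
 proof (rule grad_eqI)
  show "((%y. (-1) * g y) has_derivative (%h. - grad g x \<bullet> h)) (at x)"
   using Ck_on_has_derivative[of 0 U g x] g by (auto intro!: derivative_eq_intros)
 qed
 have pos: "grad (%y. (-1) * g y) x \<bullet> grad g x < 0" using g(4) unfolding gm by simp
 obtain s0 where s0: "s0 > 0" "!!s. 0 < s ==> s < s0 ==> x + s *\<^sub>R grad g x \<in> U & (-1) * g (x + s *\<^sub>R grad g x) < 0"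
  using along_direction[OF mC g(1,2) _ pos] g(6) by auto
 have cg: "continuous_on U g" by (rule Ck_on_continuous[OF g(3)])
 have out: "x + s *\<^sub>R grad g x \<in> - closure \<Omega>" if "0 < s" "s < s0" for s
 proof -
  have op: "open {y\<in>U. g y > 0}" by (rule open_superlevel[OF g(1) cg])
  have "{y\<in>U. g y > 0} \<inter> \<Omega> = {}" using g(5) by auto
  then have "{y\<in>U. g y > 0} \<inter> closure \<Omega> = {}" using open_Int_closure_eq_empty[OF op] by simp
  moreover have "x + s *\<^sub>R grad g x \<in> {y\<in>U. g y > 0}" using s0(2)[OF that] by auto
  ultimately show ?thesis by blast
 qed
 have "((%s. x + s *\<^sub>R grad g x) \<longlongrightarrow> x + 0 *\<^sub>R grad g x) (at_right 0)" by (intro tendsto_intros)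
 moreover have "eventually (%s. x + s *\<^sub>R grad g x \<in> closure (- closure \<Omega>)) (at_right 0)"
  using eventually_at_right_real[OF s0(1)]
 proof eventually_elim
  case (elim s)
  then have "x + s *\<^sub>R grad g x \<in> - closure \<Omega>" by (intro out) auto
  then show ?case by (rule subsetD[OF closure_subset])
 qed
 ultimately show ?thesis using Lim_in_closed_set[of "closure (- closure \<Omega>)" "%s. x + s *\<^sub>R grad g x" "at_right (0::real)"] by auto
qed

text \<open>Otherwise \<open>u\<close> would decrease from its boundary value zero along a segment inside \<open>\<Omega>\<close>.\<close>

lemma G_inward:
 assumes x: "x \<in> frontier \<Omega>" and e: "\<nu> x \<bullet> e < 0"
 shows "G x \<bullet> e \<ge> 0"
proof (rule ccontr)
 assume neg: "\<not> G x \<bullet> e \<ge> 0"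
 obtain U g where g: "open U" "x \<in> U" "Ck_on 1 U g" "grad g x ~= 0" "!!y. y \<in> U ==> y \<in> \<Omega> \<longleftrightarrow> g y < 0"
   "\<nu> x = grad g x /\<^sub>R norm (grad g x)" "g x = 0"
  using defining_function[OF x] by metis
 have "grad g x \<bullet> e < 0" using e g(4) by (simp add: g(6) mult_less_0_iff field_simps)
 then obtain s0 where s0: "s0 > 0" "!!s. 0 < s ==> s < s0 ==> x + s *\<^sub>R e \<in> U & g (x + s *\<^sub>R e) < 0"
  using along_direction[OF g(3,1,2,7)] by metis
 have inO: "x + s *\<^sub>R e \<in> \<Omega>" if "0 < s" "s < s0" for s using s0(2)[OF that] g(5) by blast
 have inC: "x + s *\<^sub>R e \<in> closure \<Omega>" if "0 <= s" "s < s0" for s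
  using inO[of s] that frontier_closure[OF x] closure_subset by (cases "s = 0") auto
 define q where "q = (%s. G (x + s *\<^sub>R e) \<bullet> e)"
 have cG: "continuous_on {0..<s0} q"
  unfolding q_def using inC by (intro continuous_intros continuous_on_compose2[OF G_cont]) auto
 have q0: "q 0 < 0" using neg by (simp add: q_def)
 have z0: "(0::real) \<in> {0..<s0}" using s0(1) by simp
 obtain d where d: "d > 0" "!!s. s \<in> {0..<s0} ==> dist s 0 < d ==> dist (q s) (q 0) < - q 0"
  using cG[unfolded continuous_on_iff] z0 q0 by (metis neg_0_less_iff_less)
 define s where "s = min s0 d / 2"
 have s: "0 < s" "s < s0" "s < d" using s0 d by (auto simp: s_def)
 obtain z where z: "0 < z" "z < s" "u (x + s *\<^sub>R e) - u (x + 0 *\<^sub>R e) = q z * (s - 0)"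
 proof (rule mvt[OF s(1), of "%s. u (x + s *\<^sub>R e)" "%z. (*) (q z)"])
  show "continuous_on {0..s} (%s. u (x + s *\<^sub>R e))"
   using inC s by (intro continuous_on_compose2[OF u_cont] continuous_intros) auto
  fix z assume z: "0 < z" "z < s"
  have O: "x + z *\<^sub>R e \<in> \<Omega>" using inO z s by simp
  have "((%s. u (x + s *\<^sub>R e)) has_real_derivative (grad u (x + z *\<^sub>R e) \<bullet> e)) (at z)"
   by (rule has_derivative_direction[OF u_has_derivative[OF O]])
  then show "((%s. u (x + s *\<^sub>R e)) has_derivative (*) (q z)) (at z)"
   by (simp add: q_def G_eq[OF O] has_field_derivative_def)
 qed (use that in auto)
 have "dist (q z) (q 0) < - q 0" using z s by (intro d(2)) auto
 then have "q z < 0" by (simp add: dist_real_def abs_less_iff)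
 then have "u (x + s *\<^sub>R e) < 0" using z(3) u_zero[OF x] s by (simp add: mult_neg_pos)
 then show False using u_pos[OF inO[OF s(1,2)]] by simp
qed

text \<open>Along all inward directions the derivative is nonnegative, so the gradient is a multiple of the normal;
the Neumann condition gives the factor.\<close>

lemma G_frontier:
 assumes x: "x \<in> frontier \<Omega>"
 shows "G x = - \<beta> *\<^sub>R \<nu> x"
proof -
 have xl: "x islimpt \<Omega>" using x frontier_notin[OF x] by (auto simp: frontier_def closure_def)
 have nt: "at x within \<Omega> ~= bot" using xl by (simp add: trivial_limit_within)
 have "(G \<longlongrightarrow> G x) (at x within closure \<Omega>)" using G_cont frontier_closure[OF x] by (simp add: continuous_on_def)
 then have "(G \<longlongrightarrow> G x) (at x within \<Omega>)" by (rule tendsto_within_subset) (rule closure_subset)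
 then have "((%y. G y \<bullet> \<nu> x) \<longlongrightarrow> G x \<bullet> \<nu> x) (at x within \<Omega>)" by (intro tendsto_intros)
 moreover have "((%y. G y \<bullet> \<nu> x) \<longlongrightarrow> - \<beta>) (at x within \<Omega>)"
 proof (rule Lim_transform_eventually)
  show "((%y. grad u y \<bullet> \<nu> x) \<longlongrightarrow> - \<beta>) (at x within \<Omega>)"
   using neumann[OF x] by (simp add: has_normal_derivative_def)
  show "\<forall>\<^sub>F y in at x within \<Omega>. grad u y \<bullet> \<nu> x = G y \<bullet> \<nu> x"
   by (auto simp: eventually_at_filter G_eq)
 qed
 ultimately have Gn: "G x \<bullet> \<nu> x = - \<beta>" using tendsto_unique[OF nt] by blast
 have n1: "\<nu> x \<bullet> \<nu> x = 1" using norm_\<nu>[OF x] by (simp add: dot_square_norm)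
 define w where "w = G x + \<beta> *\<^sub>R \<nu> x"
 have wn: "w \<bullet> \<nu> x = 0" by (simp add: w_def inner_add_left Gn n1)
 have Gw: "G x = w - \<beta> *\<^sub>R \<nu> x" by (simp add: w_def)
 have "w \<bullet> w <= \<beta> * \<delta>" if "\<delta> > 0" for \<delta>
 proof -
  have "\<nu> x \<bullet> (- w - \<delta> *\<^sub>R \<nu> x) < 0" using wn n1 that by (simp add: inner_diff_right inner_commute)
  from G_inward[OF x this] show ?thesis
   using wn n1 unfolding Gw by (simp add: inner_diff_right inner_diff_left inner_commute algebra_simps)
 qed
 from this[of "e / \<beta>" for e] have "w \<bullet> w <= 0 + e" if "e > 0" for e using that \<beta>_pos by (simp add: field_simps)
 then have "w \<bullet> w <= 0" by (rule field_le_epsilon)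
 then have "w = 0" by (metis inner_eq_zero_iff inner_ge_zero order_antisym)
 then show ?thesis using Gw by simp
qed

lemma norm_G_frontier: "x \<in> frontier \<Omega> ==> norm (G x) = \<beta>"
 using G_frontier[of x] norm_\<nu>[of x] \<beta>_pos by simp

text \<open>A uniformly Hoelder continuous function grows at most like a power below one of the distance.\<close>

lemma second_derivative_growth:
 "\<exists>A>0. \<forall>b\<in>Basis. \<forall>x\<in>\<Omega>. norm (grad (partial_deriv b u) x) <= A * (1 + norm x)"
proof -
 obtain x1 where x1: "x1 \<in> \<Omega>" using dom_ne by blast
 have one: "\<exists>A\<ge>0. \<forall>x\<in>\<Omega>. \<bar>partial_deriv c (partial_deriv b u) x\<bar> <= A * (1 + norm x)"
  if bc: "b \<in> Basis" "c \<in> Basis" for b c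
 proof -
  let ?D = "partial_deriv c (partial_deriv b u)"
  obtain C where C: "!!x y. x \<in> \<Omega> ==> y \<in> \<Omega> ==> \<bar>?D x - ?D y\<bar> <= C * dist x y powr \<alpha>"
   using regular bc unfolding C2_holder_closure_def holder_on_def by blast
  define A where "A = \<bar>?D x1\<bar> + \<bar>C\<bar> * (1 + norm x1)"
  have "\<bar>?D x\<bar> <= A * (1 + norm x)" if x: "x \<in> \<Omega>" for x
  proof -
   have p: "dist x x1 powr \<alpha> <= 1 + dist x x1"
   proof (cases "dist x x1 <= 1")
    case True
    have "dist x x1 powr \<alpha> <= 1" using True \<alpha> by (intro powr_le1) auto
    then show ?thesis using zero_le_dist[of x x1] by linarith
   next
    case False
    have "dist x x1 powr \<alpha> <= dist x x1 powr 1" using False \<alpha> by (intro powr_mono) auto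
    then show ?thesis by simp
   qed
   have "\<bar>?D x\<bar> <= \<bar>?D x1\<bar> + C * dist x x1 powr \<alpha>" using C[OF x x1] by linarith
   also have "C * dist x x1 powr \<alpha> <= \<bar>C\<bar> * (1 + dist x x1)" using p by (intro mult_mono) auto
   also have "\<bar>C\<bar> * (1 + dist x x1) <= \<bar>C\<bar> * ((1 + norm x1) * (1 + norm x))"
   proof (rule mult_left_mono)
    have "dist x x1 <= norm x + norm x1" by (simp add: dist_norm norm_triangle_ineq4)
    moreover have "0 <= norm x1 * norm x" by simp
    moreover have "(1 + norm x1) * (1 + norm x) = 1 + norm x1 + norm x + norm x1 * norm x" by (simp add: algebra_simps)
    ultimately show "1 + dist x x1 <= (1 + norm x1) * (1 + norm x)" by linarith
   qed simp
   also have "\<bar>?D x1\<bar> <= \<bar>?D x1\<bar> * (1 + norm x)" by (simp add: mult_le_cancel_left1)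
   finally show ?thesis by (simp add: A_def algebra_simps)
  qed
  moreover have "A \<ge> 0" by (simp add: A_def)
  ultimately show ?thesis by blast
 qed
 then obtain A where A: "!!b c. b \<in> Basis ==> c \<in> Basis ==> A b c \<ge> 0"
  "!!b c x. b \<in> Basis ==> c \<in> Basis ==> x \<in> \<Omega> ==> \<bar>partial_deriv c (partial_deriv b u) x\<bar> <= A b c * (1 + norm x)"
  by metis
 define S where "S = (\<Sum>b\<in>(Basis::'a set). \<Sum>c\<in>(Basis::'a set). A b c)"
 have "norm (grad (partial_deriv b u) x) <= (S + 1) * (1 + norm x)" if b: "b \<in> Basis" and x: "x \<in> \<Omega>" for b x
 proof -
  have "norm (grad (partial_deriv b u) x) <= (\<Sum>c\<in>Basis. \<bar>grad (partial_deriv b u) x \<bullet> c\<bar>)" by (rule norm_le_l1)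
  also have "... <= (\<Sum>c\<in>Basis. A b c * (1 + norm x))"
   using A(2)[OF b _ x] by (intro sum_mono) (simp add: grad_inner_Basis)
  also have "... = (\<Sum>c\<in>Basis. A b c) * (1 + norm x)" by (simp add: sum_distrib_right)
  also have "... <= S * (1 + norm x)"
  proof (rule mult_right_mono)
   show "(\<Sum>c\<in>Basis. A b c) <= S" unfolding S_def
    using b A(1) by (intro member_le_sum sum_nonneg) auto
  qed simp
  also have "... <= (S + 1) * (1 + norm x)" by (intro mult_right_mono) auto
  finally show ?thesis .
 qed
 moreover have "S \<ge> 0" unfolding S_def using A(1) by (intro sum_nonneg) auto
 ultimately show ?thesis by (intro exI[of _ "S + 1"]) auto
qed

text \<open>The gradient of the defining function is nearly constant near \<open>p\<close>, so moving in a cone about the inner normal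
decreases the function.\<close>

lemma frontier_cone:
 assumes p: "p \<in> frontier \<Omega>"
 obtains r where "r > 0" "!!x s h. x \<in> \<Omega> ==> 0 <= s ==> norm h <= s / 2 ==> dist x p + s + norm h < r ==> x - s *\<^sub>R \<nu> p + h \<in> \<Omega>"
proof -
 obtain U g where g: "open U" "p \<in> U" "Ck_on 1 U g" "grad g p ~= 0" "!!y. y \<in> U ==> y \<in> \<Omega> \<longleftrightarrow> g y < 0"
   "\<nu> p = grad g p /\<^sub>R norm (grad g p)" "g p = 0"
  using defining_function[OF p] by metis
 define \<gamma> where "\<gamma> = norm (grad g p)"
 have \<gamma>: "\<gamma> > 0" using g(4) by (simp add: \<gamma>_def)
 have "continuous_on U (grad g)" unfolding grad_def[abs_def] using g(3) by (intro continuous_intros) auto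
 then have "isCont (grad g) p" using g(1,2) continuous_on_eq_continuous_at by blast
 then obtain d where d: "d > 0" "!!y. dist y p < d ==> dist (grad g y) (grad g p) < \<gamma> / 4"
  unfolding continuous_at_eps_delta using \<gamma> by (metis divide_pos_pos zero_less_numeral)
 obtain d' where d': "d' > 0" "ball p d' \<subseteq> U" using g(1,2) open_contains_ball by blast
 define r where "r = min d d'"
 show thesis
 proof (rule that[of r])
  show "r > 0" using d d' by (simp add: r_def)
  fix x h :: 'a and s :: real assume x: "x \<in> \<Omega>" and s: "0 <= s" "norm h <= s / 2" "dist x p + s + norm h < r"
  let ?v = "h - s *\<^sub>R \<nu> p"
  show "x - s *\<^sub>R \<nu> p + h \<in> \<Omega>"
  proof (cases "s = 0")
   case True then show ?thesis using s x by simp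
  next
   case False
   then have sp: "s > 0" using s by simp
   have v: "norm ?v <= s + norm h" using norm_triangle_ineq4[of h "s *\<^sub>R \<nu> p"] norm_\<nu>[OF p] s by simp
   have inB: "x + t *\<^sub>R ?v \<in> ball p r" if "0 <= t" "t <= 1" for t
   proof -
    have "norm (t *\<^sub>R ?v) <= s + norm h" using that v by (simp add: mult_le_one) (metis mult_left_le_one_le norm_ge_zero order_trans)
    then show ?thesis using s(3) norm_triangle_ineq[of "x - p" "t *\<^sub>R ?v"]
     by (simp add: dist_norm norm_minus_commute algebra_simps)
   qed
   have inU: "x + t *\<^sub>R ?v \<in> U" if "0 <= t" "t <= 1" for t using inB[OF that] d'(2) by (auto simp: r_def)
   obtain z where z: "0 < z" "z < 1" "g (x + 1 *\<^sub>R ?v) - g (x + 0 *\<^sub>R ?v) = (grad g (x + z *\<^sub>R ?v) \<bullet> ?v) * (1 - 0)"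
   proof (rule mvt[OF zero_less_one, of "%t. g (x + t *\<^sub>R ?v)" "%z. (*) (grad g (x + z *\<^sub>R ?v) \<bullet> ?v)"])
    have cg: "continuous_on U g" by (rule Ck_on_continuous[OF g(3)])
    have "continuous_on {0..1::real} (%t. x + t *\<^sub>R ?v)" by (intro continuous_intros)
    then show "continuous_on {0..1} (%t. g (x + t *\<^sub>R ?v))"
     by (rule continuous_on_compose2[OF cg]) (use inU in auto)
    fix z :: real assume z: "0 < z" "z < 1"
    have "(g has_derivative (%h. grad g (x + z *\<^sub>R ?v) \<bullet> h)) (at (x + z *\<^sub>R ?v))"
     using Ck_on_has_derivative[of 0 U g] g(1,3) inU z by auto
    from has_derivative_direction[OF this]
    show "((%t. g (x + t *\<^sub>R ?v)) has_derivative (*) (grad g (x + z *\<^sub>R ?v) \<bullet> ?v)) (at z)"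
     by (simp add: has_field_derivative_def)
   qed (use that in auto)
   have "dist (grad g (x + z *\<^sub>R ?v)) (grad g p) < \<gamma> / 4"
    using inB[of z] z by (intro d(2)) (simp add: r_def dist_commute)
   then have "(grad g (x + z *\<^sub>R ?v) - grad g p) \<bullet> ?v <= (\<gamma> / 4) * (s + norm h)"
    using norm_cauchy_schwarz[of "grad g (x + z *\<^sub>R ?v) - grad g p" ?v] v \<gamma>
    by (smt (verit, best) dist_norm mult_mono norm_ge_zero)
   moreover have "grad g p \<bullet> ?v <= \<gamma> * norm h - s * \<gamma>"
   proof -
    have "grad g p \<bullet> \<nu> p = \<gamma>" using g(4) by (simp add: g(6) \<gamma>_def power2_norm_eq_inner[symmetric] power2_eq_square field_simps)
    then show ?thesis using norm_cauchy_schwarz[of "grad g p" h] by (simp add: inner_diff_right \<gamma>_def)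
   qed
   ultimately have "grad g (x + z *\<^sub>R ?v) \<bullet> ?v <= \<gamma> * ((5/4) * norm h - (3/4) * s)"
    by (simp add: inner_diff_left algebra_simps)
   also have "... < 0" using \<gamma> s sp by (simp add: mult_less_0_iff)
   finally have "g (x + ?v) < g x" using z(3) by simp
   also have "g x < 0" using x inU[of 0] g(5)[of x] by simp
   finally have "x + ?v \<in> \<Omega>" using g(5) inU[of 1] by simp
   then show ?thesis by (simp add: algebra_simps)
  qed
 qed
qed

text \<open>Two points near the boundary are joined inside \<open>\<Omega>\<close> by moving both a distance \<open>2 |x - y|\<close> along the inner
normal at \<open>p\<close> and then across; along this path the second derivatives are bounded.\<close>

lemma partial_locally_lipschitz:
 assumes p: "p \<in> closure \<Omega>" and b: "b \<in> Basis"
 shows "\<exists>r>0. \<exists>L\<ge>0. \<forall>x\<in>\<Omega> \<inter> ball p r. \<forall>y\<in>\<Omega> \<inter> ball p r. \<bar>partial_deriv b u x - partial_deriv b u y\<bar> <= L * norm (x - y)"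
proof -
 obtain A where A: "A > 0" "!!b x. b \<in> Basis ==> x \<in> \<Omega> ==> norm (grad (partial_deriv b u) x) <= A * (1 + norm x)"
  using second_derivative_growth by blast
 have seg: "\<bar>partial_deriv b u x - partial_deriv b u y\<bar> <= (A * (1 + (norm p + R))) * norm (x - y)"
  if "closed_segment x y \<subseteq> \<Omega> \<inter> ball p R" for x y R
 proof (rule grad_diff_segment[OF open_dom u_partial_C1[OF b]])
  show "closed_segment x y \<subseteq> \<Omega>" using that by blast
  fix z assume "z \<in> closed_segment x y"
  then have z: "z \<in> \<Omega>" "z \<in> ball p R" using that by auto
  have "norm z <= norm p + R" using z(2) norm_triangle_ineq[of p "z - p"] by (simp add: dist_norm norm_minus_commute)
  then have "A * (1 + norm z) <= A * (1 + (norm p + R))" using A(1) by (intro mult_left_mono) auto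
  then show "norm (grad (partial_deriv b u) z) <= A * (1 + (norm p + R))" using A(2)[OF b z(1)] by linarith
 qed
 from closure_cases[OF p] show ?thesis
 proof
  assume "p \<in> \<Omega>"
  then obtain r where r: "r > 0" "ball p r \<subseteq> \<Omega>" using open_dom open_contains_ball by blast
  have "\<bar>partial_deriv b u x - partial_deriv b u y\<bar> <= (A * (1 + (norm p + r))) * norm (x - y)"
   if "x \<in> \<Omega> \<inter> ball p r" "y \<in> \<Omega> \<inter> ball p r" for x y
   using that r closed_segment_subset[of x "ball p r" y] by (intro seg) auto
  moreover have "0 <= A * (1 + (norm p + r))" using A(1) r(1) by simp
  ultimately show ?thesis using r(1) by blast
 next
  assume pf: "p \<in> frontier \<Omega>"
  obtain r where r: "r > 0" "!!x s h. x \<in> \<Omega> ==> 0 <= s ==> norm h <= s / 2 ==> dist x p + s + norm h < r ==> x - s *\<^sub>R \<nu> p + h \<in> \<Omega>"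
   using frontier_cone[OF pf] by metis
  define L where "L = A * (1 + (norm p + r))"
  have L: "L \<ge> 0" using A(1) r(1) by (simp add: L_def)
  have n1: "norm (\<nu> p) = 1" by (rule norm_\<nu>[OF pf])
  have vert: "\<bar>partial_deriv b u x - partial_deriv b u (x - s *\<^sub>R \<nu> p)\<bar> <= L * s"
   if x: "x \<in> \<Omega>" "dist x p + s < r" "0 <= s" for x s
  proof -
   have "closed_segment x (x - s *\<^sub>R \<nu> p) \<subseteq> \<Omega> \<inter> ball p r"
   proof
    fix y assume "y \<in> closed_segment x (x - s *\<^sub>R \<nu> p)"
    then obtain t where t: "0 <= t" "t <= 1" "y = (1 - t) *\<^sub>R x + t *\<^sub>R (x - s *\<^sub>R \<nu> p)" by (auto simp: closed_segment_def)
    have y: "y = x - (t * s) *\<^sub>R \<nu> p + 0" using t(3) by (simp add: algebra_simps)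
    have ts: "0 <= t * s" "t * s <= s" using t x(3) by (auto intro: mult_left_le_one_le)
    have "y \<in> \<Omega>" unfolding y using x(1,2) ts by (intro r(2)) auto
    moreover have "dist y p <= dist x p + t * s"
     using norm_triangle_ineq4[of "x - p" "(t * s) *\<^sub>R \<nu> p"] n1 ts(1) by (simp add: y dist_norm algebra_simps)
    ultimately show "y \<in> \<Omega> \<inter> ball p r" using x(2) ts by (simp add: dist_commute)
   qed
   from seg[OF this] show ?thesis using n1 x(3) by (simp add: L_def)
  qed
  have "\<bar>partial_deriv b u x - partial_deriv b u y\<bar> <= (5 * L) * norm (x - y)"
   if xy: "x \<in> \<Omega> \<inter> ball p (r / 8)" "y \<in> \<Omega> \<inter> ball p (r / 8)" for x y
  proof -
   define s where "s = 2 * norm (x - y)"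
   have nxy: "norm (x - y) < r / 4"
    using xy norm_triangle_ineq4[of "x - p" "y - p"] by (simp add: dist_norm norm_minus_commute)
   have s: "0 <= s" "s < r / 2" using nxy by (auto simp: s_def)
   have dx: "dist x p < r / 8" "dist y p < r / 8" using xy by (auto simp: dist_commute)
   have 1: "\<bar>partial_deriv b u x - partial_deriv b u (x - s *\<^sub>R \<nu> p)\<bar> <= L * s"
    using xy dx s r(1) by (intro vert) auto
   have 2: "\<bar>partial_deriv b u y - partial_deriv b u (y - s *\<^sub>R \<nu> p)\<bar> <= L * s"
    using xy dx s r(1) by (intro vert) auto
   have "closed_segment (x - s *\<^sub>R \<nu> p) (y - s *\<^sub>R \<nu> p) \<subseteq> \<Omega> \<inter> ball p r"
   proof
    fix z assume "z \<in> closed_segment (x - s *\<^sub>R \<nu> p) (y - s *\<^sub>R \<nu> p)"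
    then obtain t where t: "0 <= t" "t <= 1" "z = (1 - t) *\<^sub>R (x - s *\<^sub>R \<nu> p) + t *\<^sub>R (y - s *\<^sub>R \<nu> p)"
     by (auto simp: closed_segment_def)
    have z: "z = x - s *\<^sub>R \<nu> p + t *\<^sub>R (y - x)" using t(3) by (simp add: algebra_simps)
    have th: "norm (t *\<^sub>R (y - x)) <= norm (x - y)" using t by (simp add: norm_minus_commute mult_left_le_one_le)
    have "z \<in> \<Omega>" unfolding z using xy dx s th nxy r(1) by (intro r(2)) (auto simp: s_def)
    moreover have "norm (z - p) <= norm (x - p) + norm (s *\<^sub>R \<nu> p) + norm (t *\<^sub>R (y - x))"
     using norm_triangle_ineq4[of "x - p" "s *\<^sub>R \<nu> p"] norm_triangle_ineq[of "x - p - s *\<^sub>R \<nu> p" "t *\<^sub>R (y - x)"]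
     by (simp add: z algebra_simps)
    ultimately show "z \<in> \<Omega> \<inter> ball p r" using dx s th nxy n1 r(1) by (simp add: dist_norm norm_minus_commute)
   qed
   from seg[OF this] have 3: "\<bar>partial_deriv b u (x - s *\<^sub>R \<nu> p) - partial_deriv b u (y - s *\<^sub>R \<nu> p)\<bar> <= L * norm (x - y)"
    by (simp add: L_def)
   have "\<bar>partial_deriv b u x - partial_deriv b u y\<bar> <= L * s + L * norm (x - y) + L * s" using 1 2 3 by linarith
   then show ?thesis by (simp add: s_def algebra_simps)
  qed
  moreover have "0 <= 5 * L" "r / 8 > 0" using L r(1) by auto
  ultimately show ?thesis by blast
 qed
qed

text \<open>Local Lipschitz constants on a finite cover serve for near points, and the global bound for distant ones.\<close>

lemma partial_lipschitz_bounded: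
 assumes b: "b \<in> Basis" and bd: "!!x. x \<in> \<Omega> ==> \<bar>partial_deriv b u x\<bar> <= C"
 shows "\<exists>L\<ge>0. \<forall>x\<in>\<Omega> \<inter> cball 0 T. \<forall>y\<in>\<Omega> \<inter> cball 0 T. \<bar>partial_deriv b u x - partial_deriv b u y\<bar> <= L * norm (x - y)"
proof -
 let ?K = "closure \<Omega> \<inter> cball 0 T"
 have K: "compact ?K" by (simp add: closed_Int_compact)
 let ?Q = "%p r L. r > 0 & L \<ge> 0 & (\<forall>x\<in>\<Omega> \<inter> ball p r. \<forall>y\<in>\<Omega> \<inter> ball p r.
   \<bar>partial_deriv b u x - partial_deriv b u y\<bar> <= L * norm (x - y))"
 have "\<exists>r L. ?Q p r L" if "p \<in> closure \<Omega>" for p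
  using partial_locally_lipschitz[OF that b] by auto
 then have "\<forall>p\<in>closure \<Omega>. \<exists>c. ?Q p (fst c) (snd c)" by auto
 from bchoice[OF this] obtain c where c: "\<forall>p\<in>closure \<Omega>. ?Q p (fst (c p)) (snd (c p))" by (rule exE)
 define r where "r = (%p. fst (c p))"
 define L where "L = (%p. snd (c p))"
 have rL: "r p > 0" "L p \<ge> 0" "!!x y. x \<in> \<Omega> \<inter> ball p (r p) ==> y \<in> \<Omega> \<inter> ball p (r p) ==>
    \<bar>partial_deriv b u x - partial_deriv b u y\<bar> <= L p * norm (x - y)" if "p \<in> closure \<Omega>" for p
  using bspec[OF c that] by (simp_all add: r_def L_def)
 have cov: "?K \<subseteq> (\<Union>p\<in>?K. ball p (r p / 2))"
 proof
  fix x assume x: "x \<in> ?K"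
  then have "x \<in> ball x (r x / 2)" using rL(1)[of x] by simp
  then show "x \<in> (\<Union>p\<in>?K. ball p (r p / 2))" using x by (rule UN_I[rotated])
 qed
 obtain F where F: "F \<subseteq> ?K" "finite F" "?K \<subseteq> (\<Union>p\<in>F. ball p (r p / 2))"
  by (rule compactE_image[OF K open_ball cov])
 define \<delta> where "\<delta> = Min (insert 1 ((%p. r p / 2) ` F))"
 have \<delta>: "\<delta> > 0" unfolding \<delta>_def using F rL(1) by (subst Min_gr_iff) auto
 have C0: "C \<ge> 0" using bd dom_ne by (metis abs_ge_zero all_not_in_conv order_trans)
 define M where "M = (\<Sum>p\<in>F. L p) + 2 * C / \<delta>"
 have Lp: "L p <= (\<Sum>p\<in>F. L p)" if "p \<in> F" for p using that F rL(2) by (intro member_le_sum) auto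
 have S0: "0 <= (\<Sum>p\<in>F. L p)" using F rL(2) by (intro sum_nonneg) auto
 have "\<bar>partial_deriv b u x - partial_deriv b u y\<bar> <= M * norm (x - y)"
  if xy: "x \<in> \<Omega> \<inter> cball 0 T" "y \<in> \<Omega> \<inter> cball 0 T" for x y
 proof (cases "norm (x - y) < \<delta>")
  case True
  have "x \<in> ?K" using xy closure_subset by auto
  then obtain p where p: "p \<in> F" "x \<in> ball p (r p / 2)" using F(3) by blast
  have pc: "p \<in> closure \<Omega>" using p F by auto
  have "\<delta> <= r p / 2" unfolding \<delta>_def using p F by (intro Min_le) auto
  then have "y \<in> ball p (r p)" using True p(2) dist_triangle[of p y x] by (simp add: dist_norm)
  moreover have "x \<in> ball p (r p)" using p(2) rL(1)[OF pc] by auto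
  ultimately have "\<bar>partial_deriv b u x - partial_deriv b u y\<bar> <= L p * norm (x - y)"
   using rL(3)[OF pc] xy by auto
  also have "... <= M * norm (x - y)" unfolding M_def using Lp[OF p(1)] C0 \<delta> by (intro mult_right_mono) (auto intro: add_increasing2)
  finally show ?thesis .
 next
  case False
  have "\<bar>partial_deriv b u x - partial_deriv b u y\<bar> <= 2 * C" using bd[of x] bd[of y] xy by auto
  also have "... <= 2 * C / \<delta> * norm (x - y)"
  proof -
   have "2 * C / \<delta> * \<delta> <= 2 * C / \<delta> * norm (x - y)" using False C0 \<delta> by (intro mult_left_mono) auto
   then show ?thesis using \<delta> by simp
  qed
  also have "... <= M * norm (x - y)" unfolding M_def using S0 by (intro mult_right_mono) auto
  finally show ?thesis .
 qed
 moreover have "M \<ge> 0" unfolding M_def using S0 C0 \<delta> by simp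
 ultimately show ?thesis by blast
qed

end

section \<open>The overdetermined problem in a cylinder\<close>

lemma sum_Basis_prod:
 fixes f :: "'a::euclidean_space \<times> 'b::euclidean_space => real"
 shows "(\<Sum>b\<in>Basis. f b) = (\<Sum>i\<in>Basis. f (i, 0)) + (\<Sum>j\<in>Basis. f (0, j))"
proof -
 have "inj_on (%u. (u::'a, 0::'b)) Basis" "inj_on (%u. (0::'a, u::'b)) Basis"
  by (auto intro!: inj_onI Pair_inject)
 then show ?thesis
  unfolding Basis_prod_def
  by (subst sum.union_disjoint) (auto simp: Basis_prod_def sum.reindex)
qed

text \<open>Positive on the cylinder, growing quadratically along it, and superharmonic for large \<open>M\<close>.\<close>

definition barrier :: "real => real => 'a::euclidean_space \<times> 'b::euclidean_space => real" where
 "barrier M R x = (norm (snd x))\<^sup>2 - M * (norm (fst x))\<^sup>2 + M * R\<^sup>2"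

lemma barrier_C2: "Ck_on k UNIV (barrier M R :: 'a::euclidean_space \<times> 'b::euclidean_space => real)"
proof -
 have eq: "barrier M R = (%x::'a \<times> 'b. (\<Sum>j\<in>Basis. (x \<bullet> (0, j)) * (x \<bullet> (0, j))) - M * (\<Sum>i\<in>Basis. (x \<bullet> (i, 0)) * (x \<bullet> (i, 0))) + M * R\<^sup>2)"
 proof
  fix x :: "'a \<times> 'b"
  obtain z t where x: "x = (z, t)" by force
  show "barrier M R x = (\<Sum>j\<in>Basis. (x \<bullet> (0, j)) * (x \<bullet> (0, j))) - M * (\<Sum>i\<in>Basis. (x \<bullet> (i, 0)) * (x \<bullet> (i, 0))) + M * R\<^sup>2"
   unfolding x barrier_def power2_norm_eq_inner snd_conv fst_conv
   by (subst euclidean_inner, subst (2) euclidean_inner) simp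
 qed
 show ?thesis unfolding eq
  by (intro Ck_on_add Ck_on_diff Ck_on_sum Ck_on_mult Ck_on_cmult Ck_on_inner_const Ck_on_const open_UNIV)
qed

lemma barrier_laplacian:
 "laplacian (barrier M R :: 'a::euclidean_space \<times> 'b::euclidean_space => real) x = 2 * real DIM('b) - 2 * M * real DIM('a)"
proof -
 have d: "(barrier M R has_derivative (%h. 2 * (snd x \<bullet> snd h) - 2 * M * (fst x \<bullet> fst h))) (at x)" for x :: "'a \<times> 'b"
  unfolding barrier_def[abs_def] power2_norm_eq_inner
  by (auto intro!: derivative_eq_intros simp: inner_commute algebra_simps)
 have p: "partial_deriv b (barrier M R) = (%x::'a \<times> 'b. 2 * (snd x \<bullet> snd b) - 2 * M * (fst x \<bullet> fst b))" for b
  by (rule ext, rule partial_deriv_eq[OF d])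
 have dd: "((%x::'a \<times> 'b. 2 * (snd x \<bullet> snd b) - 2 * M * (fst x \<bullet> fst b)) has_derivative
   (%h. 2 * (snd h \<bullet> snd b) - 2 * M * (fst h \<bullet> fst b))) (at x)" for b :: "'a \<times> 'b"
  by (auto intro!: derivative_eq_intros)
 have "laplacian (barrier M R) x = (\<Sum>b\<in>(Basis :: ('a \<times> 'b) set). 2 * (snd b \<bullet> snd b) - 2 * M * (fst b \<bullet> fst b))"
  unfolding laplacian_def p by (intro sum.cong refl partial_deriv_eq[OF dd])
 also have "... = 2 * real DIM('b) - 2 * M * real DIM('a)"
  unfolding sum_Basis_prod by simp
 finally show ?thesis .
qed

lemma average_cong:
 fixes w :: "'a::euclidean_space => real"
 assumes "!!y. y \<in> \<Omega> ==> w y = v y" "cball x (r * real DIM('a)) \<subseteq> \<Omega>" "r > 0"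
 shows "average w x r = average v x r"
 unfolding average_def
proof (rule Henstock_Kurzweil_Integration.integral_cong)
 fix y :: 'a assume "y \<in> cbox (- One) One"
 then have "x + r *\<^sub>R y \<in> cball x (r * real DIM('a))"
  using norm_unit_cbox[of y] assms(3) by (simp add: dist_norm)
 then show "w (x + r *\<^sub>R y) * mv_weight y = v (x + r *\<^sub>R y) * mv_weight y" using assms(1,2) by auto
qed

text \<open>The unit vector of the \<open>i\<close>-th periodic coordinate.\<close>

definition tdir :: "'m => (real^'n) \<times> (real^'m)" where "tdir i = (0, axis i 1)"

lemma tdir_Basis: "tdir i \<in> (Basis :: ((real^'n) \<times> (real^'m)) set)"
 by (auto simp: tdir_def Basis_prod_def axis_in_Basis_iff)

lemma inner_tdir: "x \<bullet> tdir i = snd x $ i"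
 by (simp add: tdir_def inner_prod_def inner_axis)

definition reflect :: "'m => real => (real^'n) \<times> (real^'m) => (real^'n) \<times> (real^'m)" where
 "reflect i c x = x + (2 * c - 2 * (x \<bullet> tdir i)) *\<^sub>R tdir i"

lemma norm_tdir: "norm (tdir i :: (real^'n) \<times> (real^'m)) = 1" using tdir_Basis norm_Basis by blast

lemma tdir_inner_self: "(tdir i :: (real^'n) \<times> (real^'m)) \<bullet> tdir i = 1"
 using tdir_Basis inner_same_Basis by blast

lemma reflect_reflect: "reflect i c (reflect i c x) = x"
 by (simp add: reflect_def inner_add_left tdir_inner_self algebra_simps)

lemma reflect_continuous: "continuous_on S (reflect i c)"
 unfolding reflect_def[abs_def] by (intro continuous_intros)

lemma partial_deriv_reflect:
 assumes f: "f differentiable (at (reflect i c x))" and b: "b \<in> Basis"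
 shows "((%x. f (reflect i c x)) has_derivative (%h. grad f (reflect i c x) \<bullet> (h - (2 * (h \<bullet> tdir i)) *\<^sub>R tdir i))) (at x)"
  and "grad f (reflect i c x) \<bullet> (b - (2 * (b \<bullet> tdir i)) *\<^sub>R tdir i) = (if b = tdir i then - 1 else 1) * partial_deriv b f (reflect i c x)"
proof -
 have r: "(reflect i c has_derivative (%h. h - (2 * (h \<bullet> tdir i)) *\<^sub>R tdir i)) (at x)"
  unfolding reflect_def[abs_def] by (auto intro!: derivative_eq_intros simp: algebra_simps)
 show "((%x. f (reflect i c x)) has_derivative (%h. grad f (reflect i c x) \<bullet> (h - (2 * (h \<bullet> tdir i)) *\<^sub>R tdir i))) (at x)"
  by (rule has_derivative_compose[where f="reflect i c" and g=f, OF r has_derivative_grad[OF f]])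
 show "grad f (reflect i c x) \<bullet> (b - (2 * (b \<bullet> tdir i)) *\<^sub>R tdir i) = (if b = tdir i then - 1 else 1) * partial_deriv b f (reflect i c x)"
 proof (cases "b = tdir i")
  case True
  then show ?thesis by (simp add: tdir_inner_self inner_diff_right grad_inner_Basis[OF tdir_Basis])
 next
  case False
  then have "b \<bullet> tdir i = 0" using b tdir_Basis inner_not_same_Basis by blast
  then show ?thesis using False by (simp add: grad_inner_Basis[OF b])
 qed
qed

lemma Ck_on_reflect:
 assumes "open \<Omega>" "!!x. x \<in> \<Omega> ==> reflect i c x \<in> \<Omega>" "Ck_on k \<Omega> f"
 shows "Ck_on k \<Omega> (%x. f (reflect i c x))"
 using assms(3)
proof (induction k arbitrary: f)
 case 0
 then have fc: "continuous_on \<Omega> f" by simp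
 have "continuous_on \<Omega> (%x. f (reflect i c x))"
  by (rule continuous_on_compose2[OF fc reflect_continuous]) (use assms(2) in auto)
 then show ?case by simp
next
 case (Suc k)
 have df: "f differentiable (at (reflect i c x))" if "x \<in> \<Omega>" for x
  using Suc.prems assms(1,2) that by (auto simp: differentiable_on_open)
 show ?case
 proof (rule Ck_on_SucI[OF assms(1) partial_deriv_reflect(1)[OF df tdir_Basis]])
  fix b :: "(real^'a) \<times> (real^'b)" assume b: "b \<in> Basis"
  have "Ck_on k \<Omega> (%x. (if b = tdir i then - 1 else 1) * partial_deriv b f (reflect i c x))"
   using Suc b by (intro Ck_on_cmult assms(1) Suc.IH) simp
  then show "Ck_on k \<Omega> (%x. grad f (reflect i c x) \<bullet> (b - (2 * (b \<bullet> tdir i)) *\<^sub>R tdir i))"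
   using Ck_on_cong[OF assms(1), of "%x. grad f (reflect i c x) \<bullet> (b - (2 * (b \<bullet> tdir i)) *\<^sub>R tdir i)"
    "%x. (if b = tdir i then - 1 else 1) * partial_deriv b f (reflect i c x)" k]
    partial_deriv_reflect(2)[OF df b] by simp
 qed
qed

locale cylinder_problem = overdetermined \<Omega> u \<nu> \<beta> \<alpha>
 for \<Omega> :: "((real^'n) \<times> (real^'m)) set" and u \<nu> \<beta> \<alpha> +
 fixes lam R :: real
 assumes lam_pos: "lam > 0" and dom_connected: "connected \<Omega>" and R_pos: "R > 0"
  and cylinder: "\<Omega> \<subseteq> ball 0 R \<times> UNIV"
  and period: "periodic_snd (2 * lam) \<Omega>" and symmetric: "symmetric_snd \<Omega>"
begin

lemma fst_bound: "x \<in> \<Omega> ==> norm (fst x) < R"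
 using cylinder by (cases x) auto

lemma fst_bound_closure: assumes "x \<in> closure \<Omega>" shows "norm (fst x) <= R"
proof -
 have "closed ({x. norm (fst x) <= R} :: ((real^'n) \<times> (real^'m)) set)" by (intro closed_Collect_le continuous_intros)
 then have "closure \<Omega> \<subseteq> {x. norm (fst x) <= R}"
  using fst_bound by (intro closure_minimal) (auto intro: less_imp_le)
 then show ?thesis using assms by auto
qed

lemma cylinder_maximum_principle:
 assumes wc: "continuous_on (closure \<Omega>) w"
  and mvp: "!!x r. r > 0 ==> cball x (r * real DIM((real^'n) \<times> (real^'m))) \<subseteq> \<Omega> ==>
   average w x r = mv_mass TYPE((real^'n) \<times> (real^'m)) * w x"
  and fr: "!!x. x \<in> frontier \<Omega> ==> w x <= K" and K: "K \<ge> 0"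
  and growth: "!!x. x \<in> \<Omega> ==> w x <= A * (1 + norm x)" and A: "A > 0"
  and x: "x \<in> \<Omega>"
 shows "w x <= K"
proof -
 (* This makes the Laplacian of the barrier negative. *)
 define M where "M = real DIM(real^'m) + 1"
 define B where "B = (barrier M R :: (real^'n) \<times> (real^'m) => real)"
 have M: "M > 0" by (simp add: M_def)
 have neg: "2 * real DIM(real^'m) - 2 * M * real DIM(real^'n) < 0"
 proof -
  have "1 <= real DIM(real^'n)" by (simp add: Suc_leI)
  then have "M * 1 <= M * real DIM(real^'n)" using M by (intro mult_left_mono) auto
  moreover have "2 * M * real DIM(real^'n) = 2 * (M * real DIM(real^'n))" by (rule mult.assoc)
  moreover have "real DIM(real^'m) < M" unfolding M_def by simp
  ultimately show ?thesis by linarith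
 qed
 have Bge: "(norm (snd x))\<^sup>2 <= B x" if "x \<in> closure \<Omega>" for x
 proof -
  have "(norm (fst x))\<^sup>2 <= R\<^sup>2" using fst_bound_closure[OF that] by (intro power_mono) auto
  then have "M * (norm (fst x))\<^sup>2 <= M * R\<^sup>2" using M by (intro mult_left_mono) auto
  then show ?thesis by (simp add: B_def barrier_def)
 qed
 show ?thesis
 proof (rule maximum_principle[OF open_dom wc mvp fr _ _ neg, where B=B])
  show "Ck_on 2 UNIV B" unfolding B_def by (rule barrier_C2)
  show "laplacian B y = 2 * real DIM(real^'m) - 2 * M * real DIM(real^'n)" for y unfolding B_def by (rule barrier_laplacian)
  show "0 <= B y" if "y \<in> closure \<Omega>" for y using Bge[OF that] by (meson order_trans zero_le_power2)
  fix e :: real assume e: "e > 0"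
  (* Beyond T the quadratic barrier dominates the linear bound on w. *)
  define T where "T = max (1 + R) (A * (2 + R) / e)"
  show "\<exists>R'. \<forall>y\<in>\<Omega>. norm y > R' --> w y <= K + e * B y"
  proof (intro exI[of _ "R + T"] ballI impI)
   fix y assume y: "y \<in> \<Omega>" "norm y > R + T"
   have "norm y <= norm (fst y) + norm (snd y)"
    by (cases y) (simp add: norm_Pair sqrt_sum_squares_le_sum)
   then have t: "norm (snd y) > T" and ny: "norm y <= R + norm (snd y)" using fst_bound[OF y(1)] y(2) by auto
   have t1: "norm (snd y) \<ge> 1" using t R_pos by (simp add: T_def)
   have "A * (1 + norm y) <= A * ((2 + R) * norm (snd y))"
   proof (rule mult_left_mono)
    have "R <= R * norm (snd y)" using R_pos t1 by simp
    then show "1 + norm y <= (2 + R) * norm (snd y)" using ny t1 by (simp add: algebra_simps)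
   qed (use A in simp)
   also have "... = (A * (2 + R) / e) * (e * norm (snd y))" using e by simp
   also have "... <= norm (snd y) * (e * norm (snd y))"
    using t e by (intro mult_right_mono) (auto simp: T_def)
   also have "... = e * (norm (snd y))\<^sup>2" by (simp add: power2_eq_square)
   also have "... <= e * B y" using Bge[of y] y(1) closure_subset e by (intro mult_left_mono) auto
   finally show "w y <= K + e * B y" using growth[OF y(1)] K by linarith
  qed
 qed (use x in auto)
qed

text \<open>Any fixed direction in the bounded variables will do, so the coordinate index is left unspecified.\<close>

definition zdir :: "(real^'n) \<times> (real^'m)" where "zdir = (axis undefined 1, 0)"

lemma norm_zdir: "norm zdir = 1" by (simp add: zdir_def norm_Pair)

lemma zray_exit:
 assumes x: "x \<in> \<Omega>"
 obtains s where "0 < s" "s <= 2 * R" "x + s *\<^sub>R zdir \<in> frontier \<Omega>" "!!t. 0 <= t ==> t < s ==> x + t *\<^sub>R zdir \<in> \<Omega>"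
proof (rule ray_exit[OF open_dom x])
 show "0 <= 2 * R" using R_pos by simp
 show "x + (2 * R) *\<^sub>R zdir ~: \<Omega>"
 proof
  assume "x + (2 * R) *\<^sub>R zdir \<in> \<Omega>"
  then have "norm (fst (x + (2 * R) *\<^sub>R zdir)) < R" by (rule fst_bound)
  then have "norm (fst x + (2 * R) *\<^sub>R axis undefined (1::real)) < R" by (simp add: zdir_def)
  moreover have "norm ((2 * R) *\<^sub>R axis (undefined::'n) (1::real)) = 2 * R" using R_pos by simp
  ultimately show False using fst_bound[OF x]
   norm_triangle_ineq4[of "fst x + (2 * R) *\<^sub>R axis undefined (1::real)" "fst x"] by simp
 qed
qed (use that in auto)

text \<open>A ray in a bounded direction leaves the domain within length \<open>2 R\<close>, so boundary values and a gradient bound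
along the ray control the function.\<close>

lemma zray_estimate:
 fixes f F :: "(real^'n) \<times> (real^'m) => real"
 assumes f: "Ck_on 1 \<Omega> f" and F: "continuous_on (closure \<Omega>) F" "!!x. x \<in> \<Omega> ==> F x = f x"
  and fr: "!!y. y \<in> frontier \<Omega> ==> \<bar>F y\<bar> <= K"
  and x: "x \<in> \<Omega>" and g: "!!y. y \<in> \<Omega> ==> norm y <= norm x + 2 * R ==> norm (grad f y) <= C"
 shows "\<bar>f x\<bar> <= K + 2 * R * C"
proof -
 obtain s where s: "0 < s" "s <= 2 * R" "x + s *\<^sub>R zdir \<in> frontier \<Omega>" "!!t. 0 <= t ==> t < s ==> x + t *\<^sub>R zdir \<in> \<Omega>"
  using zray_exit[OF x] by metis
 have C: "C \<ge> 0" using g[OF x] R_pos by (simp add: order_trans[OF norm_ge_zero])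
 have one: "\<bar>f x - f (x + t *\<^sub>R zdir)\<bar> <= 2 * R * C" if t: "0 <= t" "t < s" for t
 proof -
  have seg: "z \<in> \<Omega> & norm z <= norm x + 2 * R" if "z \<in> closed_segment x (x + t *\<^sub>R zdir)" for z
  proof -
   obtain v where v: "0 <= v" "v <= 1" "z = (1 - v) *\<^sub>R x + v *\<^sub>R (x + t *\<^sub>R zdir)" using \<open>z \<in> _\<close> by (auto simp: closed_segment_def)
   have z: "z = x + (v * t) *\<^sub>R zdir" using v(3) by (simp add: algebra_simps)
   have vt: "0 <= v * t" "v * t <= t" using v t by (auto intro: mult_left_le_one_le)
   have "norm z <= norm x + v * t" unfolding z using norm_triangle_ineq[of x "(v * t) *\<^sub>R zdir"] vt norm_zdir by simp
   then show ?thesis using s(2) s(4)[of "v * t"] vt t z by auto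
  qed
  have "\<bar>f x - f (x + t *\<^sub>R zdir)\<bar> <= C * norm (x - (x + t *\<^sub>R zdir))"
   using seg g by (intro grad_diff_segment[OF open_dom f]) auto
  also have "... = C * t" using t norm_zdir by simp
  also have "... <= C * (2 * R)" using t s C by (intro mult_left_mono) auto
  finally show ?thesis by (simp add: mult.commute)
 qed
 have cF: "continuous_on {0..s} (%t. F (x + t *\<^sub>R zdir))"
 proof (rule continuous_on_compose2[OF F(1)])
  show "continuous_on {0..s} (%t. x + t *\<^sub>R zdir)" by (intro continuous_intros)
  show "(%t. x + t *\<^sub>R zdir) ` {0..s} \<subseteq> closure \<Omega>"
  proof (rule image_subsetI)
   fix t assume "t \<in> {0..s}"
   then show "x + t *\<^sub>R zdir \<in> closure \<Omega>"
    using s(4)[of t] frontier_closure[OF s(3)] closure_subset by (cases "t = s") auto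
  qed
 qed
 then have "((%t. F (x + t *\<^sub>R zdir)) \<longlongrightarrow> F (x + s *\<^sub>R zdir)) (at s within {0..s})"
  using s(1) by (simp add: continuous_on_def)
 then have "((%t. F (x + t *\<^sub>R zdir)) \<longlongrightarrow> F (x + s *\<^sub>R zdir)) (at_left s)"
  using at_within_Icc_at_left[OF s(1)] by simp
 then have "((%t. \<bar>f x - F (x + t *\<^sub>R zdir)\<bar>) \<longlongrightarrow> \<bar>f x - F (x + s *\<^sub>R zdir)\<bar>) (at_left s)"
  by (intro tendsto_intros)
 then have "\<bar>f x - F (x + s *\<^sub>R zdir)\<bar> <= 2 * R * C"
 proof (rule tendsto_upperbound)
  show "\<forall>\<^sub>F t in at_left s. \<bar>f x - F (x + t *\<^sub>R zdir)\<bar> <= 2 * R * C"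
   using eventually_at_left_real[OF s(1)]
  proof eventually_elim
   case (elim t)
   then show ?case using one[of t] F(2)[OF s(4)[of t]] by simp
  qed
 qed simp
 then show ?thesis using fr[OF s(3)] by linarith
qed

text \<open>The second derivatives grow at most linearly, and rays in the bounded directions have bounded length.\<close>

lemma gradient_growth: "\<exists>A>0. \<forall>x\<in>\<Omega>. norm (grad u x) <= A * (1 + norm x)"
proof -
 obtain A where A: "A > 0" "!!b x. b \<in> Basis ==> x \<in> \<Omega> ==> norm (grad (partial_deriv b u) x) <= A * (1 + norm x)"
  using second_derivative_growth by blast
 define A1 where "A1 = \<beta> + 2 * R * (A * (1 + 2 * R))"
 have A1: "A1 > 0" unfolding A1_def using A(1) R_pos \<beta>_pos by (intro add_pos_nonneg) auto
 have one: "\<bar>partial_deriv b u x\<bar> <= A1 * (1 + norm x)" if b: "b \<in> Basis" and x: "x \<in> \<Omega>" for b x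
 proof -
  have "\<bar>partial_deriv b u x\<bar> <= \<beta> + 2 * R * (A * (1 + (norm x + 2 * R)))"
  proof (rule zray_estimate[OF u_partial_C1[OF b], where F="%x. G x \<bullet> b"])
   show "continuous_on (closure \<Omega>) (%x. G x \<bullet> b)" by (intro continuous_intros G_cont)
   show "G x \<bullet> b = partial_deriv b u x" if "x \<in> \<Omega>" for x by (simp add: G_eq[OF that] grad_inner_Basis[OF b])
   show "\<bar>G y \<bullet> b\<bar> <= \<beta>" if "y \<in> frontier \<Omega>" for y
    using Basis_le_norm[OF b, of "G y"] norm_G_frontier[OF that] by simp
   fix y assume y: "y \<in> \<Omega>" "norm y <= norm x + 2 * R"
   have "A * (1 + norm y) <= A * (1 + (norm x + 2 * R))" using y A(1) by (intro mult_left_mono) auto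
   then show "norm (grad (partial_deriv b u) y) <= A * (1 + (norm x + 2 * R))" using A(2)[OF b y(1)] by linarith
  qed (rule x)
  also have "... <= A1 * (1 + norm x)"
  proof -
   have "0 <= \<beta> * norm x" "0 <= 2 * R * (A * (2 * R)) * norm x" using \<beta>_pos A(1) R_pos by auto
   then show ?thesis unfolding A1_def by (simp add: algebra_simps)
  qed
  finally show ?thesis .
 qed
 let ?N = "real DIM((real^'n) \<times> (real^'m))"
 have "norm (grad u x) <= (?N * A1) * (1 + norm x)" if x: "x \<in> \<Omega>" for x
 proof -
  have "norm (grad u x) <= (\<Sum>b\<in>Basis. \<bar>grad u x \<bullet> b\<bar>)" by (rule norm_le_l1)
  also have "... <= (\<Sum>b\<in>(Basis :: ((real^'n) \<times> (real^'m)) set). A1 * (1 + norm x))"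
   using one[OF _ x] by (intro sum_mono) (simp add: grad_inner_Basis)
  finally show ?thesis by simp
 qed
 moreover have "?N > 0" by (simp only: of_nat_0_less_iff DIM_positive)
 then have "?N * A1 > 0" using A1 by (rule mult_pos_pos)
 ultimately show ?thesis by blast
qed

lemma directional_mvp:
 assumes "r > 0" "cball x (r * real DIM((real^'n) \<times> (real^'m))) \<subseteq> \<Omega>"
 shows "average (%y. grad u y \<bullet> e) x r = mv_mass TYPE((real^'n) \<times> (real^'m)) * (grad u x \<bullet> e)"
 by (rule average_directional_derivative[OF open_dom u_C2 laplace assms])

text \<open>The derivative of \<open>u\<close> in the direction \<open>e\<close> of the gradient at \<open>x\<close> has the mean value property, is at most
\<open>\<beta>\<close> on the boundary, and grows at most linearly.\<close>

lemma gradient_bound: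
 assumes x: "x \<in> \<Omega>"
 shows "norm (grad u x) <= \<beta>"
proof (cases "grad u x = 0")
 case True then show ?thesis using \<beta>_pos by simp
next
 case False
 define e where "e = grad u x /\<^sub>R norm (grad u x)"
 have e1: "norm e = 1" using False by (simp add: e_def)
 obtain A where A: "A > 0" "!!x. x \<in> \<Omega> ==> norm (grad u x) <= A * (1 + norm x)" using gradient_growth by blast
 have "G x \<bullet> e <= \<beta>"
 proof (rule cylinder_maximum_principle[where A=A and w="%x. G x \<bullet> e" and K=\<beta>])
  show "continuous_on (closure \<Omega>) (%x. G x \<bullet> e)" by (intro continuous_intros G_cont)
  show "average (%x. G x \<bullet> e) y r = mv_mass TYPE((real^'n) \<times> (real^'m)) * (G y \<bullet> e)"
   if "r > 0" "cball y (r * real DIM((real^'n) \<times> (real^'m))) \<subseteq> \<Omega>" for y r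
  proof -
   have y: "y \<in> \<Omega>" using that by (auto intro!: subsetD[OF that(2)])
   show ?thesis using average_cong[OF _ that(2,1), of "%x. G x \<bullet> e" "%x. grad u x \<bullet> e"] directional_mvp[OF that, of e]
    by (simp add: G_eq[OF y] G_eq)
  qed
  show "G y \<bullet> e <= \<beta>" if "y \<in> frontier \<Omega>" for y
   using norm_cauchy_schwarz[of "G y" e] norm_G_frontier[OF that] e1 by simp
  show "G y \<bullet> e <= A * (1 + norm y)" if "y \<in> \<Omega>" for y
   using norm_cauchy_schwarz[of "G y" e] A(2)[OF that] e1 by (simp add: G_eq[OF that])
 qed (use A x \<beta>_pos in auto)
 moreover have "grad u x \<bullet> e = norm (grad u x)" using False
  by (simp add: e_def power2_norm_eq_inner[symmetric] power2_eq_square)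
 ultimately show ?thesis by (simp add: G_eq[OF x])
qed

lemma u_bounded: "x \<in> \<Omega> ==> u x <= 2 * R * \<beta>"
 using zray_estimate[of u u 0 x \<beta>] Ck_on_le[of 1 2 \<Omega> u] u_C2 u_cont u_zero gradient_bound by fastforce

lemma u_along_ray:
 assumes g: "!!y. y \<in> \<Omega> ==> grad u y \<bullet> e = \<beta>" and s: "s > 0"
  and c: "!!t. 0 <= t ==> t <= s ==> x + t *\<^sub>R e \<in> closure \<Omega>" and i: "!!t. 0 <= t ==> t < s ==> x + t *\<^sub>R e \<in> \<Omega>"
 shows "u (x + s *\<^sub>R e) = u x + \<beta> * s"
proof -
 let ?f = "%t. u (x + t *\<^sub>R e) - \<beta> * t"
 have "?f s = ?f 0"
 proof (rule DERIV_isconst_end[OF s])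
  have "continuous_on {0..s} (%t. u (x + t *\<^sub>R e))"
   by (rule continuous_on_compose2[OF u_cont]) (use c in \<open>auto intro!: continuous_intros\<close>)
  then show "continuous_on {0..s} ?f" by (intro continuous_intros)
  fix t assume t: "0 < t" "t < s"
  have O: "x + t *\<^sub>R e \<in> \<Omega>" using i t by simp
  have "((%t. u (x + t *\<^sub>R e)) has_real_derivative \<beta>) (at t)"
   using has_derivative_direction[OF u_has_derivative[OF O]] g[OF O] by simp
  then show "(?f has_real_derivative 0) (at t)" by (auto intro!: derivative_eq_intros)
 qed
 then show ?thesis by simp
qed

text \<open>If equality held at one point, the derivative in that direction would be \<open>\<beta>\<close> everywhere, so \<open>u\<close> would
increase along the ray. The ray either stays inside, where \<open>u\<close> is bounded, or meets the boundary, where \<open>u = 0\<close>.\<close>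

lemma gradient_strict:
 assumes x0: "x0 \<in> \<Omega>"
 shows "norm (grad u x0) < \<beta>"
proof (rule ccontr)
 assume "\<not> ?thesis"
 then have eq: "norm (grad u x0) = \<beta>" using gradient_bound[OF x0] by simp
 define e where "e = grad u x0 /\<^sub>R \<beta>"
 have e1: "norm e = 1" using eq \<beta>_pos by (simp add: e_def)
 have cg: "continuous_on \<Omega> (%x. grad u x \<bullet> e)"
  unfolding grad_def using Ck_on_le[of 1 2 \<Omega> u] u_C2 by (intro continuous_intros) auto
 have g: "grad u y \<bullet> e = \<beta>" if "y \<in> \<Omega>" for y
 proof (rule strong_maximum_principle[OF open_dom dom_connected cg directional_mvp _ x0 _ that])
  show "grad u x \<bullet> e <= \<beta>" if "x \<in> \<Omega>" for x
   using norm_cauchy_schwarz[of "grad u x" e] gradient_bound[OF that] e1 by simp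
  show "grad u x0 \<bullet> e = \<beta>" using eq \<beta>_pos by (simp add: e_def power2_norm_eq_inner[symmetric] power2_eq_square)
 qed
 have "\<exists>s\<ge>0. x0 + s *\<^sub>R e ~: \<Omega>"
 proof (rule ccontr)
  assume "\<not> ?thesis"
  then have all: "x0 + s *\<^sub>R e \<in> \<Omega>" if "s \<ge> 0" for s using that by blast
  define s where "s = 2 * R + 1"
  have s: "s > 0" using R_pos by (simp add: s_def)
  have "u (x0 + s *\<^sub>R e) = u x0 + \<beta> * s"
   using all closure_subset by (intro u_along_ray[OF g s]) auto
  then have "\<beta> * s < 2 * R * \<beta>" using u_bounded[OF all[of s]] u_pos[OF x0] s by simp
  then show False using \<beta>_pos by (simp add: s_def algebra_simps)
 qed
 then obtain s where s: "s \<ge> 0" "x0 + s *\<^sub>R e ~: \<Omega>" by blast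
 obtain s1 where s1: "0 < s1" "x0 + s1 *\<^sub>R e \<in> frontier \<Omega>" "!!t. 0 <= t ==> t < s1 ==> x0 + t *\<^sub>R e \<in> \<Omega>"
  using ray_exit[OF open_dom x0 s] by metis
 have "u (x0 + s1 *\<^sub>R e) = u x0 + \<beta> * s1"
 proof (rule u_along_ray[OF g s1(1) _ s1(3)])
  fix t assume "0 <= t" "t <= s1"
  then show "x0 + t *\<^sub>R e \<in> closure \<Omega>"
   using s1(3)[of t] frontier_closure[OF s1(2)] closure_subset by (cases "t = s1") auto
 qed
 then show False using u_zero[OF s1(2)] u_pos[OF x0] \<beta>_pos s1(1) by (simp add: add_pos_pos less_imp_neq)
qed

lemma translate_in: assumes "x \<in> \<Omega>" shows "x + (2 * lam) *\<^sub>R tdir i \<in> \<Omega>" "x - (2 * lam) *\<^sub>R tdir i \<in> \<Omega>"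
proof -
 have per: "(%(z, t). (z, t + axis i (2 * lam))) ` \<Omega> = \<Omega>" using period by (simp add: periodic_snd_def)
 have f: "(%(z, t). (z, t + axis i (2 * lam))) y = y + (2 * lam) *\<^sub>R (tdir i :: (real^'n) \<times> (real^'m))" for y
  by (cases y) (simp add: tdir_def axis_def vec_eq_iff)
 show "x + (2 * lam) *\<^sub>R tdir i \<in> \<Omega>" using imageI[OF assms, of "%(z, t). (z, t + axis i (2 * lam))"] per f by metis
 obtain y where "y \<in> \<Omega>" "x = y + (2 * lam) *\<^sub>R tdir i" using assms per f by (metis (no_types, lifting) imageE)
 then show "x - (2 * lam) *\<^sub>R tdir i \<in> \<Omega>" by simp
qed

lemma translate_int: "x \<in> \<Omega> ==> x + (2 * lam * of_int k) *\<^sub>R tdir i \<in> \<Omega>"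
proof (induction k arbitrary: x rule: int_induct[where k=0])
 case base then show ?case by simp
next
 case (step1 k)
 from translate_in(1)[OF step1(2)[OF step1(3)], of i] show ?case by (simp add: algebra_simps)
next
 case (step2 k)
 from translate_in(2)[OF step2(2)[OF step2(3)], of i] show ?case by (simp add: algebra_simps)
qed

lemma flip_in: assumes "x \<in> \<Omega>" shows "x - (2 * (x \<bullet> tdir i)) *\<^sub>R tdir i \<in> \<Omega>"
proof -
 have sym: "(%(z, t). (z, \<chi> j. if j = i then - (t $ j) else t $ j)) ` \<Omega> = \<Omega>" using symmetric by (simp add: symmetric_snd_def)
 have "(%(z, t). (z, \<chi> j. if j = i then - (t $ j) else t $ j)) x = x - (2 * (x \<bullet> tdir i)) *\<^sub>R tdir i"
  by (cases x) (simp add: inner_tdir, simp add: tdir_def axis_def vec_eq_iff)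
 then show ?thesis using imageI[OF assms, of "%(z, t). (z, \<chi> j. if j = i then - (t $ j) else t $ j)"] sym by metis
qed

lemma reflect_in: assumes "x \<in> \<Omega>" shows "reflect i (lam * of_int k) x \<in> \<Omega>"
 using translate_int[OF flip_in[OF assms, of i], of k i] by (simp add: reflect_def algebra_simps)

text \<open>The coordinates are changed one at a time, each by a translation or a reflection.\<close>

lemma lattice_move:
 assumes x: "(z, t) \<in> \<Omega>" and t': "!!i. \<exists>k::int. t' $ i = t $ i + 2 * lam * of_int k \<or> t' $ i = - t $ i + 2 * lam * of_int k"
 shows "(z, t') \<in> \<Omega>"
proof -
 have "finite J ==> (z, \<chi> i. if i \<in> J then t' $ i else t $ i) \<in> \<Omega>" for J :: "'m set"
 proof (induction J rule: finite_induct)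
  case empty then show ?case using x by simp
 next
  case (insert j J)
  let ?y = "(z, \<chi> i. if i \<in> J then t' $ i else t $ i)"
  have yj: "?y \<bullet> tdir j = t $ j" using insert by (simp add: inner_tdir)
  obtain k :: int where k: "t' $ j = t $ j + 2 * lam * of_int k \<or> t' $ j = - t $ j + 2 * lam * of_int k" using t' by blast
  have "(z, \<chi> i. if i \<in> insert j J then t' $ i else t $ i) = ?y + (t' $ j - t $ j) *\<^sub>R tdir j"
   using insert(2) by (auto simp: tdir_def axis_def vec_eq_iff)
  also have "... \<in> \<Omega>"
   using k
  proof
   assume "t' $ j = t $ j + 2 * lam * of_int k"
   then show ?thesis using translate_int[OF insert(3), of k j] by simp
  next
   assume "t' $ j = - t $ j + 2 * lam * of_int k"
   then have e: "t' $ j - t $ j = 2 * (lam * of_int k) - 2 * (t $ j)" by simp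
   have "?y + (t' $ j - t $ j) *\<^sub>R tdir j = reflect j (lam * of_int k) ?y"
    by (simp only: reflect_def yj e)
   then show ?thesis using reflect_in[OF insert(3)] by simp
  qed
  finally show ?case .
 qed
 from this[of UNIV] show ?thesis by simp
qed

text \<open>The reflected function solves the same Dirichlet problem, and the maximum principle for the difference of
the two gives uniqueness.\<close>

lemma u_reflect:
 assumes x: "x \<in> \<Omega>"
 shows "u (reflect i (lam * of_int k) x) = u x"
proof -
 let ?\<rho> = "reflect i (lam * of_int k) :: (real^'n) \<times> (real^'m) => _"
 let ?v = "%x. u (?\<rho> x)"
 have cl: "?\<rho> y \<in> closure \<Omega>" if "y \<in> closure \<Omega>" for y
  using image_closure_subset[OF reflect_continuous[of "closure \<Omega>" i "lam * of_int k"] closed_closure, of \<Omega>] reflect_in closure_subset that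
  by blast
 have fr: "?\<rho> y \<in> frontier \<Omega>" if "y \<in> frontier \<Omega>" for y
 proof -
  have "?\<rho> y ~: \<Omega>" using reflect_in[of "?\<rho> y" i k] frontier_notin[OF that] by (auto simp: reflect_reflect)
  then show ?thesis using closure_cases[OF cl[OF frontier_closure[OF that]]] by blast
 qed
 have vC: "Ck_on 2 \<Omega> ?v" by (rule Ck_on_reflect[OF open_dom reflect_in u_C2])
 have vl: "laplacian ?v y = - 1" if y: "y \<in> \<Omega>" for y
 proof -
  have d1: "u differentiable (at (?\<rho> z))" if "z \<in> \<Omega>" for z
   using u_has_derivative[OF reflect_in[OF that]] by (auto simp: differentiable_def)
  have "partial_deriv b (partial_deriv b ?v) y = partial_deriv b (partial_deriv b u) (?\<rho> y)" if b: "b \<in> Basis" for b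
  proof -
   let ?s = "if b = tdir i then - 1 else 1 :: real"
   have p1: "partial_deriv b ?v z = ?s * partial_deriv b u (?\<rho> z)" if "z \<in> \<Omega>" for z
    using partial_deriv_eq[OF partial_deriv_reflect(1)[OF d1[OF that] b], of b] partial_deriv_reflect(2)[OF d1[OF that] b] by simp
   have d2: "partial_deriv b u differentiable (at (?\<rho> y))"
    using u_partial_C1[OF b] reflect_in[OF y] open_dom by (auto simp: differentiable_on_open)
   have d3: "(%z. partial_deriv b u (?\<rho> z)) differentiable (at y)"
    using partial_deriv_reflect(1)[OF d2 b] by (auto simp: differentiable_def)
   have "partial_deriv b (partial_deriv b ?v) y = partial_deriv b (%z. ?s * partial_deriv b u (?\<rho> z)) y"
    by (rule partial_deriv_cong[OF open_dom y p1])
   also have "... = ?s * partial_deriv b (%z. partial_deriv b u (?\<rho> z)) y" by (rule partial_deriv_cmult[OF d3])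
   also have "partial_deriv b (%z. partial_deriv b u (?\<rho> z)) y = ?s * partial_deriv b (partial_deriv b u) (?\<rho> y)"
    using partial_deriv_eq[OF partial_deriv_reflect(1)[OF d2 b], of b] partial_deriv_reflect(2)[OF d2 b] by simp
   finally show ?thesis by simp
  qed
  then have "laplacian ?v y = laplacian u (?\<rho> y)" by (simp add: laplacian_def)
  then show ?thesis using laplace[OF reflect_in[OF y]] by simp
 qed
 (* The factor 1 is the constant c of average_diff. *)
 have le: "u y - 1 * ?v y <= 0" if "y \<in> \<Omega>" for y
 proof (rule cylinder_maximum_principle[where A="2 * R * \<beta>" and w="%y. u y - 1 * ?v y"])
  have vc: "continuous_on (closure \<Omega>) ?v"
   by (rule continuous_on_compose2[OF u_cont reflect_continuous]) (use cl in auto)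
  then show "continuous_on (closure \<Omega>) (%y. u y - 1 * ?v y)" by (intro continuous_intros u_cont)
  fix y r assume r: "r > (0::real)" "cball y (r * real DIM((real^'n) \<times> (real^'m))) \<subseteq> \<Omega>"
  have "average (%y. u y - 1 * ?v y) y r = average u y r - 1 * average ?v y r"
   using vc u_cont closure_subset by (intro average_diff[OF _ _ r(2,1)]) (auto intro: continuous_on_subset)
  then show "average (%y. u y - 1 * ?v y) y r = mv_mass TYPE((real^'n) \<times> (real^'m)) * (u y - 1 * ?v y)"
   using average_formula[OF open_dom u_C2 laplace r] average_formula[OF open_dom vC vl r] by (simp add: algebra_simps)
 next
  show "u y - 1 * ?v y <= 0" if "y \<in> frontier \<Omega>" for y using u_zero[OF that] u_zero[OF fr[OF that]] by simp
  show "u y - 1 * ?v y <= 2 * R * \<beta> * (1 + norm y)" if y: "y \<in> \<Omega>" for y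
  proof -
   have "u y - 1 * ?v y <= 2 * R * \<beta> * 1" using u_bounded[OF y] u_pos[OF reflect_in[OF y], of i k] by simp
   also have "... <= 2 * R * \<beta> * (1 + norm y)" using R_pos \<beta>_pos by (intro mult_left_mono) auto
   finally show ?thesis .
  qed
 qed (use that R_pos \<beta>_pos in auto)
 show ?thesis using le[OF x] le[OF reflect_in[OF x, of i k]] by (simp add: reflect_reflect)
qed

lemma normal_derivative_odd:
 assumes x: "x \<in> \<Omega>"
 shows "partial_deriv (tdir i) u x = - partial_deriv (tdir i) u (reflect i (lam * of_int k) x)"
proof -
 let ?\<rho> = "reflect i (lam * of_int k) :: (real^'n) \<times> (real^'m) => _"
 have d1: "u differentiable (at (?\<rho> x))"
  using u_has_derivative[OF reflect_in[OF x]] by (auto simp: differentiable_def)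
 have "partial_deriv (tdir i) u x = partial_deriv (tdir i) (%y. u (?\<rho> y)) x"
  by (rule partial_deriv_cong[OF open_dom x]) (simp add: u_reflect)
 also have "... = - partial_deriv (tdir i) u (?\<rho> x)"
  using partial_deriv_eq[OF partial_deriv_reflect(1)[OF d1 tdir_Basis], of "tdir i"] partial_deriv_reflect(2)[OF d1 tdir_Basis, of i] by simp
 finally show ?thesis .
qed

text \<open>The derivative normal to a mirror is odd about it, so twice its value is the difference at two points at
twice the distance from the mirror.\<close>

lemma tangency:
 assumes L: "!!x y. x \<in> \<Omega> \<inter> cball 0 T ==> y \<in> \<Omega> \<inter> cball 0 T ==> \<bar>partial_deriv (tdir i) u x - partial_deriv (tdir i) u y\<bar> <= L * norm (x - y)"
  and x: "x \<in> \<Omega> \<inter> cball 0 T" "reflect i (lam * of_int k) x \<in> cball 0 T"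
 shows "\<bar>partial_deriv (tdir i) u x\<bar> <= L * \<bar>snd x $ i - lam * of_int k\<bar>"
proof -
 let ?y = "reflect i (lam * of_int k) x"
 have "2 * \<bar>partial_deriv (tdir i) u x\<bar> = \<bar>partial_deriv (tdir i) u x - partial_deriv (tdir i) u ?y\<bar>"
  using normal_derivative_odd[of x i k] x by simp
 also have "... <= L * norm (x - ?y)" using x reflect_in by (intro L) auto
 also have "norm (x - ?y) = 2 * \<bar>snd x $ i - lam * of_int k\<bar>"
 proof -
  have "x - ?y = (2 * (snd x $ i - lam * of_int k)) *\<^sub>R tdir i"
   by (simp add: reflect_def inner_tdir algebra_simps)
  then have "norm (x - ?y) = \<bar>2 * (snd x $ i - lam * of_int k)\<bar>" by (simp only: norm_scaleR norm_tdir mult_1_right)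
  then show ?thesis by (simp only: abs_mult abs_numeral)
 qed
 finally show ?thesis by linarith
qed

lemma exists_torsion_field:
 "\<exists>\<xi>. torsion_exterior \<Omega> u \<xi> \<beta>"
proof -
 have G1: "norm (G x /\<^sub>R \<beta>) <= 1" if "x \<in> closure \<Omega>" for x
  using closure_cases[OF that] gradient_bound[of x] norm_G_frontier[of x] \<beta>_pos by (auto simp: G_eq field_simps)
 obtain \<xi> where \<xi>: "continuous_on UNIV \<xi>" "\<xi> ` UNIV \<subseteq> cball 0 1" "!!x. x \<in> closure \<Omega> ==> \<xi> x = G x /\<^sub>R \<beta>"
 proof (rule Dugundji[of "cball 0 1 :: ((real^'n) \<times> (real^'m)) set" UNIV "closure \<Omega>" "%x. G x /\<^sub>R \<beta>"])
  show "continuous_on (closure \<Omega>) (%x. G x /\<^sub>R \<beta>)" by (intro continuous_intros G_cont)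
  show "(%x. G x /\<^sub>R \<beta>) ` closure \<Omega> \<subseteq> cball 0 1" using G1 by (auto simp del: norm_scaleR)
 qed (use that in auto)
 have "torsion_exterior \<Omega> u \<xi> \<beta>"
 proof
  show "norm (\<xi> x) <= 1" for x using subsetD[OF \<xi>(2), of "\<xi> x"] by simp
  show "\<xi> x = grad u x /\<^sub>R \<beta>" if "x \<in> \<Omega>" for x using \<xi>(3)[of x] that closure_subset G_eq[OF that] by auto
  show "norm (\<xi> x) = 1" if "x \<in> frontier \<Omega>" for x
   using \<xi>(3)[OF frontier_closure[OF that]] norm_G_frontier[OF that] \<beta>_pos by simp
 qed (use open_dom \<beta>_pos u_C2 u_cont u_pos u_zero laplace \<xi>(1) exterior in auto)
 then show ?thesis by blast
qed

end

section \<open>Cutoffs adapted to a slab\<close>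

lemma set_integral_tendsto_bounded:
 fixes f :: "nat => 'a::euclidean_space => real"
 assumes A: "A \<in> sets borel" "emeasure lborel A < \<infinity>"
  and m: "!!n. f n \<in> borel_measurable borel" "g \<in> borel_measurable borel"
  and C: "!!n x. x \<in> A ==> \<bar>f n x\<bar> <= C"
  and lim: "!!x. x \<in> A ==> (%n. f n x) \<longlonglongrightarrow> g x"
 shows "(%n. LBINT x:A. f n x) \<longlonglongrightarrow> (LBINT x:A. g x)"
 unfolding set_lebesgue_integral_def
proof (rule integral_dominated_convergence)
 show "(%x. indicat_real A x *\<^sub>R g x) \<in> borel_measurable lborel" "(%x. indicat_real A x *\<^sub>R f n x) \<in> borel_measurable lborel" for n
  using A m by auto
 show "integrable lborel (%x. indicat_real A x *\<^sub>R C)" using A by (auto intro!: integrable_real_indicator)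
 show "AE x in lborel. (%n. indicat_real A x *\<^sub>R f n x) \<longlonglongrightarrow> indicat_real A x *\<^sub>R g x"
  using lim by (auto intro!: AE_I2 simp: indicator_def)
 show "AE x in lborel. norm (indicat_real A x *\<^sub>R f n x) <= indicat_real A x *\<^sub>R C" for n
  using C by (auto intro!: AE_I2 simp: indicator_def)
qed

lemma lipschitz_of_C1_compact_support:
 fixes f :: "'a::euclidean_space => real"
 assumes f: "Ck_on 1 UNIV f" and K: "compact K" "!!x. x ~: K ==> f x = 0"
 obtains L where "L-lipschitz_on UNIV f"
proof -
 have g: "continuous_on UNIV (grad f)" unfolding grad_def using f by (intro continuous_intros) auto
 have gz: "grad f x = 0" if "x ~: K" for x
 by (rule grad_off_support[OF compact_imp_closed[OF K(1)] K(2) that])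
 obtain C where C: "C > 0" "!!x. norm (grad f x) <= C" using bounded_compact_support[OF g K(1) gz] by metis
 have "C-lipschitz_on UNIV f"
 proof (rule bounded_derivative_imp_lipschitz)
  have "f differentiable (at x)" for x using f by (auto simp: differentiable_on_open)
  then show "(f has_derivative (%h. grad f x \<bullet> h)) (at x within UNIV)" for x by (auto intro: has_derivative_grad)
  show "onorm (%h. grad f x \<bullet> h) <= C" for x
  proof (rule onorm_bound)
   show "norm (grad f x \<bullet> h) <= C * norm h" for h
    using Cauchy_Schwarz_ineq2[of "grad f x" h] C(2)[of x] by (simp add: order_trans[OF _ mult_right_mono])
  qed (use C in simp)
 qed (use C in auto)
 then show thesis by (rule that)
qed

lemma test_field_lipschitz:
 fixes \<eta> :: "'a::euclidean_space => 'a"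
 assumes \<eta>: "\<eta> \<in> test_fields U"
 shows "\<exists>L. L-lipschitz_on UNIV \<eta>"
proof -
 have "\<exists>L. L-lipschitz_on UNIV (%x. \<eta> x \<bullet> b)" if b: "b \<in> Basis" for b
 proof -
  note t = test_fields_component[OF \<eta> b]
  obtain K where K: "compact K" "K \<subseteq> U" "!!x. x ~: K ==> \<eta> x \<bullet> b = 0" using test_functionsD[OF t] by metis
  show ?thesis using lipschitz_of_C1_compact_support[OF test_functions_Ck[OF t] K(1,3)] by metis
 qed
 then obtain L where L: "!!b. b \<in> Basis ==> (L b)-lipschitz_on UNIV (%x. \<eta> x \<bullet> b)" by metis
 have "(\<Sum>b\<in>Basis. L b)-lipschitz_on UNIV \<eta>"
 proof (rule lipschitz_onI)
  fix x y
  have "norm (\<eta> x - \<eta> y) <= (\<Sum>b\<in>Basis. \<bar>(\<eta> x - \<eta> y) \<bullet> b\<bar>)" by (rule norm_le_l1)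
  also have "... <= (\<Sum>b\<in>Basis. L b * dist x y)"
   using lipschitz_onD[OF L, of _ x y] by (intro sum_mono) (simp add: dist_real_def inner_diff_left)
  finally show "dist (\<eta> x) (\<eta> y) <= (\<Sum>b\<in>Basis. L b) * dist x y" by (simp add: dist_norm sum_distrib_right)
 qed (use lipschitz_on_nonneg[OF L] in \<open>auto intro: sum_nonneg\<close>)
 then show ?thesis by blast
qed

lemma divergence_off_support:
 assumes "closed K" "!!x. x ~: K ==> V x = 0" "x ~: K"
 shows "divergence V x = 0"
proof -
 have "partial_deriv b (%y. V y \<bullet> b) x = partial_deriv b (%y. 0) x" for b
  by (rule partial_deriv_cong[of "- K"]) (use assms in \<open>auto simp: open_Compl\<close>)
 then show ?thesis by (simp add: divergence_def)
qed

lemma divergence_scaleR: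
 assumes f: "f differentiable (at x)" and V: "!!b. b \<in> Basis ==> (%y. V y \<bullet> b) differentiable (at x)"
 shows "divergence (%y. f y *\<^sub>R V y) x = f x * divergence V x + V x \<bullet> grad f x"
proof -
 have "divergence (%y. f y *\<^sub>R V y) x = (\<Sum>b\<in>Basis. f x * partial_deriv b (%y. V y \<bullet> b) x + partial_deriv b f x * (V x \<bullet> b))"
  unfolding divergence_def using partial_deriv_mult[OF f V] by (intro sum.cong) auto
 then show ?thesis by (simp add: sum.distrib sum_distrib_left divergence_def grad_def inner_sum_right)
qed

lemma set_integral_const_measure: "(LBINT x:A. c) = measure lborel A * (c::real)" if "A \<in> sets borel"
 using that by (simp add: set_lebesgue_integral_def)

lemma lipschitz_on_scaleR_bounded:
 fixes f :: "'a::metric_space => real" and V :: "'a => 'b::real_normed_vector"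
 assumes f: "L-lipschitz_on S f" "!!x. x \<in> S ==> \<bar>f x\<bar> <= 1" and V: "M-lipschitz_on S V" "!!x. x \<in> S ==> norm (V x) <= 1"
 shows "(L + M)-lipschitz_on S (%x. f x *\<^sub>R V x)"
proof (rule lipschitz_onI)
 fix x y assume x: "x \<in> S" "y \<in> S"
 have "f x *\<^sub>R V x - f y *\<^sub>R V y = (f x - f y) *\<^sub>R V x + f y *\<^sub>R (V x - V y)" by (simp add: algebra_simps)
 then have "norm (f x *\<^sub>R V x - f y *\<^sub>R V y) <= \<bar>f x - f y\<bar> * norm (V x) + \<bar>f y\<bar> * norm (V x - V y)"
  using norm_triangle_ineq[of "(f x - f y) *\<^sub>R V x" "f y *\<^sub>R (V x - V y)"] by simp
 also have "... <= \<bar>f x - f y\<bar> * 1 + 1 * norm (V x - V y)"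
  using f(2)[OF x(2)] V(2)[OF x(1)] by (intro add_mono mult_left_mono mult_right_mono) auto
 also have "... <= L * dist x y + M * dist x y"
  using lipschitz_onD[OF f(1) x] lipschitz_onD[OF V(1) x] by (simp add: dist_norm dist_real_def)
 finally show "dist (f x *\<^sub>R V x) (f y *\<^sub>R V y) <= (L + M) * dist x y" by (simp add: dist_norm algebra_simps)
qed (use lipschitz_on_nonneg[OF f(1)] lipschitz_on_nonneg[OF V(1)] in simp)

text \<open>A \<open>C\<^sup>1\<close> cutoff on the line: zero up to distance \<open>1 / n\<close> from the ends of \<open>[c, d]\<close> and outside, and one from
distance \<open>2 / n\<close> on.\<close>

definition edge :: "real => real => real => real => real" where
 "edge n c d s = ramp (n * (s - c) - 1) * ramp (n * (d - s) - 1)"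

definition edge' :: "real => real => real => real => real" where
 "edge' n c d s = n * (ramp' (n * (s - c) - 1) * ramp (n * (d - s) - 1) - ramp (n * (s - c) - 1) * ramp' (n * (d - s) - 1))"

lemma edge_deriv: "(edge n c d has_real_derivative edge' n c d s) (at s)"
proof -
 have 1: "((%s. ramp (n * (s - c) - 1)) has_real_derivative ramp' (n * (s - c) - 1) * n) (at s)"
  by (rule DERIV_chain2[OF ramp_deriv]) (auto intro!: derivative_eq_intros)
 have 2: "((%s. ramp (n * (d - s) - 1)) has_real_derivative ramp' (n * (d - s) - 1) * (- n)) (at s)"
  by (rule DERIV_chain2[OF ramp_deriv]) (auto intro!: derivative_eq_intros)
 show ?thesis unfolding edge_def[abs_def] edge'_def
  using DERIV_mult[OF 1 2] by (simp add: algebra_simps)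
qed

lemma edge'_continuous: "continuous_on S (edge' n c d)"
proof -
 have c: "continuous_on S (%s. ramp (n * (s - c) - 1))" "continuous_on S (%s. ramp (n * (d - s) - 1))"
  by (rule continuous_on_compose2[OF ramp_continuous[of UNIV]]; intro continuous_intros subset_UNIV)+
 have c': "continuous_on S (%s. ramp' (n * (s - c) - 1))" "continuous_on S (%s. ramp' (n * (d - s) - 1))"
  by (rule continuous_on_compose2[OF ramp'_continuous[of UNIV]]; intro continuous_intros subset_UNIV)+
 show ?thesis unfolding edge'_def[abs_def] by (intro continuous_intros c c')
qed

lemma edge_bounds: "0 <= edge n c d s" "edge n c d s <= 1"
 using ramp_bounds by (auto simp: edge_def mult_le_one)

lemma edge_zero:
 assumes "n > 0" "s - c <= 1 / n \<or> d - s <= 1 / n"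
 shows "edge n c d s = 0" "edge' n c d s = 0"
proof -
 have "n * (s - c) - 1 <= 0 \<or> n * (d - s) - 1 <= 0" using assms by (auto simp: field_simps)
 then show "edge n c d s = 0" "edge' n c d s = 0"
  by (auto simp: edge_def edge'_def ramp_zero ramp'_zero)
qed

lemma edge_one:
 assumes "n > 0" "2 / n <= s - c" "2 / n <= d - s"
 shows "edge n c d s = 1" "edge' n c d s = 0"
proof -
 have "1 <= n * (s - c) - 1" "1 <= n * (d - s) - 1" using assms by (auto simp: field_simps)
 then show "edge n c d s = 1" "edge' n c d s = 0"
  by (auto simp: edge_def edge'_def ramp_one ramp'_zero)
qed

lemma edge'_bound: assumes "n > 0" shows "\<bar>edge' n c d s\<bar> <= 2 * n"
proof -
 let ?x = "ramp' (n * (s - c) - 1) * ramp (n * (d - s) - 1)" and ?y = "ramp (n * (s - c) - 1) * ramp' (n * (d - s) - 1)"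
 have x: "0 <= ?x" "0 <= ?y" using ramp_bounds ramp'_bounds by auto
 have "?x <= 2 * 1" using ramp_bounds ramp'_bounds by (intro mult_mono) auto
 moreover have "?y <= 1 * 2" using ramp_bounds ramp'_bounds by (intro mult_mono) auto
 ultimately have "\<bar>?x - ?y\<bar> <= 2" using x by linarith
 then have "n * \<bar>?x - ?y\<bar> <= n * 2" using assms by (intro mult_left_mono) auto
 then show ?thesis using assms by (simp add: edge'_def abs_mult mult.commute)
qed

text \<open>The derivative is of order \<open>n\<close> and lives at distance at most \<open>2 / n\<close> from an end, where \<open>w\<close> is of order \<open>1 / n\<close>.\<close>

lemma edge'_weighted:
 assumes n: "n > 0" and C: "C \<ge> 0" and w: "\<bar>w\<bar> <= C * \<bar>s - c\<bar>" "\<bar>w\<bar> <= C * \<bar>s - d\<bar>"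
 shows "\<bar>edge' n c d s\<bar> * \<bar>w\<bar> <= 4 * C"
proof (cases "edge' n c d s = 0")
 case True then show ?thesis using C by simp
next
 case False
 then have pos: "s - c > 1 / n" "d - s > 1 / n" using edge_zero(2)[OF n, of s c d] by force+
 have near: "s - c < 2 / n \<or> d - s < 2 / n" using edge_one(2)[OF n, of s c d] False by force
 have n1: "1 / n > 0" using n by simp
 have "\<bar>w\<bar> <= C * (2 / n)"
  using near
 proof
  assume "s - c < 2 / n"
  then have "\<bar>s - c\<bar> <= 2 / n" using pos n1 by linarith
  then show ?thesis using w(1) C by (meson mult_left_mono order_trans)
 next
  assume "d - s < 2 / n"
  then have "\<bar>s - d\<bar> <= 2 / n" using pos n1 by linarith
  then show ?thesis using w(2) C by (meson mult_left_mono order_trans)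
 qed
 then have "\<bar>edge' n c d s\<bar> * \<bar>w\<bar> <= (2 * n) * (C * (2 / n))"
  using edge'_bound[OF n, of c d s] n by (intro mult_mono) auto
 then show ?thesis using n by simp
qed

lemma slab_Times: "(slab a b :: ((real^'n) \<times> (real^'m)) set) = UNIV \<times> box a b"
 by (auto simp: slab_def mem_box_cart)

lemma in_slab: "x \<in> slab a b \<longleftrightarrow> (\<forall>i. a $ i < snd x $ i & snd x $ i < b $ i)"
 by (cases x) (simp add: slab_def)

lemma open_slab: "open (slab a b)" unfolding slab_Times by (intro open_Times) auto

lemma convex_slab: "convex (slab a b)" unfolding slab_Times by (intro convex_Times) auto

lemma slab_closed_subset_closure:
 assumes "!!i. a $ i < b $ i"
 shows "{x. \<forall>i. a $ i <= snd x $ i & snd x $ i <= b $ i} = closure (slab a b :: ((real^'n) \<times> (real^'m)) set)"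
proof -
 have "box a b ~= {}" using assms by (simp add: interval_ne_empty_cart)
 then have "closure (slab a b :: ((real^'n) \<times> (real^'m)) set) = UNIV \<times> cbox a b"
  unfolding slab_Times closure_Times by simp
 then show ?thesis by (auto simp: mem_box_cart)
qed

text \<open>The coordinate distance to a face is the distance to the projection on it, which is outside the slab.\<close>

lemma compact_slab_margin:
 assumes K: "compact K" "K \<subseteq> (slab a b :: ((real^'n) \<times> (real^'m)) set)"
 obtains d where "d > 0" "!!x i. x \<in> K ==> d <= snd x $ i - a $ i" "!!x i. x \<in> K ==> d <= b $ i - snd x $ i"
proof -
 have "\<exists>d>0. \<forall>x\<in>K. \<forall>y\<in>- slab a b. d <= dist x y"
  using K by (intro separate_compact_closed closed_Compl open_slab) auto
 then obtain d where d: "d > 0" "!!x y. x \<in> K ==> y ~: slab a b ==> d <= dist x y" by blast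
 have face: "d <= \<bar>snd x $ i - c\<bar>" if x: "x \<in> K" and c: "c = a $ i \<or> c = b $ i" for x c i
 proof -
  let ?y = "x - (snd x $ i - c) *\<^sub>R (tdir i :: (real^'n) \<times> (real^'m))"
  have "snd ?y $ i = c" by (simp add: tdir_def)
  then have "?y ~: slab a b" using c in_slab[of ?y a b] less_irrefl by metis
  then have "d <= dist x ?y" using d(2) x by blast
  then show ?thesis by (simp add: dist_norm norm_tdir)
 qed
 have "a $ i < snd x $ i & snd x $ i < b $ i" if "x \<in> K" for x i using K(2) that in_slab by blast
 then show thesis using face d(1) by (intro that[of d]) (smt (verit))+
qed

text \<open>The second factor makes the support compact; it is one on a neighbourhood of the cylinder of radius \<open>R\<close>.\<close>

definition cutoff :: "real => real^'m => real^'m => real => (real^'n) \<times> (real^'m) => real" where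
 "cutoff R a b n x = (\<Prod>i\<in>UNIV. edge n (a $ i) (b $ i) (snd x $ i)) * ramp ((R + 2)\<^sup>2 - (norm (fst x))\<^sup>2)"

lemma Ck_on_prod:
 assumes "open U" "finite I" "!!i. i \<in> I ==> Ck_on k U (f i)"
 shows "Ck_on k U (%x. \<Prod>i\<in>I. f i x)"
 using assms(2,3) by (induction I rule: finite_induct) (auto simp: Ck_on_const assms(1) intro!: Ck_on_mult)

lemma coordinate_C1: "Ck_on k UNIV (%x::(real^'n) \<times> (real^'m). snd x $ i)"
 using Ck_on_inner_const[of UNIV k "tdir i :: (real^'n) \<times> (real^'m)"] by (simp add: inner_tdir)

lemma norm_fst_square_C1: "Ck_on k UNIV (%x::'a::euclidean_space \<times> 'b::euclidean_space. (norm (fst x))\<^sup>2)"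
proof -
 have eq: "(%x::'a \<times> 'b. (norm (fst x))\<^sup>2) = (%x. \<Sum>i\<in>Basis. (x \<bullet> (i, 0)) * (x \<bullet> (i, 0)))"
 proof
  fix x :: "'a \<times> 'b"
  show "(norm (fst x))\<^sup>2 = (\<Sum>i\<in>Basis. (x \<bullet> (i, 0)) * (x \<bullet> (i, 0)))"
   unfolding power2_norm_eq_inner by (subst euclidean_inner) (simp add: inner_prod_def)
 qed
 show ?thesis unfolding eq by (intro Ck_on_sum Ck_on_mult Ck_on_inner_const open_UNIV)
qed

lemma cutoff_C1: "Ck_on 1 UNIV (cutoff R a b n :: (real^'n) \<times> (real^'m) => real)"
 unfolding cutoff_def[abs_def]
proof (intro Ck_on_mult Ck_on_prod open_UNIV)
 show "Ck_on 1 UNIV (%x::(real^'n) \<times> (real^'m). edge n (a $ i) (b $ i) (snd x $ i))" for i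
  by (rule C1_on_compose[OF open_UNIV edge_deriv edge'_continuous coordinate_C1])
 show "Ck_on 1 UNIV (%x::(real^'n) \<times> (real^'m). ramp ((R + 2)\<^sup>2 - (norm (fst x))\<^sup>2))"
  by (rule C1_on_compose[OF open_UNIV ramp_deriv ramp'_continuous Ck_on_diff[OF open_UNIV Ck_on_const[OF open_UNIV] norm_fst_square_C1]])
qed simp

lemma cutoff_continuous: "continuous_on UNIV (cutoff R a b n)"
 by (rule Ck_on_continuous[OF cutoff_C1])

lemma cutoff_bounds: "0 <= cutoff R a b n x" "cutoff R a b n x <= 1"
proof -
 have "0 <= (\<Prod>i\<in>UNIV. edge n (a $ i) (b $ i) (snd x $ i))" "(\<Prod>i\<in>UNIV. edge n (a $ i) (b $ i) (snd x $ i)) <= 1"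
  using edge_bounds by (auto intro!: prod_nonneg prod_le_1)
 then show "0 <= cutoff R a b n x" "cutoff R a b n x <= 1"
  unfolding cutoff_def using ramp_bounds by (auto intro!: mult_le_one)
qed

lemma cutoff_support:
 assumes n: "n > 0"
 obtains K where "compact K" "K \<subseteq> (slab a b :: ((real^'n) \<times> (real^'m)) set)" "!!x. x ~: K ==> cutoff R a b n x = 0"
proof
 let ?K = "cball 0 \<bar>R + 2\<bar> \<times> cbox (\<chi> i. a $ i + 1 / n) (\<chi> i. b $ i - 1 / n) :: ((real^'n) \<times> (real^'m)) set"
 show "compact ?K" by (intro compact_Times compact_cball compact_cbox)
 show "?K \<subseteq> slab a b"
 proof (rule subsetI)
  fix x assume "x \<in> ?K"
  then have "a $ i + 1 / n <= snd x $ i & snd x $ i <= b $ i - 1 / n" for i by (auto simp: mem_box_cart)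
  moreover have "1 / n > 0" using n by simp
  ultimately show "x \<in> slab a b" unfolding in_slab by (smt (verit))
 qed
 fix x assume x: "x ~: ?K"
 show "cutoff R a b n x = 0"
 proof (cases "norm (fst x) <= \<bar>R + 2\<bar>")
  case True
  then have "snd x ~: cbox (\<chi> i. a $ i + 1 / n) (\<chi> i. b $ i - 1 / n)" using x by (cases x) auto
  then obtain i where "\<not> (a $ i + 1 / n <= snd x $ i & snd x $ i <= b $ i - 1 / n)" by (auto simp: mem_box_cart)
  then have "edge n (a $ i) (b $ i) (snd x $ i) = 0" by (intro edge_zero(1)[OF n]) linarith
  then have "(\<Prod>i\<in>UNIV. edge n (a $ i) (b $ i) (snd x $ i)) = 0" by (intro prod_zero) auto
  then show ?thesis by (simp add: cutoff_def)
 next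
  case False
  then have "\<bar>R + 2\<bar>\<^sup>2 <= (norm (fst x))\<^sup>2" by (intro power_mono) auto
  then show ?thesis by (simp add: cutoff_def ramp_zero)
 qed
qed

lemma cutoff_Cc: "n > 0 ==> (cutoff R a b n :: (real^'n) \<times> (real^'m) => real) \<in> Cc"
 using cutoff_support[of n a b R] CcI[OF cutoff_continuous] by metis

lemma radial_factor_one: assumes "norm z <= R + 1" "R > 0" shows "ramp ((R + 2)\<^sup>2 - (norm z)\<^sup>2) = 1"
proof (rule ramp_one)
 have "(norm z)\<^sup>2 <= (R + 1)\<^sup>2" using assms by (intro power_mono) auto
 then show "1 <= (R + 2)\<^sup>2 - (norm z)\<^sup>2" using assms(2) by (simp add: power2_eq_square algebra_simps)
qed

lemma cutoff_eventually_one: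
 assumes K: "compact K" "K \<subseteq> (slab a b :: ((real^'n) \<times> (real^'m)) set)" and R: "R > 0"
 shows "\<exists>N>0. \<forall>n\<ge>N. \<forall>x\<in>K. (\<forall>i. edge' n (a $ i) (b $ i) (snd x $ i) = 0) & (norm (fst x) <= R --> cutoff R a b n x = 1)"
proof -
 obtain d where d: "d > 0" "!!x i. x \<in> K ==> d <= snd x $ i - a $ i" "!!x i. x \<in> K ==> d <= b $ i - snd x $ i"
  using compact_slab_margin[OF K] by metis
 show ?thesis
 proof (intro exI[of _ "2 / d"] conjI allI impI ballI)
  show "2 / d > 0" using d by simp
  fix n x assume n: "2 / d <= n" and x: "x \<in> K"
  have np: "n > 0" using n d(1) by (meson divide_pos_pos less_le_trans zero_less_numeral)
  have nd: "2 / n <= d" using n d(1) np by (simp add: field_simps)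
  have e: "2 / n <= snd x $ i - a $ i" "2 / n <= b $ i - snd x $ i" for i using d(2,3)[OF x, of i] nd by linarith+
  show "edge' n (a $ i) (b $ i) (snd x $ i) = 0" for i by (rule edge_one(2)[OF np e])
  assume z: "norm (fst x) <= R"
  show "cutoff R a b n x = 1" using radial_factor_one[of "fst x" R] z R by (simp add: cutoff_def edge_one(1)[OF np e])
 qed
qed

lemma cutoff_grad:
 fixes x :: "(real^'n) \<times> (real^'m)"
 assumes x: "norm (fst x) < R + 1" and R: "R > 0"
 shows "grad (cutoff R a b n) x \<bullet> w = (\<Sum>i\<in>UNIV. edge' n (a $ i) (b $ i) (snd x $ i) * (w \<bullet> tdir i) * (\<Prod>j\<in>UNIV - {i}. edge n (a $ j) (b $ j) (snd x $ j)))"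
proof -
 let ?f = "%x::(real^'n) \<times> (real^'m). \<Prod>i\<in>UNIV. edge n (a $ i) (b $ i) (snd x $ i)"
 let ?P = "%i. \<Prod>j\<in>UNIV - {i}. edge n (a $ j) (b $ j) (snd x $ j)"
 have o: "open {x::(real^'n) \<times> (real^'m). norm (fst x) < R + 1}" by (intro open_Collect_less continuous_intros)
 have "grad (cutoff R a b n) x = grad ?f x"
  by (rule grad_cong[OF o]) (use x R in \<open>auto simp: cutoff_def radial_factor_one\<close>)
 also have "... = (\<Sum>i\<in>UNIV. (edge' n (a $ i) (b $ i) (snd x $ i) * ?P i) *\<^sub>R tdir i)"
 proof (rule grad_eqI)
  have e: "((%x::(real^'n) \<times> (real^'m). edge n (a $ i) (b $ i) (snd x $ i)) has_derivative (%h. edge' n (a $ i) (b $ i) (snd x $ i) * (h \<bullet> tdir i))) (at x)" for i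
  proof (rule has_derivative_eq_rhs[OF has_derivative_compose[where f="%x::(real^'n) \<times> (real^'m). snd x $ i" and g="edge n (a $ i) (b $ i)", OF _ edge_deriv[unfolded has_field_derivative_def]]])
   have "((%x::(real^'n) \<times> (real^'m). x \<bullet> tdir i) has_derivative (%h. h \<bullet> tdir i)) (at x)" by (auto intro!: derivative_eq_intros)
   then show "((%x::(real^'n) \<times> (real^'m). snd x $ i) has_derivative (%h. h \<bullet> tdir i)) (at x)" by (simp only: inner_tdir)
  qed simp
  have "(?f has_derivative (%h. \<Sum>i\<in>UNIV. (edge' n (a $ i) (b $ i) (snd x $ i) * (h \<bullet> tdir i)) * ?P i)) (at x)"
   by (rule has_derivative_prod) (rule e)
  then show "(?f has_derivative (%h. (\<Sum>i\<in>UNIV. (edge' n (a $ i) (b $ i) (snd x $ i) * ?P i) *\<^sub>R tdir i) \<bullet> h)) (at x)"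
   by (rule has_derivative_eq_rhs) (simp add: inner_sum_left inner_sum_right inner_commute mult_ac)
 qed
 finally show ?thesis by (simp add: inner_sum_left inner_sum_right inner_commute mult_ac)
qed

lemma cutoff_grad_bound:
 fixes x :: "(real^'n) \<times> (real^'m)"
 assumes x: "norm (fst x) < R + 1" and R: "R > 0"
 shows "\<bar>grad (cutoff R a b n) x \<bullet> w\<bar> <= (\<Sum>i\<in>UNIV. \<bar>edge' n (a $ i) (b $ i) (snd x $ i)\<bar> * \<bar>w \<bullet> tdir i\<bar>)"
 unfolding cutoff_grad[OF assms]
proof (rule order_trans[OF sum_abs], rule sum_mono)
 fix i
 let ?P = "\<Prod>j\<in>UNIV - {i}. edge n (a $ j) (b $ j) (snd x $ j)"
 have P: "0 <= ?P" "?P <= 1" using edge_bounds by (auto intro!: prod_nonneg prod_le_1)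
 then have "(\<bar>edge' n (a $ i) (b $ i) (snd x $ i)\<bar> * \<bar>w \<bullet> tdir i\<bar>) * ?P <= (\<bar>edge' n (a $ i) (b $ i) (snd x $ i)\<bar> * \<bar>w \<bullet> tdir i\<bar>) * 1"
  by (intro mult_left_mono) auto
 then show "\<bar>edge' n (a $ i) (b $ i) (snd x $ i) * (w \<bullet> tdir i) * ?P\<bar> <= \<bar>edge' n (a $ i) (b $ i) (snd x $ i)\<bar> * \<bar>w \<bullet> tdir i\<bar>"
  using P by (simp add: abs_mult)
qed

lemma cutoff_grad_outside:
 fixes x :: "(real^'n) \<times> (real^'m)"
 assumes n: "n > 0" and x: "x ~: slab a b"
 shows "cutoff R a b n x = 0" "grad (cutoff R a b n) x = 0"
proof -
 obtain K where K: "compact K" "K \<subseteq> (slab a b :: ((real^'n) \<times> (real^'m)) set)" "!!x. x ~: K ==> cutoff R a b n x = 0"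
  using cutoff_support[OF n] by metis
 show "cutoff R a b n x = 0" using K x by blast
 have "grad (cutoff R a b n) x = grad (%x. 0) x"
  by (rule grad_cong[of "- K"]) (use x K in \<open>auto simp: compact_imp_closed open_Compl\<close>)
 then show "grad (cutoff R a b n) x = 0" by (simp add: grad_def)
qed

lemma thin_box_volume:
 fixes l v :: "'a::euclidean_space"
 assumes e: "e \<in> Basis" and lv: "!!b. b \<in> Basis ==> l \<bullet> b <= v \<bullet> b"
 shows "measure lborel (cbox l v) = ((v - l) \<bullet> e) * (\<Prod>b\<in>Basis - {e}. (v - l) \<bullet> b)"
 using lv by (simp add: prod.remove[OF finite_Basis e])

section \<open>Cheeger sets relative to a slab\<close>

lemma C1_differentiable: "Ck_on 1 UNIV f ==> f differentiable (at x)"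
 by (simp add: differentiable_on_def)

locale slab_problem = cylinder_problem \<Omega> u \<nu> \<beta> \<alpha> lam R + torsion_exterior \<Omega> u \<xi> \<beta>
 for \<Omega> :: "((real^'n) \<times> (real^'m)) set" and u \<nu> \<beta> \<alpha> lam R \<xi> +
 fixes a b :: "real^'m"
 assumes a_lattice: "\<exists>k::int. a $ i = lam * of_int k" and b_lattice: "\<exists>k::int. b $ i = lam * of_int k"
  and ab: "a $ i < b $ i"
begin

abbreviation E :: "((real^'n) \<times> (real^'m)) set" where "E \<equiv> \<Omega> \<inter> slab a b"

abbreviation \<zeta> :: "nat => (real^'n) \<times> (real^'m) => real" where "\<zeta> k \<equiv> cutoff R a b (real (Suc k))"

definition q :: real where "q = norm a + norm b"

text \<open>Large enough for the ball to contain \<open>\<Omega> \<inter> S\<close> and its mirror images in the faces.\<close>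

definition rad :: real where "rad = R + real CARD('m) * q + 4 * q + 1"

lemma q_nonneg: "0 <= q" by (simp add: q_def)

lemma face_bound: "\<bar>a $ i\<bar> <= q" "\<bar>b $ i\<bar> <= q"
 using component_le_norm_cart[of a i] component_le_norm_cart[of b i] norm_ge_zero[of a] norm_ge_zero[of b]
 unfolding q_def by linarith+

lemma snd_bound: "x \<in> E ==> \<bar>snd x $ i\<bar> <= q"
 using face_bound[of i] by (auto simp: in_slab intro!: abs_leI dest!: spec[of _ i])

lemma norm_E: assumes "x \<in> E" shows "norm x <= R + real CARD('m) * q"
proof -
 have "norm x <= norm (fst x) + norm (snd x)"
  by (cases x) (simp add: norm_Pair sqrt_sum_squares_le_sum)
 moreover have "norm (snd x) <= (\<Sum>i\<in>UNIV. \<bar>snd x $ i\<bar>)" by (rule norm_le_l1_cart)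
 moreover have "(\<Sum>i\<in>UNIV. \<bar>snd x $ i\<bar>) <= (\<Sum>i\<in>(UNIV :: 'm set). q)" using snd_bound[OF assms] by (intro sum_mono)
 ultimately show ?thesis using fst_bound[of x] assms by simp
qed

lemma E_cball: "x \<in> E ==> x \<in> \<Omega> \<inter> ball 0 rad"
 using norm_E[of x] q_nonneg by (simp add: rad_def)

lemma E_reflect: assumes "x \<in> E" "\<bar>c\<bar> <= q" shows "reflect i c x \<in> cball 0 rad"
proof -
 have "norm (reflect i c x) <= norm x + \<bar>2 * c - 2 * (snd x $ i)\<bar>"
  unfolding reflect_def inner_tdir
  using norm_triangle_ineq[of x "(2 * c - 2 * (snd x $ i)) *\<^sub>R tdir i"] by (simp add: norm_tdir)
 then show ?thesis using norm_E[OF assms(1)] snd_bound[OF assms(1), of i] assms(2) by (simp add: rad_def)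
qed

lemma E_borel: "E \<in> sets borel" by (intro borel_open open_Int open_dom open_slab)

lemma E_finite: "emeasure lborel E < \<infinity>"
proof (rule emeasure_bounded_finite)
 have "E \<subseteq> ball 0 rad" using E_cball by blast
 then show "bounded E" using bounded_subset bounded_ball by blast
qed

lemma subset_E_finite: "A \<subseteq> E ==> emeasure lborel A < \<infinity>"
 using emeasure_mono[of A E lborel] E_borel E_finite by (auto intro: le_less_trans)

lemma partials_lipschitz:
 "\<exists>L\<ge>0. \<forall>e\<in>Basis. \<forall>x\<in>\<Omega> \<inter> cball 0 rad. \<forall>y\<in>\<Omega> \<inter> cball 0 rad. \<bar>partial_deriv e u x - partial_deriv e u y\<bar> <= L * norm (x - y)"
proof -
 have "\<exists>L\<ge>0. \<forall>x\<in>\<Omega> \<inter> cball 0 rad. \<forall>y\<in>\<Omega> \<inter> cball 0 rad. \<bar>partial_deriv e u x - partial_deriv e u y\<bar> <= L * norm (x - y)"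
  if e: "e \<in> Basis" for e
 proof (rule partial_lipschitz_bounded[OF e])
  show "\<bar>partial_deriv e u x\<bar> <= \<beta>" if "x \<in> \<Omega>" for x
   using Basis_le_norm[OF e, of "grad u x"] gradient_bound[OF that] by (simp add: grad_inner_Basis[OF e])
 qed
 then obtain L where L: "!!e. e \<in> Basis ==> L e \<ge> 0" "!!e x y. e \<in> Basis ==> x \<in> \<Omega> \<inter> cball 0 rad ==> y \<in> \<Omega> \<inter> cball 0 rad ==>
   \<bar>partial_deriv e u x - partial_deriv e u y\<bar> <= L e * norm (x - y)" by metis
 have Ls: "L e <= (\<Sum>e\<in>Basis. L e)" if "e \<in> Basis" for e
  using L(1) that by (intro member_le_sum) auto
 show ?thesis
 proof (intro exI[of _ "\<Sum>e\<in>Basis. L e"] conjI ballI)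
  show "0 <= (\<Sum>e\<in>Basis. L e)" using L(1) by (intro sum_nonneg)
  fix e x y :: "(real^'n) \<times> (real^'m)" assume e: "e \<in> Basis" "x \<in> \<Omega> \<inter> cball 0 rad" "y \<in> \<Omega> \<inter> cball 0 rad"
  have "L e * norm (x - y) <= (\<Sum>e\<in>Basis. L e) * norm (x - y)" using Ls[OF e(1)] by (intro mult_right_mono) auto
  then show "\<bar>partial_deriv e u x - partial_deriv e u y\<bar> <= (\<Sum>e\<in>Basis. L e) * norm (x - y)"
   using L(2)[OF e] by linarith
 qed
qed

lemma \<xi>_component: "x \<in> \<Omega> ==> e \<in> Basis ==> \<xi> x \<bullet> e = partial_deriv e u x / \<beta>"
 using \<xi>_eq[of x] by (simp add: grad_inner_Basis field_simps)

text \<open>On the faces \<open>\<nabla>u\<close> is tangential by symmetry, and it is Lipschitz.\<close>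

lemma \<xi>_tangential:
 "\<exists>C\<ge>0. \<forall>x\<in>E. \<forall>i. \<bar>\<xi> x \<bullet> tdir i\<bar> <= C * \<bar>snd x $ i - a $ i\<bar> & \<bar>\<xi> x \<bullet> tdir i\<bar> <= C * \<bar>snd x $ i - b $ i\<bar>"
proof -
 obtain L where L: "L \<ge> 0" "!!e x y. e \<in> Basis ==> x \<in> \<Omega> \<inter> cball 0 rad ==> y \<in> \<Omega> \<inter> cball 0 rad ==>
   \<bar>partial_deriv e u x - partial_deriv e u y\<bar> <= L * norm (x - y)" using partials_lipschitz by blast
 have face: "\<bar>\<xi> x \<bullet> tdir i\<bar> <= L / \<beta> * \<bar>snd x $ i - c\<bar>" if x: "x \<in> E" and c: "\<exists>k::int. c = lam * of_int k" "\<bar>c\<bar> <= q" for x i c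
 proof -
  obtain k :: int where k: "c = lam * of_int k" using c by blast
  have "\<bar>partial_deriv (tdir i) u x\<bar> <= L * \<bar>snd x $ i - lam * of_int k\<bar>"
  proof (rule tangency[OF L(2)[OF tdir_Basis]])
   show "x \<in> \<Omega> \<inter> cball 0 rad" using E_cball[OF x] ball_subset_cball by blast
   show "reflect i (lam * of_int k) x \<in> cball 0 rad" using E_reflect[OF x c(2), of i] k by simp
  qed auto
  moreover have "\<xi> x \<bullet> tdir i = partial_deriv (tdir i) u x / \<beta>" using x by (intro \<xi>_component tdir_Basis) auto
  ultimately show ?thesis using \<beta>_pos k by (simp add: field_simps)
 qed
 show ?thesis
  using L(1) \<beta>_pos face a_lattice b_lattice face_bound by (intro exI[of _ "L / \<beta>"] conjI ballI allI) auto
qed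

lemma \<xi>_extension:
 "\<exists>F L. L-lipschitz_on UNIV F & (\<forall>x. norm (F x) <= 1) & (\<forall>x\<in>\<Omega> \<inter> cball 0 rad. F x = \<xi> x)"
proof -
 obtain L where L: "L \<ge> 0" "!!e x y. e \<in> Basis ==> x \<in> \<Omega> \<inter> cball 0 rad ==> y \<in> \<Omega> \<inter> cball 0 rad ==>
   \<bar>partial_deriv e u x - partial_deriv e u y\<bar> <= L * norm (x - y)" using partials_lipschitz by blast
 let ?N = "real (DIM((real^'n) \<times> (real^'m)))"
 have "(?N * (L / \<beta>))-lipschitz_on (\<Omega> \<inter> cball 0 rad) \<xi>"
 proof (rule lipschitz_onI)
  fix x y assume x: "x \<in> \<Omega> \<inter> cball 0 rad" "y \<in> \<Omega> \<inter> cball 0 rad"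
  have "\<bar>(\<xi> x - \<xi> y) \<bullet> e\<bar> <= L / \<beta> * dist x y" if e: "e \<in> Basis" for e
  proof -
   have "(\<xi> x - \<xi> y) \<bullet> e = (partial_deriv e u x - partial_deriv e u y) / \<beta>"
    using x \<xi>_component[OF _ e, of x] \<xi>_component[OF _ e, of y] by (simp add: inner_diff_left diff_divide_distrib)
   then show ?thesis using L(2)[OF e x] \<beta>_pos by (simp add: dist_norm field_simps)
  qed
  then have "(\<Sum>e\<in>Basis. \<bar>(\<xi> x - \<xi> y) \<bullet> e\<bar>) <= (\<Sum>e\<in>(Basis :: ((real^'n) \<times> (real^'m)) set). L / \<beta> * dist x y)" by (intro sum_mono)
  then have "norm (\<xi> x - \<xi> y) <= ?N * (L / \<beta> * dist x y)"
   using norm_le_l1[of "\<xi> x - \<xi> y"] by (simp only: sum_constant)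
  then show "dist (\<xi> x) (\<xi> y) <= ?N * (L / \<beta>) * dist x y" by (simp only: dist_norm mult.assoc)
 qed (use L(1) \<beta>_pos in \<open>intro mult_nonneg_nonneg, auto\<close>)
 from lipschitz_extension_unit_ball[OF this \<xi>_le]
 obtain F L' where "L'-lipschitz_on UNIV F" "!!x. norm (F x) <= 1" "!!x. x \<in> \<Omega> \<inter> cball 0 rad ==> F x = \<xi> x" by metis
 then show ?thesis by blast
qed

lemma \<xi>_C1: assumes e: "e \<in> Basis" shows "Ck_on 1 \<Omega> (%x. \<xi> x \<bullet> e)"
proof -
 have "Ck_on 1 \<Omega> (%x. 1 / \<beta> * partial_deriv e u x)" by (intro Ck_on_cmult open_dom u_partial_C1[OF e])
 then show ?thesis using Ck_on_cong[OF open_dom, of "%x. \<xi> x \<bullet> e" "%x. 1 / \<beta> * partial_deriv e u x" 1] \<xi>_component[OF _ e] by simp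
qed

lemma divergence_\<xi>: assumes x: "x \<in> \<Omega>" shows "divergence \<xi> x = - 1 / \<beta>"
proof -
 have "partial_deriv e (%y. \<xi> y \<bullet> e) x = 1 / \<beta> * partial_deriv e (partial_deriv e u) x" if e: "e \<in> Basis" for e
 proof -
  have "partial_deriv e (%y. \<xi> y \<bullet> e) x = partial_deriv e (%y. 1 / \<beta> * partial_deriv e u y) x"
   by (rule partial_deriv_cong[OF open_dom x]) (simp add: \<xi>_component[OF _ e])
  also have "... = 1 / \<beta> * partial_deriv e (partial_deriv e u) x"
   using u_partial_C1[OF e] x open_dom by (intro partial_deriv_cmult) (auto simp: differentiable_on_open)
  finally show ?thesis .
 qed
 then have "divergence \<xi> x = 1 / \<beta> * laplacian u x" unfolding divergence_def laplacian_def by (simp add: sum_distrib_left)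
 then show ?thesis using laplace[OF x] by simp
qed

lemma \<zeta>_bounds: "0 <= \<zeta> k x" "\<zeta> k x <= 1" by (rule cutoff_bounds)+

lemma \<zeta>_differentiable: "\<zeta> k differentiable (at x)"
 by (rule C1_differentiable[OF cutoff_C1])

lemma \<zeta>_grad_continuous: "continuous_on UNIV (grad (\<zeta> k))"
 unfolding grad_def using cutoff_C1[of R a b "real (Suc k)"] by (intro continuous_intros) auto

lemma \<zeta>_grad_tangential: "\<exists>C\<ge>0. \<forall>k. \<forall>x\<in>E. \<bar>\<xi> x \<bullet> grad (\<zeta> k) x\<bar> <= C"
proof -
 obtain C where C: "C \<ge> 0" "!!x i. x \<in> E ==> \<bar>\<xi> x \<bullet> tdir i\<bar> <= C * \<bar>snd x $ i - a $ i\<bar>"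
   "!!x i. x \<in> E ==> \<bar>\<xi> x \<bullet> tdir i\<bar> <= C * \<bar>snd x $ i - b $ i\<bar>" using \<xi>_tangential by blast
 have "\<bar>\<xi> x \<bullet> grad (\<zeta> k) x\<bar> <= (\<Sum>i\<in>(UNIV :: 'm set). 4 * C)" if x: "x \<in> E" for k x
 proof -
  have "norm (fst x) < R + 1" using fst_bound[of x] x by simp
  then have "\<bar>grad (\<zeta> k) x \<bullet> \<xi> x\<bar> <= (\<Sum>i\<in>UNIV. \<bar>edge' (real (Suc k)) (a $ i) (b $ i) (snd x $ i)\<bar> * \<bar>\<xi> x \<bullet> tdir i\<bar>)"
   by (rule cutoff_grad_bound[OF _ R_pos])
  also have "... <= (\<Sum>i\<in>(UNIV :: 'm set). 4 * C)"
   using C x by (intro sum_mono edge'_weighted) auto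
  finally show ?thesis by (simp add: inner_commute)
 qed
 then show ?thesis using C(1) by (intro exI[of _ "\<Sum>i\<in>(UNIV :: 'm set). 4 * C"] conjI) (auto intro: sum_nonneg)
qed

lemma \<zeta>_eventually:
 assumes K: "compact K" "K \<subseteq> slab a b"
 shows "\<exists>N. \<forall>k\<ge>N. \<forall>x\<in>K. norm (fst x) <= R --> \<zeta> k x = 1 & grad (\<zeta> k) x = 0"
proof -
 obtain N where N: "!!n x. n \<ge> N ==> x \<in> K ==> (\<forall>i. edge' n (a $ i) (b $ i) (snd x $ i) = 0) & (norm (fst x) <= R --> cutoff R a b n x = 1)"
  using cutoff_eventually_one[OF K R_pos] by blast
 show ?thesis
 proof (intro exI[of _ "nat \<lceil>N\<rceil>"] allI impI ballI conjI)
  fix k x assume k: "nat \<lceil>N\<rceil> <= k" and x: "x \<in> K" "norm (fst x) <= R"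
  have n: "real (Suc k) \<ge> N" using k by linarith
  show "\<zeta> k x = 1" using N[OF n x(1)] x(2) by blast
  have "grad (\<zeta> k) x \<bullet> grad (\<zeta> k) x = 0"
   using N[OF n x(1)] x(2) by (subst cutoff_grad[OF _ R_pos]) auto
  then show "grad (\<zeta> k) x = 0" by simp
 qed
qed

lemma \<zeta>_tendsto:
 assumes x: "x \<in> E"
 shows "(%k. \<zeta> k x) \<longlonglongrightarrow> 1" "(%k. grad (\<zeta> k) x) \<longlonglongrightarrow> 0"
proof -
 obtain N where N: "!!k. k \<ge> N ==> \<zeta> k x = 1 & grad (\<zeta> k) x = 0"
  using \<zeta>_eventually[of "{x}"] x fst_bound[of x] by auto
 show "(%k. \<zeta> k x) \<longlonglongrightarrow> 1" by (rule tendsto_eventually) (use N in \<open>auto simp: eventually_sequentially\<close>)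
 show "(%k. grad (\<zeta> k) x) \<longlonglongrightarrow> 0" by (rule tendsto_eventually) (use N in \<open>auto simp: eventually_sequentially\<close>)
qed

lemma restrict_integral:
 assumes "!!x. x \<in> \<Omega> ==> x ~: slab a b ==> f x = (0::real)"
 shows "(LBINT x:\<Omega>. f x) = (LBINT x:E. f x)"
 unfolding set_lebesgue_integral_def
 by (rule Bochner_Integration.integral_cong) (use assms in \<open>auto simp: indicator_def\<close>)

text \<open>The integrands are bounded by tangency and vanish eventually at every point.\<close>

lemma tangential_limit:
 assumes A: "A \<in> sets borel" "A \<subseteq> E" and \<phi>: "continuous_on UNIV \<phi>" "!!x. \<bar>\<phi> x\<bar> <= B"
 shows "(%k. LBINT x:A. \<phi> x * (\<xi> x \<bullet> grad (\<zeta> k) x)) \<longlonglongrightarrow> 0"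
proof -
 obtain C where C: "C \<ge> 0" "!!k x. x \<in> E ==> \<bar>\<xi> x \<bullet> grad (\<zeta> k) x\<bar> <= C" using \<zeta>_grad_tangential by blast
 have B: "B \<ge> 0" using \<phi>(2)[of 0] by linarith
 have "(%k. LBINT x:A. \<phi> x * (\<xi> x \<bullet> grad (\<zeta> k) x)) \<longlonglongrightarrow> (LBINT x:A. 0)"
 proof (rule set_integral_tendsto_bounded[OF A(1) subset_E_finite[OF A(2)], where C="B * C"])
  show "(%x. \<phi> x * (\<xi> x \<bullet> grad (\<zeta> k) x)) \<in> borel_measurable borel" for k
   by (intro borel_measurable_continuous_onI continuous_intros \<phi>(1) \<xi>_cont \<zeta>_grad_continuous)
  fix x assume x: "x \<in> A"
  then have xE: "x \<in> E" using A(2) by blast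
  show "\<bar>\<phi> x * (\<xi> x \<bullet> grad (\<zeta> k) x)\<bar> <= B * C" for k
   unfolding abs_mult using \<phi>(2) C(2)[OF xE] B by (intro mult_mono) auto
  have "(%k. \<phi> x * (\<xi> x \<bullet> grad (\<zeta> k) x)) \<longlonglongrightarrow> \<phi> x * (\<xi> x \<bullet> 0)" by (intro tendsto_intros \<zeta>_tendsto(2)[OF xE])
  then show "(%k. \<phi> x * (\<xi> x \<bullet> grad (\<zeta> k) x)) \<longlonglongrightarrow> 0" by simp
 qed simp
 then show ?thesis by (simp add: set_lebesgue_integral_def)
qed

lemma \<zeta>_limit:
 assumes A: "A \<in> sets borel" "A \<subseteq> E" and \<phi>: "continuous_on UNIV \<phi>" "!!x. \<bar>\<phi> x\<bar> <= B"
 shows "(%k. LBINT x:A. \<zeta> k x * \<phi> x) \<longlonglongrightarrow> (LBINT x:A. \<phi> x)"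
proof (rule set_integral_tendsto_bounded[OF A(1) subset_E_finite[OF A(2)], where C=B])
 show "(%x. \<zeta> k x * \<phi> x) \<in> borel_measurable borel" for k
  by (intro borel_measurable_continuous_onI continuous_intros \<phi>(1) cutoff_continuous)
 show "\<phi> \<in> borel_measurable borel" by (intro borel_measurable_continuous_onI \<phi>(1))
 fix x assume x: "x \<in> A"
 show "\<bar>\<zeta> k x * \<phi> x\<bar> <= B" for k
 proof -
  have "\<bar>\<zeta> k x\<bar> * \<bar>\<phi> x\<bar> <= 1 * B" using \<zeta>_bounds[of k x] \<phi>(2)[of x] by (intro mult_mono) auto
  then show ?thesis by (simp add: abs_mult)
 qed
 have xE: "x \<in> E" using A(2) x by blast
 have "(%k. \<zeta> k x * \<phi> x) \<longlonglongrightarrow> 1 * \<phi> x" by (intro tendsto_intros \<zeta>_tendsto(1)[OF xE])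
 then show "(%k. \<zeta> k x * \<phi> x) \<longlonglongrightarrow> \<phi> x" by simp
qed

text \<open>The surface of \<open>\<Omega>\<close> inside the slab has area \<open>|\<Omega> \<inter> S| / \<beta>\<close>: the flux of \<open>\<xi>\<close> through it is the integral of
the divergence, and nothing flows through the faces.\<close>

lemma \<Lambda>_\<zeta>: "(%k. \<Lambda> (\<zeta> k)) \<longlonglongrightarrow> measure lborel E / \<beta>"
proof -
 have eq: "\<Lambda> (\<zeta> k) = (LBINT x:E. \<zeta> k x * 1) / \<beta> - (LBINT x:E. 1 * (\<xi> x \<bullet> grad (\<zeta> k) x))" for k
 proof -
  have "(LBINT x:\<Omega>. \<zeta> k x) = (LBINT x:E. \<zeta> k x)"
   by (rule restrict_integral) (simp add: cutoff_grad_outside)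
  moreover have "(LBINT x:\<Omega>. \<xi> x \<bullet> grad (\<zeta> k) x) = (LBINT x:E. \<xi> x \<bullet> grad (\<zeta> k) x)"
   by (rule restrict_integral) (simp add: cutoff_grad_outside)
  moreover have "(LBINT x:\<Omega>. \<xi> x \<bullet> grad (\<zeta> k) x) = (LBINT x:\<Omega>. \<zeta> k x) / \<beta> - \<Lambda> (\<zeta> k)"
   by (rule \<Lambda>_identity[OF cutoff_Cc cutoff_C1]) simp
  ultimately show ?thesis by simp
 qed
 have "(%k. \<Lambda> (\<zeta> k)) \<longlonglongrightarrow> (LBINT x:E. 1) / \<beta> - 0"
  unfolding eq using E_borel by (intro tendsto_diff tendsto_divide tendsto_const \<zeta>_limit[where B=1] tangential_limit[where B=1]) (use \<beta>_pos in auto)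
 then show ?thesis by (simp add: set_integral_const_measure[OF E_borel])
qed

text \<open>The tested fields are \<open>\<eta> - \<zeta> k \<xi>\<close> with \<open>\<xi>\<close> replaced by its Lipschitz extension. For \<open>\<eta> = 0\<close> this bounds the
Cheeger ratio; nonzero \<open>\<eta>\<close> serve for uniqueness.\<close>

lemma calibration_inequality:
 assumes A: "A \<in> sets borel" "A \<subseteq> E" and \<eta>: "\<eta> \<in> test_fields E" "!!x. x \<in> E ==> norm (\<xi> x) + norm (\<eta> x) <= 1"
 shows "ereal ((LBINT x:A. divergence \<eta> x + 1 / \<beta>)) <= perimeter A (slab a b)"
proof -
 obtain F L where F: "L-lipschitz_on UNIV F" "!!x. norm (F x) <= 1" "!!x. x \<in> \<Omega> \<inter> cball 0 rad ==> F x = \<xi> x"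
  using \<xi>_extension by blast
 obtain K\<eta> where K\<eta>: "compact K\<eta>" "K\<eta> \<subseteq> E" "!!x. x ~: K\<eta> ==> \<eta> x = 0" using test_fieldsD[OF \<eta>(1)] by blast
 obtain M where M: "M-lipschitz_on UNIV \<eta>" using test_field_lipschitz[OF \<eta>(1)] by blast
 have \<eta>C: "Ck_on 1 U (%x. \<eta> x \<bullet> e)" if "e \<in> Basis" "open U" for e U
  using Ck_on_subset[OF test_functions_Ck[OF test_fields_component[OF \<eta>(1) that(1)]]] that by blast
 define W where "W = \<Omega> \<inter> ball 0 rad"
 have W: "open W" "A \<subseteq> W"
  unfolding W_def by (intro open_Int open_dom open_ball) (use E_cball A(2) in blast)
 have FW: "F x = \<xi> x" if "x \<in> W" for x using F(3)[of x] that by (auto simp: W_def)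
 define V where "V = (%k x. \<eta> x - \<zeta> k x *\<^sub>R F x)"
 have bound: "ereal (LBINT x:A. divergence (V k) x) <= perimeter A (slab a b)" for k
 proof -
  obtain K where K: "compact K" "K \<subseteq> slab a b" "!!x. x ~: K ==> \<zeta> k x = 0"
   using cutoff_support[of "real (Suc k)" a b R] by (metis of_nat_0_less_iff zero_less_Suc)
  obtain L\<zeta> where L\<zeta>: "L\<zeta>-lipschitz_on UNIV (\<zeta> k)" using lipschitz_of_C1_compact_support[OF cutoff_C1 K(1,3)] by metis
  show ?thesis
  proof (rule integral_divergence_le_perimeter[where V="V k" and K="K \<union> K\<eta>" and W=W])
   show "(M + (L\<zeta> + L))-lipschitz_on UNIV (V k)"
    unfolding V_def
   proof (rule lipschitz_on_diff[OF M lipschitz_on_scaleR_bounded[OF L\<zeta> _ F(1,2)]])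
    show "\<bar>\<zeta> k x\<bar> <= 1" for x using \<zeta>_bounds[of k x] by simp
   qed
   show "norm (V k x) <= 1" for x
   proof (cases "x \<in> K\<eta>")
    case True
    then have xE: "x \<in> E" using K\<eta> by blast
    then have "x \<in> \<Omega> \<inter> ball 0 rad" by (rule E_cball)
    then have "x \<in> \<Omega> \<inter> cball 0 rad" using ball_subset_cball by blast
    then have Fx: "F x = \<xi> x" by (rule F(3))
    have "norm (V k x) <= norm (\<eta> x) + \<bar>\<zeta> k x\<bar> * norm (\<xi> x)"
     unfolding V_def Fx using norm_triangle_ineq4[of "\<eta> x" "\<zeta> k x *\<^sub>R \<xi> x"] by simp
    also have "... <= norm (\<eta> x) + 1 * norm (\<xi> x)"
     using \<zeta>_bounds[of k x] by (intro add_left_mono mult_right_mono) auto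
    also have "... <= 1" using \<eta>(2)[OF xE] by simp
    finally show ?thesis .
   next
    case False
    have "\<bar>\<zeta> k x\<bar> * norm (F x) <= 1 * 1" using \<zeta>_bounds[of k x] F(2) by (intro mult_mono) auto
    then show ?thesis using K\<eta>(3)[OF False] by (simp add: V_def)
   qed
   show "compact (K \<union> K\<eta>)" "K \<union> K\<eta> \<subseteq> slab a b" using K K\<eta> by auto
   show "V k x = 0" if "x ~: K \<union> K\<eta>" for x using that K(3) K\<eta>(3) by (simp add: V_def)
   show "open (slab a b :: ((real^'n) \<times> (real^'m)) set)" by (rule open_slab)
   show "emeasure lborel A < \<infinity>" by (rule subset_E_finite[OF A(2)])
   show "Ck_on 1 W (%x. V k x \<bullet> e)" if e: "e \<in> Basis" for e
   proof -
    have x1: "Ck_on 1 W (%x. \<xi> x \<bullet> e)" using Ck_on_subset[OF \<xi>_C1[OF e]] by (simp add: W_def)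
    have c1: "Ck_on 1 W (\<zeta> k)" by (rule Ck_on_subset[OF cutoff_C1 subset_UNIV])
    have "Ck_on 1 W (%x. \<eta> x \<bullet> e - \<zeta> k x * (\<xi> x \<bullet> e))"
     by (intro Ck_on_diff Ck_on_mult W(1) \<eta>C[OF e W(1)] x1 c1)
    then show ?thesis
     using Ck_on_cong[OF W(1), of "%x. V k x \<bullet> e" "%x. \<eta> x \<bullet> e - \<zeta> k x * (\<xi> x \<bullet> e)" 1] FW
     by (simp add: V_def inner_diff_left)
   qed
  qed (use A W in auto)
 qed
 have div: "divergence (V k) x = divergence \<eta> x + (\<zeta> k x * (1 / \<beta>) - 1 * (\<xi> x \<bullet> grad (\<zeta> k) x))" if x: "x \<in> A" for k x
 proof -
  have xW: "x \<in> W" and xO: "x \<in> \<Omega>" using x A(2) W(2) by auto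
  have d\<xi>: "(%y. \<xi> y \<bullet> e) differentiable (at x)" if "e \<in> Basis" for e
   using \<xi>_C1[OF that] xO open_dom by (auto simp: differentiable_on_open)
  have d\<eta>: "(%y. \<eta> y \<bullet> e) differentiable (at x)" if "e \<in> Basis" for e
   by (rule C1_differentiable[OF \<eta>C[OF that open_UNIV]])
  have p: "partial_deriv e (%y. V k y \<bullet> e) x = partial_deriv e (%y. \<eta> y \<bullet> e) x - partial_deriv e (%y. (\<zeta> k y *\<^sub>R \<xi> y) \<bullet> e) x" if e: "e \<in> Basis" for e
  proof -
   have dm: "(%y. \<zeta> k y * (\<xi> y \<bullet> e)) differentiable (at x)" by (intro differentiable_mult \<zeta>_differentiable d\<xi>[OF e])
   have "partial_deriv e (%y. V k y \<bullet> e) x = partial_deriv e (%y. \<eta> y \<bullet> e + (- 1) * (\<zeta> k y * (\<xi> y \<bullet> e))) x"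
    by (rule partial_deriv_cong[OF W(1) xW]) (simp add: V_def FW inner_diff_left)
   also have "... = partial_deriv e (%y. \<eta> y \<bullet> e) x + partial_deriv e (%y. (- 1) * (\<zeta> k y * (\<xi> y \<bullet> e))) x"
    by (rule partial_deriv_add[OF d\<eta>[OF e] differentiable_mult[OF differentiable_const dm]])
   also have "partial_deriv e (%y. (- 1) * (\<zeta> k y * (\<xi> y \<bullet> e))) x = (- 1) * partial_deriv e (%y. \<zeta> k y * (\<xi> y \<bullet> e)) x"
    by (rule partial_deriv_cmult[OF dm])
   finally show ?thesis by simp
  qed
  have "divergence (V k) x = divergence \<eta> x - divergence (%y. \<zeta> k y *\<^sub>R \<xi> y) x"
   unfolding divergence_def using p by (simp add: sum_subtractf)
  also have "divergence (%y. \<zeta> k y *\<^sub>R \<xi> y) x = \<zeta> k x * divergence \<xi> x + \<xi> x \<bullet> grad (\<zeta> k) x"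
   by (rule divergence_scaleR[OF \<zeta>_differentiable d\<xi>])
  finally show ?thesis by (simp add: divergence_\<xi>[OF xO])
 qed
 have cd: "continuous_on UNIV (divergence \<eta>)" by (rule divergence_borel[OF \<eta>(1)])
 have dz: "divergence \<eta> x = 0" if "x ~: K\<eta>" for x
  by (rule divergence_off_support[OF compact_imp_closed[OF K\<eta>(1)] K\<eta>(3) that])
 obtain B where B: "B > 0" "!!x. norm (divergence \<eta> x) <= B" using bounded_compact_support[OF cd K\<eta>(1) dz] by metis
 obtain C where C: "C \<ge> 0" "!!k x. x \<in> E ==> \<bar>\<xi> x \<bullet> grad (\<zeta> k) x\<bar> <= C" using \<zeta>_grad_tangential by blast
 have "(%k. LBINT x:A. divergence \<eta> x + (\<zeta> k x * (1 / \<beta>) - 1 * (\<xi> x \<bullet> grad (\<zeta> k) x))) \<longlonglongrightarrow> (LBINT x:A. divergence \<eta> x + 1 / \<beta>)"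
 proof (rule set_integral_tendsto_bounded[OF A(1) subset_E_finite[OF A(2)], where C="B + (1 / \<beta> + C)"])
  show "(%x. divergence \<eta> x + (\<zeta> k x * (1 / \<beta>) - 1 * (\<xi> x \<bullet> grad (\<zeta> k) x))) \<in> borel_measurable borel" for k
   by (intro borel_measurable_continuous_onI continuous_intros cd cutoff_continuous \<xi>_cont \<zeta>_grad_continuous)
  show "(%x. divergence \<eta> x + 1 / \<beta>) \<in> borel_measurable borel"
   by (intro borel_measurable_continuous_onI continuous_intros cd)
  fix x assume x: "x \<in> A"
  then have xE: "x \<in> E" using A(2) by blast
  show "\<bar>divergence \<eta> x + (\<zeta> k x * (1 / \<beta>) - 1 * (\<xi> x \<bullet> grad (\<zeta> k) x))\<bar> <= B + (1 / \<beta> + C)" for k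
  proof -
   have "\<zeta> k x * (1 / \<beta>) <= 1 * (1 / \<beta>)" "0 <= \<zeta> k x * (1 / \<beta>)"
    using \<zeta>_bounds[of k x] \<beta>_pos by (intro mult_right_mono mult_nonneg_nonneg; simp)+
   then show ?thesis using B(2)[of x] C(2)[OF xE, of k] unfolding real_norm_def by linarith
  qed
  have "(%k. divergence \<eta> x + (\<zeta> k x * (1 / \<beta>) - 1 * (\<xi> x \<bullet> grad (\<zeta> k) x))) \<longlonglongrightarrow> divergence \<eta> x + (1 * (1 / \<beta>) - 1 * (\<xi> x \<bullet> 0))"
   by (intro tendsto_intros \<zeta>_tendsto[OF xE])
  then show "(%k. divergence \<eta> x + (\<zeta> k x * (1 / \<beta>) - 1 * (\<xi> x \<bullet> grad (\<zeta> k) x))) \<longlonglongrightarrow> divergence \<eta> x + 1 / \<beta>" by simp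
 qed
 moreover have "(LBINT x:A. divergence (V k) x) = (LBINT x:A. divergence \<eta> x + (\<zeta> k x * (1 / \<beta>) - 1 * (\<xi> x \<bullet> grad (\<zeta> k) x)))" for k
  using A(1) div by (intro set_lebesgue_integral_cong) auto
 ultimately have "(%k. LBINT x:A. divergence (V k) x) \<longlonglongrightarrow> (LBINT x:A. divergence \<eta> x + 1 / \<beta>)" by simp
 then have "(%k. ereal (LBINT x:A. divergence (V k) x)) \<longlonglongrightarrow> ereal (LBINT x:A. divergence \<eta> x + 1 / \<beta>)" by simp
 then show ?thesis by (rule LIMSEQ_le_const2) (use bound in blast)
qed

lemma perimeter_lower:
 assumes A: "A \<in> sets borel" "A \<subseteq> E"
 shows "ereal (measure lborel A / \<beta>) <= perimeter A (slab a b)"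
proof -
 have z: "(%x. 0) \<in> test_fields E"
  unfolding test_fields_def by (auto intro!: test_functionsI[where K="{}"] Ck_on_const)
 have "ereal (LBINT x:A. divergence (%x. 0) x + 1 / \<beta>) <= perimeter A (slab a b)"
  by (rule calibration_inequality[OF A z]) (simp add: \<xi>_le)
 moreover have "divergence (%x. 0) x = 0" for x :: "(real^'n) \<times> (real^'m)" by (simp add: divergence_def)
 ultimately show ?thesis by (simp add: set_integral_const_measure[OF A(1)])
qed

text \<open>The flux of \<open>\<eta>\<close> is at most the surface area inside the slab, because a cutoff equals one on the support of
\<open>\<eta>\<close> within the cylinder.\<close>

lemma flux_upper:
 assumes \<eta>: "\<eta> \<in> test_fields (slab a b)" "!!x. norm (\<eta> x) <= 1"
 shows "(LBINT x:E. divergence \<eta> x) <= measure lborel E / \<beta>"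
proof -
 obtain K where K: "compact K" "K \<subseteq> slab a b" "!!x. x ~: K ==> \<eta> x = 0" using test_fieldsD[OF \<eta>(1)] by blast
 have dz: "divergence \<eta> x = 0" if "x ~: K" for x
  by (rule divergence_off_support[OF compact_imp_closed[OF K(1)] K(3) that])
 have "(LBINT x:\<Omega>. divergence \<eta> x) = (LBINT x:E. divergence \<eta> x)"
  using dz K(2) by (intro restrict_integral) auto
 then have eq: "(LBINT x:E. divergence \<eta> x) <= \<Lambda> (%x. norm (\<eta> x))"
  using \<Lambda>_test_field(1)[OF \<eta>(1)] flux_le_norm[OF \<eta>(1)] by simp
 obtain N where N: "!!k x. k \<ge> N ==> x \<in> K ==> norm (fst x) <= R ==> \<zeta> k x = 1" using \<zeta>_eventually[OF K(1,2)] by blast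
 have le: "\<Lambda> (%x. norm (\<eta> x)) <= \<Lambda> (\<zeta> k)" if k: "k \<ge> N" for k
 proof -
  have C: "\<zeta> k \<in> Cc" by (rule cutoff_Cc) simp
  have fC: "(%x. min (norm (\<eta> x)) (\<zeta> k x)) \<in> Cc"
  proof (rule CcI[OF _ K(1)])
   show "continuous_on UNIV (%x. min (norm (\<eta> x)) (\<zeta> k x))"
    by (intro continuous_intros test_fields_continuous[OF \<eta>(1)] cutoff_continuous)
   show "min (norm (\<eta> x)) (\<zeta> k x) = 0" if "x ~: K" for x
    using K(3)[OF that] \<zeta>_bounds[of k x] by simp
  qed
  have "\<Lambda> (%x. norm (\<eta> x)) = \<Lambda> (%x. min (norm (\<eta> x)) (\<zeta> k x))"
  proof (rule \<Lambda>_cong[OF test_fields_Cc_norm[OF \<eta>(1)] fC])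
   fix x assume x: "x \<in> frontier \<Omega>"
   have "norm (fst x) <= R" by (rule fst_bound_closure[OF frontier_closure[OF x]])
   then show "norm (\<eta> x) = min (norm (\<eta> x)) (\<zeta> k x)"
    using N[OF k, of x] \<eta>(2)[of x] K(3)[of x] \<zeta>_bounds[of k x] by (cases "x \<in> K") auto
  qed
  also have "... <= \<Lambda> (\<zeta> k)" by (rule surface.Lam_mono[OF fC C]) simp
  finally show ?thesis .
 qed
 have "\<Lambda> (%x. norm (\<eta> x)) <= measure lborel E / \<beta>"
  by (rule LIMSEQ_le_const[OF \<Lambda>_\<zeta>]) (use le in blast)
 then show ?thesis using eq by linarith
qed

lemma perimeter_E: "perimeter E (slab a b) = ereal (measure lborel E / \<beta>)"
proof (rule antisym)
 show "perimeter E (slab a b) <= ereal (measure lborel E / \<beta>)"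
  unfolding perimeter_def by (rule SUP_least) (use flux_upper in auto)
 show "ereal (measure lborel E / \<beta>) <= perimeter E (slab a b)" by (rule perimeter_lower[OF E_borel]) simp
qed

text \<open>For a test function \<open>\<phi>\<close> in \<open>\<Omega>\<close> the product \<open>\<zeta> k \<phi>\<close> carries no surface mass, so the identity on \<open>\<Omega>\<close> passes to
\<open>\<Omega> \<inter> S\<close> in the limit; the error is the flux through the faces.\<close>

lemma trace_on_faces: "has_normal_trace (slab a b) \<Omega> \<xi> (%x. - (1 / \<beta> * indicat_real \<Omega> x)) (%_. 0)"
 unfolding has_normal_trace_def
proof (intro conjI ballI)
 show "\<exists>C. AE x in perimeter_measure (slab a b). \<bar>0::real\<bar> <= C" by (rule exI[of _ 0]) simp
 fix \<phi> :: "(real^'n) \<times> (real^'m) => real" assume \<phi>: "\<phi> \<in> test_functions \<Omega>"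
 obtain K where K: "compact K" "K \<subseteq> \<Omega>" "!!x. x ~: K ==> \<phi> x = 0" using test_functionsD[OF \<phi>] by blast
 note \<phi>C = test_functions_Cc[OF \<phi>]
 have \<phi>1: "Ck_on 1 UNIV \<phi>" by (rule test_functions_Ck[OF \<phi>])
 have \<phi>c: "continuous_on UNIV \<phi>" by (rule CcD(1)[OF \<phi>C])
 have d\<phi>: "\<phi> differentiable (at x)" for x by (rule C1_differentiable[OF \<phi>1])
 have gc: "continuous_on UNIV (grad \<phi>)" unfolding grad_def using \<phi>1 by (intro continuous_intros) auto
 have gz: "grad \<phi> x = 0" if "x ~: K" for x
 by (rule grad_off_support[OF compact_imp_closed[OF K(1)] K(3) that])
 have xg: "continuous_on UNIV (%x. \<xi> x \<bullet> grad \<phi> x)" by (intro continuous_intros \<xi>_cont gc)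
 obtain B1 where B1: "B1 > 0" "!!x. norm (\<phi> x) <= B1" using bounded_compact_support[OF \<phi>c K(1,3)] by metis
 obtain B2 where B2: "B2 > 0" "!!x. norm (\<xi> x \<bullet> grad \<phi> x) <= B2"
  using bounded_compact_support[OF xg K(1)] gz by (metis inner_zero_right)
 have eq: "(LBINT x:E. \<zeta> k x * (\<xi> x \<bullet> grad \<phi> x)) + (LBINT x:E. \<phi> x * (\<xi> x \<bullet> grad (\<zeta> k) x)) = (LBINT x:E. \<zeta> k x * \<phi> x) / \<beta>" for k
 proof -
  have c: "(%x. \<zeta> k x * \<phi> x) \<in> Cc" by (rule Cc_mult_continuous[OF cutoff_continuous \<phi>C])
  have "\<Lambda> (%x. \<zeta> k x * \<phi> x) = 0"
  proof (rule \<Lambda>_vanishing[OF c])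
   fix x assume "x \<in> frontier \<Omega>"
   then have "x ~: K" using K(2) frontier_notin by blast
   then show "\<zeta> k x * \<phi> x = 0" using K(3) by simp
  qed
  then have h1: "(LBINT x:\<Omega>. \<xi> x \<bullet> grad (%x. \<zeta> k x * \<phi> x) x) = (LBINT x:\<Omega>. \<zeta> k x * \<phi> x) / \<beta>"
   using \<Lambda>_identity[OF c Ck_on_mult[OF open_UNIV cutoff_C1 \<phi>1]] by simp
  have g: "\<xi> x \<bullet> grad (%x. \<zeta> k x * \<phi> x) x = \<zeta> k x * (\<xi> x \<bullet> grad \<phi> x) + \<phi> x * (\<xi> x \<bullet> grad (\<zeta> k) x)" for x
  proof -
   have "grad (%x. \<zeta> k x * \<phi> x) x = \<zeta> k x *\<^sub>R grad \<phi> x + \<phi> x *\<^sub>R grad (\<zeta> k) x"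
    unfolding grad_def partial_deriv_mult[OF \<zeta>_differentiable d\<phi>]
    by (simp add: sum.distrib scaleR_sum_right algebra_simps)
   then show ?thesis by (simp add: inner_add_right)
  qed
  have h2: "(LBINT x:\<Omega>. \<xi> x \<bullet> grad (%x. \<zeta> k x * \<phi> x) x) = (LBINT x:E. \<zeta> k x * (\<xi> x \<bullet> grad \<phi> x) + \<phi> x * (\<xi> x \<bullet> grad (\<zeta> k) x))"
   unfolding g by (rule restrict_integral) (simp add: cutoff_grad_outside)
  have h3: "(LBINT x:\<Omega>. \<zeta> k x * \<phi> x) = (LBINT x:E. \<zeta> k x * \<phi> x)"
   by (rule restrict_integral) (simp add: cutoff_grad_outside)
  have i: "set_integrable lborel E (%x. \<zeta> k x * (\<xi> x \<bullet> grad \<phi> x))" "set_integrable lborel E (%x. \<phi> x * (\<xi> x \<bullet> grad (\<zeta> k) x))"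
  proof -
   have "integrable lborel (%x. \<zeta> k x * (\<xi> x \<bullet> grad \<phi> x))"
   proof (rule integrable_compact_support[OF _ K(1)])
    show "continuous_on UNIV (%x. \<zeta> k x * (\<xi> x \<bullet> grad \<phi> x))" by (intro continuous_on_mult cutoff_continuous xg)
   qed (simp add: gz)
   then show "set_integrable lborel E (%x. \<zeta> k x * (\<xi> x \<bullet> grad \<phi> x))"
    unfolding set_integrable_def using E_borel by (intro integrable_mult_indicator) auto
   have "integrable lborel (%x. \<phi> x * (\<xi> x \<bullet> grad (\<zeta> k) x))"
   proof (rule integrable_compact_support[OF _ K(1)])
    show "continuous_on UNIV (%x. \<phi> x * (\<xi> x \<bullet> grad (\<zeta> k) x))" by (intro continuous_on_mult continuous_on_inner \<phi>c \<xi>_cont \<zeta>_grad_continuous)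
   qed (simp add: K(3))
   then show "set_integrable lborel E (%x. \<phi> x * (\<xi> x \<bullet> grad (\<zeta> k) x))"
    unfolding set_integrable_def using E_borel by (intro integrable_mult_indicator) auto
  qed
  show ?thesis using h1 unfolding h2 h3 set_integral_add(2)[OF i] .
 qed
 have "(%k. (LBINT x:E. \<zeta> k x * (\<xi> x \<bullet> grad \<phi> x)) + (LBINT x:E. \<phi> x * (\<xi> x \<bullet> grad (\<zeta> k) x)))
   \<longlonglongrightarrow> (LBINT x:E. \<xi> x \<bullet> grad \<phi> x) + 0"
  using E_borel B1 B2 by (intro tendsto_add \<zeta>_limit[where B=B2] tangential_limit[where B=B1] xg \<phi>c) auto
 moreover have "(%k. (LBINT x:E. \<zeta> k x * \<phi> x) / \<beta>) \<longlonglongrightarrow> (LBINT x:E. \<phi> x) / \<beta>"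
  using E_borel B1 \<beta>_pos by (intro tendsto_divide tendsto_const \<zeta>_limit[where B=B1] \<phi>c) auto
 ultimately have "(LBINT x:E. \<xi> x \<bullet> grad \<phi> x) = (LBINT x:E. \<phi> x) / \<beta>"
  unfolding eq using LIMSEQ_unique by fastforce
 moreover have "(LBINT x:E. - (1 / \<beta> * indicat_real \<Omega> x) * \<phi> x) = (LBINT x:E. (- (1 / \<beta>)) * \<phi> x)"
  using E_borel by (intro set_lebesgue_integral_cong) auto
 moreover have "(LBINT x:E. (- (1 / \<beta>)) * \<phi> x) = (- (1 / \<beta>)) * (LBINT x:E. \<phi> x)" by (rule set_integral_cmult)
 ultimately have "(LBINT x:E. \<xi> x \<bullet> grad \<phi> x) + (LBINT x:E. - (1 / \<beta> * indicat_real \<Omega> x) * \<phi> x) = 0" by simp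
 then show "(LBINT x:slab a b \<inter> \<Omega>. \<xi> x \<bullet> grad \<phi> x) + (LBINT x:slab a b \<inter> \<Omega>. - (1 / \<beta> * indicat_real \<Omega> x) * \<phi> x)
   = (LINT x:reduced_boundary (slab a b)|perimeter_measure (slab a b). 0 * \<phi> x)"
  by (simp add: Int_commute set_lebesgue_integral_def)
qed simp

lemma calibrable_slab: "calibrable \<Omega> (slab a b)"
 unfolding calibrable_def
proof (intro conjI exI)
 show "BV_loc (indicat_real \<Omega>)" by (rule BV_loc_indicator)
 show "set_borel_measurable lborel \<Omega> \<xi>"
  unfolding set_borel_measurable_def using borel_measurable_continuous_onI[OF \<xi>_cont] open_dom by auto
 show "AE x in lborel. x \<in> \<Omega> --> norm (\<xi> x) <= 1" by (simp add: \<xi>_le)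
 show "has_weak_divergence \<Omega> \<xi> (%x. - (1 / \<beta> * indicat_real \<Omega> x))" by (rule weak_divergence_\<xi>)
 show "has_normal_trace \<Omega> (slab a b) \<xi> (%x. - (1 / \<beta> * indicat_real \<Omega> x)) (%_. - 1)" by (rule normal_trace_\<xi>)
 show "has_normal_trace (slab a b) \<Omega> \<xi> (%x. - (1 / \<beta> * indicat_real \<Omega> x)) (%_. 0)" by (rule trace_on_faces)
qed auto

text \<open>The derivative is at most \<open>2 n\<close> and lives in two layers whose volume is proportional to \<open>2 / n\<close>. For the few \<open>n\<close>
with overlapping layers the trivial bound is used.\<close>

lemma edge_layers: "\<exists>C. \<forall>k. (LBINT x:E. \<bar>edge' (real (Suc k)) (a $ i) (b $ i) (snd x $ i)\<bar>) <= C"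
proof -
 define l0 v0 where "l0 = ((\<chi> j. - R, a) :: (real^'n) \<times> (real^'m))" and "v0 = ((\<chi> j. R, b) :: (real^'n) \<times> (real^'m))"
 define vol where "vol = (\<Prod>e\<in>Basis - {tdir i}. (v0 - l0) \<bullet> e)"
 have l0v0: "l0 \<bullet> e <= v0 \<bullet> e" if "e \<in> Basis" for e
  using that R_pos ab by (auto simp: l0_def v0_def Basis_prod_def Basis_vec_def inner_axis less_imp_le)
 have t0: "l0 \<bullet> tdir i = a $ i" "v0 \<bullet> tdir i = b $ i" by (simp_all add: inner_tdir l0_def v0_def)
 have P: "vol \<ge> 0" unfolding vol_def using l0v0 by (intro prod_nonneg) (auto simp: inner_diff_left)
 have in_box: "l0 \<bullet> e <= x \<bullet> e & x \<bullet> e <= v0 \<bullet> e" if x: "x \<in> E" and e: "e \<in> Basis" for x e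
 proof -
  have z: "\<bar>fst x $ j\<bar> <= R" for j using component_le_norm_cart[of "fst x" j] fst_bound[of x] x by simp
  have t: "a $ j <= snd x $ j" "snd x $ j <= b $ j" for j using x by (auto simp: in_slab less_imp_le)
  have z': "- R <= fst x $ j" "fst x $ j <= R" for j using z[of j] by linarith+
  show ?thesis using e z' t by (cases x) (auto simp: l0_def v0_def Basis_prod_def Basis_vec_def inner_axis)
 qed
 have "(LBINT x:E. \<bar>edge' (real (Suc k)) (a $ i) (b $ i) (snd x $ i)\<bar>) <= 8 * vol + 8 * vol + 2 * measure lborel E * (2 / (b $ i - a $ i))" for k
 proof -
  let ?n = "real (Suc k)"
  have n: "?n > 0" by simp
  show ?thesis
  proof (cases "2 / ?n <= b $ i - a $ i")
   case True
   let ?c = "b $ i - a $ i - 2 / ?n"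
   let ?L1 = "cbox l0 (v0 - ?c *\<^sub>R tdir i)" and ?L2 = "cbox (l0 + ?c *\<^sub>R tdir i) v0"
   have o: "e \<bullet> tdir i = 0" "tdir i \<bullet> e = 0" if "e \<in> Basis - {tdir i}" for e :: "(real^'n) \<times> (real^'m)"
    using that tdir_Basis inner_not_same_Basis by blast+
   have le1: "l0 \<bullet> e <= (v0 - ?c *\<^sub>R tdir i) \<bullet> e" "(l0 + ?c *\<^sub>R tdir i) \<bullet> e <= v0 \<bullet> e" if e: "e \<in> Basis" for e
    using l0v0[OF e] o[of e] t0 tdir_inner_self e n by (cases "e = tdir i"; simp add: inner_diff_left inner_add_left)+
   have pr: "(\<Prod>e\<in>Basis - {tdir i}. (v0 - ?c *\<^sub>R tdir i - l0) \<bullet> e) = vol" "(\<Prod>e\<in>Basis - {tdir i}. (v0 - (l0 + ?c *\<^sub>R tdir i)) \<bullet> e) = vol"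
    unfolding vol_def using o by (auto intro!: prod.cong simp: inner_diff_left inner_add_left)
   have m1: "measure lborel ?L1 = 2 / ?n * vol"
   proof -
    have "measure lborel ?L1 = ((v0 - ?c *\<^sub>R tdir i - l0) \<bullet> tdir i) * vol"
     unfolding pr(1)[symmetric] by (rule thin_box_volume[OF tdir_Basis]) (rule le1(1))
    also have "(v0 - ?c *\<^sub>R tdir i - l0) \<bullet> tdir i = 2 / ?n"
     unfolding inner_diff_left inner_scaleR_left t0 tdir_inner_self by simp
    finally show ?thesis .
   qed
   have m2: "measure lborel ?L2 = 2 / ?n * vol"
   proof -
    have "measure lborel ?L2 = ((v0 - (l0 + ?c *\<^sub>R tdir i)) \<bullet> tdir i) * vol"
     unfolding pr(2)[symmetric] by (rule thin_box_volume[OF tdir_Basis]) (rule le1(2))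
    also have "(v0 - (l0 + ?c *\<^sub>R tdir i)) \<bullet> tdir i = 2 / ?n"
     unfolding inner_diff_left inner_add_left inner_scaleR_left t0 tdir_inner_self by simp
    finally show ?thesis .
   qed
   have pt: "\<bar>edge' ?n (a $ i) (b $ i) (snd x $ i)\<bar> <= 2 * ?n * (indicat_real ?L1 x + indicat_real ?L2 x)" if x: "x \<in> E" for x
   proof (cases "edge' ?n (a $ i) (b $ i) (snd x $ i) = 0")
    case True then show ?thesis using n by (simp add: indicator_def)
   next
    case False
    then have "snd x $ i - a $ i < 2 / ?n \<or> b $ i - snd x $ i < 2 / ?n" using edge_one(2)[OF n] by force
    then have "x \<in> ?L1 \<or> x \<in> ?L2"
    proof
     assume h: "snd x $ i - a $ i < 2 / ?n"
     have "x \<in> ?L1"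
      unfolding mem_box
     proof (intro ballI conjI)
      fix e :: "(real^'n) \<times> (real^'m)" assume e: "e \<in> Basis"
      show "l0 \<bullet> e <= x \<bullet> e" using in_box[OF x e] by simp
      show "x \<bullet> e <= (v0 - ?c *\<^sub>R tdir i) \<bullet> e"
       using in_box[OF x e] o[of e] e t0 tdir_inner_self h inner_tdir[of x i] by (cases "e = tdir i") (auto simp: inner_diff_left)
     qed
     then show ?thesis ..
    next
     assume h: "b $ i - snd x $ i < 2 / ?n"
     have "x \<in> ?L2"
      unfolding mem_box
     proof (intro ballI conjI)
      fix e :: "(real^'n) \<times> (real^'m)" assume e: "e \<in> Basis"
      show "x \<bullet> e <= v0 \<bullet> e" using in_box[OF x e] by simp
      show "(l0 + ?c *\<^sub>R tdir i) \<bullet> e <= x \<bullet> e"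
       using in_box[OF x e] o[of e] e t0 tdir_inner_self h inner_tdir[of x i] by (cases "e = tdir i") (auto simp: inner_add_left)
     qed
     then show ?thesis ..
    qed
    then have "1 <= indicat_real ?L1 x + indicat_real ?L2 x" by (auto simp: indicator_def)
    then have "2 * ?n * 1 <= 2 * ?n * (indicat_real ?L1 x + indicat_real ?L2 x)" using n by (intro mult_left_mono) auto
    then show ?thesis using edge'_bound[OF n, of "a $ i" "b $ i" "snd x $ i"] by linarith
   qed
   have cb: "integrable lborel (indicat_real (cbox p w))" for p w :: "(real^'n) \<times> (real^'m)"
    by (intro integrable_real_indicator) (auto simp: emeasure_lborel_cbox_eq)
   have "(LBINT x:E. \<bar>edge' ?n (a $ i) (b $ i) (snd x $ i)\<bar>) <= (LBINT x. 2 * ?n * (indicat_real ?L1 x + indicat_real ?L2 x))"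
    unfolding set_lebesgue_integral_def
   proof (rule integral_mono')
    show "integrable lborel (%x. 2 * ?n * (indicat_real ?L1 x + indicat_real ?L2 x))" using cb by (intro integrable_mult_right Bochner_Integration.integrable_add)
    show "indicat_real E x *\<^sub>R \<bar>edge' ?n (a $ i) (b $ i) (snd x $ i)\<bar> <= 2 * ?n * (indicat_real ?L1 x + indicat_real ?L2 x)" for x
     using pt[of x] n by (cases "x \<in> E") (auto simp: indicator_def)
    show "0 <= 2 * ?n * (indicat_real ?L1 x + indicat_real ?L2 x)" for x using n by (simp add: indicator_def)
   qed
   also have "... = 2 * ?n * (measure lborel ?L1 + measure lborel ?L2)"
    using cb by (simp add: Bochner_Integration.integral_add)
   also have "... = 8 * vol" proof -
    have "2 * r * (2 / r * v + 2 / r * v) = 8 * v" if "r > 0" for r v :: real using that by (simp add: field_simps)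
    from this[OF n] show ?thesis unfolding m1 m2 .
   qed
   finally show ?thesis using P ab[of i] by (smt (verit) divide_nonneg_pos measure_nonneg mult_nonneg_nonneg)
  next
   case False
   then have nb: "?n <= 2 / (b $ i - a $ i)" using ab[of i] n by (simp add: field_simps)
   have "(LBINT x:E. \<bar>edge' ?n (a $ i) (b $ i) (snd x $ i)\<bar>) <= (LBINT x:E. 2 * ?n)"
    unfolding set_lebesgue_integral_def
   proof (rule integral_mono')
    show "integrable lborel (%x. indicat_real E x *\<^sub>R (2 * ?n))" using E_borel E_finite by (auto intro!: integrable_real_indicator)
   qed (use edge'_bound[OF n] n in \<open>auto simp: indicator_def\<close>)
   also have "... = 2 * measure lborel E * ?n" by (simp add: set_integral_const_measure[OF E_borel])
   also have "... <= 2 * measure lborel E * (2 / (b $ i - a $ i))" using nb by (intro mult_left_mono) auto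
   finally show ?thesis using P by linarith
  qed
 qed
 then show ?thesis by blast
qed

lemma \<zeta>_gradient_mass: "\<exists>C. \<forall>k w. continuous_on UNIV w --> (\<forall>x. norm (w x) <= 1) --> - (LBINT x:E. w x \<bullet> grad (\<zeta> k) x) <= C"
proof -
 have "\<forall>i. \<exists>C. \<forall>k. (LBINT x:E. \<bar>edge' (real (Suc k)) (a $ i) (b $ i) (snd x $ i)\<bar>) <= C" using edge_layers by blast
 then obtain C where C: "!!i k. (LBINT x:E. \<bar>edge' (real (Suc k)) (a $ i) (b $ i) (snd x $ i)\<bar>) <= C i" by metis
 show ?thesis
 proof (intro exI[of _ "\<Sum>i\<in>UNIV. C i"] allI impI)
  fix k and w :: "(real^'n) \<times> (real^'m) => (real^'n) \<times> (real^'m)" assume w: "continuous_on UNIV w" "\<forall>x. norm (w x) <= 1"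
  let ?n = "real (Suc k)"
  let ?g = "%i x::(real^'n) \<times> (real^'m). \<bar>edge' ?n (a $ i) (b $ i) (snd x $ i)\<bar>"
  have gi: "set_integrable lborel E (?g i)" for i
  proof (rule set_integrable_bounded_finite[OF E_borel E_finite, where C="2 * ?n"])
   have "continuous_on UNIV (%x::(real^'n) \<times> (real^'m). edge' ?n (a $ i) (b $ i) (snd x $ i))"
    by (rule continuous_on_compose2[OF edge'_continuous[of UNIV] Ck_on_continuous[OF coordinate_C1[of 0]]]) auto
   then have "continuous_on UNIV (?g i)" by (intro continuous_intros)
   then show "set_borel_measurable lborel E (?g i)"
    unfolding set_borel_measurable_def using E_borel borel_measurable_continuous_onI by (intro borel_measurable_scaleR borel_measurable_indicator) auto
  qed (use edge'_bound[of ?n] in auto)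
  have "- (LBINT x:E. w x \<bullet> grad (\<zeta> k) x) = (LBINT x:E. - (w x \<bullet> grad (\<zeta> k) x))"
   by (simp add: set_lebesgue_integral_def)
  also have "... <= (LBINT x:E. (\<Sum>i\<in>UNIV. ?g i x))"
   unfolding set_lebesgue_integral_def
  proof (rule integral_mono')
   show "integrable lborel (%x. indicat_real E x *\<^sub>R (\<Sum>i\<in>UNIV. ?g i x))"
    using gi unfolding set_integrable_def scaleR_sum_right by (intro Bochner_Integration.integrable_sum) auto
   fix x :: "(real^'n) \<times> (real^'m)"
   show "0 <= indicat_real E x *\<^sub>R (\<Sum>i\<in>UNIV. ?g i x)" by (auto simp: indicator_def intro!: sum_nonneg)
   have "- (w x \<bullet> grad (\<zeta> k) x) <= (\<Sum>i\<in>UNIV. ?g i x)" if x: "x \<in> E"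
   proof -
    have "norm (fst x) < R + 1" using fst_bound[of x] x by simp
    then have "\<bar>grad (\<zeta> k) x \<bullet> w x\<bar> <= (\<Sum>i\<in>UNIV. ?g i x * \<bar>w x \<bullet> tdir i\<bar>)" by (rule cutoff_grad_bound[OF _ R_pos])
    also have "... <= (\<Sum>i\<in>UNIV. ?g i x * 1)"
    proof (intro sum_mono mult_left_mono)
     show "\<bar>w x \<bullet> tdir i\<bar> <= 1" for i using Basis_le_norm[OF tdir_Basis, of "w x" i] w(2) order_trans by blast
    qed auto
    finally show ?thesis by (simp add: inner_commute)
   qed
   then show "indicat_real E x *\<^sub>R - (w x \<bullet> grad (\<zeta> k) x) <= indicat_real E x *\<^sub>R (\<Sum>i\<in>UNIV. ?g i x)" by (auto simp: indicator_def)
  qed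
  also have "... = (\<Sum>i\<in>UNIV. (LBINT x:E. ?g i x))"
   using gi unfolding set_lebesgue_integral_def set_integrable_def scaleR_sum_right
   by (intro Bochner_Integration.integral_sum) auto
  also have "... <= (\<Sum>i\<in>UNIV. C i)" using C by (intro sum_mono)
  finally show "- (LBINT x:E. w x \<bullet> grad (\<zeta> k) x) <= (\<Sum>i\<in>UNIV. C i)" .
 qed
qed

text \<open>The boundary of \<open>\<Omega> \<inter> S\<close> consists of the surface of \<open>\<Omega>\<close> in the slab, seen by \<open>\<Lambda>\<close>, and the faces, seen by the
gradients of the cutoffs; both have bounded mass.\<close>

lemma perimeter_E_finite: "perimeter E UNIV < \<infinity>"
proof -
 obtain C where C: "!!k w. continuous_on UNIV w ==> (!!x. norm (w x) <= 1) ==> - (LBINT x:E. w x \<bullet> grad (\<zeta> k) x) <= C"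
  using \<zeta>_gradient_mass by blast
 have "Bseq (%k. \<Lambda> (\<zeta> k))" using \<Lambda>_\<zeta> by (intro convergent_imp_Bseq) (auto simp: convergent_def)
 then obtain B where B: "!!k. \<bar>\<Lambda> (\<zeta> k)\<bar> <= B" by (auto simp: Bseq_def)
 have "(LBINT x:E. divergence \<eta> x) <= B + C" if \<eta>: "\<eta> \<in> test_fields UNIV" "!!x. norm (\<eta> x) <= 1" for \<eta>
 proof -
  obtain K where K: "compact K" "!!x. x ~: K ==> \<eta> x = 0" using test_fieldsD[OF \<eta>(1)] by metis
  have cd: "continuous_on UNIV (divergence \<eta>)" by (rule divergence_borel[OF \<eta>(1)])
  have c\<eta>: "continuous_on UNIV \<eta>" by (rule test_fields_continuous[OF \<eta>(1)])
  have dz: "divergence \<eta> x = 0" if "x ~: K" for x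
   by (rule divergence_off_support[OF compact_imp_closed[OF K(1)] K(2) that])
  obtain B' where B': "B' > 0" "!!x. norm (divergence \<eta> x) <= B'" using bounded_compact_support[OF cd K(1) dz] by metis
  have le: "(LBINT x:E. \<zeta> k x * divergence \<eta> x) <= B + C" for k
  proof -
   define V where "V = (%x. \<zeta> k x *\<^sub>R \<eta> x)"
   have \<eta>1: "Ck_on 1 UNIV (%x. \<eta> x \<bullet> e)" if "e \<in> Basis" for e by (rule test_functions_Ck[OF test_fields_component[OF \<eta>(1) that]])
   have V1: "Ck_on 1 \<Omega> (%x. V x \<bullet> e)" if e: "e \<in> Basis" for e
    using Ck_on_subset[OF Ck_on_mult[OF open_UNIV cutoff_C1 \<eta>1[OF e]] subset_UNIV] by (simp add: V_def)
   have Vc: "continuous_on UNIV V" unfolding V_def by (intro continuous_intros cutoff_continuous c\<eta>)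
   have VK: "V x = 0" if "x ~: K" for x using K(2)[OF that] by (simp add: V_def)
   have dV: "divergence V x = \<zeta> k x * divergence \<eta> x + \<eta> x \<bullet> grad (\<zeta> k) x" for x
    unfolding V_def by (rule divergence_scaleR[OF \<zeta>_differentiable C1_differentiable[OF \<eta>1]])
   have c1: "continuous_on UNIV (%x. \<zeta> k x * divergence \<eta> x)" by (intro continuous_intros cutoff_continuous cd)
   have c2: "continuous_on UNIV (%x. \<eta> x \<bullet> grad (\<zeta> k) x)" by (intro continuous_intros c\<eta> \<zeta>_grad_continuous)
   have i1: "integrable lborel (%x. \<zeta> k x * divergence \<eta> x)"
    by (rule integrable_compact_support[OF c1 K(1)]) (simp add: dz)
   have i2: "integrable lborel (%x. \<eta> x \<bullet> grad (\<zeta> k) x)"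
    by (rule integrable_compact_support[OF c2 K(1)]) (simp add: K(2))
   have s: "set_integrable lborel X (%x. \<zeta> k x * divergence \<eta> x)" "set_integrable lborel X (%x. \<eta> x \<bullet> grad (\<zeta> k) x)" if "X \<in> sets borel" for X
    unfolding set_integrable_def using that i1 i2 by (auto intro!: integrable_mult_indicator simp del: real_scaleR_def)
   have sV: "set_integrable lborel \<Omega> (divergence V)"
    unfolding dV[abs_def] using open_dom by (intro set_integral_add(1) s) auto
   have "\<Lambda> (%x. \<xi> x \<bullet> V x) = - (LBINT x:\<Omega>. divergence V x)" by (rule \<Lambda>_flux[OF V1 Vc K(1) VK sV])
   moreover have "(LBINT x:\<Omega>. divergence V x) = (LBINT x:E. divergence V x)"
    by (rule restrict_integral) (simp add: dV cutoff_grad_outside)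
   moreover have "(LBINT x:E. divergence V x) = (LBINT x:E. \<zeta> k x * divergence \<eta> x) + (LBINT x:E. \<eta> x \<bullet> grad (\<zeta> k) x)"
    unfolding dV using E_borel by (intro set_integral_add(2) s)
   moreover have "- \<Lambda> (%x. \<xi> x \<bullet> V x) <= \<Lambda> (\<zeta> k)"
   proof -
    have c: "(%x. \<xi> x \<bullet> V x) \<in> Cc" by (rule CcI[OF _ K(1)]) (auto intro!: continuous_intros \<xi>_cont Vc simp: VK)
    have cz: "\<zeta> k \<in> Cc" by (rule cutoff_Cc) simp
    have "\<Lambda> (%x. - 1 * (\<xi> x \<bullet> V x)) <= \<Lambda> (\<zeta> k)"
    proof (rule surface.Lam_mono[OF Cc_cmult[OF c] cz])
     fix x
     have "\<bar>\<xi> x \<bullet> V x\<bar> <= norm (\<xi> x) * norm (V x)" by (rule Cauchy_Schwarz_ineq2)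
     also have "... <= 1 * (\<zeta> k x * 1)"
      unfolding V_def norm_scaleR using \<xi>_le \<eta>(2) \<zeta>_bounds[of k x] by (intro mult_mono) auto
     finally show "- 1 * (\<xi> x \<bullet> V x) <= \<zeta> k x" by simp
    qed
    then show ?thesis using surface.Lam_cmult[OF c, of "- 1"] by simp
   qed
   moreover have "\<Lambda> (\<zeta> k) <= B" using B[of k] by linarith
   ultimately show ?thesis using C[OF c\<eta> \<eta>(2), of k] by linarith
  qed
  have "(%k. LBINT x:E. \<zeta> k x * divergence \<eta> x) \<longlonglongrightarrow> (LBINT x:E. divergence \<eta> x)"
   by (rule \<zeta>_limit[OF E_borel _ cd, where B=B']) (use B'(2) in auto)
  then show ?thesis by (rule LIMSEQ_le_const2) (use le in blast)
 qed
 then have "perimeter E UNIV <= ereal (B + C)" unfolding perimeter_def by (intro SUP_least) auto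
 then show ?thesis by (rule le_less_trans) simp
qed

text \<open>The \<open>2 (b\<^sub>i - a\<^sub>i)\<close>-periodic even folding of the line onto \<open>[a\<^sub>i, b\<^sub>i]\<close>: a triangle wave.\<close>

definition fold :: "'m => real => real" where
 "fold i s = a $ i + (b $ i - a $ i) / pi * arccos (cos (pi * (s - a $ i) / (b $ i - a $ i)))"

lemma fold_range: "a $ i <= fold i s" "fold i s <= b $ i"
proof -
 let ?w = "b $ i - a $ i" and ?c = "arccos (cos (pi * (s - a $ i) / (b $ i - a $ i)))"
 have c: "0 <= ?c" "?c <= pi" using arccos_bounded[of "cos (pi * (s - a $ i) / ?w)"] by auto
 have w: "?w / pi \<ge> 0" using ab[of i] by simp
 have "?w / pi * ?c <= ?w / pi * pi" using c w by (intro mult_left_mono) auto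
 moreover have "0 <= ?w / pi * ?c" using c w by (intro mult_nonneg_nonneg)
 ultimately show "a $ i <= fold i s" "fold i s <= b $ i" by (auto simp: fold_def)
qed

lemma fold_id: assumes "a $ i <= s" "s <= b $ i" shows "fold i s = s"
proof -
 have w: "b $ i - a $ i > 0" using ab[of i] by simp
 have "0 <= pi * (s - a $ i) / (b $ i - a $ i)" using assms w by simp
 moreover have "pi * (s - a $ i) / (b $ i - a $ i) <= pi" using assms w by (simp add: divide_le_eq)
 ultimately have "arccos (cos (pi * (s - a $ i) / (b $ i - a $ i))) = pi * (s - a $ i) / (b $ i - a $ i)" by (rule arccos_cos)
 then show ?thesis using w by (simp add: fold_def)
qed

lemma fold_move: "\<exists>k::int. fold i s = s + 2 * lam * of_int k \<or> fold i s = - s + 2 * lam * of_int k"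
proof -
 let ?w = "b $ i - a $ i"
 define th where "th = pi * (s - a $ i) / ?w"
 have w: "?w > 0" using ab[of i] by simp
 obtain ka kb :: int where k: "a $ i = lam * of_int ka" "b $ i = lam * of_int kb" using a_lattice b_lattice by metis
 have "cos (arccos (cos th)) = cos th" by simp
 then obtain n where n: "n \<in> \<int>" "arccos (cos th) = th + 2 * n * pi \<or> arccos (cos th) = - th + 2 * n * pi" using cos_eq by metis
 obtain j :: int where j: "n = of_int j" using n(1) by (auto simp: Ints_def)
 have wt: "?w / pi * th = s - a $ i" using w by (simp add: th_def)
 have f: "fold i s = a $ i + ?w / pi * arccos (cos th)" by (simp add: fold_def th_def)
 show ?thesis using n(2)
 proof
  assume h: "arccos (cos th) = th + 2 * n * pi"
  have "?w / pi * (th + 2 * n * pi) = ?w / pi * th + 2 * n * ?w" by (simp add: field_simps)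
  then have "fold i s = s + 2 * n * ?w" unfolding f h wt by simp
  also have "... = s + 2 * lam * of_int (j * (kb - ka))" unfolding k j by (simp add: algebra_simps)
  finally show ?thesis by blast
 next
  assume h: "arccos (cos th) = - th + 2 * n * pi"
  have "?w / pi * (- th + 2 * n * pi) = - (?w / pi * th) + 2 * n * ?w" by (simp add: field_simps)
  then have "fold i s = - s + (2 * a $ i + 2 * n * ?w)" unfolding f h wt by simp
  also have "... = - s + 2 * lam * of_int (ka + j * (kb - ka))" unfolding k j by (simp add: algebra_simps)
  finally show ?thesis by blast
 qed
qed

lemma fold_continuous: "continuous_on S (fold i)"
 unfolding fold_def[abs_def] using ab[of i] by (intro continuous_intros) auto

definition Eb :: "((real^'n) \<times> (real^'m)) set" where "Eb = \<Omega> \<inter> closure (slab a b)"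

text \<open>Folding moves each coordinate by reflections and translations that preserve \<open>\<Omega>\<close>, and it fixes the closed slab.\<close>

lemma Eb_fold: "Eb = (%x. (fst x, \<chi> i. fold i (snd x $ i))) ` \<Omega>"
proof -
 have Eb': "Eb = \<Omega> \<inter> {x. \<forall>i. a $ i <= snd x $ i & snd x $ i <= b $ i}"
  unfolding Eb_def slab_closed_subset_closure[OF ab, symmetric] ..
 show ?thesis
 proof (intro equalityI subsetI)
  fix x assume x: "x \<in> Eb"
  then have "x = (fst x, \<chi> i. fold i (snd x $ i))" using fold_id by (simp add: Eb' prod_eq_iff vec_eq_iff)
  then show "x \<in> (%x. (fst x, \<chi> i. fold i (snd x $ i))) ` \<Omega>" using x Eb' by blast
 next
  fix y assume "y \<in> (%x. (fst x, \<chi> i. fold i (snd x $ i))) ` \<Omega>"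
  then obtain x where x: "x \<in> \<Omega>" "y = (fst x, \<chi> i. fold i (snd x $ i))" by blast
  have "(fst x, \<chi> i. fold i (snd x $ i)) \<in> \<Omega>"
   by (rule lattice_move[of "fst x" "snd x"]) (use x(1) fold_move in auto)
  then show "y \<in> Eb" using fold_range x(2) by (simp add: Eb')
 qed
qed

lemma Eb_connected: "connected Eb"
 unfolding Eb_fold
proof (rule connected_continuous_image[OF _ dom_connected])
 have "continuous_on \<Omega> (%x. fold i (snd x $ i))" for i
  by (rule continuous_on_compose2[OF fold_continuous[of UNIV]]) (auto intro!: continuous_intros)
 then show "continuous_on \<Omega> (%x. (fst x, \<chi> i. fold i (snd x $ i)))"
  by (intro continuous_intros)
qed

lemma near_Eb: assumes "p \<in> Eb" "r > 0" shows "ball p r \<inter> slab a b ~= {}"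
proof -
 have "p \<in> ball p r \<inter> closure (slab a b)" using assms by (simp add: Eb_def)
 then have "ball p r \<inter> closure (slab a b) ~= {}" by blast
 then show ?thesis using open_Int_closure_eq_empty[OF open_ball[of p r], of "slab a b"] by simp
qed

lemma E_pos: "emeasure lborel E > 0"
proof (rule open_emeasure_pos)
 show "open E" by (intro open_Int open_dom open_slab)
 have "Eb ~= {}" using dom_ne Eb_fold by auto
 then show "E ~= {}" using open_Int_closure_eq_empty[OF open_dom, of "slab a b"] by (simp add: Eb_def)
qed

lemma measure_pos: "A \<subseteq> E ==> emeasure lborel A > 0 ==> measure lborel A > 0"
 using subset_E_finite[of A] by (simp add: measure_def enn2real_positive_iff)

lemma enn_measure: "A \<subseteq> E ==> enn2ereal (emeasure lborel A) = ereal (measure lborel A)"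
 using subset_E_finite[of A] by (simp add: emeasure_eq_ennreal_measure)

lemma E_competitor: "E \<in> cheeger_competitors \<Omega> (slab a b)"
 using E_borel E_pos perimeter_E_finite by (simp add: cheeger_competitors_def)

lemma ratio_E: "cheeger_ratio (slab a b) E = ereal (1 / \<beta>)"
 using measure_pos[OF order_refl E_pos] by (simp add: cheeger_ratio_def perimeter_E enn_measure)

lemma ratio_lower: assumes A: "A \<in> cheeger_competitors \<Omega> (slab a b)" shows "ereal (1 / \<beta>) <= cheeger_ratio (slab a b) A"
proof -
 have h: "A \<in> sets borel" "A \<subseteq> E" "emeasure lborel A > 0" using A by (auto simp: cheeger_competitors_def)
 have m: "measure lborel A > 0" by (rule measure_pos[OF h(2,3)])
 have "ereal (1 / \<beta>) * ereal (measure lborel A) <= perimeter A (slab a b)" using perimeter_lower[OF h(1,2)] by simp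
 then show ?thesis unfolding cheeger_ratio_def enn_measure[OF h(2)]
  using m by (subst ereal_le_divide_pos) (auto simp: mult.commute)
qed

lemma constant_eq: "cheeger_constant \<Omega> (slab a b) = ereal (1 / \<beta>)"
 unfolding cheeger_constant_def
 by (rule antisym[OF INF_lower2[OF E_competitor] INF_greatest[OF ratio_lower]]) (simp add: ratio_E)

lemma cheeger_set_perimeter:
 assumes A: "cheeger_set \<Omega> (slab a b) A"
 shows "A \<in> sets borel" "A \<subseteq> E" "emeasure lborel A > 0" "perimeter A (slab a b) = ereal (measure lborel A / \<beta>)"
proof -
 show h: "A \<in> sets borel" "A \<subseteq> E" "emeasure lborel A > 0"
  using A by (auto simp: cheeger_set_def cheeger_competitors_def)
 have m: "measure lborel A > 0" by (rule measure_pos[OF h(2,3)])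
 have "perimeter A (slab a b) / ereal (measure lborel A) = ereal (1 / \<beta>)"
  using A constant_eq by (simp add: cheeger_set_def cheeger_ratio_def enn_measure[OF h(2)])
 then show "perimeter A (slab a b) = ereal (measure lborel A / \<beta>)"
  using m by (cases "perimeter A (slab a b)") (auto simp: field_simps)
qed

text \<open>Compactness turns the strict inequality into a uniform gap, the room for perturbing the calibration.\<close>

lemma \<xi>_strict: assumes "compact K" "K \<subseteq> E" obtains \<kappa> where "\<kappa> > 0" "!!x. x \<in> K ==> norm (\<xi> x) + \<kappa> <= 1"
proof (cases "K = {}")
 case True then show thesis by (intro that[of 1]) auto
next
 case False
 have "continuous_on K (%x. norm (\<xi> x))" by (intro continuous_intros continuous_on_subset[OF \<xi>_cont]) auto
 from continuous_attains_sup[OF assms(1) False this]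
 obtain p where p: "p \<in> K" "!!x. x \<in> K ==> norm (\<xi> x) <= norm (\<xi> p)" by blast
 have pO: "p \<in> \<Omega>" using p assms by blast
 have "norm (\<xi> p) < 1" using gradient_strict[OF pO] \<xi>_eq[OF pO] \<beta>_pos by (simp add: field_simps)
 then show thesis using p by (intro that[of "1 - norm (\<xi> p)"]) auto
qed

text \<open>For a Cheeger set the calibration inequality is an equality, so the linear term in \<open>\<eta>\<close> has a sign for \<open>\<eta>\<close> and
for \<open>- \<eta>\<close>.\<close>

lemma cheeger_set_gradient:
 assumes A: "cheeger_set \<Omega> (slab a b) A" and \<phi>: "\<phi> \<in> test_functions E" and e: "e \<in> Basis"
 shows "(LBINT x:A. partial_deriv e \<phi> x) = 0"
proof -
 note h = cheeger_set_perimeter[OF A]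
 obtain K where K: "compact K" "K \<subseteq> E" "!!x. x ~: K ==> \<phi> x = 0" using test_functionsD[OF \<phi>] by blast
 obtain \<kappa> where \<kappa>: "\<kappa> > 0" "!!x. x \<in> K ==> norm (\<xi> x) + \<kappa> <= 1" using \<xi>_strict[OF K(1,2)] by metis
 have \<phi>1: "Ck_on 1 UNIV \<phi>" by (rule test_functions_Ck[OF \<phi>])
 obtain B where B: "B > 0" "!!x. norm (\<phi> x) <= B"
  using bounded_compact_support[OF Ck_on_continuous[OF \<phi>1] K(1,3)] by metis
 (* The bound on c keeps norm (\<eta> x) within the gap. *)
 have le: "c * (LBINT x:A. partial_deriv e \<phi> x) <= 0" if c: "\<bar>c\<bar> * B <= \<kappa>" for c
 proof -
  define \<eta> where "\<eta> = (%x. (c * \<phi> x) *\<^sub>R e)"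
  have \<eta>T: "\<eta> \<in> test_fields E"
   unfolding test_fields_def
  proof (intro CollectI ballI)
   fix e' :: "(real^'n) \<times> (real^'m)" assume "e' \<in> Basis"
   have "(%x. (c * (e \<bullet> e')) * \<phi> x) \<in> test_functions E"
    using test_functions_Ck[OF \<phi>] K by (intro test_functionsI[OF _ K(1,2)] Ck_on_cmult) auto
   then show "(%x. \<eta> x \<bullet> e') \<in> test_functions E" by (simp add: \<eta>_def mult_ac)
  qed
  have \<eta>n: "norm (\<xi> x) + norm (\<eta> x) <= 1" for x
  proof (cases "x \<in> K")
   case True
   have "norm (\<eta> x) = \<bar>c\<bar> * \<bar>\<phi> x\<bar>" using e by (simp add: \<eta>_def abs_mult)
   also have "... <= \<bar>c\<bar> * B" using B(2)[of x] by (intro mult_left_mono) auto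
   finally show ?thesis using c \<kappa>(2)[OF True] by linarith
  next
   case False then show ?thesis using K(3) \<xi>_le by (simp add: \<eta>_def)
  qed
  have d\<eta>: "divergence \<eta> x = c * partial_deriv e \<phi> x" for x
  proof -
   have "divergence \<eta> x = (\<Sum>e'\<in>Basis. (c * (e \<bullet> e')) * partial_deriv e' \<phi> x)"
    unfolding divergence_def \<eta>_def
   proof (intro sum.cong refl)
    fix e' :: "(real^'n) \<times> (real^'m)" assume "e' \<in> Basis"
    have "partial_deriv e' (%y. (c * (e \<bullet> e')) * \<phi> y) x = (c * (e \<bullet> e')) * partial_deriv e' \<phi> x"
     by (rule partial_deriv_cmult[OF C1_differentiable[OF \<phi>1]])
    then show "partial_deriv e' (%y. ((c * \<phi> y) *\<^sub>R e) \<bullet> e') x = (c * (e \<bullet> e')) * partial_deriv e' \<phi> x" by (simp add: mult_ac)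
   qed
   also have "... = (\<Sum>e'\<in>Basis. if e' = e then c * partial_deriv e \<phi> x else 0)"
    using e by (intro sum.cong) (auto simp: inner_Basis)
   finally show ?thesis using e by simp
  qed
  have pc: "continuous_on UNIV (partial_deriv e \<phi>)" using \<phi>1 e by auto
  have pz: "partial_deriv e \<phi> x = 0" if "x ~: K" for x
  proof -
   have "partial_deriv e \<phi> x = partial_deriv e (%x. 0) x"
    by (rule partial_deriv_cong[of "- K"]) (use that K in \<open>auto simp: compact_imp_closed open_Compl\<close>)
   then show ?thesis by simp
  qed
  have i1: "set_integrable lborel A (%x. c * partial_deriv e \<phi> x)"
   unfolding set_integrable_def
   using integrable_compact_support[OF pc K(1) pz] h(1) by (intro integrable_mult_indicator) auto
  have i2: "set_integrable lborel A (%x. 1 / \<beta>)"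
   unfolding set_integrable_def using h(1) subset_E_finite[OF h(2)] by (auto intro!: integrable_real_indicator)
  have "ereal (LBINT x:A. divergence \<eta> x + 1 / \<beta>) <= perimeter A (slab a b)"
   by (rule calibration_inequality[OF h(1,2) \<eta>T \<eta>n])
  then have "(LBINT x:A. c * partial_deriv e \<phi> x) + (LBINT x:A. 1 / \<beta>) <= measure lborel A / \<beta>"
   unfolding h(4) d\<eta> set_integral_add(2)[OF i1 i2] by simp
  then show ?thesis unfolding set_integral_cmult set_integral_const_measure[OF h(1)] by simp
 qed
 have "\<kappa> / B * (LBINT x:A. partial_deriv e \<phi> x) <= 0" "- (\<kappa> / B) * (LBINT x:A. partial_deriv e \<phi> x) <= 0"
  using le[of "\<kappa> / B"] le[of "- (\<kappa> / B)"] B(1) \<kappa>(1) by auto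
 moreover have "\<kappa> / B > 0" using B(1) \<kappa>(1) by simp
 ultimately show ?thesis by (metis antisym mult_minus_left neg_le_0_iff_le mult_le_0_iff not_less zero_le_mult_iff)
qed

text \<open>A second countable space is covered by countably many of the balls.\<close>

lemma locally_null_null:
 fixes N :: "'a::euclidean_space set"
 assumes N: "N \<in> sets borel" and loc: "!!p. p \<in> N ==> \<exists>r>0. emeasure lborel (ball p r \<inter> N) = 0"
 shows "emeasure lborel N = 0"
proof -
 have "negligible N"
 proof (rule locally_negligible_alt[THEN iffD2], rule ballI)
  fix p assume p: "p \<in> N"
  obtain r where r: "r > 0" "emeasure lborel (ball p r \<inter> N) = 0" using loc[OF p] by blast
  have "ball p r \<inter> N \<in> null_sets lborel" using r(2) N by (intro null_setsI) auto
  then have "negligible (ball p r \<inter> N)" using negligible_iff_null_sets null_sets_completionI by blast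
  then show "\<exists>U. openin (top_of_set N) U & p \<in> U & negligible U"
  proof (intro exI[of _ "ball p r \<inter> N"] conjI)
   have "openin (top_of_set N) (N \<inter> ball p r)" by (rule openin_open_Int[OF open_ball])
   then show "openin (top_of_set N) (ball p r \<inter> N)" by (simp only: Int_commute)
   show "p \<in> ball p r \<inter> N" using p r(1) by simp
  qed
 qed
 then have "N \<in> null_sets lebesgue" by (simp only: negligible_iff_null_sets)
 then have "emeasure lebesgue N = 0" by (rule null_setsD1)
 then show ?thesis using emeasure_completion[of N lborel] N by simp
qed

text \<open>Near each point of \<open>\<Omega>\<close> in the closed slab the set is null or conull in the slab; both alternatives are open
and exclude each other, and the set of these points is connected.\<close>

lemma cheeger_set_conull:
 assumes A: "cheeger_set \<Omega> (slab a b) A"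
 shows "emeasure lborel (E - A) = 0"
proof -
 note h = cheeger_set_perimeter[OF A]
 let ?O = "%X. {p. \<exists>r>0. emeasure lborel (ball p r \<inter> X) = 0}"
 have op: "open (?O X)" if X: "X \<in> sets borel" for X :: "((real^'n) \<times> (real^'m)) set"
  unfolding open_contains_ball
 proof
  fix p assume "p \<in> ?O X"
  then obtain r where r: "r > 0" "emeasure lborel (ball p r \<inter> X) = 0" by blast
  have "ball p (r / 2) \<subseteq> ?O X"
  proof
   fix y assume y: "y \<in> ball p (r / 2)"
   have "ball y (r / 2) \<subseteq> ball p r"
   proof
    fix z assume "z \<in> ball y (r / 2)"
    then show "z \<in> ball p r" using y dist_triangle[of p z y] by simp
   qed
   then have "emeasure lborel (ball y (r / 2) \<inter> X) <= emeasure lborel (ball p r \<inter> X)"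
    using X by (intro emeasure_mono) auto
   then show "y \<in> ?O X" using r by (auto intro!: exI[of _ "r / 2"])
  qed
  then show "\<exists>e>0. ball p e \<subseteq> ?O X" using r(1) by (intro exI[of _ "r / 2"]) auto
 qed
 let ?U1 = "?O A" and ?U2 = "?O (slab a b - A)"
 have sb: "slab a b - A \<in> sets borel" by (intro sets.Diff borel_open open_slab h(1))
 have cover: "Eb \<subseteq> ?U1 \<union> ?U2"
 proof
  fix p assume p: "p \<in> Eb"
  obtain r where r: "r > 0" "ball p r \<subseteq> \<Omega>" using p open_dom by (auto simp: Eb_def open_contains_ball)
  let ?C = "ball p r \<inter> slab a b"
  have "emeasure lborel (A \<inter> ?C) = 0 \<or> emeasure lborel (?C - A) = 0"
  proof (rule null_or_conull_of_zero_gradient)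
   show "open ?C" "convex ?C" by (intro open_Int open_ball open_slab convex_Int convex_ball convex_slab)+
   show "bounded ?C" by (intro bounded_Int disjI1 bounded_ball)
   show "A \<in> sets borel" by (rule h(1))
   fix \<phi> :: "(real^'n) \<times> (real^'m) => real" and e :: "(real^'n) \<times> (real^'m)" assume \<phi>: "\<phi> \<in> test_functions ?C" and e: "e \<in> Basis"
   have "\<phi> \<in> test_functions E" by (rule test_functions_mono[OF \<phi>]) (use r in auto)
   then show "(LBINT x:A. partial_deriv e \<phi> x) = 0" using cheeger_set_gradient[OF A _ e] by blast
  qed
  moreover have "A \<inter> ?C = ball p r \<inter> A" using h(2) by blast
  moreover have "?C - A = ball p r \<inter> (slab a b - A)" by blast
  ultimately show "p \<in> ?U1 \<union> ?U2" using r(1) by auto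
 qed
 have disj: "?U1 \<inter> ?U2 \<inter> Eb = {}"
 proof (rule ccontr)
  assume "?U1 \<inter> ?U2 \<inter> Eb ~= {}"
  then obtain p r1 r2 where p: "p \<in> Eb" "r1 > 0" "emeasure lborel (ball p r1 \<inter> A) = 0" "r2 > 0" "emeasure lborel (ball p r2 \<inter> (slab a b - A)) = 0" by blast
  define r where "r = min r1 r2"
  have r: "r > 0" using p by (simp add: r_def)
  have "emeasure lborel (ball p r \<inter> slab a b) <= emeasure lborel ((ball p r1 \<inter> A) \<union> (ball p r2 \<inter> (slab a b - A)))"
   using h(1) sb by (intro emeasure_mono) (auto simp: r_def)
  also have "... <= emeasure lborel (ball p r1 \<inter> A) + emeasure lborel (ball p r2 \<inter> (slab a b - A))"
   using h(1) sb by (intro emeasure_subadditive) auto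
  finally have "emeasure lborel (ball p r \<inter> slab a b) = 0" using p by simp
  moreover have "emeasure lborel (ball p r \<inter> slab a b) > 0"
   using near_Eb[OF p(1) r] by (intro open_emeasure_pos open_Int open_ball open_slab)
  ultimately show False by simp
 qed
 have EEb: "E \<subseteq> Eb" unfolding Eb_def using closure_subset by blast
 have "?U1 \<inter> Eb = {} \<or> ?U2 \<inter> Eb = {}"
  using connectedD[OF Eb_connected op[OF h(1)] op[OF sb] disj cover] .
 then show ?thesis
 proof
  assume e1: "?U1 \<inter> Eb = {}"
  show ?thesis
  proof (rule locally_null_null)
   show "E - A \<in> sets borel" using E_borel h(1) by auto
   fix p assume "p \<in> E - A"
   then have "p \<in> ?U2" using e1 cover EEb by blast
   then obtain r where r: "r > 0" "emeasure lborel (ball p r \<inter> (slab a b - A)) = 0" by blast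
   have "emeasure lborel (ball p r \<inter> (E - A)) <= emeasure lborel (ball p r \<inter> (slab a b - A))"
    using sb by (intro emeasure_mono) auto
   then show "\<exists>r>0. emeasure lborel (ball p r \<inter> (E - A)) = 0" using r by auto
  qed
 next
  assume e2: "?U2 \<inter> Eb = {}"
  have "emeasure lborel A = 0"
  proof (rule locally_null_null[OF h(1)])
   fix p assume "p \<in> A"
   then have "p \<in> ?U1" using e2 cover EEb h(2) by blast
   then show "\<exists>r>0. emeasure lborel (ball p r \<inter> A) = 0" by blast
  qed
  then show ?thesis using h(3) by simp
 qed
qed

lemma uniquely_self_cheeger_slab: "uniquely_self_cheeger \<Omega> (slab a b)"
 unfolding uniquely_self_cheeger_def self_cheeger_def
proof (intro conjI allI impI)
 show "cheeger_set \<Omega> (slab a b) E" using E_competitor ratio_E constant_eq by (simp add: cheeger_set_def)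
 fix A assume A: "cheeger_set \<Omega> (slab a b) A"
 note h = cheeger_set_perimeter[OF A]
 have "sym_diff A E = E - A" using h(2) by blast
 then show "sym_diff A E \<in> null_sets lborel" using cheeger_set_conull[OF A] h(1) E_borel by (simp add: null_sets_def)
qed

end

section \<open>The theorem\<close>

text \<open>Boundedness in \<open>z\<close> yields the enclosing cylinder of radius \<open>R\<close>, and the lattice conditions put the
faces of the slab on hyperplanes about which \<open>u\<close> is even.\<close>

theorem theorem1p3:
  fixes \<Omega> :: "((real^'n) \<times> (real^'m)) set"
    and u :: "(real^'n) \<times> (real^'m) \<Rightarrow> real"
    and \<nu> :: "(real^'n) \<times> (real^'m) \<Rightarrow> (real^'n) \<times> (real^'m)"
    and a b :: "real^'m"
    and lam \<beta> \<alpha> :: real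
  assumes "lam > 0" and "\<beta> > 0" and "0 < \<alpha>" and "\<alpha> < 1"
    and "open \<Omega>" and "connected \<Omega>" and "\<Omega> \<noteq> {}"
    and "radial_fst \<Omega>" and "bounded_fst \<Omega>"
    and "periodic_snd (2 * lam) \<Omega>" and "symmetric_snd \<Omega>"
    and "\<forall>x\<in>frontier \<Omega>. outer_unit_normal \<Omega> x (\<nu> x)"
    and "C2_holder_closure \<alpha> \<Omega> u"
    and "\<forall>x\<in>\<Omega>. u x > 0"
    and "\<forall>x\<in>\<Omega>. - laplacian u x = 1"
    and "\<forall>x\<in>frontier \<Omega>. u x = 0"
    and "\<forall>x\<in>frontier \<Omega>. has_normal_derivative \<Omega> u (\<nu> x) (- \<beta>) x"
    and "\<forall>i. \<exists>k::int. a $ i = lam * of_int k"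
    and "\<forall>i. \<exists>k::int. b $ i = lam * of_int k"
    and "\<forall>i. a $ i < b $ i"
  shows "uniquely_self_cheeger \<Omega> (slab a b) \<and>
         cheeger_constant \<Omega> (slab a b) = ereal (1 / \<beta>) \<and>
         solves_one_laplace \<Omega> (indicat_real \<Omega>) (\<lambda>x. 1 / \<beta> * indicat_real \<Omega> x) \<and>
         calibrable \<Omega> (slab a b)"
proof -
 obtain R where R: "R > 0" "\<Omega> \<subseteq> ball 0 R \<times> UNIV" using \<open>bounded_fst \<Omega>\<close> by (auto simp: bounded_fst_def)
 have lap: "laplacian u x = - 1" if "x \<in> \<Omega>" for x using assms(15) that by (metis minus_equation_iff)
 interpret P: cylinder_problem \<Omega> u \<nu> \<beta> \<alpha> lam R
  by unfold_locales (use assms R lap in auto)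
 obtain \<xi> where "torsion_exterior \<Omega> u \<xi> \<beta>" using P.exists_torsion_field by blast
 then interpret T: torsion_exterior \<Omega> u \<xi> \<beta> .
 interpret S: slab_problem \<Omega> u \<nu> \<beta> \<alpha> lam R \<xi> a b
  by unfold_locales (use assms in auto)
 show ?thesis
  using S.uniquely_self_cheeger_slab S.constant_eq T.one_laplace S.calibrable_slab by blast
qed

end
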